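(* Let $R$ be a commutative Noetherian ring, let $F$ and $G$ be free $R$-modules of ranks $\mathfrak f$ and $\mathfrak g$ with $1\le \mathfrak g<\mathfrak f$, let $\tau\in F^*$, let $\mu:G^*\to\bigwedge^2F$ be an $R$-module homomorphism, let $\Psi:G^*\to F$ be $\Psi(\gamma)=\tau(\mu(\gamma))$, let $\delta=\mathfrak f-\mathfrak g$, and let $\epsilon$ be an integer with $\lceil\frac{\delta-1}2\rceil\le\epsilon\le\lceil\frac{\delta}2\rceil$. Let the ideal $\mathfrak C$ of $R$ and the graded module with maps $\mathbb M^{\epsilon}$ be as defined in the context, and put $\overline R=R/I_{\mathfrak g}(\Psi)$ and $\widetilde R=R/(I_{\mathfrak g}(\Psi)+\mathfrak C)$. Then the following hold. (a) The maps and modules of $\mathbb M^{\epsilon}$ form a complex. Assume for the rest of the statements that $\delta\le\operatorname{grade}I_{\mathfrak g}(\Psi)$ and $\mathfrak f\le\operatorname{grade}I_1(\tau)$. (b) If $\epsilon=\lceil\frac\delta2\rceil$, then $\mathbb M^{\epsilon}$ is a resolution of $\overline R$ by free $R$-modules. (c) If $\epsilon=\lceil\frac{\delta-1}2\rceil$, then $\mathbb M^{\epsilon}$ is a resolution of $\widetilde R$ by free $R$-modules. Assume for the rest of the statements that, in addition, $I_1(\tau)$ is a proper ideal of $R$. (d) The projective dimension of the $R$-module $\overline R$ is $\mathfrak f-1$ if $\delta$ is even and $\mathfrak f$ if $\delta$ is odd. The projective dimension of the $R$-module $\widetilde R$ is $$\begin{cases}\mathfrak f-1,&\text{if }\delta\text{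 is even},\\ \mathfrak f-2,&\text{if }\delta\text{ is odd, }3\le\delta,\text{ and }2\le\mathfrak g,\\ \mathfrak f-1,&\text{if }\delta\text{ is odd, }\mathfrak g=1,\text{ and }\operatorname{grade}I_{\mathfrak g}(\Psi)\le\delta,\\ 1,&\text{if }\delta=1\text{ and }2\le\mathfrak g.\end{cases}$$ (e) If $\delta$ is even, then $\operatorname{depth}R_{\mathfrak p}=\delta$ for every $\mathfrak p\in\operatorname{Ass}_R(\overline R)$. (f) Assume that one of the following three hypotheses is in effect: (i) $\delta$ is even; (ii) $\delta$ is odd and $2\le\mathfrak g$; (iii) $\delta$ is odd, $\mathfrak g=1$, and $\operatorname{grade}I_{\mathfrak g}(\Psi)\le\delta$. Then $\operatorname{depth}R_{\mathfrak p}=\delta$ for every $\mathfrak p\in\operatorname{Ass}_R(\widetilde R)$. (g) If one of the hypotheses (i), (ii), (iii) of part (f) is in effect, then the ideals $$\mathfrak C+I_{\mathfrak g}(\Psi),\quad I_{\mathfrak g}(\Psi):I_1(\tau),\quad I_{\mathfrak g}(\Psi):I_1(\tau)^\infty,\quad I_{\mathfrak g}(\Psi)^{\mathrm{gunm}}$$ of $R$ are equal; in particular $\widetilde R=R/I_{\mathfrak g}(\Psi)^{\mathrm{gunm}}$. (h) If one of the hypotheses (i), (ii), (iii) of part (f) is in effect and $\epsilon=\lceil\frac{\delta-1}2\rceil$, then $\mathbb M^{\epsilon}$ is a resolution of $R/I_{\mathfrak g}(\Psi)^{\mathrm{gunm}}$ by free $R$-modules.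
   Context: All functors ($\otimes$, $(-)^*=\operatorname{Hom}_R(-,R)$, $\operatorname{Sym}$, $D$, $\bigwedge$) are over $R$. Ideals. $I_1(\tau)=\tau(F)$, and $I_{\mathfrak g}(\Psi)$ is the ideal generated by the $\mathfrak g\times\mathfrak g$ minors of a matrix of $\Psi$. The grade of a proper ideal is the length of a maximal $R$-regular sequence in it; the unit ideal has infinite grade. $I:J^\infty=\bigcup_n I:J^n$. A proper ideal $I$ is grade unmixed if $\operatorname{grade}\mathfrak p=\operatorname{grade}I$ for every $\mathfrak p\in\operatorname{Ass}(R/I)$. The grade unmixed part $I^{\mathrm{gunm}}$ of a proper ideal $I$ is the largest ideal $K$ with $I\subseteq K$ and $\operatorname{grade}I<\operatorname{grade}(I:K)$; equivalently, the smallest grade unmixed ideal $K$ with $I\subseteq K$ and $\operatorname{grade}K=\operatorname{grade}I$. Multilinear conventions. $\tau$ acts on $\bigwedge^\bullet F$ as the derivation of degree $-1$ with $\tau(x_1\wedge\dots\wedge x_r)=\sum_i(-1)^{i+1}\tau(x_i)x_1\wedge\dots\widehat{x_i}\dots\wedge x_r$. Let $Y_1,\dots,Y_{\mathfrak g}$ be a basis of $G$ and $X_1,\dots,X_{\mathfrak g}$ the dual basis of $G^*$. $D_\bullet(G^* )$ is the divided power algebra, a module over $\operatorname{Sym}_\bullet G$ by contraction ($Y_\ell$ lowers the divided exponent of $X_\ell$ by one). $\binom Yi$ denotes the set of monomials of degree $i$ in $Y_1,\dots,Y_{\mathfrak g}$ (empty for $i<0$); for $m=Y_1^{a_1}\cdots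 Y_{\mathfrak g}^{a_{\mathfrak g}}$ put $m^*=X_1^{(a_1)}\cdots X_{\mathfrak g}^{(a_{\mathfrak g})}$. The subalgebra $\bigwedge^{2\bullet}F$ has its usual divided powers: if $v=\sum_{p<q}a_{pq}\,e_p\wedge e_q$ for a basis $e_1,\dots,e_{\mathfrak f}$ of $F$ and $A$ is the alternating matrix with entries $a_{pq}$ for $p<q$, then $v^{(\ell)}=\sum_{|K|=2\ell}\operatorname{Pf}(A_K)\,e_K$, where $A_K$ is the submatrix on rows and columns $K$. $D(\mu):D_\bullet(G^* )\to\bigwedge^{2\bullet}F$ is the divided power algebra homomorphism induced by $\mu$, so $[D(\mu)](X_1^{(a_1)}\cdots X_{\mathfrak g}^{(a_{\mathfrak g})})=\mu(X_1)^{(a_1)}\wedge\dots\wedge\mu(X_{\mathfrak g})^{(a_{\mathfrak g})}$. $\omega_{G^*}$ is a basis of $\bigwedge^{\mathfrak g}G^*$ and $\omega_G$ the dual basis of $\bigwedge^{\mathfrak g}G$, where $X_1\wedge\dots\wedge X_{\mathfrak g}$ is dual to $Y_{\mathfrak g}\wedge\dots\wedge Y_1$ (similarly for other free modules). $\chi(S)$ is $1$ if the statement $S$ is true and $0$ otherwise. $\binom ab$ is $0$ for $b<0$, $1$ for $b=0$, and $a(a-1)\cdots(a-b+1)/b!$ for $b>0$. The map $c$ and the ideal $\mathfrak C$. If $\delta$ is odd, fix $Y_1\in G$, $X_1\in G^*$ with $Y_1(X_1)=1$ and decompositions $G=RY_1\oplus G_+$, $G^*=RX_1\oplus G_+^*$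 with $G_+,G_+^*$ free of rank $\mathfrak g-1$, $Y_1(G_+^* )=0$, $G_+(X_1)=0$. Let $\int_{X_1}:D_iG^*\to D_{i+1}G^*$ be $\int_{X_1}\big(\sum_jX_1^{(j)}\otimes\gamma_{i-j,+}\big)=\sum_jX_1^{(j+1)}\otimes\gamma_{i-j,+}$ for $\gamma_{i-j,+}\in D_{i-j}(G_+^* )$. Define $c:D_{\frac{\delta-1}2}(G^* )\to\bigwedge^{\mathfrak f}F\otimes\bigwedge^{\mathfrak g}G$ by $$c(\gamma)=[D(\mu)]\Big(\int_{X_1}\gamma\Big)\wedge\Big(\bigwedge^{\mathfrak g-1}\Psi\Big)(\omega_{G_+^*})\otimes\omega_{G_+}\wedge Y_1,$$ where $\omega_{G_+^*}$, $\omega_{G_+}$ are dual bases of $\bigwedge^{\mathfrak g-1}G_+^*$, $\bigwedge^{\mathfrak g-1}G_+$ (so $X_1\wedge\omega_{G_+^*}$ and $\omega_{G_+}\wedge Y_1$ are dual bases). Put $\mathfrak C=\operatorname{ann}_R(\operatorname{coker}c)$ if $\delta$ is odd (i.e. the image of $c$ under an identification of the rank one target with $R$), and $\mathfrak C=0$ if $\delta$ is even. The object $\mathbb M^\epsilon$. For $i,j\ge0$ let $V^{\mathbb T}_{i,j}$ and $V^{\mathbb B}_{i,j}$ both denote copies of $\bigwedge^iF\otimes D_j(G^* )$ (zero if $i<0$ or $j<0$). As a graded module $$\mathbb M^\epsilon=\bigoplus_{\epsilon\le J,\ I+J\le\delta-1}V^{\mathbb T}_{I,J}\ \oplus\bigoplus_{j\le\epsilon-1,\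 \delta\le i+j}V^{\mathbb B}_{i,j}\ \oplus\ \Big(\bigwedge^{\mathfrak f}F\otimes\bigwedge^{\mathfrak g}G\Big),$$ with $V^{\mathbb T}_{I,J}$ in position $I+2J-\delta+2$, $V^{\mathbb B}_{i,j}$ in position $i+2j-\delta+1$, and $\bigwedge^{\mathfrak f}F\otimes\bigwedge^{\mathfrak g}G$ in position $0$. The maps $d:\mathbb M^\epsilon_N\to\mathbb M^\epsilon_{N-1}$ are as follows (with $f_i\in\bigwedge^iF$, $\gamma_j\in D_j(G^* )$). (1) For $N\ge2$, on $V^{\mathbb T}_{I,J}$ the value $d(f_I\otimes\gamma_J)$ is the sum of $\chi(\epsilon\le J-1)\sum_{\ell=1}^{\mathfrak g}\Psi(X_\ell)\wedge f_I\otimes Y_\ell(\gamma_J)\in V^{\mathbb T}_{I+1,J-1}$, of $\tau(f_I)\otimes\gamma_J\in V^{\mathbb T}_{I-1,J}$, and of the elements $$(-1)^{I+j}\binom{J-1-j}{J-\epsilon}\sum_{m\in\binom Y{J-j}}[D(\mu)](m^* )\wedge f_I\otimes m(\gamma_J)\in V^{\mathbb B}_{i,j}$$ over all $(i,j)$ with $i+2j=I+2J$ and $\delta\le i+j$ (these vanish unless $j\le\epsilon-1$). (2) For $N\ge2$, on $V^{\mathbb B}_{i,j}$ the value $d(f_i\otimes\gamma_j)$ is the sum of $\sum_{\ell=1}^{\mathfrak g}\Psi(X_\ell)\wedge f_i\otimes Y_\ell(\gamma_j)\in V^{\mathbb B}_{i+1,j-1}$ and $\chi(\delta\le i+j-1)\,\tau(f_i)\otimes\gamma_j\in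 V^{\mathbb B}_{i-1,j}$. (3) $\mathbb M^\epsilon_1$ consists of $V^{\mathbb B}_{\delta,0}$ (present when $\epsilon\ge1$) and, if $\epsilon=\frac{\delta-1}2$, also $V^{\mathbb T}_{0,\epsilon}$; and $d(f_\delta)=f_\delta\wedge(\bigwedge^{\mathfrak g}\Psi)(\omega_{G^*})\otimes\omega_G$ on $V^{\mathbb B}_{\delta,0}$, $d(\gamma_\epsilon)=c(\gamma_\epsilon)$ on $V^{\mathbb T}_{0,\epsilon}$. *)

theory Defs
  imports "HOL-Algebra.Module" "HOL-Algebra.Ring_Divisibility" "HOL-Algebra.Ideal_Product"
    "HOL-Combinatorics.Permutations" "HOL-Library.Extended_Nat"
begin

section \<open>Modules over a commutative ring\<close>

definition mod_hom ::
  "('a,'x) ring_scheme \<Rightarrow> ('a,'m,'y) module_scheme \<Rightarrow> ('a,'n,'z) module_scheme \<Rightarrow> ('m \<Rightarrow> 'n) set" where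
  "mod_hom R M N = {h \<in> carrier M \<rightarrow> carrier N.
     (\<forall>x\<in>carrier M. \<forall>y\<in>carrier M. h (x \<oplus>\<^bsub>M\<^esub> y) = h x \<oplus>\<^bsub>N\<^esub> h y) \<and>
     (\<forall>r\<in>carrier R. \<forall>x\<in>carrier M. h (r \<odot>\<^bsub>M\<^esub> x) = r \<odot>\<^bsub>N\<^esub> h x)}"

definition ring_module :: "('a,'x) ring_scheme \<Rightarrow> ('a,'a) module" where
  "ring_module R = \<lparr>carrier = carrier R, monoid.mult = monoid.mult R, one = one R, zero = zero R,
     add = add R, smult = monoid.mult R\<rparr>"

text \<open>The record type of modules extends that of rings; the fields \<open>mult\<close> and \<open>one\<close> play
  no role in the locale \<^locale>\<open>module\<close> and are left unspecified below.\<close>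

definition free_module :: "('a,'x) ring_scheme \<Rightarrow> 'b set \<Rightarrow> ('a, 'b \<Rightarrow> 'a) module" where
  "free_module R B = \<lparr>carrier = {v. (\<forall>b. v b \<in> carrier R) \<and> (\<forall>b. b \<notin> B \<longrightarrow> v b = \<zero>\<^bsub>R\<^esub>) \<and>
                                    finite {b. v b \<noteq> \<zero>\<^bsub>R\<^esub>}},
     monoid.mult = undefined, one = undefined, zero = (\<lambda>b. \<zero>\<^bsub>R\<^esub>),
     add = (\<lambda>v w b. v b \<oplus>\<^bsub>R\<^esub> w b), smult = (\<lambda>r v b. r \<otimes>\<^bsub>R\<^esub> v b)\<rparr>"

definition quot_module :: "('a,'m,'y) module_scheme \<Rightarrow> 'm set \<Rightarrow> ('a, 'm set) module" where
  "quot_module M H = \<lparr>carrier = a_rcosets\<^bsub>M\<^esub> H, monoid.mult = undefined, one = undefined, zero = H,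
     add = set_add M, smult = (\<lambda>r X. \<Union>x\<in>X. H +>\<^bsub>M\<^esub> (r \<odot>\<^bsub>M\<^esub> x))\<rparr>"

definition dual_module :: "('a,'x) ring_scheme \<Rightarrow> ('a,'m,'y) module_scheme \<Rightarrow> ('a, 'm \<Rightarrow> 'a) module" where
  "dual_module R M = \<lparr>carrier = mod_hom R M (ring_module R) \<inter> extensional (carrier M),
     monoid.mult = undefined, one = undefined, zero = (\<lambda>x\<in>carrier M. \<zero>\<^bsub>R\<^esub>),
     add = (\<lambda>u v. \<lambda>x\<in>carrier M. u x \<oplus>\<^bsub>R\<^esub> v x), smult = (\<lambda>r u. \<lambda>x\<in>carrier M. r \<otimes>\<^bsub>R\<^esub> u x)\<rparr>"

definition is_basis ::
  "('a,'x) ring_scheme \<Rightarrow> ('a,'m,'y) module_scheme \<Rightarrow> 'i set \<Rightarrow> ('i \<Rightarrow> 'm) \<Rightarrow> bool" where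
  "is_basis R M I e \<longleftrightarrow> finite I \<and> e \<in> I \<rightarrow> carrier M \<and>
     (\<forall>x\<in>carrier M. \<exists>!c. c \<in> I \<rightarrow>\<^sub>E carrier R \<and> x = (\<Oplus>\<^bsub>M\<^esub>i\<in>I. c i \<odot>\<^bsub>M\<^esub> e i))"

definition finite_free :: "('a,'x) ring_scheme \<Rightarrow> ('a,'m,'y) module_scheme \<Rightarrow> bool" where
  "finite_free R M \<longleftrightarrow> (\<exists>(n::nat) e. is_basis R M {1..n} e)"

text \<open>Projective means: direct summand (retract) of a free module. Every module is a quotient of
  the free module on its own underlying set, and a projective module is a retract of that one, so
  index sets of the type of the module suffice.\<close>

definition projective :: "('a,'x) ring_scheme \<Rightarrow> ('a,'m,'y) module_scheme \<Rightarrow> bool" where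
  "projective R P \<longleftrightarrow> module R P \<and>
     (\<exists>(B :: 'm set). \<exists>i \<in> mod_hom R P (free_module R B). \<exists>q \<in> mod_hom R (free_module R B) P.
        \<forall>x\<in>carrier P. q (i x) = x)"

text \<open>The map \<open>d k\<close> goes from \<open>P k\<close> to \<open>P (k - 1)\<close>; \<open>d 0\<close> is not used.\<close>

definition chain_complex ::
  "('a,'x) ring_scheme \<Rightarrow> (nat \<Rightarrow> ('a,'m,'y) module_scheme) \<Rightarrow> (nat \<Rightarrow> 'm \<Rightarrow> 'm) \<Rightarrow> bool" where
  "chain_complex R P d \<longleftrightarrow> (\<forall>k. module R (P k)) \<and>
     (\<forall>k. d (Suc k) \<in> mod_hom R (P (Suc k)) (P k)) \<and>
     (\<forall>k. \<forall>x\<in>carrier (P (Suc (Suc k))). d (Suc k) (d (Suc (Suc k)) x) = \<zero>\<^bsub>P k\<^esub>)"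

definition resolution ::
  "('a,'x) ring_scheme \<Rightarrow> (nat \<Rightarrow> ('a,'m,'y) module_scheme) \<Rightarrow> (nat \<Rightarrow> 'm \<Rightarrow> 'm)
     \<Rightarrow> ('a,'n,'z) module_scheme \<Rightarrow> bool" where
  "resolution R P d M \<longleftrightarrow> chain_complex R P d \<and>
     (\<forall>k. a_kernel (P (Suc k)) (P k) (d (Suc k)) = d (Suc (Suc k)) ` carrier (P (Suc (Suc k)))) \<and>
     (\<exists>h \<in> mod_hom R (P 0) M. h ` carrier (P 0) = carrier M \<and>
        a_kernel (P 0) M h = d 1 ` carrier (P 1))"

definition free_resolution ::
  "('a,'x) ring_scheme \<Rightarrow> (nat \<Rightarrow> ('a,'m,'y) module_scheme) \<Rightarrow> (nat \<Rightarrow> 'm \<Rightarrow> 'm)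
     \<Rightarrow> ('a,'n,'z) module_scheme \<Rightarrow> bool" where
  "free_resolution R P d M \<longleftrightarrow> resolution R P d M \<and> (\<forall>k. finite_free R (P k))"

text \<open>The modules of a resolution have to live on some fixed type. The type
  \<open>('m + 'a + nat) \<Rightarrow> 'a\<close> carries a free module whose rank is at least the cardinality of
  \<open>M\<close>, of \<open>R\<close> and of the natural numbers; hence it carries a free resolution of \<open>M\<close>
  together with all its syzygies, and restricting to it does not change the projective dimension.\<close>

definition proj_dim :: "('a,'x) ring_scheme \<Rightarrow> ('a,'m,'y) module_scheme \<Rightarrow> enat" where
  "proj_dim R M = Inf {enat n | n.
     \<exists>(P :: nat \<Rightarrow> ('a, ('m + 'a + nat) \<Rightarrow> 'a) module) d. resolution R P d M \<and>
       (\<forall>k. projective R (P k)) \<and> (\<forall>k>n. carrier (P k) = {\<zero>\<^bsub>P k\<^esub>})}"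

definition annihilator :: "('a,'x) ring_scheme \<Rightarrow> ('a,'m,'y) module_scheme \<Rightarrow> 'a set" where
  "annihilator R M = {r \<in> carrier R. \<forall>x\<in>carrier M. r \<odot>\<^bsub>M\<^esub> x = \<zero>\<^bsub>M\<^esub>}"

definition Ass :: "('a,'x) ring_scheme \<Rightarrow> ('a,'m,'y) module_scheme \<Rightarrow> 'a set set" where
  "Ass R M = {p. primeideal p R \<and> (\<exists>x\<in>carrier M. p = {r \<in> carrier R. r \<odot>\<^bsub>M\<^esub> x = \<zero>\<^bsub>M\<^esub>})}"


section \<open>Grade, depth, colon ideals\<close>

definition regular_sequence :: "('a,'x) ring_scheme \<Rightarrow> 'a list \<Rightarrow> bool" where
  "regular_sequence R xs \<longleftrightarrow> set xs \<subseteq> carrier R \<and> Idl\<^bsub>R\<^esub> (set xs) \<noteq> carrier R \<and>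
     (\<forall>i<length xs. \<forall>r\<in>carrier R.
        r \<otimes>\<^bsub>R\<^esub> (xs ! i) \<in> Idl\<^bsub>R\<^esub> (set (take i xs)) \<longrightarrow> r \<in> Idl\<^bsub>R\<^esub> (set (take i xs)))"

text \<open>In a Noetherian ring all maximal regular sequences in a proper ideal have the same length,
  which is therefore the supremum of the lengths of the regular sequences in that ideal.\<close>

definition grade :: "('a,'x) ring_scheme \<Rightarrow> 'a set \<Rightarrow> enat" where
  "grade R I = (if I = carrier R then \<infinity>
     else Sup {enat (length xs) | xs. regular_sequence R xs \<and> set xs \<subseteq> I})"

definition fraction :: "('a,'x) ring_scheme \<Rightarrow> 'a set \<Rightarrow> 'a \<Rightarrow> 'a \<Rightarrow> ('a \<times> 'a) set" where
  "fraction R S a s = {(b,t). b \<in> carrier R \<and> t \<in> S \<and>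
     (\<exists>u\<in>S. u \<otimes>\<^bsub>R\<^esub> (t \<otimes>\<^bsub>R\<^esub> a) = u \<otimes>\<^bsub>R\<^esub> (s \<otimes>\<^bsub>R\<^esub> b))}"

definition fraction_ring :: "('a,'x) ring_scheme \<Rightarrow> 'a set \<Rightarrow> ('a \<times> 'a) set ring" where
  "fraction_ring R S = \<lparr>carrier = {fraction R S a s | a s. a \<in> carrier R \<and> s \<in> S},
     monoid.mult = (\<lambda>X Y. \<Union>(a,s)\<in>X. \<Union>(b,t)\<in>Y. fraction R S (a \<otimes>\<^bsub>R\<^esub> b) (s \<otimes>\<^bsub>R\<^esub> t)),
     one = fraction R S \<one>\<^bsub>R\<^esub> \<one>\<^bsub>R\<^esub>, zero = fraction R S \<zero>\<^bsub>R\<^esub> \<one>\<^bsub>R\<^esub>,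
     add = (\<lambda>X Y. \<Union>(a,s)\<in>X. \<Union>(b,t)\<in>Y. fraction R S ((t \<otimes>\<^bsub>R\<^esub> a) \<oplus>\<^bsub>R\<^esub> (s \<otimes>\<^bsub>R\<^esub> b)) (s \<otimes>\<^bsub>R\<^esub> t))\<rparr>"

definition localization :: "('a,'x) ring_scheme \<Rightarrow> 'a set \<Rightarrow> ('a \<times> 'a) set ring" where
  "localization R p = fraction_ring R (carrier R - p)"

text \<open>For a local ring; its maximal ideal is the set of non-units.\<close>

definition local_depth :: "('a,'x) ring_scheme \<Rightarrow> enat" where
  "local_depth S = grade S (carrier S - Units S)"

definition colon :: "('a,'x) ring_scheme \<Rightarrow> 'a set \<Rightarrow> 'a set \<Rightarrow> 'a set" where
  "colon R I J = {r \<in> carrier R. \<forall>x\<in>J. r \<otimes>\<^bsub>R\<^esub> x \<in> I}"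

definition saturation :: "('a,'x) ring_scheme \<Rightarrow> 'a set \<Rightarrow> 'a set \<Rightarrow> 'a set" where
  "saturation R I J = (\<Union>n::nat. colon R I (J [^]\<^bsub>ideals_set R\<^esub> n))"

definition gunm :: "('a,'x) ring_scheme \<Rightarrow> 'a set \<Rightarrow> 'a set" where
  "gunm R I = (GREATEST K. ideal K R \<and> I \<subseteq> K \<and> grade R I < grade R (colon R I K))"


section \<open>Signs, minors, Pfaffians, binomial coefficients\<close>

definition sgn_pow :: "('a,'x) ring_scheme \<Rightarrow> nat \<Rightarrow> 'a" where
  "sgn_pow R n = (\<ominus>\<^bsub>R\<^esub> \<one>\<^bsub>R\<^esub>) [^]\<^bsub>R\<^esub> n"

definition ring_det :: "('a,'x) ring_scheme \<Rightarrow> nat \<Rightarrow> (nat \<Rightarrow> nat \<Rightarrow> 'a) \<Rightarrow> 'a" where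
  "ring_det R n A = (\<Oplus>\<^bsub>R\<^esub>\<sigma>\<in>{\<sigma>. \<sigma> permutes {1..n}}.
     (if evenperm \<sigma> then \<one>\<^bsub>R\<^esub> else \<ominus>\<^bsub>R\<^esub> \<one>\<^bsub>R\<^esub>) \<otimes>\<^bsub>R\<^esub> (\<Otimes>\<^bsub>R\<^esub>i\<in>{1..n}. A i (\<sigma> i)))"

definition minors_ideal ::
  "('a,'x) ring_scheme \<Rightarrow> nat \<Rightarrow> nat \<Rightarrow> nat \<Rightarrow> (nat \<Rightarrow> nat \<Rightarrow> 'a) \<Rightarrow> 'a set" where
  "minors_ideal R r m n A = Idl\<^bsub>R\<^esub> {ring_det R r (\<lambda>i k. A (\<rho> i) (\<kappa> k)) | \<rho> \<kappa>.
     \<rho> \<in> {1..r} \<rightarrow> {1..m} \<and> strict_mono_on {1..r} \<rho> \<and>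
     \<kappa> \<in> {1..r} \<rightarrow> {1..n} \<and> strict_mono_on {1..r} \<kappa>}"

definition perfect_matchings :: "nat set \<Rightarrow> (nat \<times> nat) set set" where
  "perfect_matchings K = {P. P \<subseteq> {(p,q). p \<in> K \<and> q \<in> K \<and> p < q} \<and>
     (\<forall>k\<in>K. \<exists>!e. e \<in> P \<and> (k = fst e \<or> k = snd e))}"

definition crossings :: "(nat \<times> nat) set \<Rightarrow> nat" where
  "crossings P = card {((p,q),(r,s)). (p,q) \<in> P \<and> (r,s) \<in> P \<and> p < r \<and> r < q \<and> q < s}"

text \<open>The sign of the permutation \<open>p\<^sub>1, q\<^sub>1, p\<^sub>2, q\<^sub>2, \<dots>\<close> attached to a matching with
  \<open>p\<^sub>i < q\<^sub>i\<close> is the parity of the number of crossings. Only the entries of \<open>A\<close> above the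
  diagonal are used.\<close>

definition pfaffian :: "('a,'x) ring_scheme \<Rightarrow> (nat \<Rightarrow> nat \<Rightarrow> 'a) \<Rightarrow> nat set \<Rightarrow> 'a" where
  "pfaffian R A K = (\<Oplus>\<^bsub>R\<^esub>P\<in>perfect_matchings K.
     sgn_pow R (crossings P) \<otimes>\<^bsub>R\<^esub> (\<Otimes>\<^bsub>R\<^esub>e\<in>P. A (fst e) (snd e)))"

definition zbinom :: "int \<Rightarrow> int \<Rightarrow> int" where
  "zbinom a b = (if b < 0 then 0 else (\<Prod>i<nat b. a - int i) div fact (nat b))"


section \<open>Exterior and divided power algebras in coordinates\<close>

text \<open>\<open>F\<close> is free with basis \<open>e\<^sub>1, \<dots>, e\<^sub>f\<close>. The exterior power \<open>\<And>\<^sup>i F\<close> is the free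
  module on the \<open>e\<^sub>K = e\<^bsub>k1\<^esub> \<and> \<dots> \<and> e\<^bsub>ki\<^esub>\<close> for
  \<open>K = {k1 < \<dots> < ki} \<subseteq> {1..f}\<close>, and an element of the exterior algebra is the function
  taking \<open>K\<close> to the coefficient of \<open>e\<^sub>K\<close>; in particular \<open>\<And>\<^sup>1 F\<close> is \<open>F\<close>, with
  \<open>e\<^sub>p\<close> written \<open>e\<^bsub>{p}\<^esub>\<close>. \<open>G\<^sup>*\<close> is free with basis \<open>X\<^sub>1, \<dots>, X\<^sub>g\<close>, and
  \<open>D\<^sub>j(G\<^sup>*)\<close> is the free module on the \<open>X\<^sub>1\<^bsup>(a1)\<^esup> \<cdots> X\<^sub>g\<^bsup>(ag)\<^esup>\<close> for exponent vectors
  \<open>a\<close> of degree \<open>j\<close>; exponent vectors also index the monomials in \<open>Y\<^sub>1, \<dots>, Y\<^sub>g\<close>.\<close>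

definition ext_basis :: "nat \<Rightarrow> nat \<Rightarrow> nat set set" where
  "ext_basis f i = {K. K \<subseteq> {1..f} \<and> card K = i}"

definition exponents :: "nat \<Rightarrow> nat \<Rightarrow> (nat \<Rightarrow> nat) set" where
  "exponents g j = {a. (\<forall>l. l \<notin> {1..g} \<longrightarrow> a l = 0) \<and> sum a {1..g} = j}"

definition ext_power :: "('a,'x) ring_scheme \<Rightarrow> nat \<Rightarrow> nat \<Rightarrow> ('a, nat set \<Rightarrow> 'a) module" where
  "ext_power R f i = free_module R (ext_basis f i)"

definition div_power :: "('a,'x) ring_scheme \<Rightarrow> nat \<Rightarrow> nat \<Rightarrow> ('a, (nat \<Rightarrow> nat) \<Rightarrow> 'a) module" where
  "div_power R g j = free_module R (exponents g j)"

text \<open>For disjoint \<open>K\<close> and \<open>L\<close>, \<open>e\<^sub>K \<and> e\<^sub>L\<close> is \<open>e\<^bsub>K \<union> L\<^esub>\<close> up to the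
  sign counting the inversions between \<open>K\<close> and \<open>L\<close>.\<close>

definition wedge :: "('a,'x) ring_scheme \<Rightarrow> (nat set \<Rightarrow> 'a) \<Rightarrow> (nat set \<Rightarrow> 'a) \<Rightarrow> nat set \<Rightarrow> 'a" where
  "wedge R u v = (\<lambda>M. \<Oplus>\<^bsub>R\<^esub>K\<in>Pow M.
     sgn_pow R (card {(k,l). k \<in> K \<and> l \<in> M - K \<and> l < k}) \<otimes>\<^bsub>R\<^esub> (u K \<otimes>\<^bsub>R\<^esub> v (M - K)))"

definition ext_one :: "('a,'x) ring_scheme \<Rightarrow> nat set \<Rightarrow> 'a" where
  "ext_one R = (\<lambda>K. if K = {} then \<one>\<^bsub>R\<^esub> else \<zero>\<^bsub>R\<^esub>)"

definition wedge_list :: "('a,'x) ring_scheme \<Rightarrow> (nat set \<Rightarrow> 'a) list \<Rightarrow> nat set \<Rightarrow> 'a" where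
  "wedge_list R us = foldr (wedge R) us (ext_one R)"

text \<open>The derivation of degree \<open>-1\<close> on the exterior algebra given by the linear form
  \<open>\<tau>\<close> with \<open>\<tau>(e\<^sub>p) = t p\<close>: the coefficient at \<open>e\<^sub>L\<close> collects the
  contributions of the \<open>e\<^bsub>L \<union> {p}\<^esub>\<close>.\<close>

definition derivation :: "('a,'x) ring_scheme \<Rightarrow> nat \<Rightarrow> (nat \<Rightarrow> 'a) \<Rightarrow> (nat set \<Rightarrow> 'a) \<Rightarrow> nat set \<Rightarrow> 'a" where
  "derivation R f t v = (\<lambda>L. \<Oplus>\<^bsub>R\<^esub>p\<in>{1..f} - L.
     sgn_pow R (card {q \<in> L. q < p}) \<otimes>\<^bsub>R\<^esub> (t p \<otimes>\<^bsub>R\<^esub> v (insert p L)))"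

text \<open>The divided power \<open>v\<^bsup>(l)\<^esup>\<close> of \<open>v \<in> \<And>\<^sup>2 F\<close>.\<close>

definition ext_divpow :: "('a,'x) ring_scheme \<Rightarrow> nat \<Rightarrow> (nat set \<Rightarrow> 'a) \<Rightarrow> nat \<Rightarrow> nat set \<Rightarrow> 'a" where
  "ext_divpow R f v l = (\<lambda>K. if K \<in> ext_basis f (2 * l) then pfaffian R (\<lambda>p q. v {p,q}) K else \<zero>\<^bsub>R\<^esub>)"

text \<open>From here on \<open>t p = \<tau>(e\<^sub>p)\<close> and \<open>x l = \<mu>(X\<^sub>l)\<close>. The next definition is
  \<open>[D(\<mu>)](X\<^sub>1\<^bsup>(a1)\<^esup> \<cdots> X\<^sub>g\<^bsup>(ag)\<^esup>)\<close>, the second one its linear extension.\<close>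

definition Dmu_mono ::
  "('a,'x) ring_scheme \<Rightarrow> nat \<Rightarrow> nat \<Rightarrow> (nat \<Rightarrow> nat set \<Rightarrow> 'a) \<Rightarrow> (nat \<Rightarrow> nat) \<Rightarrow> nat set \<Rightarrow> 'a" where
  "Dmu_mono R f g x a = wedge_list R (map (\<lambda>l. ext_divpow R f (x l) (a l)) [1..<Suc g])"

definition Dmu ::
  "('a,'x) ring_scheme \<Rightarrow> nat \<Rightarrow> nat \<Rightarrow> (nat \<Rightarrow> nat set \<Rightarrow> 'a) \<Rightarrow> ((nat \<Rightarrow> nat) \<Rightarrow> 'a) \<Rightarrow> nat set \<Rightarrow> 'a" where
  "Dmu R f g x \<gamma> = (\<lambda>K. \<Oplus>\<^bsub>R\<^esub>a\<in>{a. \<gamma> a \<noteq> \<zero>\<^bsub>R\<^esub>}. \<gamma> a \<otimes>\<^bsub>R\<^esub> Dmu_mono R f g x a K)"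

text \<open>\<open>\<Psi>(X\<^sub>l)\<close>.\<close>

definition Psi ::
  "('a,'x) ring_scheme \<Rightarrow> nat \<Rightarrow> (nat \<Rightarrow> 'a) \<Rightarrow> (nat \<Rightarrow> nat set \<Rightarrow> 'a) \<Rightarrow> nat \<Rightarrow> nat set \<Rightarrow> 'a" where
  "Psi R f t x l = derivation R f t (x l)"

definition Psi_minors ::
  "('a,'x) ring_scheme \<Rightarrow> nat \<Rightarrow> nat \<Rightarrow> (nat \<Rightarrow> 'a) \<Rightarrow> (nat \<Rightarrow> nat set \<Rightarrow> 'a) \<Rightarrow> 'a set" where
  "Psi_minors R f g t x = minors_ideal R g g f (\<lambda>l p. Psi R f t x l {p})"

text \<open>The action on \<open>D(G\<^sup>*)\<close> of the monomial in \<open>Y\<^sub>1, \<dots>, Y\<^sub>g\<close> with exponent vector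
  \<open>b\<close>: it takes the basis vector with exponents \<open>a\<close> to the one with exponents
  \<open>a - b\<close>, or to \<open>0\<close>.\<close>

definition contract :: "(nat \<Rightarrow> nat) \<Rightarrow> ((nat \<Rightarrow> nat) \<Rightarrow> 'a) \<Rightarrow> (nat \<Rightarrow> nat) \<Rightarrow> 'a" where
  "contract b \<gamma> = (\<lambda>a. \<gamma> (\<lambda>l. a l + b l))"

definition Y_monomials :: "nat \<Rightarrow> int \<Rightarrow> (nat \<Rightarrow> nat) set" where
  "Y_monomials g i = (if i < 0 then {} else exponents g (nat i))"

definition unit_exponent :: "nat \<Rightarrow> nat \<Rightarrow> nat" where
  "unit_exponent l = (\<lambda>k. if k = l then 1 else 0)"

definition integral_X1 :: "('a,'x) ring_scheme \<Rightarrow> ((nat \<Rightarrow> nat) \<Rightarrow> 'a) \<Rightarrow> (nat \<Rightarrow> nat) \<Rightarrow> 'a" where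
  "integral_X1 R \<gamma> = (\<lambda>a. if a 1 = 0 then \<zero>\<^bsub>R\<^esub> else \<gamma> (a(1 := a 1 - 1)))"


section \<open>The complex\<close>

text \<open>Basis elements: \<open>VT (K, a)\<close> and \<open>VB (K, a)\<close> stand for
  \<open>e\<^sub>K \<otimes> X\<^bsup>(a)\<^esup>\<close> in the two families of copies of \<open>\<And>\<^sup>i F \<otimes> D\<^sub>j(G\<^sup>*)\<close>, and
  \<open>Top\<close> for \<open>(e\<^sub>1 \<and> \<dots> \<and> e\<^sub>f) \<otimes> (Y\<^sub>g \<and> \<dots> \<and> Y\<^sub>1)\<close>.\<close>

datatype M_basis_elt = VT "nat set \<times> (nat \<Rightarrow> nat)" | VB "nat set \<times> (nat \<Rightarrow> nat)" | Top

definition V_basis :: "nat \<Rightarrow> nat \<Rightarrow> nat \<Rightarrow> nat \<Rightarrow> (nat set \<times> (nat \<Rightarrow> nat)) set" where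
  "V_basis f g i j = ext_basis f i \<times> exponents g j"

abbreviation delta :: "nat \<Rightarrow> nat \<Rightarrow> int" where
  "delta f g \<equiv> int f - int g"

definition T_index :: "nat \<Rightarrow> nat \<Rightarrow> int \<Rightarrow> nat \<Rightarrow> (nat \<times> nat) set" where
  "T_index f g \<epsilon> N = {(I,J). \<epsilon> \<le> int J \<and> int I + int J \<le> delta f g - 1 \<and>
     int I + 2 * int J - delta f g + 2 = int N}"

definition B_index :: "nat \<Rightarrow> nat \<Rightarrow> int \<Rightarrow> nat \<Rightarrow> (nat \<times> nat) set" where
  "B_index f g \<epsilon> N = {(i,j). int j \<le> \<epsilon> - 1 \<and> delta f g \<le> int i + int j \<and>
     int i + 2 * int j - delta f g + 1 = int N}"

definition M_module ::
  "('a,'x) ring_scheme \<Rightarrow> nat \<Rightarrow> nat \<Rightarrow> int \<Rightarrow> nat \<Rightarrow> ('a, M_basis_elt \<Rightarrow> 'a) module" where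
  "M_module R f g \<epsilon> N = free_module R
     (VT ` (\<Union>(I,J)\<in>T_index f g \<epsilon> N. V_basis f g I J) \<union>
      VB ` (\<Union>(i,j)\<in>B_index f g \<epsilon> N. V_basis f g i j) \<union>
      (if N = 0 then {Top} else {}))"

text \<open>The components of an element in \<open>V\<^sup>T\<^bsub>I,J\<^esub>\<close> and \<open>V\<^sup>B\<^bsub>i,j\<^esub>\<close>.\<close>

definition VT_part :: "('a,'x) ring_scheme \<Rightarrow> nat \<Rightarrow> nat \<Rightarrow> nat \<Rightarrow> nat \<Rightarrow> (M_basis_elt \<Rightarrow> 'a)
    \<Rightarrow> nat set \<times> (nat \<Rightarrow> nat) \<Rightarrow> 'a" where
  "VT_part R f g I J w = (\<lambda>k. if k \<in> V_basis f g I J then w (VT k) else \<zero>\<^bsub>R\<^esub>)"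

definition VB_part :: "('a,'x) ring_scheme \<Rightarrow> nat \<Rightarrow> nat \<Rightarrow> nat \<Rightarrow> nat \<Rightarrow> (M_basis_elt \<Rightarrow> 'a)
    \<Rightarrow> nat set \<times> (nat \<Rightarrow> nat) \<Rightarrow> 'a" where
  "VB_part R f g i j w = (\<lambda>k. if k \<in> V_basis f g i j then w (VB k) else \<zero>\<^bsub>R\<^esub>)"

text \<open>\<open>h \<otimes> id\<close> and \<open>id \<otimes> h\<close> on \<open>\<And> F \<otimes> D(G\<^sup>*)\<close>.\<close>

definition on_ext :: "((nat set \<Rightarrow> 'a) \<Rightarrow> nat set \<Rightarrow> 'a)
    \<Rightarrow> (nat set \<times> (nat \<Rightarrow> nat) \<Rightarrow> 'a) \<Rightarrow> nat set \<times> (nat \<Rightarrow> nat) \<Rightarrow> 'a" where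
  "on_ext h w = (\<lambda>(K,a). h (\<lambda>L. w (L,a)) K)"

definition on_div :: "(((nat \<Rightarrow> nat) \<Rightarrow> 'a) \<Rightarrow> (nat \<Rightarrow> nat) \<Rightarrow> 'a)
    \<Rightarrow> (nat set \<times> (nat \<Rightarrow> nat) \<Rightarrow> 'a) \<Rightarrow> nat set \<times> (nat \<Rightarrow> nat) \<Rightarrow> 'a" where
  "on_div h w = (\<lambda>(K,a). h (\<lambda>b. w (K,b)) a)"

text \<open>\<open>f\<^sub>i \<otimes> \<gamma>\<^sub>j \<mapsto> \<Sum>\<^sub>l \<Psi>(X\<^sub>l) \<and> f\<^sub>i \<otimes> Y\<^sub>l(\<gamma>\<^sub>j)\<close>\<close>

definition Psi_term :: "('a,'x) ring_scheme \<Rightarrow> nat \<Rightarrow> nat \<Rightarrow> (nat \<Rightarrow> 'a) \<Rightarrow> (nat \<Rightarrow> nat set \<Rightarrow> 'a)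
    \<Rightarrow> (nat set \<times> (nat \<Rightarrow> nat) \<Rightarrow> 'a) \<Rightarrow> nat set \<times> (nat \<Rightarrow> nat) \<Rightarrow> 'a" where
  "Psi_term R f g t x w = (\<lambda>k. \<Oplus>\<^bsub>R\<^esub>l\<in>{1..g}.
     on_ext (wedge R (Psi R f t x l)) (on_div (contract (unit_exponent l)) w) k)"

text \<open>\<open>f\<^sub>i \<otimes> \<gamma>\<^sub>j \<mapsto> \<Sum> [D(\<mu>)](m\<^sup>*) \<and> f\<^sub>i \<otimes> m(\<gamma>\<^sub>j)\<close>, the sum being
  over the monomials \<open>m\<close> of degree \<open>n\<close>\<close>

definition mu_term :: "('a,'x) ring_scheme \<Rightarrow> nat \<Rightarrow> nat \<Rightarrow> (nat \<Rightarrow> nat set \<Rightarrow> 'a) \<Rightarrow> int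
    \<Rightarrow> (nat set \<times> (nat \<Rightarrow> nat) \<Rightarrow> 'a) \<Rightarrow> nat set \<times> (nat \<Rightarrow> nat) \<Rightarrow> 'a" where
  "mu_term R f g x n w = (\<lambda>k. \<Oplus>\<^bsub>R\<^esub>m\<in>Y_monomials g n.
     on_ext (wedge R (Dmu_mono R f g x m)) (on_div (contract m) w) k)"

definition d_T :: "('a,'x) ring_scheme \<Rightarrow> nat \<Rightarrow> nat \<Rightarrow> (nat \<Rightarrow> 'a) \<Rightarrow> (nat \<Rightarrow> nat set \<Rightarrow> 'a) \<Rightarrow> int
    \<Rightarrow> nat \<Rightarrow> nat \<Rightarrow> (nat set \<times> (nat \<Rightarrow> nat) \<Rightarrow> 'a) \<Rightarrow> M_basis_elt \<Rightarrow> 'a" where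
  "d_T R f g t x \<epsilon> I J w = (\<lambda>z. case z of
       VT k \<Rightarrow> (if \<epsilon> \<le> int J - 1 then Psi_term R f g t x w k else \<zero>\<^bsub>R\<^esub>)
                 \<oplus>\<^bsub>R\<^esub> on_ext (derivation R f t) w k
     | VB k \<Rightarrow> (\<Oplus>\<^bsub>R\<^esub>ij\<in>{(i,j). i + 2 * j = I + 2 * J \<and> delta f g \<le> int i + int j}.
                 let j = snd ij in
                 sgn_pow R (I + j) \<otimes>\<^bsub>R\<^esub>
                   ([zbinom (int J - 1 - int j) (int J - \<epsilon>)] \<cdot>\<^bsub>R\<^esub> mu_term R f g x (int J - int j) w k))
     | Top \<Rightarrow> \<zero>\<^bsub>R\<^esub>)"

definition d_B :: "('a,'x) ring_scheme \<Rightarrow> nat \<Rightarrow> nat \<Rightarrow> (nat \<Rightarrow> 'a) \<Rightarrow> (nat \<Rightarrow> nat set \<Rightarrow> 'a)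
    \<Rightarrow> nat \<Rightarrow> nat \<Rightarrow> (nat set \<times> (nat \<Rightarrow> nat) \<Rightarrow> 'a) \<Rightarrow> M_basis_elt \<Rightarrow> 'a" where
  "d_B R f g t x i j w = (\<lambda>z. case z of
       VT k \<Rightarrow> \<zero>\<^bsub>R\<^esub>
     | VB k \<Rightarrow> Psi_term R f g t x w k \<oplus>\<^bsub>R\<^esub>
                 (if delta f g \<le> int i + int j - 1 then on_ext (derivation R f t) w k else \<zero>\<^bsub>R\<^esub>)
     | Top \<Rightarrow> \<zero>\<^bsub>R\<^esub>)"

definition top_module :: "('a,'x) ring_scheme \<Rightarrow> ('a, M_basis_elt \<Rightarrow> 'a) module" where
  "top_module R = free_module R {Top}"

definition top_elt :: "('a,'x) ring_scheme \<Rightarrow> 'a \<Rightarrow> M_basis_elt \<Rightarrow> 'a" where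
  "top_elt R r = (\<lambda>z. if z = Top then r else \<zero>\<^bsub>R\<^esub>)"

text \<open>The vectors \<open>Y\<^sub>1\<close>, \<open>X\<^sub>1\<close> and the complements \<open>G\<^sub>+\<close>, \<open>G\<^sub>+\<^sup>*\<close> in the
  construction of \<open>c\<close> are the ones given by the bases \<open>Y\<^sub>1, \<dots>, Y\<^sub>g\<close> and
  \<open>X\<^sub>1, \<dots>, X\<^sub>g\<close>, with \<open>X\<^sub>2 \<and> \<dots> \<and> X\<^sub>g\<close> and \<open>Y\<^sub>g \<and> \<dots> \<and> Y\<^sub>2\<close> as dual
  generators of the top exterior powers.\<close>

definition c_map :: "('a,'x) ring_scheme \<Rightarrow> nat \<Rightarrow> nat \<Rightarrow> (nat \<Rightarrow> 'a) \<Rightarrow> (nat \<Rightarrow> nat set \<Rightarrow> 'a)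
    \<Rightarrow> ((nat \<Rightarrow> nat) \<Rightarrow> 'a) \<Rightarrow> M_basis_elt \<Rightarrow> 'a" where
  "c_map R f g t x \<gamma> = top_elt R
     (wedge R (Dmu R f g x (integral_X1 R \<gamma>)) (wedge_list R (map (Psi R f t x) [2..<Suc g])) {1..f})"

definition C_ideal ::
  "('a,'x) ring_scheme \<Rightarrow> nat \<Rightarrow> nat \<Rightarrow> (nat \<Rightarrow> 'a) \<Rightarrow> (nat \<Rightarrow> nat set \<Rightarrow> 'a) \<Rightarrow> 'a set" where
  "C_ideal R f g t x = (if odd (f - g)
     then annihilator R (quot_module (top_module R)
            (c_map R f g t x ` carrier (div_power R g ((f - g - 1) div 2))))
     else {\<zero>\<^bsub>R\<^esub>})"

definition d_1 :: "('a,'x) ring_scheme \<Rightarrow> nat \<Rightarrow> nat \<Rightarrow> (nat \<Rightarrow> 'a) \<Rightarrow> (nat \<Rightarrow> nat set \<Rightarrow> 'a) \<Rightarrow> int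
    \<Rightarrow> (M_basis_elt \<Rightarrow> 'a) \<Rightarrow> M_basis_elt \<Rightarrow> 'a" where
  "d_1 R f g t x \<epsilon> w = (\<lambda>z.
     top_elt R (wedge R (\<lambda>K. VB_part R f g (f - g) 0 w (K, \<lambda>l. 0))
                        (wedge_list R (map (Psi R f t x) [1..<Suc g])) {1..f}) z
     \<oplus>\<^bsub>R\<^esub> (if 2 * \<epsilon> = delta f g - 1
           then c_map R f g t x (\<lambda>a. VT_part R f g 0 (nat \<epsilon>) w ({}, a)) z else \<zero>\<^bsub>R\<^esub>))"

definition M_diff :: "('a,'x) ring_scheme \<Rightarrow> nat \<Rightarrow> nat \<Rightarrow> (nat \<Rightarrow> 'a) \<Rightarrow> (nat \<Rightarrow> nat set \<Rightarrow> 'a) \<Rightarrow> int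
    \<Rightarrow> nat \<Rightarrow> (M_basis_elt \<Rightarrow> 'a) \<Rightarrow> M_basis_elt \<Rightarrow> 'a" where
  "M_diff R f g t x \<epsilon> N w =
     (if N \<ge> 2 then
        (\<lambda>z. (\<Oplus>\<^bsub>R\<^esub>IJ\<in>T_index f g \<epsilon> N. d_T R f g t x \<epsilon> (fst IJ) (snd IJ) (VT_part R f g (fst IJ) (snd IJ) w) z)
           \<oplus>\<^bsub>R\<^esub> (\<Oplus>\<^bsub>R\<^esub>ij\<in>B_index f g \<epsilon> N. d_B R f g t x (fst ij) (snd ij) (VB_part R f g (fst ij) (snd ij) w) z))
      else if N = 1 then d_1 R f g t x \<epsilon> w
      else (\<lambda>z. \<zero>\<^bsub>R\<^esub>))"

end

theory Submission
  imports Defs "HOL-Library.Function_Algebras" "HOL-Library.Poly_Mapping" "HOL-Combinatorics.Multiset_Permutations"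
begin

text \<open>All identities of multilinear algebra are proved over a ring of class comm_ring_1 modulo an
ideal J. Such a ring maps onto R, namely the formal integer combinations of multisets of elements of R,
and with J the kernel of the evaluation the complex over R is the complex upstairs modulo J.

A cycle multiplied by t q ^ 2 * Lam L ^ g is a boundary, where t q is a value of the linear form and
Lam L a maximal minor: wedging with a vector q is a homotopy for contraction with t, up to the
factor t q, and the maximal minors contract the rows of Psi as in the Eagon-Northcott complex. So the
homology dies after inverting t q and any element of the ideal of minors. In positions above f - g it
already dies after inverting t q, hence a regular sequence of length f - g in the ideal of minors
removes the minors, and then one of length f in the ideal of the t q removes the t q.

The same chase in position 0, up to a multiplicative set S, shows that an element of R lies in the
image ideal N as soon as a long enough regular sequence multiplies it into N; with S trivial, the
powers of t q, and the complement of a prime this gives the colon ideal, the unmixed part and the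
depth of the associated primes. The resolutions have the expected length because the
last differential has entries in a proper ideal, so that no homotopy can split it.\<close>

section \<open>Exterior algebra\<close>

text \<open>Nothing may be divided in R, not even by 2. So alternating expressions are shown to
  vanish by pairing terms, and tau(v^(l+1)) = tau(v) wedge v^(l) comes from Pfaffian expansions
  instead of factorials. With mu_n the sum over monomials of degree n, d after d = 0 rests on tau
  mu_n = mu_n tau + Psi mu_(n-1); the correction terms cancel by Pascal's rule, which dictates the
  binomial coefficients. Wedging with a basis vector stops being a homotopy only where a
  neighbouring summand is cut off: on I + J = f - g - 1 in V^T and on i + j = f - g in V^B. What is
  left of a cycle there is a strand governed by Psi; this is where minors enter. One factor t q
  passes from a cycle to that defect; a second one disposes of the V^B part that remains once the
  V^T part is gone. For odd f - g the two admissible values of eps differ at the ends of the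
  complex. In position 0 they give the minors alone, or the minors and the image of c; and 2 * eps
  <= f - g makes the complex zero from position f on, so that f elements of the ideal of tau can
  test membership in the ideal that is resolved.\<close>

text \<open>An element of the exterior algebra is the family of its coordinates: u K is the coefficient
of the basis vector indexed by K. In the second type divided power monomials are indexed by exponents.\<close>

type_synonym 'r ext = "nat set => 'r"
type_synonym 'r dext = "(nat => nat) => 'r ext"

abbreviation (input) iff_ascii (infixr "<->" 25) where
 "A <-> B == (A::bool) = B"

text \<open>For disjoint K and L this is the sign in e_K wedge e_L = +- e_(K Un L). Disjointness is
  not built in, so that the sign is multiplicative in each argument under disjoint unions.\<close>

definition isgn :: "nat set => ('r::comm_ring_1) ext" where
 "isgn K L = (-1) ^ card {(k,l). k : K & l : L & l < k}"

text \<open>At an infinite set the sum runs over an infinite power set and is 0 by convention.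
  Products vanish there although a factor need not; hence the unit laws ask the factor to vanish on
  infinite sets.\<close>

definition wdg :: "('r::comm_ring_1) ext => 'r ext => 'r ext" where
 "wdg u v = (%M. SUM K:Pow M. isgn K (M - K) * (u K * v (M - K)))"

definition wdg_one :: "('r::comm_ring_1) ext" where
 "wdg_one = (%K. if K = {} then 1 else 0)"

definition scal :: "'r::comm_ring_1 => ('b => 'r) => 'b => 'r" where
 "scal c u = (%k. c * u k)"

definition alt :: "('r::comm_ring_1) ext => 'r ext" where
 "alt u = (%K. (-1) ^ card K * u K)"

text \<open>Contraction with the p-th coordinate form. Splitting \<open>contr\<close> into these
  reduces the Leibniz rule and anticommutation to a single coordinate.\<close>

definition ann1 :: "nat => ('r::comm_ring_1) ext => 'r ext" where
 "ann1 p v = (%K. if p : K then 0 else isgn {p} K * v (insert p K))"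

definition contr :: "nat => (nat => 'r::comm_ring_1) => 'r ext => 'r ext" where
 "contr f t v = (%L. SUM p:{1..f}. t p * ann1 p v L)"

lemma scal_apply [simp]: "scal c u k = c * u k"
 by (simp add: scal_def)

lemma isgn_sq [simp]: "isgn K L * isgn K L = (1::'r::comm_ring_1)"
 by (simp add: isgn_def flip: power_add mult_2)

lemma isgn_sq_left [simp]: "isgn K L * (isgn K L * x) = (x::'r::comm_ring_1)"
 by (simp flip: mult.assoc)

lemma finite_inversions: "finite A ==> finite B ==> finite {(k,l). k : A & l : B & l < (k::nat)}"
 by (rule finite_subset[of _ "A \<times> B"]) auto

lemma isgn_Un_left:
 assumes "finite A" "finite B" "finite C" "A Int B = {}"
 shows "isgn (A Un B) C = isgn A C * (isgn B C :: 'r::comm_ring_1)"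
proof -
 have "{(k,l). k : A Un B & l : C & l < k} =
   {(k,l). k : A & l : C & l < k} Un {(k,l). k : B & l : C & l < k}" by auto
 moreover have "card ... = card {(k,l). k : A & l : C & l < k} + card {(k,l). k : B & l : C & l < k}"
  using assms by (intro card_Un_disjoint finite_inversions) auto
 ultimately show ?thesis by (simp add: isgn_def power_add)
qed

lemma isgn_Un_right:
 assumes "finite A" "finite B" "finite C" "A Int B = {}"
 shows "isgn C (A Un B) = isgn C A * (isgn C B :: 'r::comm_ring_1)"
proof -
 have "{(k,l). k : C & l : A Un B & l < k} =
   {(k,l). k : C & l : A & l < k} Un {(k,l). k : C & l : B & l < k}" by auto
 moreover have "card ... = card {(k,l). k : C & l : A & l < k} + card {(k,l). k : C & l : B & l < k}"
  using assms by (intro card_Un_disjoint finite_inversions) auto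
 ultimately show ?thesis by (simp add: isgn_def power_add)
qed

lemma isgn_insert_left:
 "finite A ==> finite C ==> p ~: A ==> isgn (insert p A) C = isgn {p} C * (isgn A C :: 'r::comm_ring_1)"
 using isgn_Un_left[of "{p}" A C] by simp

lemma isgn_insert_right:
 "finite A ==> finite C ==> p ~: A ==> isgn C (insert p A) = isgn C {p} * (isgn C A :: 'r::comm_ring_1)"
 using isgn_Un_right[of "{p}" A C] by simp

lemma isgn_empty [simp]: "isgn {} C = 1" "isgn C {} = 1"
 by (simp_all add: isgn_def)

text \<open>Disjointness excludes k = l, so the inversions of (A,B) and the reversed inversions of
  (B,A) partition A \<times> B.\<close>

lemma isgn_commute:
 assumes "finite A" "finite B" "A Int B = {}"
 shows "isgn A B * isgn B A = ((-1) ^ (card A * card B) :: 'r::comm_ring_1)"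
proof -
 let ?S = "{(k,l). k : A & l : B & l < k}" and ?T = "{(k,l). k : B & l : A & l < k}"
 let ?U = "{(k,l). k : A & l : B & k < l}"
 have "card ?T = card ?U"
  by (rule bij_betw_same_card[of "%(x,y). (y,x)"]) (auto simp: bij_betw_def inj_on_def)
 moreover have "A \<times> B = ?S Un ?U"
  using assms(3) by (auto simp: set_eq_iff) (metis disjoint_iff linorder_neqE_nat)
 moreover have "finite ?U" by (rule finite_subset[of _ "A \<times> B"]) (use assms in auto)
 hence "card (?S Un ?U) = card ?S + card ?U"
  by (intro card_Un_disjoint finite_inversions assms) auto
 ultimately have "card ?S + card ?T = card A * card B" by (metis card_cartesian_product)
 thus ?thesis by (simp add: isgn_def flip: power_add)
qed

lemma isgn_single: "p ~= q ==> isgn {p} {q} = (if q < p then -1 else (1::'r::comm_ring_1))"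
proof -
 assume "p ~= q"
 have "{(k,l). k : {p} & l : {q} & l < k} = (if q < p then {(p,q)} else {})" by auto
 thus ?thesis by (simp add: isgn_def)
qed

lemma isgn_single_card: "isgn {p} K = (-1::'r::comm_ring_1) ^ card {q : K. q < p}"
proof -
 have "{(k,l). k : {p} & l : K & l < k} = (%q. (p,q)) ` {q : K. q < p}" by auto
 thus ?thesis by (simp add: isgn_def card_image inj_on_def)
qed

lemma isgn_single_commute:
 assumes "finite L" "p ~: L"
 shows "isgn L {p} = (-1) ^ card L * (isgn {p} L :: 'r::comm_ring_1)"
proof -
 have "isgn L {p} * isgn {p} L = ((-1) ^ card L :: 'r)"
  using isgn_commute[of L "{p}"] assms by simp
 hence "isgn L {p} * isgn {p} L * isgn {p} L = ((-1) ^ card L :: 'r) * isgn {p} L"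
  by simp
 thus ?thesis by (simp add: mult.assoc)
qed

lemma additive_sum:
 fixes h :: "'m::comm_monoid_add => 'n::comm_monoid_add"
 assumes "h 0 = 0" "!!u v. h (u + v) = h u + h v"
 shows "h (SUM i:A. u i) = (SUM i:A. h (u i))"
 by (induction A rule: infinite_finite_induct) (simp_all add: assms)

lemma sum_apply: "(SUM i:A. u i) k = (SUM i:A. u i k :: 'r::comm_monoid_add)"
 using additive_sum[of "%f. f k" u A] by simp

lemma wdg_infinite: "infinite M ==> wdg u v M = 0"
 by (simp add: wdg_def)

lemma wdg_add_left: "wdg (u + u') v = wdg u v + wdg u' v"
 by (auto simp: wdg_def fun_eq_iff algebra_simps sum.distrib)

lemma wdg_add_right: "wdg u (v + v') = wdg u v + wdg u v'"
 by (auto simp: wdg_def fun_eq_iff algebra_simps sum.distrib)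

lemma wdg_scal_left: "wdg (scal c u) v = scal c (wdg u v)"
 by (auto simp: wdg_def fun_eq_iff algebra_simps sum_distrib_left)

lemma wdg_scal_right: "wdg u (scal c v) = scal c (wdg u v)"
 by (auto simp: wdg_def fun_eq_iff algebra_simps sum_distrib_left)

lemma wdg_zero_left [simp]: "wdg 0 v = 0"
 by (auto simp: wdg_def fun_eq_iff)

lemma wdg_zero_right [simp]: "wdg u 0 = 0"
 by (auto simp: wdg_def fun_eq_iff)

lemma wdg_uminus_left: "wdg (- u) v = - wdg u v"
 by (auto simp: wdg_def fun_eq_iff sum_negf)

lemma wdg_uminus_right: "wdg u (- v) = - wdg u v"
 by (auto simp: wdg_def fun_eq_iff sum_negf)

lemma wdg_sum_left: "wdg (SUM i:A. u i) v = (SUM i:A. wdg (u i) v)"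
 using additive_sum[of "%u. wdg u v"] by (simp add: wdg_add_left)

lemma wdg_sum_right: "wdg u (SUM i:A. v i) = (SUM i:A. wdg u (v i))"
 using additive_sum[of "wdg u"] by (simp add: wdg_add_right)

lemma wdg_one_left:
 assumes "!!K. infinite K ==> v K = 0" shows "wdg wdg_one v = v"
proof
 fix M
 show "wdg wdg_one v M = v M"
 proof (cases "finite M")
  case True
  have "wdg wdg_one v M = (SUM K:Pow M. if K = {} then v M else 0)"
   unfolding wdg_def wdg_one_def by (rule sum.cong) auto
  thus ?thesis using True by simp
 qed (simp add: wdg_infinite assms)
qed

lemma wdg_one_right:
 assumes "!!K. infinite K ==> v K = 0" shows "wdg v wdg_one = v"
proof
 fix M
 show "wdg v wdg_one M = v M"
 proof (cases "finite M")
  case True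
  have "wdg v wdg_one M = (SUM K:Pow M. if K = M then v M else 0)"
   unfolding wdg_def wdg_one_def by (rule sum.cong) auto
  thus ?thesis using True by simp
 qed (simp add: wdg_infinite assms)
qed

text \<open>Both sides sum over the ordered splittings of M into three blocks, and both signs are
  the product of the three pairwise signs.\<close>

lemma wdg_assoc: "wdg (wdg u v) w = wdg u (wdg v w)"
proof
 fix M
 show "wdg (wdg u v) w M = wdg u (wdg v w) M"
 proof (cases "finite M")
  case fM: True
  have "wdg (wdg u v) w M = (SUM (D,A):(SIGMA D:Pow M. Pow D).
    isgn D (M - D) * (isgn A (D - A) * (u A * v (D - A)) * w (M - D)))"
   unfolding wdg_def sum_distrib_left sum_distrib_right
   by (subst sum.Sigma) (use fM in "auto intro: finite_subset")
  also have "... = (SUM (A,B):(SIGMA A:Pow M. Pow (M - A)).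
    isgn A (M - A) * (u A * (isgn B (M - A - B) * (v B * w (M - A - B)))))"
  proof (rule sum.reindex_bij_witness[where i = "%(A,B). (A Un B, A)" and j = "%(D,A). (A, D - A)"])
   fix z assume "z : (SIGMA D:Pow M. Pow D)"
   then obtain D A where z: "z = (D,A)" and s: "A <= D" "D <= M" by auto
   have fin: "finite D" "finite A" "finite (D - A)" "finite (M - D)"
    using s fM by (auto intro: finite_subset)
   define B C where "B = D - A" and "C = M - D"
   have e: "D = A Un B" "M - A = B Un C" "M - A - B = C" and dj: "A Int B = {}" "B Int C = {}"
    and fin': "finite B" "finite C"
    using s fin by (auto simp: B_def C_def)
   have "isgn D C * (isgn A B :: 'a) = isgn A (M - A) * isgn B C"
    unfolding e(1,2) isgn_Un_left[OF fin(2) fin' dj(1)] isgn_Un_right[OF fin' fin(2) dj(2)]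
    by (simp add: ac_simps)
   hence "isgn D C * (isgn A B * (u A * v B) * w C) =
    isgn A (M - A) * (u A * (isgn B C * (v B * w C)))"
    by (metis (no_types, opaque_lifting) ab_semigroup_mult_class.mult_ac(1) mult.left_commute)
   thus "(case case z of (D, A) => (A, D - A) of (A, B) =>
    isgn A (M - A) * (u A * (isgn B (M - A - B) * (v B * w (M - A - B))))) =
    (case z of (D, A) => isgn D (M - D) * (isgn A (D - A) * (u A * v (D - A)) * w (M - D)))"
    unfolding z using e(3) by (simp add: B_def C_def)
  qed auto
  also have "... = wdg u (wdg v w) M"
   unfolding wdg_def sum_distrib_left sum_distrib_right
   by (subst sum.Sigma) (use fM in "auto intro: finite_subset")
  finally show ?thesis .
 qed (simp add: wdg_infinite)
qed

text \<open>Complementing the summation set exchanges the two factors; the parities of the blocks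
  then decide whether factors commute or anticommute.\<close>

lemma wdg_commute_weighted:
 "wdg u v M = (SUM K:Pow M. (-1) ^ (card K * card (M - K)) * (isgn K (M - K) * (v K * u (M - K))))"
proof (cases "finite M")
 case True
 show ?thesis unfolding wdg_def
 proof (rule sum.reindex_bij_witness[where i = "%K. M - K" and j = "%K. M - K"])
  fix K assume K: "K : Pow M"
  hence f: "finite K" "finite (M - K)" "K Int (M - K) = {}" using True by (auto intro: finite_subset)
  have e: "M - (M - K) = K" using K by auto
  have "isgn K (M - K) * isgn (M - K) K * isgn (M - K) K = ((-1) ^ (card K * card (M - K)) :: 'a) * isgn (M - K) K"
   by (simp add: isgn_commute[OF f])
  hence "isgn K (M - K) = ((-1) ^ (card K * card (M - K)) :: 'a) * isgn (M - K) K"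
   by (simp add: mult.assoc)
  thus "(-1) ^ (card (M - K) * card (M - (M - K))) * (isgn (M - K) (M - (M - K)) * (v (M - K) * u (M - (M - K)))) =
    isgn K (M - K) * (u K * v (M - K))"
   unfolding e by (simp add: ac_simps)
 qed auto
qed (simp add: wdg_infinite)

lemma wdg_even_commute:
 assumes "!!K. odd (card K) ==> u K = 0"
 shows "wdg u v = wdg v u"
proof
 fix M
 have "wdg v u M = (SUM K:Pow M. (-1) ^ (card K * card (M - K)) * (isgn K (M - K) * (u K * v (M - K))))"
  by (rule wdg_commute_weighted)
 also have "... = wdg u v M"
  unfolding wdg_def by (rule sum.cong) (use assms in "auto simp: uminus_power_if")
 finally show "wdg u v M = wdg v u M" ..
qed

lemma wdg_odd_anticommute:
 assumes "!!K. even (card K) ==> u K = 0" "!!K. even (card K) ==> v K = 0"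
 shows "wdg u v = - wdg v u"
proof
 fix M
 have "wdg v u M = (SUM K:Pow M. (-1) ^ (card K * card (M - K)) * (isgn K (M - K) * (u K * v (M - K))))"
  by (rule wdg_commute_weighted)
 also have "... = - wdg u v M"
  unfolding wdg_def sum_negf[symmetric]
 proof (rule sum.cong)
  fix K assume "K : Pow M"
  show "(- 1) ^ (card K * card (M - K)) * (isgn K (M - K) * (u K * v (M - K))) =
    - (isgn K (M - K) * (u K * v (M - K)))"
   using assms(1)[of K] assms(2)[of "M - K"]
   by (cases "even (card K) | even (card (M - K))") auto
 qed simp
 finally show "wdg u v M = (- wdg v u) M" by simp
qed

definition vec1 :: "nat => ('r::comm_ring_1) ext => bool" where
 "vec1 f u <-> (ALL K. u K ~= 0 --> (EX p:{1..f}. K = {p}))"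

lemma vec1_even: "vec1 f u ==> even (card K) ==> u K = 0"
 unfolding vec1_def by (metis One_nat_def card.empty card_insert_disjoint empty_iff finite.emptyI odd_one)

lemma wdg_vec1_anticommute: "vec1 f u ==> vec1 f v ==> wdg u v = - wdg v u"
 by (rule wdg_odd_anticommute) (auto intro: vec1_even)

text \<open>Anticommutation only yields that twice the square is 0, and 2 may be a zero divisor. So
  the square is computed at two-element sets, where the two orders cancel; elsewhere no term
  survives.\<close>

lemma wdg_vec1_self:
 assumes "vec1 f u" shows "wdg u u = 0"
proof
 fix M
 have z: "u K = 0" if "!!p. K ~= {p}" for K using assms that by (auto simp: vec1_def)
 show "wdg u u M = 0 M"
 proof (cases "EX p q. p < q & M = {p,q}")
  case True
  then obtain p q where pq: "p < q" "M = {p,q}" by auto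
  have "wdg u u M = (SUM K:{{p},{q}}. isgn K (M - K) * (u K * u (M - K)))"
   unfolding wdg_def
   by (rule sum.mono_neutral_right) (use pq z in "auto simp: Pow_insert")
  also have "... = isgn {p} {q} * (u {p} * u {q}) + isgn {q} {p} * (u {q} * u {p})"
   using pq by (simp add: insert_Diff_if)
  also have "... = 0" using pq by (simp add: isgn_single)
  finally show ?thesis by simp
 next
  case False
  have "isgn K (M - K) * (u K * u (M - K)) = 0" if "K : Pow M" for K
  proof (rule ccontr)
   assume n: "isgn K (M - K) * (u K * u (M - K)) ~= 0"
   hence "u K ~= 0" "u (M - K) ~= 0" by auto
   then obtain p q where "K = {p}" "M - K = {q}" using z by metis
   hence "M = {p,q}" "p ~= q" using that by auto
   thus False using False by (metis insert_commute linorder_neqE_nat)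
  qed
  thus ?thesis unfolding wdg_def by (simp add: sum.neutral)
 qed
qed

text \<open>When p is added to a set split into two blocks it joins the left or the right one. These
  are the two terms of the rule, and moving p past the left block produces
  \<open>alt\<close>.\<close>

lemma ann1_wdg: "ann1 p (wdg u v) = wdg (ann1 p u) v + wdg (alt u) (ann1 p v)"
proof
 fix K
 show "ann1 p (wdg u v) K = (wdg (ann1 p u) v + wdg (alt u) (ann1 p v)) K"
 proof (cases "finite K")
  case fK: True
  define N where "N = K - {p}"
  have fN: "finite N" "p ~: N" using fK by (auto simp: N_def)
  have split: "sum F (Pow (insert p N)) = (SUM L:Pow N. F L + F (insert p L))" for F :: "nat set => 'a"
  proof -
   have "sum F (Pow (insert p N)) = sum F (Pow N) + sum F (insert p ` Pow N)"
    unfolding Pow_insert using fN by (intro sum.union_disjoint) auto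
   also have "sum F (insert p ` Pow N) = (SUM L:Pow N. F (insert p L))"
   proof (subst sum.reindex)
    show "inj_on (insert p) (Pow N)" using fN by (auto simp: inj_on_def)
   qed simp
   finally show ?thesis by (simp add: sum.distrib)
  qed
  have sL: "isgn L {p} = (-1) ^ card L * (isgn {p} L :: 'a)" if "L <= N" for L
   using that fN by (intro isgn_single_commute) (auto intro: finite_subset)
  have si: "isgn (insert p L) (N - L) = isgn {p} (N - L) * (isgn L (N - L) :: 'a)"
   "isgn L (insert p (N - L)) = isgn L {p} * (isgn L (N - L) :: 'a)"
   "card (insert p L) = Suc (card L)" "finite L" "p ~: L"
   "isgn {p} N = isgn {p} L * (isgn {p} (N - L) :: 'a)" if "L <= N" for L
  proof -
   have fL: "finite L" "p ~: L" using that fN by (auto intro: finite_subset)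
   show "isgn (insert p L) (N - L) = isgn {p} (N - L) * (isgn L (N - L) :: 'a)"
    using fL fN by (intro isgn_insert_left) auto
   show "isgn L (insert p (N - L)) = isgn L {p} * (isgn L (N - L) :: 'a)"
    using fL fN by (intro isgn_insert_right) auto
   show "card (insert p L) = Suc (card L)" "finite L" "p ~: L" using fL by auto
   have "isgn {p} (L Un (N - L)) = isgn {p} L * (isgn {p} (N - L) :: 'a)"
    using fL fN by (intro isgn_Un_right) auto
   moreover have "L Un (N - L) = N" using that by auto
   ultimately show "isgn {p} N = isgn {p} L * (isgn {p} (N - L) :: 'a)" by simp
  qed
  have dif: "insert p N - insert p L = N - L" "insert p N - L = insert p (N - L)" "N - insert p L = N - L"
    if "L <= N" for L using fN that by auto
  show ?thesis
  proof (cases "p : K")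
   case False
   hence KN: "K = N" by (auto simp: N_def)
   have "ann1 p (wdg u v) K = (SUM L:Pow N. isgn {p} N *
    (isgn L (insert p (N - L)) * (u L * v (insert p (N - L))) +
    isgn (insert p L) (N - L) * (u (insert p L) * v (N - L))))"
    unfolding ann1_def wdg_def KN split using fN by (simp add: sum_distrib_left dif)
   also have "... = (SUM L:Pow N. isgn L (N - L) * (ann1 p u L * v (N - L)) +
    isgn L (N - L) * (alt u L * ann1 p v (N - L)))"
   proof (rule sum.cong)
    fix L assume "L : Pow N"
    hence L: "L <= N" by auto
    have pN: "p ~: N - L" using fN by auto
    show "isgn {p} N * (isgn L (insert p (N - L)) * (u L * v (insert p (N - L))) +
    isgn (insert p L) (N - L) * (u (insert p L) * v (N - L))) =
    isgn L (N - L) * (ann1 p u L * v (N - L)) + isgn L (N - L) * (alt u L * ann1 p v (N - L))"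
    using si(5)[OF L] pN unfolding si(1,2,6)[OF L] sL[OF L] ann1_def alt_def
    by (simp add: algebra_simps)
   qed simp
   also have "... = (wdg (ann1 p u) v + wdg (alt u) (ann1 p v)) K"
    by (simp add: wdg_def KN sum.distrib)
   finally show ?thesis .
  next
   case True
   hence KN: "K = insert p N" by (auto simp: N_def)
   have "(wdg (ann1 p u) v + wdg (alt u) (ann1 p v)) K =
    (SUM L:Pow (insert p N). isgn L (insert p N - L) * (ann1 p u L * v (insert p N - L)) +
    isgn L (insert p N - L) * (alt u L * ann1 p v (insert p N - L)))"
    by (simp add: wdg_def KN sum.distrib)
   \<comment> \<open>If p already lies in K, the term of L in the first product cancels the term of
     \<open>insert p L\<close> in the second.\<close>
   also have "... = 0"
    unfolding split
   proof (rule sum.neutral, rule ballI)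
    fix L assume "L : Pow N"
    hence L: "L <= N" by auto
    have pN: "p ~: N - L" using fN by auto
    show "isgn L (insert p N - L) * (ann1 p u L * v (insert p N - L)) +
    isgn L (insert p N - L) * (alt u L * ann1 p v (insert p N - L)) +
    (isgn (insert p L) (insert p N - insert p L) * (ann1 p u (insert p L) * v (insert p N - insert p L)) +
    isgn (insert p L) (insert p N - insert p L) * (alt u (insert p L) * ann1 p v (insert p N - insert p L))) = 0"
    using si(5)[OF L] pN unfolding dif[OF L] si(1,2,6)[OF L] sL[OF L] ann1_def alt_def si(3)[OF L]
    by (simp add: algebra_simps)
   qed
   finally show ?thesis using True by (simp add: ann1_def)
  qed
 qed (simp add: wdg_infinite ann1_def)
qed

lemma ann1_add: "ann1 p (u + v) = ann1 p u + ann1 p v"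
 by (auto simp: ann1_def fun_eq_iff algebra_simps)

lemma ann1_scal: "ann1 p (scal c u) = scal c (ann1 p u)"
 by (auto simp: ann1_def fun_eq_iff algebra_simps)

lemma contr_add: "contr f t (u + v) = contr f t u + contr f t v"
 by (auto simp: contr_def fun_eq_iff ann1_add algebra_simps sum.distrib)

lemma contr_scal: "contr f t (scal c u) = scal c (contr f t u)"
 by (auto simp: contr_def fun_eq_iff ann1_scal algebra_simps sum_distrib_left)

lemma ann1_zero [simp]: "ann1 p 0 = 0"
 by (auto simp: fun_eq_iff ann1_def zero_fun_def)

lemma contr_zero [simp]: "contr f t 0 = 0"
 by (auto simp: contr_def fun_eq_iff)

lemma contr_uminus: "contr f t (- u) = - contr f t u"
 by (auto simp: contr_def fun_eq_iff ann1_def sum_negf[symmetric] intro!: sum.cong)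

lemma contr_sum: "contr f t (SUM i:A. u i) = (SUM i:A. contr f t (u i))"
 using additive_sum[of "contr f t"] by (simp add: contr_add)

lemma contr_eq_sum: "contr f t v = (SUM p:{1..f}. scal (t p) (ann1 p v))"
proof
 fix K
 show "contr f t v K = (SUM p:{1..f}. scal (t p) (ann1 p v)) K"
  by (simp add: contr_def sum_apply)
qed

lemma contr_wdg: "contr f t (wdg u v) = wdg (contr f t u) v + wdg (alt u) (contr f t v)"
proof -
 have s: "scal c (u + v) = scal c u + scal c v" for c :: 'a and u v :: "nat set => 'a"
  by (auto simp: fun_eq_iff algebra_simps)
 show ?thesis
  by (simp add: contr_eq_sum ann1_wdg s wdg_sum_left wdg_sum_right wdg_scal_left wdg_scal_right sum.distrib)
qed

lemma alt_odd: "(!!K. even (card K) ==> u K = 0) ==> alt u = - u"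
 unfolding alt_def fun_eq_iff by (auto simp: uminus_power_if)

lemma alt_even: "(!!K. odd (card K) ==> u K = 0) ==> alt u = u"
 unfolding alt_def fun_eq_iff by (auto simp: uminus_power_if)

lemma alt_vec1: "vec1 f u ==> alt u = - u"
 by (rule alt_odd) (rule vec1_even)

text \<open>Off-diagonal terms cancel in mirror pairs. The diagonal is assumed to vanish separately
  because antisymmetry says only 2 F p p = 0.\<close>

lemma alternating_sum:
 fixes F :: "'i => 'i => 'r::comm_ring_1"
 assumes "finite A" "!!p. p : A ==> F p p = 0" "!!p q. p : A ==> q : A ==> p ~= q ==> F p q = - F q p"
 shows "(SUM p:A. SUM q:A. F p q) = 0"
 using assms
proof (induction A rule: finite_induct)
 case empty
 show ?case by simp
next
 case (insert a A)
 have "(SUM q:A. F a q) = - (SUM p:A. F p a)"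
  unfolding sum_negf[symmetric]
 proof (rule sum.cong)
  fix q assume "q : A"
  thus "F a q = - F q a" using insert(2) by (intro insert.prems(2)) auto
 qed simp
 moreover have "(SUM p:insert a A. SUM q:insert a A. F p q) =
   F a a + (SUM q:A. F a q) + ((SUM p:A. F p a) + (SUM p:A. SUM q:A. F p q))"
  using insert(1,2) by (simp add: sum.distrib)
 moreover have "(SUM p:A. SUM q:A. F p q) = 0" by (rule insert.IH) (blast intro: insert.prems)+
 ultimately show ?case using insert.prems(1)[of a] by simp
qed

lemma ann1_ann1: "ann1 p (ann1 q v) K = - ann1 q (ann1 p v) K"
 "ann1 p (ann1 p v) K = 0"
proof -
 show "ann1 p (ann1 p v) K = 0" by (simp add: ann1_def)
 have i: "isgn {p} (insert q K) = isgn {p} {q} * (isgn {p} K :: 'a)" if "q ~: K" "finite K" for p q :: nat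
  using that by (intro isgn_insert_right) auto
 have fin: "finite {x : K. x < p}" for p by (rule finite_subset[of _ "{..<p}"]) auto
 have i: "isgn {p} (insert q K) = isgn {p} {q} * (isgn {p} K :: 'a)" if "q ~: K" "p ~= q" for p q :: nat
 proof -
  have "{x : insert q K. x < p} = (if q < p then insert q {x : K. x < p} else {x : K. x < p})" by auto
  thus ?thesis using that fin[of p]
   by (auto simp: isgn_single_card[of _ K] isgn_single_card[of _ "insert q K"] isgn_single)
 qed
 show "ann1 p (ann1 q v) K = - ann1 q (ann1 p v) K"
  by (cases "p = q") (auto simp: ann1_def i insert_commute isgn_single)
qed

lemma ann1_sum: "ann1 p (SUM i:A. u i) = (SUM i:A. ann1 p (u i))"
 using additive_sum[of "ann1 p"] by (simp add: ann1_add)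

lemma contr_contr_expand:
 "contr f s (contr f t v) K = (SUM p:{1..f}. SUM q:{1..f}. s p * t q * ann1 p (ann1 q v) K)"
 by (simp add: contr_eq_sum sum_distrib_left mult.assoc sum_apply ann1_sum ann1_scal)

lemma contr_contr_self: "contr f t (contr f t v) = 0"
proof
 fix K
 show "contr f t (contr f t v) K = 0 K"
 proof -
  have "t p * t q * ann1 p (ann1 q v) K = - (t q * t p * ann1 q (ann1 p v) K)" for p q
   by (subst ann1_ann1(1)) (simp add: ac_simps)
  hence "(SUM p:{1..f}. SUM q:{1..f}. t p * t q * ann1 p (ann1 q v) K) = 0"
   by (rule alternating_sum[rotated 2]) (simp_all only: ann1_ann1(2) mult_zero_right finite_atLeastAtMost)
  thus ?thesis by (simp add: contr_contr_expand)
 qed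
qed

lemma contr_anticommute: "contr f s (contr f t v) = - contr f t (contr f s v)"
proof
 fix K
 have "contr f t (contr f s v) K = (SUM q:{1..f}. SUM p:{1..f}. t p * s q * ann1 p (ann1 q v) K)"
  unfolding contr_contr_expand by (rule sum.swap)
 also have "... = - contr f s (contr f t v) K"
  unfolding contr_contr_expand sum_negf[symmetric]
  by (intro sum.cong refl) (subst ann1_ann1(1), simp add: ac_simps)
 finally show "contr f s (contr f t v) K = (- contr f t (contr f s v)) K" by simp
qed

lemma contr_vec1:
 assumes "vec1 f u"
 shows "contr f t u = scal (SUM p:{1..f}. t p * u {p}) wdg_one"
proof
 fix K
 show "contr f t u K = scal (SUM p:{1..f}. t p * u {p}) wdg_one K"
 proof (cases "K = {}")
  case True
  thus ?thesis by (simp add: contr_def ann1_def wdg_one_def)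
 next
  case False
  hence "insert p K ~= {q}" if "p ~: K" for p q
   using that by auto
  hence "ann1 p u K = 0" for p
   using assms unfolding ann1_def vec1_def by (metis mult_zero_right)
  thus ?thesis using False by (simp add: contr_def wdg_one_def)
 qed
qed

section \<open>Pfaffians and divided powers\<close>

definition pf :: "(nat => nat => 'r::comm_ring_1) => 'r ext" where
 "pf A K = (SUM P:perfect_matchings K. (-1) ^ crossings P * (PROD e:P. A (fst e) (snd e)))"

definition divpow :: "nat => ('r::comm_ring_1) ext => nat => 'r ext" where
 "divpow f v l = (%K. if K : ext_basis f (2 * l) then pf (%p q. v {p,q}) K else 0)"

lemma perfect_matchings_D:
 assumes "P : perfect_matchings K"
 shows "(a,b) : P ==> a : K & b : K & a < b"
  "[|e : P; e' : P; k = fst e | k = snd e; k = fst e' | k = snd e'|] ==> e = e'"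
  "k : K ==> EX e:P. k = fst e | k = snd e"
proof -
 show 1: "(a,b) : P ==> a : K & b : K & a < b" for a b
  using assms unfolding perfect_matchings_def by blast
 show "[|e : P; e' : P; k = fst e | k = snd e; k = fst e' | k = snd e'|] ==> e = e'"
 proof -
  assume h: "e : P" "e' : P" "k = fst e | k = snd e" "k = fst e' | k = snd e'"
  have "k : K" using 1[of "fst e" "snd e"] h by auto
  hence "EX! e. e : P & (k = fst e | k = snd e)" using assms unfolding perfect_matchings_def by blast
  thus "e = e'" using h by blast
 qed
 show "k : K ==> EX e:P. k = fst e | k = snd e"
  using assms unfolding perfect_matchings_def by blast
qed

lemma finite_matching: "finite K ==> P : perfect_matchings K ==> finite P"
 by (rule finite_subset[of _ "K \<times> K"]) (auto simp: perfect_matchings_def)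

lemma finite_perfect_matchings: "finite K ==> finite (perfect_matchings K)"
 by (rule finite_subset[of _ "Pow (K \<times> K)"]) (auto simp: perfect_matchings_def)

lemma perfect_matchings_insert:
 assumes "P : perfect_matchings N" "a < b" "a ~: N" "b ~: N"
 shows "insert (a,b) P : perfect_matchings (insert a (insert b N))" "(a,b) ~: P"
proof -
 note D = perfect_matchings_D[OF assms(1)]
 show "(a,b) ~: P" using D(1) assms by blast
 have "EX! e. e : insert (a,b) P & (k = fst e | k = snd e)" if k: "k : insert a (insert b N)" for k
 proof (cases "k : N")
  case True
  then obtain e where e: "e : P" "k = fst e | k = snd e" using D(3) by blast
  show ?thesis
  proof (rule ex1I[of _ e])
   fix e' assume "e' : insert (a,b) P & (k = fst e' | k = snd e')"
   thus "e' = e" using e D(2)[of e' e k] True assms by auto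
  qed (use e in auto)
 next
  case False
  hence "k = a | k = b" using k by auto
  moreover have "e' ~: P" if "k = fst e' | k = snd e'" for e'
   using that D(1)[of "fst e'" "snd e'"] False by auto
  ultimately show ?thesis by (intro ex1I[of _ "(a,b)"]) (simp, blast)
 qed
 moreover have "insert (a,b) P <= {(p,q). p : insert a (insert b N) & q : insert a (insert b N) & p < q}"
  using D(1) assms by auto
 ultimately show "insert (a,b) P : perfect_matchings (insert a (insert b N))"
  unfolding perfect_matchings_def by (intro CollectI conjI ballI)
qed

lemma perfect_matchings_remove:
 assumes "P : perfect_matchings K" "(a,b) : P"
 shows "P - {(a,b)} : perfect_matchings (K - {a,b})"
proof -
 note D = perfect_matchings_D[OF assms(1)]
 have "EX! e. e : P - {(a,b)} & (k = fst e | k = snd e)" if k: "k : K - {a,b}" for k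
 proof -
  obtain e where e: "e : P" "k = fst e | k = snd e" using D(3)[of k] k by blast
  hence "e ~= (a,b)" using k by auto
  show ?thesis
  proof (rule ex1I[of _ e])
   fix e' assume "e' : P - {(a,b)} & (k = fst e' | k = snd e')"
   thus "e' = e" using D(2)[of e' e k] e by simp
  qed (use e \<open>e ~= (a,b)\<close> in simp)
 qed
 moreover have "P - {(a,b)} <= {(p,q). p : K - {a,b} & q : K - {a,b} & p < q}"
 proof
  fix e assume e: "e : P - {(a,b)}"
  obtain p q where pq: "e = (p,q)" by (cases e)
  have "p : K" "q : K" "p < q" using D(1)[of p q] e pq by auto
  moreover have "k ~= a & k ~= b" if "k = p | k = q" for k
   using D(2)[of e "(a,b)" k] e pq assms(2) that by auto
  ultimately show "e : {(p,q). p : K - {a,b} & q : K - {a,b} & p < q}" using pq by auto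
 qed
 ultimately show ?thesis unfolding perfect_matchings_def by (intro CollectI conjI ballI)
qed

text \<open>An edge of P crosses (a,b) exactly when one of its ends lies between a and b. So modulo
  2 the new crossings are counted by the points of N between a and b, and the two signs count the
  points below a and below b.\<close>

lemma crossings_insert:
 assumes P: "P : perfect_matchings N" and "finite N" "a < b" "a ~: N" "b ~: N"
 shows "(-1 :: 'r::comm_ring_1) ^ crossings (insert (a,b) P) =
   (-1) ^ crossings P * (isgn {a} N * isgn {b} N)"
proof -
 note D = perfect_matchings_D[OF P]
 have fP: "finite P" by (rule finite_matching) (use assms in auto)
 define X1 where "X1 = {(r,s). (r,s) : P & a < r & r < b & b < s}"
 define X2 where "X2 = {(r,s). (r,s) : P & r < a & a < s & s < b}"
 define X3 where "X3 = {(r,s). (r,s) : P & a < r & s < b}"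
 define C where "C = {((p,q),(r,s)). (p,q) : P & (r,s) : P & p < r & r < q & q < s}"
 have fin: "finite X1" "finite X2" "finite X3"
  using fP unfolding X1_def X2_def X3_def by (auto intro: finite_subset[of _ P])
 have fC: "finite C" by (rule finite_subset[of _ "P \<times> P"]) (use fP in "auto simp: C_def")
 have nab: "(a,b) ~: P" using D(1) assms by blast
 have "{((p,q),(r,s)). (p,q) : insert (a,b) P & (r,s) : insert (a,b) P & p < r & r < q & q < s} =
   C Un Pair (a,b) ` X1 Un (%e. (e,(a,b))) ` X2"
  by (auto simp: C_def X1_def X2_def image_iff)
 hence "crossings (insert (a,b) P) = card (C Un Pair (a,b) ` X1 Un (%e. (e,(a,b))) ` X2)"
  by (simp add: crossings_def)
 also have "... = card (C Un Pair (a,b) ` X1) + card ((%e. (e,(a,b))) ` X2)"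
  by (rule card_Un_disjoint) (use fC fin nab in "auto simp: C_def X1_def X2_def")
 also have "card (C Un Pair (a,b) ` X1) = card C + card (Pair (a,b) ` X1)"
  by (rule card_Un_disjoint) (use fC fin nab in "auto simp: C_def X1_def")
 finally have 1: "crossings (insert (a,b) P) = crossings P + card X1 + card X2"
  by (simp add: card_image inj_on_def C_def crossings_def)
 have ne: "k ~= a" "k ~= b" if "k : N" for k using that assms by auto
 \<comment> \<open>Crossing edges put one end into the interval, from the right in \<open>X1\<close>
   and from the left in \<open>X2\<close>; the nested edges of \<open>X3\<close> put in both ends
   and so do not affect the parity.\<close>
 have N: "{k : N. a < k & k < b} = fst ` (X1 Un X3) Un snd ` (X2 Un X3)" (is "?L = ?R")
 proof
  show "?L <= ?R"
  proof
   fix k assume k: "k : ?L"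
   then obtain e where e: "e : P" "k = fst e | k = snd e" using D(3) by blast
   obtain r s where rs: "e = (r,s)" by (cases e)
   have "r : N" "s : N" "r < s" using D(1) e rs by blast+
   hence *: "r ~= a" "r ~= b" "s ~= a" "s ~= b" "r < s" using ne by auto
   show "k : ?R"
   proof (cases "k = r")
    case True
    hence "(r,s) : X1 Un X3" using k e rs * by (auto simp: X1_def X3_def)
    thus ?thesis using True by (metis UnI1 fst_conv image_eqI)
   next
    case False
    hence "(r,s) : X2 Un X3" using k e rs * by (auto simp: X2_def X3_def)
    thus ?thesis using False e(2) rs by (metis UnI2 fst_conv snd_conv image_eqI)
   qed
  qed
  show "?R <= ?L" using D(1) by (force simp: X1_def X2_def X3_def)
 qed
 have inj1: "inj_on fst P"
 proof (rule inj_onI)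
  fix e e' assume "e : P" "e' : P" "fst e = fst e'"
  thus "e = e'" using D(2)[of e e' "fst e"] by simp
 qed
 have inj2: "inj_on snd P"
 proof (rule inj_onI)
  fix e e' assume "e : P" "e' : P" "snd e = snd e'"
  thus "e = e'" using D(2)[of e e' "snd e"] by simp
 qed
 have "card {k : N. a < k & k < b} = card (fst ` (X1 Un X3)) + card (snd ` (X2 Un X3))"
  unfolding N
 proof (rule card_Un_disjoint)
  show "fst ` (X1 Un X3) Int snd ` (X2 Un X3) = {}"
  proof (rule ccontr)
   assume "fst ` (X1 Un X3) Int snd ` (X2 Un X3) ~= {}"
   then obtain e e' where e: "e : P" "e' : P" "fst e = snd e'" by (auto simp: X1_def X2_def X3_def)
   hence "e = e'" using D(2)[of e e' "fst e"] by auto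
   thus False using D(1)[of "fst e" "snd e"] e by auto
  qed
 qed (use fin in auto)
 also have "card (fst ` (X1 Un X3)) = card (X1 Un X3)"
  by (rule card_image, rule inj_on_subset[OF inj1]) (auto simp: X1_def X3_def)
 also have "card (X1 Un X3) = card X1 + card X3"
  by (rule card_Un_disjoint) (use fin in "auto simp: X1_def X3_def")
 also have "card (snd ` (X2 Un X3)) = card (X2 Un X3)"
  by (rule card_image, rule inj_on_subset[OF inj2]) (auto simp: X2_def X3_def)
 also have "card (X2 Un X3) = card X2 + card X3"
  by (rule card_Un_disjoint) (use fin in "auto simp: X2_def X3_def")
 finally have 2: "card {k : N. a < k & k < b} = card X1 + card X2 + 2 * card X3" by simp
 have "{q : N. q < b} = {q : N. q < a} Un {k : N. a < k & k < b}"
  using assms by (auto) (metis nat_neq_iff)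
 moreover have "card ... = card {q : N. q < a} + card {k : N. a < k & k < b}"
  by (rule card_Un_disjoint) (use assms in auto)
 ultimately have 3: "card {q : N. q < b} = card {q : N. q < a} + (card X1 + card X2 + 2 * card X3)"
  using 2 by simp
 show ?thesis unfolding 1 isgn_single_card 3
  by (simp add: power_add power_mult mult.assoc flip: power_mult_distrib)
qed

text \<open>Each matching has exactly one edge at p, and removing it leaves a matching of L - {q}.
  The matrix is symmetric, not alternating, because its entries will be the coordinates of a 2-form
  at unordered pairs; the orientation is carried by the signs.\<close>

lemma pf_expand:
 fixes A :: "nat => nat => 'r::comm_ring_1"
 assumes fL: "finite L" and pL: "p ~: L" and sym: "!!i j. A i j = A j i"
 shows "pf A (insert p L) =
  (SUM q:L. isgn {p} (L - {q}) * isgn {q} (L - {q}) * A p q * pf A (L - {q}))"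
proof -
 define ed where "ed q = (min p q, max p q)" for q
 have ed_mem: "p = fst (ed q) | p = snd (ed q)" for q by (auto simp: ed_def min_def max_def)
 have ed_inj: "ed q = ed r ==> q = r" for q r by (auto simp: ed_def min_def max_def split: if_splits)
 have ex: "EX! q. q : L & ed q : P" if P: "P : perfect_matchings (insert p L)" for P
 proof -
  obtain e where e: "e : P" "p = fst e | p = snd e" using perfect_matchings_D(3)[OF P] by blast
  obtain a b where ab: "e = (a,b)" by (cases e)
  have *: "a : insert p L" "b : insert p L" "a < b"
   using perfect_matchings_D(1)[OF P] e ab by blast+
  have "EX q:L. e = ed q"
  proof (cases "p = a")
   case True
   thus ?thesis using * ab by (intro bexI[of _ b]) (auto simp: ed_def)
  next
   case False
   thus ?thesis using e(2) * ab by (intro bexI[of _ a]) (auto simp: ed_def)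
  qed
  then obtain q where q: "q : L" "e = ed q" by blast
  show ?thesis
  proof (rule ex1I[of _ q])
   fix r assume "r : L & ed r : P"
   hence "ed r = ed q" using perfect_matchings_D(2)[OF P, of "ed r" "ed q" p] e q ed_mem by auto
   thus "r = q" by (rule ed_inj)
  qed (use e q in auto)
 qed
 define pt where "pt P = (THE q. q : L & ed q : P)" for P
 have pt: "pt P : L" "ed (pt P) : P" if "P : perfect_matchings (insert p L)" for P
  using theI'[OF ex[OF that]] by (auto simp: pt_def)
 have rem: "insert p L - {fst (ed q), snd (ed q)} = L - {q}" if "q : L" for q
  using pL that by (auto simp: ed_def min_def max_def)
 have ins: "insert (ed q) P : perfect_matchings (insert p L)" "ed q ~: P"
   "(-1 :: 'r) ^ crossings (insert (ed q) P) = (-1) ^ crossings P * (isgn {p} (L - {q}) * isgn {q} (L - {q}))"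
  if q: "q : L" and P: "P : perfect_matchings (L - {q})" for q P
 proof -
  have "p ~= q" using q pL by auto
  hence lt: "min p q < max p q" "min p q ~: L - {q}" "max p q ~: L - {q}" using pL by (auto simp: min_def max_def)
  have eq: "insert (min p q) (insert (max p q) (L - {q})) = insert p L"
   using q by (auto simp: min_def max_def)
  show "insert (ed q) P : perfect_matchings (insert p L)" "ed q ~: P"
   using perfect_matchings_insert[OF P lt] unfolding eq ed_def by auto
  have "(-1 :: 'r) ^ crossings (insert (ed q) P) = (-1) ^ crossings P * (isgn {min p q} (L - {q}) * isgn {max p q} (L - {q}))"
   unfolding ed_def using crossings_insert[OF P _ lt] fL by simp
  thus "(-1 :: 'r) ^ crossings (insert (ed q) P) = (-1) ^ crossings P * (isgn {p} (L - {q}) * isgn {q} (L - {q}))"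
   by (cases "p <= q") (simp_all add: min_def max_def mult.commute)
 qed
 have "(SUM q:L. isgn {p} (L - {q}) * isgn {q} (L - {q}) * A p q * pf A (L - {q})) =
   (SUM (q,P):(SIGMA q:L. perfect_matchings (L - {q})).
    isgn {p} (L - {q}) * isgn {q} (L - {q}) * A p q *
    ((-1) ^ crossings P * (PROD e:P. A (fst e) (snd e))))"
  unfolding pf_def sum_distrib_left
  by (subst sum.Sigma) (use fL in "auto intro: finite_perfect_matchings")
 also have "... = (SUM P:perfect_matchings (insert p L). (-1) ^ crossings P * (PROD e:P. A (fst e) (snd e)))"
 proof (rule sum.reindex_bij_witness[where j = "%(q,P). insert (ed q) P" and i = "%P. (pt P, P - {ed (pt P)})"])
  fix z assume "z : (SIGMA q:L. perfect_matchings (L - {q}))"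
  then obtain q P where z: "z = (q,P)" and q: "q : L" and P: "P : perfect_matchings (L - {q})" by auto
  note i = ins[OF q P]
  have "pt (insert (ed q) P) = q" using ex[OF i(1)] pt[OF i(1)] q by blast
  thus "(%P. (pt P, P - {ed (pt P)})) (case z of (q, P) => insert (ed q) P) = z"
   using i(2) by (simp add: z)
  show "(case z of (q, P) => insert (ed q) P) : perfect_matchings (insert p L)" using i(1) z by simp
  have "finite P" by (rule finite_matching[OF _ P]) (use fL in auto)
  moreover have "A (fst (ed q)) (snd (ed q)) = A p q" using sym by (auto simp: ed_def min_def max_def)
  ultimately show "(-1) ^ crossings (case z of (q, P) => insert (ed q) P) *
    (PROD e:(case z of (q, P) => insert (ed q) P). A (fst e) (snd e)) =
    (case z of (q, P) => isgn {p} (L - {q}) * isgn {q} (L - {q}) * A p q *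
    ((-1) ^ crossings P * (PROD e:P. A (fst e) (snd e))))"
   using i(2) unfolding z by (simp add: i(3) ac_simps)
 next
  fix P assume P: "P : perfect_matchings (insert p L)"
  note pt = pt[OF P]
  show "(case (pt P, P - {ed (pt P)}) of (q, P) => insert (ed q) P) = P" using pt by auto
  have "(fst (ed (pt P)), snd (ed (pt P))) : P" using pt by simp
  from perfect_matchings_remove[OF P this] show "(pt P, P - {ed (pt P)}) : (SIGMA q:L. perfect_matchings (L - {q}))"
   using pt rem[OF pt(1)] by simp
 qed
 finally show ?thesis by (simp add: pf_def)
qed

text \<open>The analogue of a Pfaffian in which row p occurs twice. Expanding once more along p
  gives a double sum over the two partners q and r, and exchanging them changes nothing but
  \<open>isgn {q} {r}\<close>.\<close>

lemma pf_repeated_row: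
 fixes A :: "nat => nat => 'r::comm_ring_1"
 assumes fN: "finite N" and pN: "p ~: N" and sym: "!!i j. A i j = A j i"
 shows "(SUM q:N. isgn {q} (insert p N - {q}) * isgn {p} {q} * A p q * pf A (insert p (N - {q}))) = 0"
proof -
 define F where "F q r = (if q = r then 0 else
   - isgn {q} {r} * (isgn {q} (N - {q,r}) * isgn {r} (N - {q,r}) * isgn {p} (N - {q,r})) *
    (A p q * A p r * pf A (N - {q,r})))" for q r
 have "(SUM q:N. isgn {q} (insert p N - {q}) * isgn {p} {q} * A p q * pf A (insert p (N - {q}))) =
   (SUM q:N. SUM r:N. F q r)"
 proof (rule sum.cong)
  fix q assume q: "q : N"
  hence pq: "p ~= q" using pN by auto
  have e: "pf A (insert p (N - {q})) = (SUM r:N - {q}. isgn {p} (N - {q} - {r}) * isgn {r} (N - {q} - {r}) * A p r * pf A (N - {q} - {r}))"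
   by (rule pf_expand) (use fN pN sym in auto)
  have s1: "isgn {q} (insert p N - {q}) = isgn {q} {p} * (isgn {q} (N - {q}) :: 'r)"
  proof -
   have "insert p N - {q} = insert p (N - {q})" using pq by auto
   thus ?thesis using isgn_insert_right[of "N - {q}" "{q}" p] fN pN by simp
  qed
  have s2: "isgn {q} {p} * isgn {p} {q} = (-1 :: 'r)" using pq by (auto simp: isgn_single)
  have "isgn {q} (insert p N - {q}) * isgn {p} {q} * A p q * pf A (insert p (N - {q})) =
    (isgn {q} {p} * isgn {p} {q}) * isgn {q} (N - {q}) * A p q * pf A (insert p (N - {q}))"
   unfolding s1 by (simp add: ac_simps)
  also have "... = (SUM r:N - {q}. - isgn {q} (N - {q}) * A p q * (isgn {p} (N - {q} - {r}) * isgn {r} (N - {q} - {r}) * A p r * pf A (N - {q} - {r})))"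
   unfolding s2 e sum_distrib_left by simp
  also have "... = (SUM r:N - {q}. F q r)"
  proof (rule sum.cong)
   fix r assume r: "r : N - {q}"
   have "isgn {q} (insert r (N - {q,r})) = isgn {q} {r} * (isgn {q} (N - {q,r}) :: 'r)"
    using fN by (intro isgn_insert_right) auto
   moreover have "insert r (N - {q,r}) = N - {q}" using r by auto
   ultimately have s3: "isgn {q} (N - {q}) = isgn {q} {r} * (isgn {q} (N - {q,r}) :: 'r)" by simp
   have e2: "N - {q} - {r} = N - {q,r}" by auto
   show "- isgn {q} (N - {q}) * A p q * (isgn {p} (N - {q} - {r}) * isgn {r} (N - {q} - {r}) * A p r * pf A (N - {q} - {r})) = F q r"
    unfolding s3 e2 F_def using r by (simp add: ac_simps)
  qed simp
  also have "... = (SUM r:N. F q r)"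
   using fN q by (subst sum.remove[of N q]) (auto simp: F_def)
  finally show "isgn {q} (insert p N - {q}) * isgn {p} {q} * A p q * pf A (insert p (N - {q})) = (SUM r:N. F q r)" .
 qed simp
 also have "... = 0"
 proof (rule alternating_sum[OF fN])
  show "F q q = 0" for q by (simp add: F_def)
  fix q r :: nat assume "q ~= r"
  moreover from this have "isgn {q} {r} = - (isgn {r} {q} :: 'r)" by (auto simp: isgn_single)
  moreover have "{q,r} = {r,q}" by auto
  ultimately show "F q r = - F r q" by (simp add: F_def ac_simps)
 qed
 finally show ?thesis .
qed

definition twoform :: "nat => ('r::comm_ring_1) ext => bool" where
 "twoform f v <-> (ALL K. v K ~= 0 --> K : ext_basis f 2)"

lemma contr_vec1_twoform:
 assumes "twoform f v" shows "vec1 f (contr f t v)"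
 unfolding vec1_def
proof (intro allI impI)
 fix K assume "contr f t v K ~= 0"
 then obtain p where p: "p : {1..f}" "ann1 p v K ~= 0"
  unfolding contr_def by (metis (no_types, lifting) mult_zero_right sum.neutral)
 hence "p ~: K" "v (insert p K) ~= 0" by (auto simp: ann1_def split: if_splits)
 hence "insert p K : ext_basis f 2" using assms by (auto simp: twoform_def)
 hence K: "K <= {1..f}" "card (insert p K) = 2" "finite K" by (auto simp: ext_basis_def intro: finite_subset)
 hence "card K = 1" using \<open>p ~: K\<close> by simp
 thus "EX p:{1..f}. K = {p}" using K(1) by (auto simp: card_1_singleton_iff)
qed

lemma wdg_vec1_left:
 assumes "vec1 f u" "finite L"
 shows "wdg u v L = (SUM q:L. isgn {q} (L - {q}) * (u {q} * v (L - {q})))"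
proof -
 have "wdg u v L = (SUM M:(%q. {q}) ` L. isgn M (L - M) * (u M * v (L - M)))"
  unfolding wdg_def
 proof (rule sum.mono_neutral_right)
  show "ALL M:Pow L - (%q. {q}) ` L. isgn M (L - M) * (u M * v (L - M)) = 0"
  proof
   fix M assume M: "M : Pow L - (%q. {q}) ` L"
   hence "M ~= {q}" for q by auto
   hence "u M = 0" using assms(1) by (auto simp: vec1_def)
   thus "isgn M (L - M) * (u M * v (L - M)) = 0" by simp
  qed
 qed (use assms in auto)
 also have "... = (SUM q:L. isgn {q} (L - {q}) * (u {q} * v (L - {q})))"
  by (subst sum.reindex) (auto simp: inj_on_def)
 finally show ?thesis .
qed

text \<open>Compare coefficients of t p at a set L of size 2l + 1. For p outside L the identity is
  the Pfaffian expansion along p; for p in L the left side is 0 and the right side is an expansion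
  with row p repeated.\<close>

lemma contr_divpow:
 fixes x :: "('r::comm_ring_1) ext"
 assumes x: "twoform f x"
 shows "contr f t (divpow f x (Suc l)) = wdg (contr f t x) (divpow f x l)"
proof
 fix L
 let ?A = "%p q. x {p,q}"
 let ?psi = "contr f t x"
 have sym: "?A i j = ?A j i" for i j by (simp add: insert_commute)
 have v1: "vec1 f ?psi" by (rule contr_vec1_twoform[OF x])
 show "contr f t (divpow f x (Suc l)) L = wdg ?psi (divpow f x l) L"
 proof (cases "L : ext_basis f (2 * l + 1)")
  case False
  have "ann1 p (divpow f x (Suc l)) L = 0" if "p : {1..f}" for p
  proof (cases "p : L")
   case pL: False
   have "insert p L ~: ext_basis f (2 * Suc l)"
   proof
    assume "insert p L : ext_basis f (2 * Suc l)"
    hence "L <= {1..f}" "card (insert p L) = 2 * Suc l" "finite L"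
    by (auto simp: ext_basis_def intro: finite_subset)
    thus False using pL False by (auto simp: ext_basis_def)
   qed
   thus ?thesis by (simp add: ann1_def divpow_def)
  qed (simp add: ann1_def)
  hence l: "contr f t (divpow f x (Suc l)) L = 0" by (simp add: contr_def)
  have "wdg ?psi (divpow f x l) L = 0"
  proof (cases "finite L")
   case True
   have "?psi {q} * divpow f x l (L - {q}) = 0" if "q : L" for q
   proof (rule ccontr)
    assume n: "?psi {q} * divpow f x l (L - {q}) ~= 0"
    hence "?psi {q} ~= 0" "divpow f x l (L - {q}) ~= 0" by auto
    hence "q : {1..f}" "L - {q} : ext_basis f (2 * l)"
    using v1 by (auto simp: vec1_def divpow_def split: if_splits)
    hence "L <= {1..f}" "card (L - {q}) = 2 * l" by (auto simp: ext_basis_def)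
    thus False using False that True by (auto simp: ext_basis_def card_Diff_singleton_if)
    (metis Suc_pred card_gt_0_iff empty_iff)
   qed
   thus ?thesis unfolding wdg_vec1_left[OF v1 True] by simp
  qed (simp add: wdg_infinite)
  thus ?thesis using l by simp
 next
  case True
  hence L: "L <= {1..f}" "card L = 2 * l + 1" "finite L" by (auto simp: ext_basis_def intro: finite_subset)
  have d: "divpow f x l (L - {q}) = pf ?A (L - {q})" if "q : L" for q
   using L that by (auto simp: divpow_def ext_basis_def)
  have psi: "?psi {q} = (SUM p:{1..f}. t p * (if p = q then 0 else isgn {p} {q} * x {p,q}))" for q
   by (auto simp: contr_def ann1_def intro!: sum.cong)
  have "wdg ?psi (divpow f x l) L = (SUM q:L. SUM p:{1..f}. t p *
    (if p = q then 0 else isgn {q} (L - {q}) * isgn {p} {q} * x {p,q} * pf ?A (L - {q})))"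
   unfolding wdg_vec1_left[OF v1 L(3)]
   by (rule sum.cong) (auto simp: d psi sum_distrib_left sum_distrib_right intro!: sum.cong)
  also have "... = (SUM p:{1..f}. t p * (SUM q:L.
    (if p = q then 0 else isgn {q} (L - {q}) * isgn {p} {q} * x {p,q} * pf ?A (L - {q}))))"
   by (subst sum.swap) (simp add: sum_distrib_left)
  also have "... = contr f t (divpow f x (Suc l)) L"
   unfolding contr_def
  proof (intro sum.cong refl arg_cong2[where f = "(*)"])
   fix p assume p: "p : {1..f}"
   show "(SUM q:L. if p = q then 0 else isgn {q} (L - {q}) * isgn {p} {q} * x {p, q} * pf ?A (L - {q})) =
    ann1 p (divpow f x (Suc l)) L"
   proof (cases "p : L")
    case pL: False
    have "ann1 p (divpow f x (Suc l)) L = isgn {p} L * pf ?A (insert p L)"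
    using pL p L by (auto simp: ann1_def divpow_def ext_basis_def)
    also have "... = (SUM q:L. isgn {p} L * (isgn {p} (L - {q}) * isgn {q} (L - {q}) * x {p,q} * pf ?A (L - {q})))"
    unfolding pf_expand[OF L(3) pL sym] by (simp add: sum_distrib_left)
    also have "... = (SUM q:L. if p = q then 0 else isgn {q} (L - {q}) * isgn {p} {q} * x {p, q} * pf ?A (L - {q}))"
    proof (rule sum.cong)
    fix q assume q: "q : L"
    have "isgn {p} (insert q (L - {q})) = isgn {p} {q} * (isgn {p} (L - {q}) :: 'r)"
    using L by (intro isgn_insert_right) auto
    hence "isgn {p} L = isgn {p} {q} * (isgn {p} (L - {q}) :: 'r)"
    using q by (simp add: insert_absorb)
    thus "isgn {p} L * (isgn {p} (L - {q}) * isgn {q} (L - {q}) * x {p,q} * pf ?A (L - {q})) =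
    (if p = q then 0 else isgn {q} (L - {q}) * isgn {p} {q} * x {p, q} * pf ?A (L - {q}))"
    using q pL by (auto simp: ac_simps)
    qed simp
    finally show ?thesis ..
   next
    case pL: True
    define N where "N = L - {p}"
    have N: "L = insert p N" "p ~: N" "finite N" using pL L by (auto simp: N_def)
    have "(SUM q:L. if p = q then 0 else isgn {q} (L - {q}) * isgn {p} {q} * x {p, q} * pf ?A (L - {q})) =
    (SUM q:N. isgn {q} (insert p N - {q}) * isgn {p} {q} * x {p, q} * pf ?A (insert p (N - {q})))"
    unfolding N(1) sum.insert[OF N(3,2)]
    proof -
    have "insert p N - {q} = insert p (N - {q})" if "q : N" for q using that N by auto
    hence "(SUM q:N. if p = q then 0 else isgn {q} (insert p N - {q}) * isgn {p} {q} * x {p, q} * pf ?A (insert p N - {q})) =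
    (SUM q:N. isgn {q} (insert p N - {q}) * isgn {p} {q} * x {p, q} * pf ?A (insert p (N - {q})))"
    using N by (intro sum.cong) auto
    thus "(if p = p then 0 else isgn {p} (insert p N - {p}) * isgn {p} {p} * x {p, p} * pf ?A (insert p N - {p})) +
    (SUM q:N. if p = q then 0 else isgn {q} (insert p N - {q}) * isgn {p} {q} * x {p, q} * pf ?A (insert p N - {q})) =
    (SUM q:N. isgn {q} (insert p N - {q}) * isgn {p} {q} * x {p, q} * pf ?A (insert p (N - {q})))" by simp
    qed
    also have "... = 0" by (rule pf_repeated_row[OF N(3,2) sym])
    finally show ?thesis using pL by (simp add: ann1_def)
   qed
  qed
  finally show ?thesis ..
 qed
qed

lemma perfect_matchings_empty: "perfect_matchings {} = {{}}"
 by (auto simp: perfect_matchings_def)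

lemma divpow_0: "divpow f x 0 = wdg_one"
proof
 fix K
 have "ext_basis f 0 = {{}}" by (auto simp: ext_basis_def card_eq_0_iff intro: finite_subset)
 moreover have "crossings {} = 0" by (simp add: crossings_def case_prod_unfold)
 hence "pf A {} = 1" for A :: "nat => nat => 'a"
  by (simp add: pf_def perfect_matchings_empty)
 ultimately show "divpow f x 0 K = wdg_one K" by (simp add: divpow_def wdg_one_def)
qed

definition homog :: "nat => nat => ('r::comm_ring_1) ext => bool" where
 "homog f d u <-> (ALL K. u K ~= 0 --> K : ext_basis f d)"

lemma wdg_nonzero:
 assumes "wdg u v K ~= 0"
 obtains L where "L <= K" "finite K" "u L ~= 0" "v (K - L) ~= 0"
proof -
 have fK: "finite K" using assms wdg_infinite by blast
 obtain L where "L : Pow K" "isgn L (K - L) * (u L * v (K - L)) ~= 0"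
  using assms unfolding wdg_def by (rule sum.not_neutral_contains_not_neutral)
 thus thesis using fK by (intro that[of L]) auto
qed

lemma homog_wdg:
 assumes "homog f d u" "homog f e v" shows "homog f (d + e) (wdg u v)"
 unfolding homog_def
proof (intro allI impI)
 fix K assume "wdg u v K ~= 0"
 then obtain L where L: "L <= K" "finite K" "u L ~= 0" "v (K - L) ~= 0" by (rule wdg_nonzero)
 hence "L : ext_basis f d" "K - L : ext_basis f e" using assms by (auto simp: homog_def)
 moreover have "card K = card L + card (K - L)"
  using L by (metis card_Diff_subset card_mono finite_subset le_add_diff_inverse)
 ultimately show "K : ext_basis f (d + e)" using L by (auto simp: ext_basis_def)
qed

lemma homog_one: "homog f 0 wdg_one"
 by (auto simp: homog_def wdg_one_def ext_basis_def)

lemma homog_divpow: "homog f (2 * l) (divpow f v l)"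
 by (auto simp: homog_def divpow_def)

lemma homog_odd: "homog f d u ==> even d ==> odd (card K) ==> u K = 0"
 by (auto simp: homog_def ext_basis_def)

lemma homog_infinite: "homog f d u ==> infinite K ==> u K = 0"
 by (auto simp: homog_def ext_basis_def dest: finite_subset)

lemma vec1_homog: "vec1 f u ==> homog f 1 u"
 by (fastforce simp: vec1_def homog_def ext_basis_def)

text \<open>A homogeneous left factor takes exactly d elements of K, so a weight that depends only
  on the size of the right block is constant on all nonzero terms. This is how cutting down to
  bidegrees passes through the operators.\<close>

lemma wdg_weighted:
 assumes "homog f d u" "finite K"
 shows "wdg u (%L. c (card L) * v L) K = c (card K - d) * wdg u v K"
 unfolding wdg_def sum_distrib_left
proof (rule sum.cong)
 fix L assume L: "L : Pow K"
 show "isgn L (K - L) * (u L * (c (card (K - L)) * v (K - L))) = c (card K - d) * (isgn L (K - L) * (u L * v (K - L)))"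
 proof (cases "u L = 0")
  case False
  hence "card L = d" using assms(1) by (auto simp: homog_def ext_basis_def)
  hence "card (K - L) = card K - d" using L assms(2) by (metis PowD card_Diff_subset finite_subset)
  thus ?thesis by (simp add: ac_simps)
 qed simp
qed simp

lemma wdg_cong_subsets:
 "(!!L. L <= K ==> v L = v' L) ==> wdg u v K = wdg u v' K"
 unfolding wdg_def by (intro sum.cong) auto

lemma wdg_vec1_commute:
 assumes "vec1 f u" shows "wdg u v = wdg (alt v) u"
proof
 fix M
 show "wdg u v M = wdg (alt v) u M"
  unfolding wdg_commute_weighted[of u v M] unfolding wdg_def
 proof (rule sum.cong)
  fix K assume "K : Pow M"
  show "(- 1) ^ (card K * card (M - K)) * (isgn K (M - K) * (v K * u (M - K))) =
    isgn K (M - K) * (alt v K * u (M - K))"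
  proof (cases "u (M - K) = 0")
   case False
   hence "card (M - K) = 1" using assms by (auto simp: vec1_def)
   thus ?thesis by (simp add: alt_def ac_simps)
  qed simp
 qed simp
qed

lemma contr_top: "contr f t y {1..f} = 0"
 by (simp add: contr_def ann1_def)

lemma contr_wdg_one [simp]: "contr f t wdg_one = 0"
proof
 fix K
 have "ann1 p wdg_one K = (0::'a)" for p by (simp add: ann1_def wdg_one_def)
 thus "contr f t wdg_one K = 0 K" by (simp add: contr_def)
qed

lemma wdg_scal_one_left: "(!!K. infinite K ==> v K = 0) ==> wdg (scal c wdg_one) v = scal c v"
 by (simp add: wdg_scal_left wdg_one_left)

section \<open>Exponent vectors and the operators Psi, tau and mu_n on the bigraded module\<close>

abbreviation expdeg :: "nat => (nat => nat) => nat" where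
 "expdeg g a \<equiv> sum a {1..g}"

abbreviation uexp :: "nat => nat => nat" where "uexp \<equiv> unit_exponent"

lemma uexp_apply: "uexp l k = (if k = l then 1 else 0)"
 by (simp add: unit_exponent_def)

lemma finite_exponents: "finite (exponents g n)"
proof -
 have "exponents g n <= {a. ALL l. (l : {1..g} --> a l : {0..n}) & (l ~: {1..g} --> a l = 0)}"
 proof
  fix a assume a: "a : exponents g n"
  hence "a l <= n" if "l : {1..g}" for l
   using member_le_sum[of l "{1..g}" a] that by (auto simp: exponents_def)
  thus "a : {a. ALL l. (l : {1..g} --> a l : {0..n}) & (l ~: {1..g} --> a l = 0)}"
   using a by (auto simp: exponents_def)
 qed
 moreover have "finite ..." by (intro finite_set_of_finite_funs) auto
 ultimately show ?thesis by (rule finite_subset)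
qed

lemma exponents_0: "exponents g 0 = {0}"
 by (auto simp: exponents_def fun_eq_iff) (metis One_nat_def atLeastAtMost_iff)

lemma expdeg_add: "expdeg g (a + b) = expdeg g a + expdeg g b"
 by (simp add: sum.distrib)

lemma expdeg_uexp: "l : {1..g} ==> expdeg g (uexp l) = 1"
 by (simp add: uexp_apply sum.delta)

lemma exponents_add_uexp:
 assumes "a : exponents g n" "l : {1..g}" shows "a + uexp l : exponents g (Suc n)"
 using assms expdeg_add[of a "uexp l" g] expdeg_uexp[of l g]
 by (auto simp: exponents_def uexp_apply)

lemma exponents_minus_uexp:
 assumes "a : exponents g (Suc n)" "l : {1..g}" "a l ~= 0"
 shows "a - uexp l : exponents g n" "a - uexp l + uexp l = a"
proof -
 show e: "a - uexp l + uexp l = a" using assms(3) by (auto simp: fun_eq_iff uexp_apply)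
 have "expdeg g (a - uexp l) + 1 = expdeg g a"
  using expdeg_add[of "a - uexp l" "uexp l" g] expdeg_uexp[OF assms(2)] e by simp
 thus "a - uexp l : exponents g n" using assms by (auto simp: exponents_def uexp_apply)
qed

locale koszul_data =
 fixes f g :: nat and t :: "nat => 'r::comm_ring_1" and x :: "nat => 'r ext"
 assumes x2: "twoform f (x l)"
begin

definition psi :: "nat => 'r ext" where "psi l = contr f t (x l)"

text \<open>Taken over an arbitrary list of indices so that the derivation rule can be proved by
  induction on the list.\<close>

definition DL :: "nat list => 'r dext" where
 "DL ls m = foldr wdg (map (%l. divpow f (x l) (m l)) ls) wdg_one"

definition Dm :: "'r dext" where "Dm = DL [1..<Suc g]"

definition PL :: "nat list => 'r ext" where
 "PL ls = foldr wdg (map psi ls) wdg_one"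

text \<open>\<open>W a\<close> is the exterior coefficient of X^(a). Contraction by Y_l lowers the
  exponent of a basis vector, so in coordinates it raises the argument: the coefficient of Y_l(W) at
  a is that of W at \<open>a + uexp l\<close>.\<close>

definition PsiH :: "'r dext => 'r dext" where
 "PsiH W a = (SUM l:{1..g}. wdg (psi l) (W (a + uexp l)))"

definition tauH :: "'r dext => 'r dext" where
 "tauH W a = contr f t (W a)"

definition muH :: "nat => 'r dext => 'r dext" where
 "muH n W a = (SUM m:exponents g n. wdg (Dm m) (W (a + m)))"

lemma psi_vec1: "vec1 f (psi l)"
 unfolding psi_def by (rule contr_vec1_twoform[OF x2])

lemma contr_psi: "contr f t (psi l) = 0"
 by (simp add: psi_def contr_contr_self)

lemma contr_psi_wdg: "contr f t (wdg (psi l) v) = - wdg (psi l) (contr f t v)"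
 by (simp add: contr_wdg contr_psi alt_vec1[OF psi_vec1] wdg_uminus_left)

lemma psi_psi_wdg: "wdg (psi l) (wdg (psi k) v) = - wdg (psi k) (wdg (psi l) v)"
 "wdg (psi l) (wdg (psi l) v) = 0"
 by (simp_all flip: wdg_assoc add: wdg_vec1_self[OF psi_vec1] wdg_vec1_anticommute[OF psi_vec1[of l] psi_vec1[of k]] wdg_uminus_left)

lemma homog_DL: "homog f (2 * (\<Sum>l\<leftarrow>ls. m l)) (DL ls m)"
proof (induction ls)
 case Nil show ?case by (simp add: DL_def homog_one)
next
 case (Cons k ls)
 have "homog f (2 * m k + 2 * (\<Sum>l\<leftarrow>ls. m l)) (wdg (divpow f (x k) (m k)) (DL ls m))"
  by (intro homog_wdg homog_divpow Cons)
 thus ?case by (simp add: DL_def)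
qed

lemma homog_Dm: "homog f (2 * expdeg g m) (Dm m)"
proof -
 have "(\<Sum>l\<leftarrow>[1..<Suc g]. m l) = expdeg g m"
  by (metis atLeastLessThanSuc_atLeastAtMost atLeastLessThan_upt interv_sum_list_conv_sum_set_nat set_upt)
 thus ?thesis using homog_DL[where ls = "[1..<Suc g]" and m = m] by (simp add: Dm_def)
qed

lemma Dm_commute: "wdg (Dm m) v = wdg v (Dm m)"
 by (rule wdg_even_commute) (rule homog_odd[OF homog_Dm], auto)

lemma divpow_commute: "wdg (divpow f v l) w = wdg w (divpow f v l)"
 by (rule wdg_even_commute) (rule homog_odd[OF homog_divpow], auto)

lemma Dm_left_commute: "wdg (Dm m) (wdg u v) = wdg u (wdg (Dm m) v)"
 using wdg_assoc[of "Dm m" u v] wdg_assoc[of u "Dm m" v] by (simp add: Dm_commute[of m u])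

lemma divpow_left_commute: "wdg (divpow f y l) (wdg u v) = wdg u (wdg (divpow f y l) v)"
 using wdg_assoc[of "divpow f y l" u v] wdg_assoc[of u "divpow f y l" v] by (simp add: divpow_commute[of y l u])

lemma alt_Dm: "alt (Dm m) = Dm m"
 by (rule alt_even) (rule homog_odd[OF homog_Dm], auto)

lemma alt_divpow: "alt (divpow f v l) = divpow f v l"
 by (rule alt_even) (rule homog_odd[OF homog_divpow], auto)

text \<open>The Leibniz rule over the list; the factors are even, so no signs appear. Distinctness
  makes lowering the exponent of k invisible to the remaining factors.\<close>

lemma contr_DL:
 "distinct ls ==> contr f t (DL ls m) =
   (SUM l:set ls. if m l = 0 then 0 else wdg (psi l) (DL ls (m - uexp l)))"
proof (induction ls)
 case Nil show ?case by (simp add: DL_def)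
next
 case (Cons k ls)
 have DL_Cons: "DL (k # ls) m = wdg (divpow f (x k) (m k)) (DL ls m)" for m by (simp add: DL_def)
 have same: "DL ls (m - uexp k) = DL ls m"
  using Cons.prems unfolding DL_def by (intro arg_cong2[where f = "%a. foldr wdg a"] map_cong) (auto simp: uexp_apply)
 have 1: "contr f t (divpow f (x k) (m k)) = (if m k = 0 then 0 else wdg (psi k) (divpow f (x k) (m k - 1)))"
  using contr_divpow[OF x2[of k], of t "m k - 1"] by (auto simp: divpow_0 psi_def)
 have 2: "wdg (divpow f (x k) (m k)) (if m l = 0 then 0 else wdg (psi l) (DL ls (m - uexp l))) =
  (if m l = 0 then 0 else wdg (psi l) (DL (k # ls) (m - uexp l)))" if "l : set ls" for l
 proof -
  have "l ~= k" using that Cons.prems by auto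
  hence "(m - uexp l) k = m k" by (simp add: uexp_apply)
  thus ?thesis by (simp add: DL_Cons divpow_left_commute)
 qed
 have "contr f t (DL (k # ls) m) = wdg (contr f t (divpow f (x k) (m k))) (DL ls m) +
   (SUM l:set ls. wdg (divpow f (x k) (m k)) (if m l = 0 then 0 else wdg (psi l) (DL ls (m - uexp l))))"
  using Cons by (simp add: DL_Cons contr_wdg alt_divpow wdg_sum_right)
 also have "wdg (contr f t (divpow f (x k) (m k))) (DL ls m) =
   (if m k = 0 then 0 else wdg (psi k) (DL (k # ls) (m - uexp k)))"
  by (simp add: 1 wdg_assoc DL_Cons same uexp_apply)
 also have "(SUM l:set ls. wdg (divpow f (x k) (m k)) (if m l = 0 then 0 else wdg (psi l) (DL ls (m - uexp l)))) =
  (SUM l:set ls. if m l = 0 then 0 else wdg (psi l) (DL (k # ls) (m - uexp l)))"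
  using 2 by (rule sum.cong[OF refl])
 finally show ?case using Cons.prems by simp
qed

lemma contr_Dm: "contr f t (Dm m) = (SUM l:{1..g}. if m l = 0 then 0 else wdg (psi l) (Dm (m - uexp l)))"
proof -
 have "set [1..<Suc g] = {1..g}" by auto
 thus ?thesis unfolding Dm_def by (subst contr_DL) auto
qed

lemma PsiH_add: "PsiH (W + W') = PsiH W + PsiH W'"
 by (rule ext) (simp add: PsiH_def wdg_add_right sum.distrib)

lemma tauH_add: "tauH (W + W') = tauH W + tauH W'"
 by (rule ext) (simp add: tauH_def contr_add)

lemma muH_add: "muH n (W + W') = muH n W + muH n W'"
 by (rule ext) (simp add: muH_def wdg_add_right sum.distrib)

lemma PsiH_zero [simp]: "PsiH 0 = 0" by (rule ext) (simp add: PsiH_def)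
lemma tauH_zero [simp]: "tauH 0 = 0" by (rule ext) (simp add: tauH_def)
lemma muH_zero [simp]: "muH n 0 = 0" by (rule ext) (simp add: muH_def)

lemma PsiH_sum: "PsiH (SUM i:A. W i) = (SUM i:A. PsiH (W i))"
 using additive_sum[of PsiH] by (simp add: PsiH_add)

lemma tauH_sum: "tauH (SUM i:A. W i) = (SUM i:A. tauH (W i))"
 using additive_sum[of tauH] by (simp add: tauH_add)

lemma PsiH_uminus: "PsiH (- W) = - PsiH W"
 by (rule ext) (simp add: PsiH_def wdg_uminus_right sum_negf)

text \<open>The exterior factors anticommute while the contractions by Y_l and Y_k commute.\<close>

lemma PsiH_PsiH: "PsiH (PsiH W) = 0"
proof (rule ext, rule ext)
 fix a K
 have "PsiH (PsiH W) a K = (SUM l:{1..g}. SUM k:{1..g}. wdg (psi l) (wdg (psi k) (W (a + uexp l + uexp k))) K)"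
  by (simp add: PsiH_def wdg_sum_right sum_apply)
 also have "... = 0"
 proof (rule alternating_sum)
  fix l k
  have "a + uexp l + uexp k = a + uexp k + uexp l" by (simp add: ac_simps)
  thus "wdg (psi l) (wdg (psi k) (W (a + uexp l + uexp k))) K = - wdg (psi k) (wdg (psi l) (W (a + uexp k + uexp l))) K"
   using psi_psi_wdg(1)[of l k] by simp
 qed (simp_all add: psi_psi_wdg(2))
 finally show "PsiH (PsiH W) a K = 0 a K" by simp
qed

lemma tauH_tauH: "tauH (tauH W) = 0"
 by (rule ext) (simp add: tauH_def contr_contr_self)

lemma tauH_PsiH: "tauH (PsiH W) = - PsiH (tauH W)"
 by (rule ext) (simp add: PsiH_def tauH_def contr_sum contr_psi_wdg sum_negf)

lemma PsiH_muH: "PsiH (muH n W) = muH n (PsiH W)"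
proof
 fix a
 have "PsiH (muH n W) a = (SUM l:{1..g}. SUM m:exponents g n. wdg (psi l) (wdg (Dm m) (W (a + uexp l + m))))"
  by (simp add: PsiH_def muH_def wdg_sum_right)
 also have "... = (SUM m:exponents g n. SUM l:{1..g}. wdg (psi l) (wdg (Dm m) (W (a + uexp l + m))))"
  by (rule sum.swap)
 also have "... = muH n (PsiH W) a"
  by (simp add: PsiH_def muH_def wdg_sum_right Dm_left_commute ac_simps)
 finally show "PsiH (muH n W) a = muH n (PsiH W) a" .
qed

text \<open>tau lowers one divided exponent of \<open>Dm m\<close> and frees a factor
  \<open>psi l\<close>. Writing m = m' + \<open>uexp l\<close> turns this step into the contraction
  inside \<open>PsiH\<close>. Every cancellation between V^T and V^B goes back to this rule.\<close>

lemma tauH_muH_Suc: "tauH (muH (Suc n) W) = muH (Suc n) (tauH W) + PsiH (muH n W)"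
proof
 fix a
 let ?F = "%l m. wdg (psi l) (wdg (Dm (m - uexp l)) (W (a + m)))"
 have "tauH (muH (Suc n) W) a = (SUM m:exponents g (Suc n). wdg (contr f t (Dm m)) (W (a + m))) + muH (Suc n) (tauH W) a"
  by (simp add: tauH_def muH_def contr_sum contr_wdg alt_Dm sum.distrib)
 also have "(SUM m:exponents g (Suc n). wdg (contr f t (Dm m)) (W (a + m))) =
   (SUM m:exponents g (Suc n). SUM l:{1..g}. if m l = 0 then 0 else ?F l m)"
  by (auto simp: contr_Dm wdg_sum_left wdg_assoc intro!: sum.cong)
 also have "... = (SUM l:{1..g}. SUM m:exponents g (Suc n). if m l = 0 then 0 else ?F l m)"
  by (rule sum.swap)
 also have "... = (SUM l:{1..g}. SUM m:exponents g n. wdg (psi l) (wdg (Dm m) (W (a + uexp l + m))))"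
 proof (rule sum.cong)
  fix l assume l: "l : {1..g}"
  have "(SUM m:exponents g (Suc n). if m l = 0 then 0 else ?F l m) = (SUM m:{m : exponents g (Suc n). m l ~= 0}. ?F l m)"
   by (subst sum.inter_filter[OF finite_exponents]) (auto intro!: sum.cong)
  also have "... = (SUM m:exponents g n. wdg (psi l) (wdg (Dm m) (W (a + uexp l + m))))"
  proof (rule sum.reindex_bij_witness[where i = "%m. m + uexp l" and j = "%m. m - uexp l"])
   fix m assume m: "m : {m : exponents g (Suc n). m l ~= 0}"
   show "m - uexp l + uexp l = m" "m - uexp l : exponents g n"
    using exponents_minus_uexp[of m g n l] m l by auto
   hence "a + uexp l + (m - uexp l) = a + m" by (simp add: ac_simps)
   thus "wdg (psi l) (wdg (Dm (m - uexp l)) (W (a + uexp l + (m - uexp l)))) = ?F l m" by simp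
  next
   fix m assume m: "m : exponents g n"
   show "m + uexp l - uexp l = m" by (auto simp: fun_eq_iff)
   show "m + uexp l : {m : exponents g (Suc n). m l ~= 0}"
    using exponents_add_uexp[OF m l] by (auto simp: uexp_apply)
  qed
  finally show "(SUM m:exponents g (Suc n). if m l = 0 then 0 else ?F l m) =
   (SUM m:exponents g n. wdg (psi l) (wdg (Dm m) (W (a + uexp l + m))))" .
 qed simp
 also have "... = PsiH (muH n W) a"
  by (simp add: PsiH_def muH_def wdg_sum_right)
 finally show "tauH (muH (Suc n) W) a = (muH (Suc n) (tauH W) + PsiH (muH n W)) a" by (subst plus_fun_apply) (subst add.commute)
qed

lemma Dm_0: "Dm 0 = wdg_one"
proof -
 have "DL ls 0 = wdg_one" for ls
 proof (induction ls)
  case (Cons k ls)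
  have "wdg wdg_one wdg_one = (wdg_one :: 'r ext)"
   by (rule wdg_one_left) (auto simp: wdg_one_def)
  thus ?case using Cons by (simp add: DL_def divpow_0)
 qed (simp add: DL_def)
 thus ?thesis by (simp add: Dm_def)
qed

lemma muH_0: "(!!a K. infinite K ==> W a K = 0) ==> muH 0 W = W"
 by (rule ext) (simp add: muH_def exponents_0 Dm_0 wdg_one_left)

end

section \<open>The complex\<close>

lemma of_boolD: "x = of_bool P * (x::'r::comm_ring_1) ==> x ~= 0 ==> P"
 by (cases P) auto

locale complex_data = koszul_data f g t x
 for f g :: nat and t :: "nat => 'r::comm_ring_1" and x :: "nat => 'r ext" +
 fixes eps :: nat
 assumes g_pos: "1 <= g" and g_less: "g < f" and eps_ge: "f <= g + 2 * eps + 1" and eps_le: "g + 2 * eps <= f + 1"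
begin

abbreviation de :: nat where "de \<equiv> f - g"

definition ok :: "nat set => (nat => nat) => bool" where
 "ok K a <-> K <= {1..f} & (ALL l. l ~: {1..g} --> a l = 0)"

text \<open>With weights 0 and 1 this cuts an operator down to the summands of the complex; general
  weights let the signs and binomial coefficients travel through the same lemmas.\<close>

definition tr :: "(nat => nat => 'r) => 'r dext => 'r dext" where
 "tr c W a K = (if ok K a then c (card K) (expdeg g a) * W a K else 0)"

lemma ok_finite: "ok K a ==> finite K"
 by (auto simp: ok_def intro: finite_subset)

lemma ok_subset: "ok K a ==> L <= K ==> ok L a"
 by (auto simp: ok_def)

lemma ok_add: "ok K a ==> (!!l. l ~: {1..g} ==> m l = 0) ==> ok K (a + m)"
 by (auto simp: ok_def)

lemma ok_uexp: "ok K a ==> l : {1..g} ==> ok K (a + uexp l)"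
 by (rule ok_add) (auto simp: uexp_apply)

text \<open>\<open>PsiH\<close>, \<open>tauH\<close> and \<open>muH n\<close> have bidegrees (1,-1),
  (-1,0) and (2n,-n), so a weight passes through each of them with shifted arguments. The truncated
  difference does no harm, since \<open>PsiH\<close> vanishes at the empty set.\<close>

lemma PsiH_tr:
 assumes "ok K a"
 shows "PsiH (tr c W) a K = c (card K - 1) (Suc (expdeg g a)) * PsiH W a K"
proof -
 have "wdg (psi l) (tr c W (a + uexp l)) K = c (card K - 1) (Suc (expdeg g a)) * wdg (psi l) (W (a + uexp l)) K"
  if l: "l : {1..g}" for l
 proof -
  have "wdg (psi l) (tr c W (a + uexp l)) K = wdg (psi l) (%L. c (card L) (Suc (expdeg g a)) * W (a + uexp l) L) K"
  proof (rule wdg_cong_subsets)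
   fix L assume "L <= K"
   hence "ok L (a + uexp l)" using assms l ok_uexp ok_subset by blast
   thus "tr c W (a + uexp l) L = c (card L) (Suc (expdeg g a)) * W (a + uexp l) L"
    unfolding tr_def expdeg_add expdeg_uexp[OF l] by simp
  qed
  also have "... = c (card K - 1) (Suc (expdeg g a)) * wdg (psi l) (W (a + uexp l)) K"
   by (rule wdg_weighted[OF vec1_homog[OF psi_vec1] ok_finite[OF assms], where c = "%i. c i (Suc (expdeg g a))"])
  finally show ?thesis .
 qed
 thus ?thesis by (simp add: PsiH_def sum_apply sum_distrib_left)
qed

lemma tauH_tr:
 assumes "ok K a"
 shows "tauH (tr c W) a K = c (Suc (card K)) (expdeg g a) * tauH W a K"
 unfolding tauH_def contr_def sum_distrib_left
proof (rule sum.cong)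
 fix p assume p: "p : {1..f}"
 show "t p * ann1 p (tr c W a) K = c (Suc (card K)) (expdeg g a) * (t p * ann1 p (W a) K)"
 proof (cases "p : K")
  case False
  hence "ok (insert p K) a" "card (insert p K) = Suc (card K)"
   using assms p ok_finite[OF assms] by (auto simp: ok_def)
  thus ?thesis using False by (simp add: ann1_def tr_def)
 qed (simp add: ann1_def)
qed simp

lemma muH_tr:
 assumes "ok K a"
 shows "muH n (tr c W) a K = c (card K - 2 * n) (expdeg g a + n) * muH n W a K"
proof -
 have "wdg (Dm m) (tr c W (a + m)) K = c (card K - 2 * n) (expdeg g a + n) * wdg (Dm m) (W (a + m)) K"
  if m: "m : exponents g n" for m
 proof -
  have dm: "expdeg g m = n" "!!l. l ~: {1..g} ==> m l = 0" using m by (auto simp: exponents_def)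
  have "wdg (Dm m) (tr c W (a + m)) K = wdg (Dm m) (%L. c (card L) (expdeg g a + n) * W (a + m) L) K"
  proof (rule wdg_cong_subsets)
   fix L assume "L <= K"
   hence "ok L (a + m)" using assms dm ok_add ok_subset by blast
   thus "tr c W (a + m) L = c (card L) (expdeg g a + n) * W (a + m) L"
    unfolding tr_def expdeg_add dm(1) by simp
  qed
  also have "... = c (card K - 2 * n) (expdeg g a + n) * wdg (Dm m) (W (a + m)) K"
   using wdg_weighted[OF homog_Dm[of m] ok_finite[OF assms], where c = "%i. c i (expdeg g a + n)"] dm(1) by simp
  finally show ?thesis .
 qed
 thus ?thesis by (simp add: muH_def sum_apply sum_distrib_left)
qed

lemma PsiH_empty: "PsiH W a {} = 0"
proof -
 have "vec1 f (psi l) ==> psi l {} = 0" for l by (auto simp: vec1_def)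
 thus ?thesis using psi_vec1 by (simp add: PsiH_def sum_apply wdg_def)
qed

lemma muH_small:
 assumes "finite K" "card K < 2 * n" shows "muH n W a K = 0"
proof -
 have "wdg (Dm m) v K = 0" if m: "m : exponents g n" for m v
 proof (rule ccontr)
  assume "wdg (Dm m) v K ~= 0"
  then obtain L where L: "L <= K" "Dm m L ~= 0" by (rule wdg_nonzero)
  hence "card L = 2 * n" using homog_Dm[of m] m by (auto simp: homog_def ext_basis_def exponents_def)
  thus False using card_mono[OF assms(1) L(1)] assms(2) by simp
 qed
 thus ?thesis by (simp add: muH_def sum_apply)
qed

lemma tr_comp:
 "tr d (PsiH (tr c W)) = tr (%i j. d i j * c (i - 1) (Suc j)) (PsiH W)"
 "tr d (tauH (tr c W)) = tr (%i j. d i j * c (Suc i) j) (tauH W)"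
 "tr d (muH n (tr c W)) = tr (%i j. d i j * c (i - 2 * n) (j + n)) (muH n W)"
 by (rule ext, rule ext, simp add: tr_def[of d] tr_def[of "%i j. d i j * _ i j"] PsiH_tr tauH_tr muH_tr mult.assoc)+

lemma PsiH_cong: "ok K a ==> tr (%i j. 1) W = tr (%i j. 1) W' ==> PsiH W a K = PsiH W' a K"
 using PsiH_tr[of K a "%i j. 1" W] PsiH_tr[of K a "%i j. 1" W'] by simp

lemma muH_cong: "ok K a ==> tr (%i j. 1) W = tr (%i j. 1) W' ==> muH n W a K = muH n W' a K"
 using muH_tr[of K a n "%i j. 1" W] muH_tr[of K a n "%i j. 1" W'] by simp

lemma two_step_tr:
 assumes "ok K a"
 shows "PsiH (tauH (tr c W)) a K = c (Suc (card K - 1)) (Suc (expdeg g a)) * PsiH (tauH W) a K"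
  "muH n (tauH (tr c W)) a K = c (Suc (card K - 2 * n)) (expdeg g a + n) * muH n (tauH W) a K"
  "muH n (PsiH (tr c W)) a K = c (card K - 2 * n - 1) (Suc (expdeg g a + n)) * muH n (PsiH W) a K"
proof -
 let ?c = "%i j. c (Suc i) j"
 have 1: "tr (%i j. 1) (tauH (tr c W)) = tr (%i j. 1) (tr ?c (tauH W))"
  unfolding tr_comp by (rule ext, rule ext) (simp add: tr_def)
 show "PsiH (tauH (tr c W)) a K = c (Suc (card K - 1)) (Suc (expdeg g a)) * PsiH (tauH W) a K"
  using PsiH_cong[OF assms 1] PsiH_tr[OF assms, of ?c] by simp
 show "muH n (tauH (tr c W)) a K = c (Suc (card K - 2 * n)) (expdeg g a + n) * muH n (tauH W) a K"
  using muH_cong[OF assms 1] muH_tr[OF assms, of n ?c] by simp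
 let ?c = "%i j. c (i - 1) (Suc j)"
 have 1: "tr (%i j. 1) (PsiH (tr c W)) = tr (%i j. 1) (tr ?c (PsiH W))"
  unfolding tr_comp by (rule ext, rule ext) (simp add: tr_def)
 show "muH n (PsiH (tr c W)) a K = c (card K - 2 * n - 1) (Suc (expdeg g a + n)) * muH n (PsiH W) a K"
  using muH_cong[OF assms 1] muH_tr[OF assms, of n ?c] by simp
qed

lemma PsiH_muH_small:
 assumes "ok K a" "card K < 2 * n + 1" shows "PsiH (muH n W) a K = 0"
proof -
 have "tr (%i j. 1) (muH n W) = tr (%i j. 1) (tr (%i j. of_bool (2 * n <= i)) (muH n W))"
  by (rule ext, rule ext) (auto simp: tr_def muH_small ok_finite)
 from PsiH_cong[OF assms(1) this] PsiH_tr[OF assms(1), of "%i j. of_bool (2 * n <= i)" "muH n W"]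
 have e: "PsiH (muH n W) a K = of_bool (2 * n <= card K - 1) * PsiH (muH n W) a K" by simp
 show ?thesis
 proof (rule ccontr)
  assume nz: "PsiH (muH n W) a K ~= 0"
  hence "K ~= {}" using PsiH_empty by metis
  hence "card K ~= 0" using ok_finite[OF assms(1)] by simp
  thus False using of_boolD[OF e nz] assms(2) by simp
 qed
qed

definition chT :: "nat => nat => bool" where "chT i j <-> eps <= j & i + j + 1 <= de"
definition chB :: "nat => nat => bool" where "chB i j <-> j < eps & de <= i + j"

abbreviation iT :: "nat => nat => 'r" where "iT i j \<equiv> of_bool (chT i j)"
abbreviation iB :: "nat => nat => 'r" where "iB i j \<equiv> of_bool (chB i j)"

text \<open>The coefficient binom(J-1-j, J-eps) written with n = J - j. The conditional stands for
  the value 0 at a negative lower argument.\<close>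

definition bn :: "nat => nat => nat" where
 "bn n j = (if eps <= j + n then (n - 1) choose (j + n - eps) else 0)"

text \<open>The target of mu_n has i = I + 2n, so the sign (-1)^(I+j) depends on the target bidegree
  only.\<close>

definition cf :: "nat => nat => nat => 'r" where
 "cf n i j = (-1) ^ (i + j) * of_nat (bn n j)"

definition Tc :: "(M_basis_elt => 'r) => 'r dext" where
 "Tc w a K = w (VT (K, a))"

definition Bc :: "(M_basis_elt => 'r) => 'r dext" where
 "Bc w a K = w (VB (K, a))"

definition mk :: "'r dext => 'r dext => 'r => M_basis_elt => 'r" where
 "mk T B c z = (case z of VT k => T (snd k) (fst k) | VB k => B (snd k) (fst k) | Top => c)"

lemma Tc_mk [simp]: "Tc (mk T B c) = T" by (rule ext, rule ext) (simp add: Tc_def mk_def)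
lemma Bc_mk [simp]: "Bc (mk T B c) = B" by (rule ext, rule ext) (simp add: Bc_def mk_def)
lemma mk_Top [simp]: "mk T B c Top = c" by (simp add: mk_def)

lemma mk_collapse: "mk (Tc w) (Bc w) (w Top) = w"
proof
 fix z show "mk (Tc w) (Bc w) (w Top) z = w z"
  by (cases z) (auto simp: mk_def Tc_def Bc_def)
qed

lemma M_eqI: "Tc w = Tc w' ==> Bc w = Bc w' ==> w Top = w' Top ==> w = w'"
 by (metis mk_collapse)

definition ddT :: "(M_basis_elt => 'r) => 'r dext" where
 "ddT w = tr iT (PsiH (Tc w) + tauH (Tc w))"

text \<open>The bound f suffices because \<open>muH n\<close> raises the exterior degree by 2n; n
  starts at 1 because I + J < f - g <= i + j with i + 2j = I + 2J forces j < J.\<close>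

definition ddB :: "(M_basis_elt => 'r) => 'r dext" where
 "ddB w = tr iB (PsiH (Bc w) + tauH (Bc w)) + (SUM n:{1..f}. tr (%i j. iB i j * cf n i j) (muH n (Tc w)))"

definition dd :: "(M_basis_elt => 'r) => M_basis_elt => 'r" where
 "dd w = mk (ddT w) (ddB w) 0"

definition valid :: "(M_basis_elt => 'r) => bool" where
 "valid w <-> Tc w = tr iT (Tc w) & Bc w = tr iB (Bc w)"

lemma tr_add: "tr c (V + W) = tr c V + tr c W"
 by (auto simp: tr_def fun_eq_iff algebra_simps)

lemma tr_zero [simp]: "tr c 0 = 0"
 by (auto simp: tr_def fun_eq_iff)

lemma tr_sum: "tr c (SUM i:A. W i) = (SUM i:A. tr c (W i))"
 using additive_sum[of "tr c"] by (simp add: tr_add)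

lemma sum_apply2: "(SUM i:A. W i) a K = (SUM i:A. W i a K :: 'r)"
 by (simp add: sum_apply)

text \<open>Pascal's rule; the indicators record which intermediate summands exist. At j + 1 = eps
  and at j + n < eps one of them is missing, but there the omitted binomial coefficient is 0, so the
  truncation does not disturb the rule.\<close>

lemma bn_pascal:
 assumes "1 <= n" "eps <= j + n + 1" "j < eps"
 shows "bn (Suc n) j = of_bool (Suc j < eps) * bn n (Suc j) + of_bool (eps <= j + n) * bn n j"
proof (cases "eps <= j + n")
 case True
 define k where "k = j + n - eps"
 obtain n' where n': "n = Suc n'" using assms(1) by (cases n) auto
 have e: "j + Suc n - eps = Suc k" "Suc j + n - eps = Suc k" using True by (auto simp: k_def)
 have "bn (Suc n) j = ((n - 1) choose (Suc k)) + ((n - 1) choose k)"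
  using True e unfolding bn_def n' by simp
 moreover have "bn n j = (n - 1) choose k" using True by (simp add: bn_def k_def)
 moreover have "bn n (Suc j) = (n - 1) choose (Suc k)" using True e by (simp add: bn_def)
 moreover have "(n - 1) choose (Suc k) = 0" if "~ Suc j < eps"
  using that assms by (intro binomial_eq_0) (auto simp: k_def)
 ultimately show ?thesis using True by auto
next
 case False
 hence e: "eps = j + n + 1" using assms by simp
 have "bn (Suc n) j = 1" "bn n (Suc j) = 1" unfolding bn_def using e by simp_all
 thus ?thesis using e assms by simp
qed

text \<open>Into V^B, the composites Psi after mu, tau after mu and mu after Psi all contribute
  multiples of Psi mu_n, and \<open>bn_pascal\<close> makes them cancel. The terms mu_n tau cancel
  because \<open>cf\<close> changes sign with the exterior degree.\<close>

lemma dd_dd: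
 assumes "valid w" shows "dd (dd w) = 0"
proof (rule M_eqI)
 have T: "Tc w = tr iT (Tc w)" and B: "Bc w = tr iB (Bc w)" using assms by (auto simp: valid_def)
 let ?T = "Tc w" and ?B = "Bc w"
 have z: "Tc 0 = 0" "Bc 0 = 0" by (auto simp: Tc_def Bc_def fun_eq_iff)
 have T1: "PsiH (tauH ?T) a K = iT (Suc (card K - 1)) (Suc (expdeg g a)) * PsiH (tauH ?T) a K" if "ok K a" for a K
  using two_step_tr(1)[OF that, of iT ?T] T by simp
 have B1: "PsiH (tauH ?B) a K = iB (Suc (card K - 1)) (Suc (expdeg g a)) * PsiH (tauH ?B) a K" if "ok K a" for a K
  using two_step_tr(1)[OF that, of iB ?B] B by simp
 show "Tc (dd (dd w)) = Tc 0"
 proof (rule ext, rule ext)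
  fix a K
  show "Tc (dd (dd w)) a K = Tc 0 a K"
  proof (cases "ok K a & chT (card K) (expdeg g a)")
   case True
   hence ok: "ok K a" and ch: "chT (card K) (expdeg g a)" by auto
   define p where "p = PsiH (tauH ?T) a K"
   have "Tc (dd (dd w)) a K = PsiH (Tc (dd w)) a K + tauH (Tc (dd w)) a K"
    using ok ch by (simp add: dd_def[of "dd w"] ddT_def[of "dd w"] tr_def)
   also have "PsiH (Tc (dd w)) a K = iT (card K - 1) (Suc (expdeg g a)) * p"
    by (simp add: dd_def ddT_def PsiH_tr[OF ok] PsiH_add PsiH_PsiH p_def)
   also have "tauH (Tc (dd w)) a K = - iT (Suc (card K)) (expdeg g a) * p"
    by (simp add: dd_def ddT_def tauH_tr[OF ok] tauH_add tauH_tauH tauH_PsiH p_def)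
   \<comment> \<open>If the composite is nonzero its source lies in V^T. Together with the target
     this forces both intermediate summands to be present, so the two paths cancel; otherwise both
     sides are 0 anyway.\<close>
   also have "iT (card K - 1) (Suc (expdeg g a)) * p + - iT (Suc (card K)) (expdeg g a) * p = 0"
   proof (cases "p = 0")
    case False
    hence "card K ~= 0" using PsiH_empty[of _ a] ok_finite[OF ok] by (auto simp: p_def)
    moreover have "chT (Suc (card K - 1)) (Suc (expdeg g a))" using of_boolD[OF T1[OF ok]] False unfolding p_def by blast
    ultimately have "chT (card K - 1) (Suc (expdeg g a))" "chT (Suc (card K)) (expdeg g a)"
    using ch by (auto simp: chT_def)
    thus ?thesis by simp
   qed simp
   finally show ?thesis by (simp add: z)
  qed (auto simp: dd_def ddT_def tr_def z)
 qed
 show "Bc (dd (dd w)) = Bc 0"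
 proof (rule ext, rule ext)
  fix a K
  show "Bc (dd (dd w)) a K = Bc 0 a K"
  proof (cases "ok K a & chB (card K) (expdeg g a)")
   case True
   define i j where "i = card K" and "j = expdeg g a"
   have ok: "ok K a" and ch: "chB i j" using True by (auto simp: i_def j_def)
   define q P Q where "q = PsiH (tauH ?B) a K" and "P n = muH n (PsiH ?T) a K" and "Q n = muH n (tauH ?T) a K" for n
   have "Bc (dd (dd w)) a K = PsiH (ddB w) a K + tauH (ddB w) a K + (SUM n:{1..f}. cf n i j * muH n (ddT w) a K)"
    using ok ch by (simp add: dd_def ddB_def[of "dd w"] tr_def sum_apply2 i_def j_def)
    (simp add: dd_def ddB_def[of "mk _ _ _"] tr_def sum_apply2)
   also have "PsiH (ddB w) a K = iB (i - 1) (Suc j) * q + (SUM n:{1..f}. iB (i - 1) (Suc j) * cf n (i - 1) (Suc j) * P n)"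
    by (simp add: ddB_def PsiH_add PsiH_sum PsiH_tr[OF ok] PsiH_PsiH sum_apply2 q_def P_def PsiH_muH i_def j_def)
   also have "tauH (ddB w) a K = - iB (Suc i) j * q + (SUM n:{1..f}. iB (Suc i) j * cf n (Suc i) j * (Q n + P (n - 1)))"
   proof -
    have "tauH (muH n ?T) a K = Q n + P (n - 1)" if "n : {1..f}" for n
    using that tauH_muH_Suc[of "n - 1" ?T] PsiH_muH[of "n - 1" ?T] by (simp add: P_def Q_def)
    thus ?thesis
    by (simp add: ddB_def tauH_add tauH_sum tauH_tr[OF ok] tauH_tauH sum_apply2 q_def tauH_PsiH i_def j_def)
   qed
   also have "(SUM n:{1..f}. cf n i j * muH n (ddT w) a K) =
    (SUM n:{1..f}. cf n i j * iT (i - 2 * n) (j + n) * (P n + Q n))"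
    by (simp add: ddT_def muH_tr[OF ok] muH_add P_def Q_def i_def j_def mult.assoc)
   finally have "Bc (dd (dd w)) a K = (iB (i - 1) (Suc j) * q - iB (Suc i) j * q) +
    ((SUM n:{1..f}. iB (i - 1) (Suc j) * cf n (i - 1) (Suc j) * P n) +
    (SUM n:{1..f}. iB (Suc i) j * cf n (Suc i) j * P (n - 1)) +
    (SUM n:{1..f}. cf n i j * iT (i - 2 * n) (j + n) * P n)) +
    (SUM n:{1..f}. (iB (Suc i) j * cf n (Suc i) j + cf n i j * iT (i - 2 * n) (j + n)) * Q n)"
    by (simp add: algebra_simps sum.distrib)
   moreover have "iB (i - 1) (Suc j) * q - iB (Suc i) j * q = 0"
   proof (cases "q = 0")
    case False
    hence "i ~= 0" using PsiH_empty[of _ a] ok_finite[OF ok] by (auto simp: q_def i_def)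
    moreover have "chB (Suc (i - 1)) (Suc j)" using of_boolD[OF B1[OF ok]] False unfolding q_def i_def j_def by blast
    ultimately have "chB (i - 1) (Suc j)" "chB (Suc i) j"
    using ch by (auto simp: chB_def)
    thus ?thesis by simp
   qed simp
   moreover have "(iB (Suc i) j * cf n (Suc i) j + cf n i j * iT (i - 2 * n) (j + n)) * Q n = 0" if n: "n : {1..f}" for n
   proof (cases "Q n = 0")
    case False
    have "2 * n <= i" using False muH_small[OF ok_finite[OF ok]] by (force simp: Q_def i_def)
    moreover have "chT (Suc (i - 2 * n)) (j + n)"
    using of_boolD[OF two_step_tr(2)[OF ok, of n iT ?T, folded T]] False unfolding Q_def i_def j_def by blast
    ultimately have "chT (i - 2 * n) (j + n)" "chB (Suc i) j" using ch by (auto simp: chT_def chB_def)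
    thus ?thesis by (simp add: cf_def)
   qed simp
   moreover have "(SUM n:{1..f}. iB (i - 1) (Suc j) * cf n (i - 1) (Suc j) * P n) +
    (SUM n:{1..f}. iB (Suc i) j * cf n (Suc i) j * P (n - 1)) +
    (SUM n:{1..f}. cf n i j * iT (i - 2 * n) (j + n) * P n) = 0"
   proof -
    have Pnz: "n >= 1 & 2 * n + 1 <= i & eps <= j + n + 1 & chT (i - 2 * n - 1) (Suc (j + n))" if "P n ~= 0" for n
    proof -
    have "2 * n + 1 <= i" using that PsiH_muH_small[OF ok, of n ?T] by (force simp: P_def i_def PsiH_muH)
    moreover have c: "chT (i - 2 * n - 1) (Suc (j + n))"
    using of_boolD[OF two_step_tr(3)[OF ok, of n iT ?T, folded T]] that unfolding P_def i_def j_def by blast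
    moreover have "n >= 1"
    proof (rule ccontr)
    assume "~ n >= 1"
    thus False using c ch \<open>2 * n + 1 <= i\<close> by (auto simp: chT_def chB_def)
    qed
    ultimately show ?thesis by (auto simp: chT_def)
    qed
    have Pf: "P f = 0" using Pnz[of f] ok g_less card_mono[of "{1..f}" K] by (force simp: ok_def i_def)
    \<comment> \<open>tau after mu_n contributes \<open>P (n - 1)\<close>. After the shift of n the
      range returns to {1..f} because \<open>P 0\<close> and \<open>P f\<close> vanish.\<close>
    have "(SUM n:{1..f}. iB (Suc i) j * cf n (Suc i) j * P (n - 1)) = (SUM n:{0..<f}. iB (Suc i) j * cf (Suc n) (Suc i) j * P n)"
    by (rule sum.reindex_bij_witness[where i = Suc and j = "%n. n - 1"]) auto
    also have "... = (SUM n:{0..f}. iB (Suc i) j * cf (Suc n) (Suc i) j * P n)"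
    proof -
    have e: "{0..f} = insert f {0..<f}" by auto
    show ?thesis unfolding e by (subst sum.insert) (simp_all add: Pf)
    qed
    also have "... = (SUM n:{1..f}. iB (Suc i) j * cf (Suc n) (Suc i) j * P n)"
    proof -
    have e: "{0..f} = insert 0 {1..f}" by auto
    have "P 0 = 0" using Pnz[of 0] by force
    thus ?thesis unfolding e by (subst sum.insert) simp_all
    qed
    finally have s: "(SUM n:{1..f}. iB (Suc i) j * cf n (Suc i) j * P (n - 1)) = (SUM n:{1..f}. iB (Suc i) j * cf (Suc n) (Suc i) j * P n)" .
    have "(iB (i - 1) (Suc j) * cf n (i - 1) (Suc j) + iB (Suc i) j * cf (Suc n) (Suc i) j + cf n i j * iT (i - 2 * n) (j + n)) * P n = 0" for n
    proof (cases "P n = 0")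
    case False
    note N = Pnz[OF this]
    have 1: "chB (Suc i) j" "chB (i - 1) (Suc j) <-> Suc j < eps" "chT (i - 2 * n) (j + n) <-> eps <= j + n"
    using ch N by (auto simp: chB_def chT_def)
    obtain i' where i': "i = Suc i'" using N by (cases i) auto
    have "bn (Suc n) j = of_bool (Suc j < eps) * bn n (Suc j) + of_bool (eps <= j + n) * bn n j"
    by (rule bn_pascal) (use N ch in "auto simp: chB_def")
    hence "of_nat (bn (Suc n) j) = (of_bool (Suc j < eps) * of_nat (bn n (Suc j)) + of_bool (eps <= j + n) * of_nat (bn n j) :: 'r)"
    by simp
    hence "iB (i - 1) (Suc j) * cf n (i - 1) (Suc j) + iB (Suc i) j * cf (Suc n) (Suc i) j + cf n i j * iT (i - 2 * n) (j + n) = 0"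
    unfolding cf_def 1(2,3) using 1(1) unfolding i' by (simp add: algebra_simps)
    thus ?thesis by simp
    qed simp
    hence "(SUM n:{1..f}. (iB (i - 1) (Suc j) * cf n (i - 1) (Suc j) + iB (Suc i) j * cf (Suc n) (Suc i) j + cf n i j * iT (i - 2 * n) (j + n)) * P n) = 0"
    by (intro sum.neutral) blast
    thus ?thesis by (simp only: s sum.distrib distrib_right)
   qed
   ultimately have "Bc (dd (dd w)) a K = 0" by simp
   thus ?thesis by (simp add: z)
  next
   case False
   thus ?thesis by (auto simp: dd_def ddB_def tr_def z sum_apply2)
  qed
 qed
 show "dd (dd w) Top = 0 Top" by (simp add: dd_def)
qed

end

section \<open>Congruence modulo an ideal, and the exterior products behind the differential in
  position 1\<close>

definition is_idl :: "'r::comm_ring_1 set => bool" where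
 "is_idl J <-> 0 : J & (ALL a:J. ALL b:J. a + b : J) & (ALL r. ALL a:J. r * a : J)"

lemma is_idlD:
 assumes "is_idl J"
 shows "0 : J" "a : J ==> b : J ==> a + b : J" "a : J ==> r * a : J" "a : J ==> a * r : J"
  "a : J ==> - a : J" "a : J ==> b : J ==> a - b : J"
proof -
 show m: "a : J ==> r * a : J" for a r using assms by (auto simp: is_idl_def)
 show p: "a : J ==> b : J ==> a + b : J" for a b using assms by (auto simp: is_idl_def)
 show "0 : J" using assms by (auto simp: is_idl_def)
 show "a : J ==> a * r : J" using m[of a r] by (simp add: mult.commute)
 show n: "a : J ==> - a : J" for a using m[of a "-1"] by simp
 show "a : J ==> b : J ==> a - b : J" using p[of a "- b"] n[of b] by simp
qed

lemma is_idl_sum: "is_idl J ==> (!!i. i : A ==> u i : J) ==> sum u A : J"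
 by (induction A rule: infinite_finite_induct) (auto intro: is_idlD)

definition inJ :: "'r::comm_ring_1 set => ('b => 'r) => bool" where
 "inJ J u <-> (ALL k. u k : J)"

lemma inJ_wdg: "is_idl J ==> inJ J v ==> inJ J (wdg u v)"
 unfolding inJ_def wdg_def by (auto intro!: is_idl_sum is_idlD(3))

lemma inJ_wdg_left:
 assumes "is_idl J" "inJ J u" shows "inJ J (wdg u v)"
 unfolding inJ_def wdg_def
 by (intro allI is_idl_sum[OF assms(1)] is_idlD(3)[OF assms(1)] is_idlD(4)[OF assms(1)] assms(2)[unfolded inJ_def, rule_format])

lemma inJD: "inJ J u ==> u k : J"
 by (simp add: inJ_def)

lemma inJ_contr: "is_idl J ==> inJ J v ==> inJ J (contr f s v)"
 unfolding inJ_def contr_def ann1_def by (auto intro!: is_idl_sum is_idlD(3) simp: is_idlD(1))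

lemma inJ_add: "is_idl J ==> inJ J u ==> inJ J v ==> inJ J (u + v)"
 by (auto simp: inJ_def intro: is_idlD)

lemma inJ_diff: "is_idl J ==> inJ J u ==> inJ J v ==> inJ J (u - v)"
 by (auto simp: inJ_def intro: is_idlD)

lemma inJ_zero: "is_idl J ==> inJ J 0"
 by (auto simp: inJ_def intro: is_idlD)

lemma inJ_scal: "is_idl J ==> inJ J u ==> inJ J (scal c u)"
 by (auto simp: inJ_def intro: is_idlD)

lemma inJ_uminus: "is_idl J ==> inJ J u ==> inJ J (- u)"
 by (auto simp: inJ_def intro: is_idlD)

lemma inJ_alt: "is_idl J ==> inJ J u ==> inJ J (alt u)"
 by (auto simp: inJ_def alt_def intro: is_idlD)

lemma inJ_sum: "is_idl J ==> (!!i. i : A ==> inJ J (u i)) ==> inJ J (SUM i:A. u i)"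
 unfolding inJ_def sum_apply by (auto intro: is_idl_sum)

definition inJ2 :: "'r::comm_ring_1 set => ('a => 'b => 'r) => bool" where
 "inJ2 J W <-> (ALL a. inJ J (W a))"

lemma inJ2D: "inJ2 J W ==> W a K : J"
 by (auto simp: inJ2_def inJ_def)

lemma inJ2I: "(!!a K. W a K : J) ==> inJ2 J W"
 by (auto simp: inJ2_def inJ_def)

definition scal2 :: "'r::comm_ring_1 => ('a => 'b => 'r) => 'a => 'b => 'r" where
 "scal2 c W = (%a. scal c (W a))"

lemma scal2_apply: "scal2 c W a K = c * W a K"
 by (simp add: scal2_def)

lemma inJ2_add: "is_idl J ==> inJ2 J u ==> inJ2 J v ==> inJ2 J (u + v)"
 by (auto simp: inJ2_def inJ_def intro: is_idlD)

lemma inJ2_diff: "is_idl J ==> inJ2 J u ==> inJ2 J v ==> inJ2 J (u - v)"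
 by (auto simp: inJ2_def inJ_def intro: is_idlD)

lemma inJ2_scal: "is_idl J ==> inJ2 J u ==> inJ2 J (scal2 c u)"
 by (auto simp: inJ2_def inJ_def scal2_apply intro: is_idlD)

lemma inJ2_uminus: "is_idl J ==> inJ2 J u ==> inJ2 J (- u)"
 by (auto simp: inJ2_def inJ_def intro: is_idlD)

lemma inJ2_zero: "is_idl J ==> inJ2 J 0"
 by (auto simp: inJ2_def inJ_def intro: is_idlD)

context koszul_data
begin

lemma inJ2_PsiH: "is_idl J ==> inJ2 J W ==> inJ2 J (PsiH W)"
 unfolding inJ2_def PsiH_def
 by (intro allI inJ_sum inJ_wdg) auto

lemma inJ2_tauH: "is_idl J ==> inJ2 J W ==> inJ2 J (tauH W)"
 by (auto simp: tauH_def inJ2_def intro!: inJ_contr)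

lemma inJ2_muH: "is_idl J ==> inJ2 J W ==> inJ2 J (muH n W)"
 unfolding inJ2_def muH_def
 by (intro allI inJ_sum inJ_wdg) auto

lemma scal_diff: "scal c (u - v) = scal c u - scal c (v :: 'b => 'r)"
 by (auto simp: fun_eq_iff algebra_simps)

lemma PsiH_scal: "PsiH (scal2 c W) = scal2 c (PsiH W)"
 by (rule ext, rule ext) (simp add: PsiH_def scal2_def wdg_scal_right sum_apply sum_distrib_left)

lemma tauH_scal: "tauH (scal2 c W) = scal2 c (tauH W)"
 by (rule ext) (simp add: tauH_def scal2_def contr_scal)

lemma muH_scal: "muH n (scal2 c W) = scal2 c (muH n W)"
 by (rule ext, rule ext) (simp add: muH_def scal2_def wdg_scal_right sum_apply sum_distrib_left)

lemma PsiH_diff: "PsiH (W - W') = PsiH W - PsiH W'"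
 using PsiH_add[of W "- W'"] PsiH_uminus[of W'] by (simp only: diff_conv_add_uminus)

lemma PL_Cons: "PL (l # ls) = wdg (psi l) (PL ls)"
 by (simp add: PL_def)

lemma contr_PL: "contr f t (PL ls) = 0"
proof (induction ls)
 case Nil show ?case by (simp add: PL_def)
next
 case (Cons k ls)
 show ?case by (simp only: PL_Cons contr_psi_wdg Cons wdg_zero_right minus_zero)
qed

lemma psi_PL: "l : set ls ==> wdg (psi l) (PL ls) = 0"
proof (induction ls)
 case (Cons k ls)
 show ?case
 proof (cases "l = k")
  case False
  hence "wdg (psi l) (PL ls) = 0" using Cons by auto
  thus ?thesis by (simp only: PL_Cons psi_psi_wdg(1)[of l k] wdg_zero_right minus_zero)
 qed (simp only: PL_Cons psi_psi_wdg(2))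
qed simp

lemma homog_PL: "homog f (length ls) (PL ls)"
proof (induction ls)
 case Nil show ?case by (simp add: PL_def homog_one)
next
 case (Cons k ls)
 show ?case using homog_wdg[OF vec1_homog[OF psi_vec1[of k]] Cons] by (simp add: PL_Cons)
qed

lemma alt_homog: "homog f d u ==> alt u = scal ((-1) ^ d) u"
proof
 fix K assume u: "homog f d u"
 show "alt u K = scal ((-1) ^ d) u K"
  using u by (cases "u K = 0") (auto simp: alt_def homog_def ext_basis_def)
qed

lemma alt_wdg: "alt (wdg u v) = wdg (alt u) (alt v)"
proof
 fix K
 show "alt (wdg u v) K = wdg (alt u) (alt v) K"
 proof (cases "finite K")
  case True
  show ?thesis
   unfolding wdg_def alt_def sum_distrib_left
  proof (rule sum.cong)
   fix L assume "L : Pow K"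
   hence "card K = card L + card (K - L)"
    using True by (metis PowD card_Diff_subset card_mono finite_subset le_add_diff_inverse)
   thus "(- 1) ^ card K * (isgn L (K - L) * (u L * v (K - L))) =
    isgn L (K - L) * ((- 1) ^ card L * u L * ((- 1) ^ card (K - L) * v (K - L)))"
    by (simp add: power_add ac_simps)
  qed simp
 qed (simp add: wdg_infinite alt_def)
qed

text \<open>Its coordinate at a set L of size g is the maximal minor of Psi on the columns
  L.\<close>

definition Lam :: "'r ext" where "Lam = PL [1..<Suc g]"

text \<open>The exterior product occurring in c(X^(a)): the shift by \<open>uexp 1\<close> is the
  integral along X_1, and the factors Psi(X_l) start at l = 2.\<close>

definition Wt :: "'r dext" where
 "Wt a = wdg (Dm (a + uexp 1)) (PL [2..<Suc g])"

lemma wdg_psi_left_Lam: "l : {1..g} ==> wdg (wdg (psi l) v) Lam = 0"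
 using psi_PL[of l "[1..<Suc g]"]
 by (simp only: wdg_vec1_commute[OF psi_vec1] wdg_assoc Lam_def) (simp del: upt_Suc)

text \<open>tau kills \<open>Lam\<close>, so the product is itself a value of tau, and such a value
  has no top coordinate.\<close>

lemma wdg_contr_Lam: "wdg (contr f t v) Lam {1..f} = 0"
proof -
 have "contr f t (wdg v Lam) = wdg (contr f t v) Lam"
  by (simp only: contr_wdg contr_PL Lam_def wdg_zero_right add_0_right)
 thus ?thesis by (metis contr_top)
qed

text \<open>Lowering the exponent of X_l frees a factor Psi(X_l), which occurs already unless l =
  1.\<close>

lemma contr_Wt:
 assumes "1 <= g" shows "contr f t (Wt a) = wdg (Dm a) Lam"
proof -
 let ?PL = "PL [2..<Suc g]" and ?m = "a + uexp 1"
 have e: "[1..<Suc g] = 1 # [2..<Suc g]" using assms by (simp add: upt_conv_Cons numeral_2_eq_2 del: upt_Suc)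
 have "contr f t (Wt a) = (SUM l:{1..g}. wdg (if ?m l = 0 then 0 else wdg (psi l) (Dm (?m - uexp l))) ?PL)"
  by (simp only: Wt_def contr_wdg contr_PL contr_Dm wdg_sum_left wdg_zero_right add_0_right)
 also have "... = (SUM l:{1..g}. if l = 1 then wdg (wdg (psi 1) (Dm a)) ?PL else 0)"
 proof (rule sum.cong)
  fix l assume l: "l : {1..g}"
  show "wdg (if ?m l = 0 then 0 else wdg (psi l) (Dm (?m - uexp l))) ?PL = (if l = 1 then wdg (wdg (psi 1) (Dm a)) ?PL else 0)"
  proof (cases "l = 1")
   case True
   have "?m - uexp 1 = a" by (auto simp: fun_eq_iff)
   thus ?thesis using True by (simp add: uexp_apply)
  next
   case False
   hence "wdg (psi l) ?PL = 0" using l by (intro psi_PL) auto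
   hence "wdg (wdg (psi l) v) ?PL = 0" for v
    by (simp only: wdg_vec1_commute[OF psi_vec1] wdg_assoc) simp
   thus ?thesis using False by simp
  qed
 qed simp
 also have "... = wdg (wdg (psi 1) (Dm a)) ?PL" using assms by (simp add: sum.delta)
 also have "... = wdg (Dm a) Lam"
  unfolding Lam_def e PL_Cons by (simp only: wdg_assoc Dm_left_commute)
 finally show ?thesis .
qed

text \<open>tau of \<open>wdg v (Wt a)\<close> has no top coordinate, and its two Leibniz terms are
  the two sides. With v a basis vector this shows that each t p multiplies the values of c into the
  ideal of minors.\<close>

lemma tau_Wt:
 assumes "1 <= g" "vec1 f v"
 shows "(SUM p:{1..f}. t p * v {p}) * Wt a {1..f} = wdg v (wdg (Dm a) Lam) {1..f}"
proof -
 have i: "infinite K ==> Wt a K = 0" for K by (simp add: Wt_def wdg_infinite)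
 have "0 = contr f t (wdg v (Wt a)) {1..f}" by (rule contr_top[symmetric])
 also have "... = (SUM p:{1..f}. t p * v {p}) * Wt a {1..f} - wdg v (wdg (Dm a) Lam) {1..f}"
  by (simp add: contr_wdg contr_vec1[OF assms(2)] wdg_scal_one_left i alt_vec1[OF assms(2)] wdg_uminus_left contr_Wt[OF assms(1)])
 finally show ?thesis by simp
qed

end

section \<open>Positions, supports and the differential\<close>

context complex_data
begin

definition Mbasis :: "nat => M_basis_elt => bool" where
 "Mbasis k z = (case z of
   VT (K,a) => ok K a & chT (card K) (expdeg g a) & k + de = card K + 2 * expdeg g a + 2
  | VB (K,a) => ok K a & chB (card K) (expdeg g a) & k + de = card K + 2 * expdeg g a + 1
  | Top => k = 0)"

definition inM :: "nat => (M_basis_elt => 'r) => bool" where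
 "inM k w <-> (ALL z. w z ~= 0 --> Mbasis k z)"

lemma inM_T: "inM k w ==> Tc w a K ~= 0 ==> ok K a & chT (card K) (expdeg g a) & k + de = card K + 2 * expdeg g a + 2"
 unfolding inM_def Tc_def Mbasis_def by (drule spec[of _ "VT (K,a)"]) simp

lemma inM_B: "inM k w ==> Bc w a K ~= 0 ==> ok K a & chB (card K) (expdeg g a) & k + de = card K + 2 * expdeg g a + 1"
 unfolding inM_def Bc_def Mbasis_def by (drule spec[of _ "VB (K,a)"]) simp

lemma inMI:
 assumes "!!a K. Tc w a K ~= 0 ==> ok K a & chT (card K) (expdeg g a) & k + de = card K + 2 * expdeg g a + 2"
  "!!a K. Bc w a K ~= 0 ==> ok K a & chB (card K) (expdeg g a) & k + de = card K + 2 * expdeg g a + 1"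
  "w Top ~= 0 ==> k = 0"
 shows "inM k w"
 unfolding inM_def
proof (intro allI impI)
 fix z assume "w z ~= 0"
 thus "Mbasis k z"
  using assms by (cases z) (auto simp: Mbasis_def Tc_def Bc_def)
qed

lemma inM_valid:
 assumes w: "inM k w" shows "valid w"
proof -
 have "Tc w a K = tr iT (Tc w) a K" for a K
  using inM_T[OF w, of a K] by (cases "Tc w a K = 0") (simp_all add: tr_def)
 moreover have "Bc w a K = tr iB (Bc w) a K" for a K
  using inM_B[OF w, of a K] by (cases "Bc w a K = 0") (simp_all add: tr_def)
 ultimately show ?thesis unfolding valid_def by blast
qed

definition supp :: "(nat => nat => bool) => 'r dext => bool" where
 "supp Q W <-> (ALL a K. W a K ~= 0 --> ok K a & Q (card K) (expdeg g a))"

lemma suppD: "supp Q W ==> W a K ~= 0 ==> ok K a & Q (card K) (expdeg g a)"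
 by (auto simp: supp_def)

lemma supp_mono: "supp Q W ==> (!!i j. Q i j ==> Q' i j) ==> supp Q' W"
 by (auto simp: supp_def)

lemma supp_tr: "supp (%i j. c i j ~= 0) (tr c W)"
 by (auto simp: supp_def tr_def split: if_splits)

lemma supp_tr_id:
 assumes "supp Q W" "!!i j. Q i j ==> c i j = 1" shows "tr c W = W"
proof (rule ext, rule ext)
 fix a K show "tr c W a K = W a K"
  using assms suppD[OF assms(1), of a K] by (cases "W a K = 0") (auto simp: tr_def)
qed

lemma supp_tr_zero:
 assumes "supp Q W" "!!i j. Q i j ==> c i j = 0" shows "tr c W = 0"
proof (rule ext, rule ext)
 fix a K show "tr c W a K = 0 a K"
  using assms suppD[OF assms(1), of a K] by (cases "W a K = 0") (auto simp: tr_def)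
qed

lemma supp_zero: "supp Q 0" by (simp add: supp_def)

lemma supp_add: "supp Q V ==> supp Q W ==> supp Q (V + W)"
 by (auto simp: supp_def) (metis add.left_neutral add.right_neutral)+

lemma supp_scal2: "supp Q V ==> supp Q (scal2 c V)"
 by (auto simp: supp_def scal2_apply) (metis mult_zero_right)+

lemma supp_sum: "(!!i. i : A ==> supp Q (V i)) ==> supp Q (SUM i:A. V i)"
 by (induction A rule: infinite_finite_induct) (auto intro: supp_zero supp_add)

lemma supp_PsiH:
 assumes W: "supp Q W"
 shows "supp (%i j. i >= 1 & Q (i - 1) (Suc j)) (PsiH W)"
 unfolding supp_def
proof (intro allI impI)
 fix a K assume nz: "PsiH W a K ~= 0"
 then obtain l where l: "l : {1..g}" "wdg (psi l) (W (a + uexp l)) K ~= 0"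
  unfolding PsiH_def sum_apply by (rule sum.not_neutral_contains_not_neutral)
 then obtain L where L: "L <= K" "finite K" "psi l L ~= 0" "W (a + uexp l) (K - L) ~= 0" by (elim wdg_nonzero)
 have s: "ok (K - L) (a + uexp l)" using suppD[OF W, OF L(4)] by simp
 obtain p where p: "p : {1..f}" "L = {p}" using L(3) psi_vec1[of l] by (auto simp: vec1_def)
 have a: "a l' = 0" if "l' ~: {1..g}" for l' using s that by (auto simp: ok_def)
 have ok: "ok K a" using s a p by (auto simp: ok_def)
 have "K ~= {}" using L(1) p by auto
 hence "card K >= 1" using L(2) by (simp add: Suc_leI card_gt_0_iff)
 moreover have "PsiH W a K = of_bool (Q (card K - 1) (Suc (expdeg g a))) * PsiH W a K"
  using PsiH_tr[OF ok, of "%i j. of_bool (Q i j)" W] supp_tr_id[OF W, of "%i j. of_bool (Q i j)"] by simp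
 ultimately show "ok K a & card K >= 1 & Q (card K - 1) (Suc (expdeg g a))"
  using ok of_boolD nz by blast
qed

lemma supp_tauH:
 assumes W: "supp Q W"
 shows "supp (%i j. Q (Suc i) j) (tauH W)"
 unfolding supp_def
proof (intro allI impI)
 fix a K assume nz: "tauH W a K ~= 0"
 then obtain p where p: "p : {1..f}" "t p * ann1 p (W a) K ~= 0"
  unfolding tauH_def contr_def by (rule sum.not_neutral_contains_not_neutral)
 hence "W a (insert p K) ~= 0" by (auto simp: ann1_def split: if_splits)
 hence ok: "ok K a" using suppD[OF W] ok_subset by blast
 have "tauH W a K = of_bool (Q (Suc (card K)) (expdeg g a)) * tauH W a K"
  using tauH_tr[OF ok, of "%i j. of_bool (Q i j)" W] supp_tr_id[OF W, of "%i j. of_bool (Q i j)"] by simp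
 thus "ok K a & Q (Suc (card K)) (expdeg g a)"
  using ok of_boolD nz by blast
qed

lemma supp_muH:
 assumes W: "supp Q W"
 shows "supp (%i j. i >= 2 * n & Q (i - 2 * n) (j + n)) (muH n W)"
 unfolding supp_def
proof (intro allI impI)
 fix a K assume nz: "muH n W a K ~= 0"
 then obtain m where m: "m : exponents g n" "wdg (Dm m) (W (a + m)) K ~= 0"
  unfolding muH_def sum_apply by (rule sum.not_neutral_contains_not_neutral)
 then obtain L where L: "L <= K" "finite K" "Dm m L ~= 0" "W (a + m) (K - L) ~= 0" by (elim wdg_nonzero)
 have s: "ok (K - L) (a + m)" using suppD[OF W, OF L(4)] by simp
 have LL: "L <= {1..f}" using L(3) homog_Dm[of m] by (auto simp: homog_def ext_basis_def)
 have a: "a l' = 0" if "l' ~: {1..g}" for l' using s that by (auto simp: ok_def)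
 have ok: "ok K a" using s a LL by (auto simp: ok_def)
 have "card K >= 2 * n" using muH_small[OF L(2), of n W a] nz by (meson not_le_imp_less)
 moreover have "muH n W a K = of_bool (Q (card K - 2 * n) (expdeg g a + n)) * muH n W a K"
  using muH_tr[OF ok, of n "%i j. of_bool (Q i j)" W] supp_tr_id[OF W, of "%i j. of_bool (Q i j)"] by simp
 ultimately show "ok K a & card K >= 2 * n & Q (card K - 2 * n) (expdeg g a + n)"
  using ok of_boolD nz by blast
qed

lemma supp_finite: "supp Q W ==> infinite K ==> W a K = 0"
 using suppD ok_finite by blast

text \<open>Position 1 contains at most V^B_(f-g,0) and V^T_(0,eps); so V^B is read at exponent 0
  only, and V^T at the empty exterior index only.\<close>

definition d1 :: "(M_basis_elt => 'r) => M_basis_elt => 'r" where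
 "d1 w = mk 0 0 (wdg (Bc w 0) Lam {1..f} +
   (if 2 * eps + 1 = de then SUM a:exponents g eps. Tc w a {} * Wt a {1..f} else 0))"

definition D :: "nat => (M_basis_elt => 'r) => M_basis_elt => 'r" where
 "D k w = (if k >= 2 then dd w else if k = 1 then d1 w else 0)"

lemma inM_suppT: "inM k w ==> supp (%i j. chT i j & k + de = i + 2 * j + 2) (Tc w)"
 unfolding supp_def using inM_T by blast

lemma inM_suppB: "inM k w ==> supp (%i j. chB i j & k + de = i + 2 * j + 1) (Bc w)"
 unfolding supp_def using inM_B by blast

lemma inM_mkI: "supp (%i j. chT i j & k + de = i + 2 * j + 2) T ==> supp (%i j. chB i j & k + de = i + 2 * j + 1) B
  ==> (c ~= 0 ==> k = 0) ==> inM k (mk T B c)"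
 by (rule inMI) (auto simp: supp_def)

lemma supp_conj_tr:
 assumes "supp Q W"
 shows "supp (%i j. P i j & Q i j) (tr (%i j. of_bool (P i j)) W)"
  "supp (%i j. P i j & Q i j) (tr (%i j. of_bool (P i j) * c i j) W)"
proof -
 have "ok K a & P (card K) (expdeg g a) & Q (card K) (expdeg g a)"
  if "tr (%i j. of_bool (P i j) * c i j) W a K ~= 0" for c a K
 proof -
  have "ok K a" "of_bool (P (card K) (expdeg g a)) * c (card K) (expdeg g a) * W a K ~= 0"
   using that unfolding tr_def by presburger+
  note prod = this
  have "P (card K) (expdeg g a)"
  proof (rule ccontr)
   assume "~ P (card K) (expdeg g a)"
   hence "of_bool (P (card K) (expdeg g a)) = (0::'r)" by simp
   thus False using prod(2) by (simp only: mult_zero_left simp_thms)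
  qed
  moreover have "W a K ~= 0" using prod(2) by auto
  moreover note prod(1)
  ultimately have "P (card K) (expdeg g a)" "W a K ~= 0" by blast+
  thus ?thesis using suppD[OF assms] by blast
 qed
 from this[of "%i j. 1"] this
 show "supp (%i j. P i j & Q i j) (tr (%i j. of_bool (P i j)) W)"
  "supp (%i j. P i j & Q i j) (tr (%i j. of_bool (P i j) * c i j) W)"
  unfolding supp_def by simp_all
qed

lemma inM_dd: "inM (Suc k) w ==> inM k (dd w)"
 unfolding dd_def
proof (rule inM_mkI)
 assume w: "inM (Suc k) w"
 note T = inM_suppT[OF w] and B = inM_suppB[OF w]
 show "supp (%i j. chT i j & k + de = i + 2 * j + 2) (ddT w)"
  unfolding ddT_def tr_add
  by (intro supp_add supp_mono[OF supp_conj_tr(1)[OF supp_PsiH[OF T]]] supp_mono[OF supp_conj_tr(1)[OF supp_tauH[OF T]]]) auto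
 show "supp (%i j. chB i j & k + de = i + 2 * j + 1) (ddB w)"
  unfolding ddB_def tr_add
  by (intro supp_add supp_sum supp_mono[OF supp_conj_tr(1)[OF supp_PsiH[OF B]]] supp_mono[OF supp_conj_tr(1)[OF supp_tauH[OF B]]]
    supp_mono[OF supp_conj_tr(2)[OF supp_muH[OF T]]]) auto
qed simp

lemma inM_d1: "inM 0 (d1 w)"
 unfolding d1_def by (rule inM_mkI) (simp_all add: supp_zero)

lemma inM_zero: "inM k 0"
 by (simp add: inM_def)

lemma inM_D: "inM (Suc k) w ==> inM k (D (Suc k) w)"
 unfolding D_def using inM_dd[of k w] inM_d1[of w] by (cases k) auto

lemma Tc_add: "Tc (v + w) = Tc v + Tc w" by (auto simp: Tc_def fun_eq_iff)
lemma Bc_add: "Bc (v + w) = Bc v + Bc w" by (auto simp: Bc_def fun_eq_iff)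
lemma Tc_scal: "Tc (scal c w) = scal2 c (Tc w)" by (auto simp: Tc_def fun_eq_iff scal2_apply)
lemma Bc_scal: "Bc (scal c w) = scal2 c (Bc w)" by (auto simp: Bc_def fun_eq_iff scal2_apply)
lemma mk_add: "mk T B c + mk T' B' c' = mk (T + T') (B + B') (c + c')"
 by (auto simp: mk_def fun_eq_iff split: M_basis_elt.splits)
lemma mk_scal: "scal c (mk T B b) = mk (scal2 c T) (scal2 c B) (c * b)"
 by (auto simp: mk_def fun_eq_iff scal2_apply split: M_basis_elt.splits)
lemma mk_zero: "mk 0 0 0 = 0"
 by (auto simp: mk_def fun_eq_iff split: M_basis_elt.splits)

lemma tr_scal2: "tr c (scal2 r W) = scal2 r (tr c W)"
 by (auto simp: tr_def fun_eq_iff scal2_apply)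

lemma scal2_add: "scal2 c (V + W) = scal2 c V + scal2 c W"
 by (auto simp: fun_eq_iff scal2_apply algebra_simps)

lemma scal2_zero: "scal2 c 0 = 0" by (auto simp: fun_eq_iff scal2_apply)

lemma scal2_sum: "scal2 c (SUM i:A. W i) = (SUM i:A. scal2 c (W i))"
 using additive_sum[of "scal2 c"] by (simp add: scal2_add scal2_zero)

lemma dd_add: "dd (v + w) = dd v + dd w"
proof -
 have "ddT (v + w) = ddT v + ddT w"
  by (simp only: ddT_def Tc_add PsiH_add tauH_add tr_add ac_simps)
 moreover have "ddB (v + w) = ddB v + ddB w"
  by (simp only: ddB_def Tc_add Bc_add PsiH_add tauH_add muH_add tr_add sum.distrib ac_simps)
 ultimately show ?thesis unfolding dd_def by (simp only: mk_add add_0)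
qed

lemma dd_scal: "dd (scal c w) = scal c (dd w)"
proof -
 have "ddT (scal c w) = scal2 c (ddT w)"
  by (simp only: ddT_def Tc_scal PsiH_scal tauH_scal tr_scal2 flip: scal2_add)
 moreover have "ddB (scal c w) = scal2 c (ddB w)"
  by (simp only: ddB_def Tc_scal Bc_scal PsiH_scal tauH_scal muH_scal tr_scal2 flip: scal2_add scal2_sum)
 ultimately show ?thesis unfolding dd_def by (simp only: mk_scal mult_zero_right)
qed

lemma d1_add: "d1 (v + w) = d1 v + d1 w"
 unfolding d1_def mk_add Tc_add Bc_add plus_fun_apply[of "Bc v"] wdg_add_left
 by (simp add: algebra_simps sum.distrib)

lemma d1_scal: "d1 (scal c w) = scal c (d1 w)"
 unfolding d1_def mk_scal Tc_scal Bc_scal scal2_zero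
 by (simp add: scal2_def wdg_scal_left algebra_simps sum_distrib_left)

lemma D_add: "D k (v + w) = D k v + D k w"
 unfolding D_def using dd_add d1_add by auto

lemma D_scal: "D k (scal c w) = scal c (D k w)"
 unfolding D_def using dd_scal d1_scal by (auto simp: fun_eq_iff)

lemma inJ_mk: "is_idl J ==> inJ2 J T ==> inJ2 J B ==> c : J ==> inJ J (mk T B c)"
 by (auto simp: inJ_def inJ2_def mk_def split: M_basis_elt.splits)

lemma inJ_Tc: "inJ J w ==> inJ2 J (Tc w)" by (auto simp: inJ_def inJ2_def Tc_def)
lemma inJ_Bc: "inJ J w ==> inJ2 J (Bc w)" by (auto simp: inJ_def inJ2_def Bc_def)

lemma inJ2_tr: "is_idl J ==> inJ2 J W ==> inJ2 J (tr c W)"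
 by (auto simp: inJ_def inJ2_def tr_def intro: is_idlD)

lemma inJ2_sum:
 assumes "is_idl J" "!!i. i : A ==> inJ2 J (W i)" shows "inJ2 J (SUM i:A. W i)"
proof (rule inJ2I)
 fix a K
 show "(SUM i:A. W i) a K : J"
  unfolding sum_apply by (rule is_idl_sum[OF assms(1)]) (rule inJ2D[OF assms(2)])
qed

lemma inJ_D:
 assumes J: "is_idl J" and w: "inJ J w" shows "inJ J (D k w)"
proof -
 note [intro] = inJ2_add inJ2_tr inJ2_sum inJ2_PsiH inJ2_tauH inJ2_muH inJ_Tc inJ_Bc
 have "inJ J (dd w)"
  unfolding dd_def ddT_def ddB_def
  by (intro inJ_mk[OF J] inJ2_add[OF J] inJ2_tr[OF J] inJ2_sum[OF J] inJ2_PsiH[OF J] inJ2_tauH[OF J] inJ2_muH[OF J]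
    inJ_Tc[OF w] inJ_Bc[OF w] is_idlD(1)[OF J])
 moreover have "inJ J (d1 w)"
 proof -
  have "inJ J (Bc w 0)" using inJ_Bc[OF w] by (auto simp: inJ2_def)
  hence "wdg (Bc w 0) Lam {1..f} : J" using inJ_wdg_left[OF J] by (auto simp: inJ_def)
  moreover have "(SUM a:exponents g eps. Tc w a {} * Wt a {1..f}) : J"
   by (intro is_idl_sum[OF J] is_idlD(4)[OF J] inJ2D[OF inJ_Tc[OF w]])
  ultimately show ?thesis unfolding d1_def
   by (intro inJ_mk[OF J] inJ2_zero[OF J]) (auto intro: is_idlD[OF J])
 qed
 ultimately show ?thesis unfolding D_def using inJ_zero[OF J] by auto
qed

text \<open>In position 2 a V^T part has I + 2J = f - g, which with J >= eps forces J = eps and I in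
  {0,1}. For I = 0 the value is the top coordinate of tau(\<open>Wt a\<close>), which is 0. For I =
  1 the mu term cancels c after tau by \<open>tau_Wt\<close>; the minus sign is (-1)^(f-g) with f -
  g odd.\<close>

lemma d1_dd:
 assumes w: "inM 2 w" shows "d1 (dd w) = 0"
proof -
 note sT = inM_suppT[OF w] and sB = inM_suppB[OF w]
 let ?T = "Tc w" and ?B = "Bc w"
 have T_nz: "eps <= expdeg g a & card K + expdeg g a + 1 <= de & de = card K + 2 * expdeg g a" if "?T a K ~= 0" for a K
  using inM_T[OF w that] by (auto simp: chT_def)
 let ?X = "%n. wdg (muH n ?T 0) Lam {1..f}"
 have Bc0: "Bc (dd w) 0 = (PsiH ?B + tauH ?B) 0 + (SUM n:{1..f}. tr (%i j. iB i j * cf n i j) (muH n ?T) 0)"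
 proof -
  have "tr iB (PsiH ?B + tauH ?B) 0 K = (PsiH ?B + tauH ?B) 0 K" for K
  proof -
   have z: "expdeg g (0::nat => nat) = 0" by simp
   have "ok K 0 & chB (card K) 0" if "PsiH ?B 0 K ~= 0"
    using suppD[OF supp_PsiH[OF sB], OF that] eps_le by (auto simp: chB_def)
   hence p: "PsiH ?B 0 K = 0" if "~ (ok K 0 & chB (card K) 0)" using that by blast
   have "ok K 0 & chB (card K) 0" if "tauH ?B 0 K ~= 0"
    using suppD[OF supp_tauH[OF sB], OF that] eps_le by (auto simp: chB_def)
   hence q: "tauH ?B 0 K = 0" if "~ (ok K 0 & chB (card K) 0)" using that by blast
   show ?thesis unfolding tr_def z plus_fun_apply using p q
    by (cases "ok K 0 & chB (card K) 0") auto
  qed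
  hence "tr iB (PsiH ?B + tauH ?B) 0 = (PsiH ?B + tauH ?B) 0" by blast
  thus ?thesis by (simp add: dd_def ddB_def sum_apply)
 qed
 have P: "wdg (PsiH ?B 0) Lam {1..f} = 0"
  by (simp add: PsiH_def wdg_sum_left wdg_psi_left_Lam)
 have Q: "wdg (tauH ?B 0) Lam {1..f} = 0"
  unfolding tauH_def by (rule wdg_contr_Lam)
 have TB: "wdg (tr (%i j. iB i j * cf n i j) (muH n ?T) 0) Lam {1..f} =
   (if n = eps then (-1) ^ de * ?X n else 0)" if n: "n : {1..f}" for n
 proof -
  have "tr (%i j. iB i j * cf n i j) (muH n ?T) 0 K = (if n = eps then (-1) ^ de * muH n ?T 0 K else 0)" for K
  proof (cases "muH n ?T 0 K = 0")
   case False
   have s: "ok K 0" "card K >= 2 * n" "chT (card K - 2 * n) n" "de = card K"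
    using suppD[OF supp_muH[OF sT], OF False] by auto
   hence "n = eps" "chB (card K) 0" using eps_ge n by (auto simp: chT_def chB_def)
   moreover have "bn eps 0 = 1" by (simp add: bn_def)
   ultimately show ?thesis using s by (simp add: tr_def cf_def)
  next
   case True
   thus ?thesis by (simp only: tr_def mult_zero_right if_cancel)
  qed
  hence "tr (%i j. iB i j * cf n i j) (muH n ?T) 0 = scal (if n = eps then (-1) ^ de else 0) (muH n ?T 0)"
   by (auto simp: fun_eq_iff)
  thus ?thesis by (simp add: wdg_scal_left)
 qed
 have B: "wdg (Bc (dd w) 0) Lam {1..f} = (if eps >= 1 then (-1) ^ de * ?X eps else 0)"
 proof -
  have "wdg (Bc (dd w) 0) Lam {1..f} = (SUM n:{1..f}. if n = eps then (-1) ^ de * ?X n else 0)"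
   using TB unfolding Bc0 plus_fun_apply wdg_add_left wdg_sum_left sum_apply P Q by simp
  moreover have "eps <= f" using eps_le g_less by auto
  ultimately show ?thesis by (simp add: sum.delta)
 qed
 have X: "?X eps = (SUM a:exponents g eps. wdg (wdg (Dm a) (?T a)) Lam {1..f})"
  by (simp add: muH_def wdg_sum_left sum_apply)
 show ?thesis
 proof (cases "2 * eps + 1 = de")
  case False
  have "?X eps = 0" if "eps >= 1"
   unfolding X
  proof (rule sum.neutral, rule ballI)
   fix a assume a: "a : exponents g eps"
   have T0: "?T a K = 0" if "K ~= {}" for K
   proof (rule ccontr)
    assume nz: "?T a K ~= 0"
    hence "de = card K + 2 * eps" using T_nz[OF nz] a by (auto simp: exponents_def)
    hence "card K = 0" using False eps_ge by linarith
    thus False using that inM_T[OF w nz] ok_finite by auto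
   qed
   hence e: "?T a = scal (?T a {}) wdg_one" by (auto simp: fun_eq_iff wdg_one_def)
   have "wdg (wdg (Dm a) wdg_one) Lam {1..f} = wdg (Dm a) Lam {1..f}"
    by (subst wdg_one_right) (auto intro: homog_infinite[OF homog_Dm])
   also have "... = 0" using contr_top[where t = t and y = "Wt a" and f = f] contr_Wt[OF g_pos, of a] by simp
   finally show "wdg (wdg (Dm a) (?T a)) Lam {1..f} = 0"
    by (subst e) (simp add: wdg_scal_right wdg_scal_left)
  qed
  hence "wdg (Bc (dd w) 0) Lam {1..f} = 0" using B by auto
  thus ?thesis using False by (simp add: d1_def mk_zero)
 next
  case True
  have "Tc (dd w) a {} * Wt a {1..f} = wdg (wdg (Dm a) (?T a)) Lam {1..f}" if a: "a : exponents g eps" for a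
  proof -
   have da: "expdeg g a = eps" using a by (auto simp: exponents_def)
   have v1: "vec1 f (?T a)" unfolding vec1_def
   proof (intro allI impI)
    fix K assume nz: "?T a K ~= 0"
    have "de = card K + 2 * expdeg g a" using T_nz[OF nz] by blast
    hence "card K = 1" using da True by linarith
    moreover have "ok K a" using inM_T[OF w nz] by blast
    ultimately have "card K = 1" "ok K a" by blast+
    thus "EX p:{1..f}. K = {p}" by (auto simp: card_1_singleton_iff ok_def)
   qed
   have ok: "ok {} a" using a by (auto simp: ok_def exponents_def)
   have ch: "chT 0 eps" using True by (auto simp: chT_def)
   have "Tc (dd w) a {} = tauH ?T a {}"
    using ok ch da by (simp add: dd_def ddT_def tr_def PsiH_empty)
   also have "... = (SUM p:{1..f}. t p * ?T a {p})"
    by (simp add: tauH_def contr_vec1[OF v1] wdg_one_def)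
   finally have "Tc (dd w) a {} * Wt a {1..f} = wdg (?T a) (wdg (Dm a) Lam) {1..f}"
    using tau_Wt[OF g_pos v1] by simp
   thus ?thesis by (simp add: Dm_left_commute wdg_assoc)
  qed
  hence s: "(SUM a:exponents g eps. Tc (dd w) a {} * Wt a {1..f}) = ?X eps" unfolding X by (rule sum.cong[OF refl])
  have "wdg (Bc (dd w) 0) Lam {1..f} + ?X eps = 0"
  proof (cases "eps >= 1")
   case True
   have "odd de" using \<open>2 * eps + 1 = de\<close> by presburger
   thus ?thesis using B True by simp
  next
   \<comment> \<open>Now f - g = 1 and eps = 0: there is no V^B_(1,0) to cancel against, but I + 2J
     = 1 and I + J <= 0 are incompatible, so V^T is empty in position 2.\<close>
   case e0: False
   hence "de = 1" using True by simp
   have "?T a K = 0" for a K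
    using T_nz[of a K] \<open>de = 1\<close> by (cases "?T a K = 0") auto
   hence "?T = 0" by (auto simp: fun_eq_iff)
   thus ?thesis using B e0 by simp
  qed
  thus ?thesis using True s by (simp add: d1_def mk_zero)
 qed
qed

lemma D_D:
 assumes "inM (Suc (Suc k)) w" shows "D (Suc k) (D (Suc (Suc k)) w) = 0"
proof (cases k)
 case 0
 thus ?thesis using d1_dd[of w] assms by (simp add: D_def numeral_2_eq_2)
next
 case (Suc k')
 thus ?thesis using dd_dd[OF inM_valid[OF assms]] by (simp add: D_def)
qed

end

section \<open>Homotopies for the rows of Psi\<close>

definition single :: "nat => ('r::comm_ring_1) ext" where
 "single p K = (if K = {p} then 1 else 0)"

lemma single_vec1: "p : {1..f} ==> vec1 f (single p)"
 by (auto simp: vec1_def single_def)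

lemma vec1_expand:
 assumes "vec1 f v" shows "v = (SUM p:{1..f}. scal (v {p}) (single p))"
proof
 fix K
 have s: "(SUM p:{1..f}. scal (v {p}) (single p)) K = (SUM p:{1..f}. if K = {p} then v K else 0)"
  unfolding sum_apply by (rule sum.cong) (auto simp: single_def)
 show "v K = (SUM p:{1..f}. scal (v {p}) (single p)) K"
 proof (cases "EX p:{1..f}. K = {p}")
  case True
  then obtain p where p: "p : {1..f}" "K = {p}" by blast
  have "(SUM q:{1..f}. if K = {q} then v K else 0) = (SUM q:{1..f}. if p = q then v K else 0)"
   using p by (intro sum.cong) auto
  thus ?thesis using p s by simp
 next
  case False
  hence "v K = 0" using assms by (auto simp: vec1_def)
  thus ?thesis unfolding s by (simp only: if_cancel sum.neutral_const)
 qed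
qed

definition FW :: "('r::comm_ring_1) ext list => 'r ext" where
 "FW us = foldr wdg us wdg_one"

lemma FW_Cons: "FW (u # us) = wdg u (FW us)" by (simp add: FW_def)

lemma wdg_FW_mem:
 assumes "!!u. u : set us ==> vec1 f u" "v : set us" shows "wdg v (FW us) = 0"
 using assms
proof (induction us)
 case (Cons u us)
 have vu: "vec1 f v" "vec1 f u" using Cons.prems by auto
 show ?case
 proof (cases "v = u")
  case True
  thus ?thesis using wdg_assoc[of v v "FW us"] wdg_vec1_self[OF vu(1)] by (simp only: FW_Cons wdg_zero_left)
 next
  case False
  hence 0: "wdg v (FW us) = 0" using Cons by (simp del: zero_fun_apply)
  have "wdg v (FW (u # us)) = wdg (- wdg u v) (FW us)"
   unfolding FW_Cons wdg_assoc[symmetric] wdg_vec1_anticommute[OF vu] ..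
  also have "... = 0" by (simp only: wdg_uminus_left wdg_assoc 0 wdg_zero_right minus_zero)
  finally show ?thesis .
 qed
qed simp

lemma FW_not_distinct:
 assumes "!!u. u : set us ==> vec1 f u" "~ distinct us" shows "FW us = 0"
 using assms
proof (induction us)
 case (Cons u us)
 show ?case
 proof (cases "u : set us")
  case True
  have v: "vec1 f w" if "w : set us" for w using Cons.prems that by simp
  show ?thesis unfolding FW_Cons by (rule wdg_FW_mem[OF v True])
 next
  case False
  hence "FW us = 0" using Cons.IH Cons.prems by (metis distinct.simps(2) list.set_intros(2))
  thus ?thesis by (simp only: FW_Cons wdg_zero_right)
 qed
qed simp

context koszul_data
begin

definition slot :: "nat list => nat => 'r ext => 'r ext" where
 "slot ls l v = FW (map (%k. if k = l then v else psi k) ls)"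

lemma PL_FW: "PL ls = FW (map psi ls)" by (simp add: PL_def FW_def)

lemma slot_self: "slot ls l (psi l) = PL ls"
proof -
 have "map (%k. if k = l then psi l else psi k) ls = map psi ls" by simp
 thus ?thesis by (simp only: slot_def PL_FW)
qed

lemma slot_other:
 assumes "k ~= l" "k : set ls" "l : set ls" shows "slot ls l (psi k) = 0"
 unfolding slot_def
proof (rule FW_not_distinct)
 let ?us = "map (%m. if m = l then psi k else psi m) ls"
 show "u : set ?us ==> vec1 f u" for u using psi_vec1 by auto
 obtain i j where ij: "i < length ls" "ls ! i = k" "j < length ls" "ls ! j = l"
  using assms by (auto simp: in_set_conv_nth)
 hence "?us ! i = ?us ! j" "i ~= j" using assms(1) by auto
 thus "~ distinct ?us" using ij by (auto simp: distinct_conv_nth)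
qed

lemma slot_sum:
 "distinct ls ==> l : set ls ==> slot ls l (SUM p:A. scal (c p) (u p)) = (SUM p:A. scal (c p) (slot ls l (u p)))"
proof (induction ls)
 case (Cons k ls)
 show ?case
 proof (cases "k = l")
  case True
  hence e: "map (%k. if k = l then v else psi k) ls = map psi ls" for v
   using Cons.prems by (auto intro!: map_cong)
  have "slot (k # ls) l v = wdg v (FW (map psi ls))" for v
   using True unfolding slot_def list.map FW_Cons e by (simp only: if_True simp_thms)
  thus ?thesis by (simp only: wdg_sum_left wdg_scal_left)
 next
  case False
  hence "slot (k # ls) l v = wdg (psi k) (slot ls l v)" for v
   unfolding slot_def list.map FW_Cons by (simp only: if_False)
  moreover have "distinct ls" "l : set ls" using Cons.prems False by auto
  note Cons.IH[OF this]
  ultimately show ?thesis by (simp only: wdg_sum_right wdg_scal_right)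
 qed
qed simp

text \<open>The cofactors of the minor on the columns L, obtained by putting a basis vector in place
  of the l-th factor of \<open>Lam\<close>. As a linear form, \<open>phi L l\<close> takes Psi(X_l)
  to \<open>Lam L\<close> and the other Psi(X_k) to 0, which is Cramer's rule.\<close>

definition phi :: "nat set => nat => nat => 'r" where
 "phi L l p = slot [1..<Suc g] l (single p) L"

lemma phi_psi:
 assumes "l : {1..g}" "k : {1..g}"
 shows "(SUM p:{1..f}. phi L l p * psi k {p}) = (if k = l then Lam L else 0)"
proof -
 let ?ls = "[1..<Suc g]"
 have l: "l : set ?ls" "k : set ?ls" using assms by auto
 have "slot ?ls l (psi k) = slot ?ls l (SUM p:{1..f}. scal (psi k {p}) (single p))"
  by (simp only: vec1_expand[OF psi_vec1, symmetric])
 also have "... = (SUM p:{1..f}. scal (psi k {p}) (slot ?ls l (single p)))"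
  by (rule slot_sum) (use l in auto)
 finally have "slot ?ls l (psi k) L = (SUM p:{1..f}. psi k {p} * phi L l p)"
  by (simp only: sum_apply phi_def scal_apply)
 moreover have "slot ?ls l (psi k) = (if k = l then Lam else 0)"
  using slot_other[OF _ l(2,1)] slot_self by (auto simp: Lam_def)
 ultimately have "(SUM p:{1..f}. psi k {p} * phi L l p) = (if k = l then Lam else 0) L" by (simp only:)
 thus ?thesis by (auto simp: mult.commute)
qed

definition Bl :: "nat set => nat => 'r ext => 'r ext" where
 "Bl L l v = contr f (phi L l) v"

lemma Bl_psi_wdg:
 assumes "l : {1..g}" "k : {1..g}" "!!K. infinite K ==> v K = 0"
 shows "Bl L l (wdg (psi k) v) = (if k = l then scal (Lam L) v else 0) - wdg (psi k) (Bl L l v)"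
proof -
 have "Bl L l (wdg (psi k) v) = wdg (scal (if k = l then Lam L else 0) wdg_one) v + wdg (- psi k) (Bl L l v)"
  unfolding Bl_def contr_wdg contr_vec1[OF psi_vec1] phi_psi[OF assms(1,2)] alt_vec1[OF psi_vec1] ..
 also have "wdg (scal (if k = l then Lam L else 0) wdg_one) v = (if k = l then scal (Lam L) v else 0)"
  by (subst wdg_scal_one_left[OF assms(3)]) (auto simp: fun_eq_iff)
 finally show ?thesis by (simp only: wdg_uminus_left add_uminus_conv_diff)
qed

text \<open>On exponents this is the integral along X_l, not multiplication by X_l: no multiplicity
  of divided powers appears, so contraction by Y_l undoes it exactly.\<close>

definition hl :: "nat set => nat => 'r dext => 'r dext" where
 "hl L l W a = (if a l = 0 then 0 else Bl L l (W (a - uexp l)))"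

text \<open>The integral never reaches exponents with \<open>a l = 0\<close>. There only
  \<open>PsiH\<close> after \<open>hl\<close> acts, and this is the term by which the homotopy
  relation fails.\<close>

definition Pl :: "nat set => nat => 'r dext => 'r dext" where
 "Pl L l W a = (if a l = 0 then Bl L l (wdg (psi l) (W a)) else 0)"

lemma Bl_sum: "Bl L l (SUM i:A. u i) = (SUM i:A. Bl L l (u i))"
 by (simp only: Bl_def contr_sum)

lemma hl_homotopy:
 assumes l: "l : {1..g}" and W: "!!a K. infinite K ==> W a K = 0"
 shows "PsiH (hl L l W) + hl L l (PsiH W) = scal2 (Lam L) W - Pl L l W"
proof (rule ext)
 fix a
 have "PsiH (hl L l W) a + hl L l (PsiH W) a = scal (Lam L) (W a) - Pl L l W a"
 proof (cases "a l = 0")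
  case False
  have 1: "wdg (psi k) (hl L l W (a + uexp k)) = wdg (psi k) (Bl L l (W (a - uexp l + uexp k)))" for k
  proof -
   have "a + uexp k - uexp l = a - uexp l + uexp k" using False by (auto simp: fun_eq_iff uexp_apply)
   thus ?thesis using False by (simp add: hl_def)
  qed
  have "hl L l (PsiH W) a = (SUM k:{1..g}. Bl L l (wdg (psi k) (W (a - uexp l + uexp k))))"
   using False by (simp only: hl_def PsiH_def if_False Bl_sum)
  also have "... = (SUM k:{1..g}. (if k = l then scal (Lam L) (W (a - uexp l + uexp k)) else 0) - wdg (psi k) (Bl L l (W (a - uexp l + uexp k))))"
   by (intro sum.cong refl Bl_psi_wdg l W)
  also have "... = (SUM k:{1..g}. if k = l then scal (Lam L) (W (a - uexp l + uexp k)) else 0) - PsiH (hl L l W) a"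
   unfolding sum_subtractf PsiH_def 1 ..
  also have "(SUM k:{1..g}. if k = l then scal (Lam L) (W (a - uexp l + uexp k)) else 0) = scal (Lam L) (W (a - uexp l + uexp l))"
   by (subst sum.delta) (use l in auto)
  also have "a - uexp l + uexp l = a" using False by (auto simp: fun_eq_iff uexp_apply)
  finally show ?thesis using False by (simp only: Pl_def if_False diff_zero add_diff_eq add_diff_cancel_left')
 next
  case True
  \<comment> \<open>From exponent 0 at l only k = l leads to a positive exponent, so a single
    summand survives.\<close>
  have "PsiH (hl L l W) a = (SUM k:{1..g}. if k = l then wdg (psi l) (Bl L l (W a)) else 0)"
   unfolding PsiH_def
  proof (rule sum.cong)
   fix k
   have "a + uexp l - uexp l = a" by (auto simp: fun_eq_iff)
   thus "wdg (psi k) (hl L l W (a + uexp k)) = (if k = l then wdg (psi l) (Bl L l (W a)) else 0)"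
    using True by (auto simp: hl_def uexp_apply)
  qed simp
  also have "... = wdg (psi l) (Bl L l (W a))" by (subst sum.delta) (use l in auto)
  also have "... = scal (Lam L) (W a) - Bl L l (wdg (psi l) (W a))"
   using Bl_psi_wdg[where L = L and v = "W a", OF l l W] by (simp only: if_True simp_thms diff_add_cancel add_diff_cancel diff_diff_eq2 add_diff_cancel_left')
  finally show ?thesis using True by (simp add: hl_def Pl_def)
 qed
 thus "(PsiH (hl L l W) + hl L l (PsiH W)) a = (scal2 (Lam L) W - Pl L l W) a"
  by (simp only: plus_fun_apply minus_apply scal2_def)
qed

lemma inJ_Bl: "is_idl J ==> inJ J v ==> inJ J (Bl L l v)"
 unfolding Bl_def by (rule inJ_contr)

lemma inJ2_hl: "is_idl J ==> inJ2 J W ==> inJ2 J (hl L l W)"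
 unfolding inJ2_def hl_def by (auto intro: inJ_Bl inJ_zero)

lemma inJ2_Pl: "is_idl J ==> inJ2 J W ==> inJ2 J (Pl L l W)"
 unfolding inJ2_def Pl_def by (auto intro: inJ_Bl inJ_zero inJ_wdg)

lemma tau_Bl: "contr f t (Bl L l v) = - Bl L l (contr f t v)"
 unfolding Bl_def by (rule contr_anticommute)

lemma tauH_hl: "tauH (hl L l W) = - hl L l (tauH W)"
 by (rule ext, rule ext) (simp add: tauH_def hl_def tau_Bl)

lemma Bl_uminus: "Bl L l (- v) = - Bl L l v" unfolding Bl_def by (rule contr_uminus)

lemma tauH_Pl: "tauH (Pl L l W) = Pl L l (tauH W)"
proof
 fix a
 have "contr f t (Bl L l (wdg (psi l) (W a))) = Bl L l (wdg (psi l) (contr f t (W a)))"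
  by (simp only: tau_Bl contr_psi_wdg Bl_uminus minus_minus)
 thus "tauH (Pl L l W) a = Pl L l (tauH W) a"
  by (simp only: tauH_def Pl_def contr_zero split: if_splits) simp
qed

lemma Bl_PL:
 "l : {1..g} ==> l ~: set ls ==> set ls <= {1..g} ==> Bl L l (PL ls) = 0"
proof (induction ls)
 case Nil show ?case by (simp add: PL_def Bl_def)
next
 case (Cons k ls)
 have "Bl L l (PL ls) = 0" using Cons by (simp del: zero_fun_apply)
 moreover have "infinite K ==> PL ls K = 0" for K using homog_infinite[OF homog_PL] .
 ultimately have "Bl L l (wdg (psi k) (PL ls)) = 0 - wdg (psi k) 0"
  using Cons.prems by (subst Bl_psi_wdg) auto
 thus ?case by (simp only: PL_Cons wdg_zero_right diff_zero)
qed

text \<open>The contraction \<open>Bl L l\<close> kills Psi(X_k) for k > l, so it can be pulled out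
  of the whole product. What remains inside is, up to sign, the product of v with Psi(X_l), ...,
  Psi(X_g), assumed to lie in J.\<close>

lemma inJ_Pl_Lam:
 assumes J: "is_idl J" and l: "l : {1..g}" and y: "inJ J (wdg v (PL [l..<Suc g]))"
 shows "inJ J (wdg (Bl L l (wdg (psi l) v)) (PL [Suc l..<Suc g]))"
proof -
 let ?P = "PL [Suc l..<Suc g]" and ?Q = "PL [l..<Suc g]"
 have e: "[l..<Suc g] = l # [Suc l..<Suc g]" using l by (simp add: upt_conv_Cons del: upt_Suc)
 have z: "contr f (phi L l) ?P = 0" unfolding Bl_def[symmetric]
  by (rule Bl_PL[OF l]) (use l in auto)
 have "wdg (Bl L l (wdg (psi l) v)) ?P = Bl L l (wdg (wdg (psi l) v) ?P)"
  unfolding Bl_def contr_wdg[of f _ _ ?P] z wdg_zero_right add_0_right ..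
 also have "wdg (wdg (psi l) v) ?P = wdg (alt v) ?Q"
  unfolding e PL_Cons wdg_vec1_commute[OF psi_vec1, of l v] wdg_assoc ..
 also have "... = scal ((-1) ^ length [l..<Suc g]) (alt (wdg v ?Q))"
 proof -
  have "alt (wdg v ?Q) = scal ((-1) ^ length [l..<Suc g]) (wdg (alt v) ?Q)"
   unfolding alt_wdg alt_homog[OF homog_PL] wdg_scal_right ..
  moreover have "scal c (scal c u) = scal (c * c) u" for c :: 'r and u :: "'r ext"
   by (auto simp: fun_eq_iff mult.assoc)
  moreover have "scal 1 u = u" for u :: "'r ext" by (auto simp: fun_eq_iff)
  moreover have "(-1 :: 'r) ^ n * (-1) ^ n = 1" for n by (simp flip: power_mult_distrib)
  ultimately show ?thesis by (simp only:)
 qed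
 finally show ?thesis by (simp only: inJ_Bl[OF J inJ_scal[OF J inJ_alt[OF J y]]])
qed

end

context complex_data
begin

lemma supp_contr:
 assumes "contr f s v K ~= 0" obtains p where "p : {1..f}" "p ~: K" "v (insert p K) ~= 0"
proof -
 from assms obtain p where p: "p : {1..f}" "s p * ann1 p v K ~= 0"
  unfolding contr_def by (rule sum.not_neutral_contains_not_neutral)
 thus thesis by (intro that[of p]) (auto simp: ann1_def split: if_splits)
qed

lemma supp_hl:
 assumes l: "l : {1..g}" and W: "supp Q W"
 shows "supp (%i j. j >= 1 & Q (Suc i) (j - 1)) (hl L l W)"
 unfolding supp_def
proof (intro allI impI)
 fix a K assume nz: "hl L l W a K ~= 0"
 hence al: "a l ~= 0" and "contr f (phi L l) (W (a - uexp l)) K ~= 0" by (auto simp: hl_def Bl_def split: if_splits)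
 then obtain p where p: "p : {1..f}" "p ~: K" "W (a - uexp l) (insert p K) ~= 0" by (elim supp_contr)
 have s: "ok (insert p K) (a - uexp l)" "Q (card (insert p K)) (expdeg g (a - uexp l))"
  using suppD[OF W, OF p(3)] by blast+
 have e: "a - uexp l + uexp l = a" using al by (auto simp: fun_eq_iff uexp_apply)
 have "ok K (a - uexp l + uexp l)" by (rule ok_uexp[OF ok_subset[OF s(1)] l]) auto
 hence ok: "ok K a" unfolding e .
 have "expdeg g a = Suc (expdeg g (a - uexp l))"
  using expdeg_add[of "a - uexp l" "uexp l" g] expdeg_uexp[OF l] e by simp
 moreover have "card (insert p K) = Suc (card K)" using p ok_finite[OF ok] by simp
 ultimately show "ok K a & expdeg g a >= 1 & Q (Suc (card K)) (expdeg g a - 1)" using ok s by simp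
qed

lemma supp_Pl:
 assumes l: "l : {1..g}" and W: "supp Q W"
 shows "supp Q (Pl L l W)" "Pl L l W a K ~= 0 ==> a l = 0 & W a ~= 0"
proof -
 have *: "a l = 0 & W a ~= 0 & ok K a & Q (card K) (expdeg g a)" if nz: "Pl L l W a K ~= 0" for a K
 proof -
  have al: "a l = 0" and c: "contr f (phi L l) (wdg (psi l) (W a)) K ~= 0"
   using nz by (auto simp: Pl_def Bl_def split: if_splits)
  from c obtain p where p: "p : {1..f}" "p ~: K" "wdg (psi l) (W a) (insert p K) ~= 0" by (elim supp_contr)
  from p(3) obtain M where M: "M <= insert p K" "finite (insert p K)" "psi l M ~= 0" "W a (insert p K - M) ~= 0"
   by (elim wdg_nonzero)
  obtain q where q: "q : {1..f}" "M = {q}" using M(3) psi_vec1[of l] by (auto simp: vec1_def)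
  have s: "ok (insert p K - M) a" "Q (card (insert p K - M)) (expdeg g a)" using suppD[OF W, OF M(4)] by blast+
  have "K <= {1..f}" using s(1) p q by (auto simp: ok_def)
  hence "ok K a" using s(1) by (auto simp: ok_def)
  moreover have "card (insert p K - M) = card K" using M q p by (auto simp: card_Diff_singleton)
  moreover have "W a ~= 0" using M(4) by (auto simp: fun_eq_iff)
  ultimately show ?thesis using s al by simp
 qed
 thus "supp Q (Pl L l W)" by (simp add: supp_def)
 show "Pl L l W a K ~= 0 ==> a l = 0 & W a ~= 0" using * by blast
qed

text \<open>Each round applies \<open>hl_homotopy\<close> to one more variable at the price of a
  factor \<open>Lam L\<close>, and confines the remainder y to exponents that are 0 at that
  variable. Cycle condition, compatibility with tau and the product with the remaining Psi(X_k) are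
  carried along to keep the induction going.\<close>

lemma eagon_northcott_step:
 assumes J: "is_idl J" and W: "supp (%i j. i = i0 & j = j0) W" and cyc: "inJ2 J (PsiH W)"
  and n: "n <= g"
 shows "EX w y. inJ2 J (scal2 (Lam L ^ n) W - PsiH w - y) & supp (%i j. Suc i = i0 & j = Suc j0) w &
   supp (%i j. i = i0 & j = j0) y & (ALL a K. y a K ~= 0 --> (ALL l:{1..n}. a l = 0)) & inJ2 J (PsiH y) &
   (inJ2 J (tauH W) --> inJ2 J (tauH w) & inJ2 J (tauH y)) &
   (inJ J (wdg (W 0) Lam) --> inJ J (wdg (y 0) (PL [Suc n..<Suc g])))"
 using n
proof (induction n)
 case 0
 have "scal2 (Lam L ^ 0) W - PsiH 0 - W = 0" by (rule ext, rule ext) (simp add: scal2_apply)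
 hence "inJ2 J (scal2 (Lam L ^ 0) W - PsiH 0 - W)" by (simp only: inJ2_zero[OF J])
 moreover have "PL [Suc 0..<Suc g] = Lam" by (simp add: Lam_def)
 moreover have "inJ2 J (tauH 0)" by (simp only: tauH_zero inJ2_zero[OF J])
 ultimately show ?case using W cyc supp_zero
  by (intro exI[of _ 0] exI[of _ W] conjI impI allI) (simp_all only:, simp)
next
 case (Suc n)
 define l where "l = Suc n"
 have l: "l : {1..g}" using Suc.prems by (auto simp: l_def)
 obtain w y where IH: "inJ2 J (scal2 (Lam L ^ n) W - PsiH w - y)" "supp (%i j. Suc i = i0 & j = Suc j0) w"
   "supp (%i j. i = i0 & j = j0) y" "!!a K. y a K ~= 0 ==> (ALL l:{1..n}. a l = 0)" "inJ2 J (PsiH y)"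
   "inJ2 J (tauH W) ==> inJ2 J (tauH w) & inJ2 J (tauH y)"
   "inJ J (wdg (W 0) Lam) ==> inJ J (wdg (y 0) (PL [Suc n..<Suc g]))"
  using Suc.IH[OF Suc_leD[OF Suc.prems]] by blast
 have fin: "infinite K ==> y a K = 0" for a K using supp_finite[OF IH(3)] .
 note hom = hl_homotopy[where L = L, OF l fin]
 let ?w = "scal2 (Lam L) w + hl L l y" and ?y = "Pl L l y"
 have e1: "scal2 (Lam L ^ Suc n) W - PsiH ?w - ?y = scal2 (Lam L) (scal2 (Lam L ^ n) W - PsiH w - y) + hl L l (PsiH y)"
 proof (rule ext, rule ext)
  fix a K
  have "(PsiH (hl L l y) + hl L l (PsiH y)) a K = (scal2 (Lam L) y - Pl L l y) a K" using hom by simp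
  hence h: "hl L l (PsiH y) a K = Lam L * y a K - Pl L l y a K - PsiH (hl L l y) a K"
   by (simp add: scal2_apply algebra_simps)
  show "(scal2 (Lam L ^ Suc n) W - PsiH ?w - ?y) a K = (scal2 (Lam L) (scal2 (Lam L ^ n) W - PsiH w - y) + hl L l (PsiH y)) a K"
   unfolding minus_apply plus_fun_apply PsiH_add PsiH_scal h
   by (simp add: scal2_apply algebra_simps)
 qed
 have A: "inJ2 J (scal2 (Lam L ^ Suc n) W - PsiH ?w - ?y)"
  unfolding e1 by (intro inJ2_add[OF J] inJ2_scal[OF J] inJ2_hl[OF J] IH)
 have B: "supp (%i j. Suc i = i0 & j = Suc j0) ?w"
  by (intro supp_add supp_scal2 IH supp_mono[OF supp_hl[OF l IH(3)]]) auto
 have C: "supp (%i j. i = i0 & j = j0) ?y" by (rule supp_Pl[OF l IH(3)])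
 have D: "ALL l:{1..Suc n}. a l = 0" if nz: "?y a K ~= 0" for a K
 proof -
  have "a l = 0" "y a ~= 0" using supp_Pl(2)[OF l IH(3) nz] by blast+
  then obtain K' where "y a K' ~= 0" by (auto simp: fun_eq_iff)
  hence "ALL l:{1..n}. a l = 0" by (rule IH(4))
  thus ?thesis using \<open>a l = 0\<close> by (auto simp: l_def le_Suc_eq)
 qed
 have E: "inJ2 J (PsiH ?y)"
 proof -
  have "?y = scal2 (Lam L) y - PsiH (hl L l y) - hl L l (PsiH y)"
   using hom by (simp add: algebra_simps)
  hence "PsiH ?y = scal2 (Lam L) (PsiH y) - 0 - PsiH (hl L l (PsiH y))"
   by (simp only: PsiH_diff PsiH_scal PsiH_PsiH)
  thus ?thesis
   by (simp only:) (intro inJ2_diff[OF J] inJ2_scal[OF J] inJ2_zero[OF J] inJ2_PsiH[OF J] inJ2_hl[OF J] IH)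
 qed
 have F: "inJ2 J (tauH ?w) & inJ2 J (tauH ?y)" if "inJ2 J (tauH W)"
  using IH(6)[OF that] unfolding tauH_add tauH_scal tauH_hl tauH_Pl
  by (intro conjI inJ2_add[OF J] inJ2_scal[OF J] inJ2_uminus[OF J] inJ2_hl[OF J] inJ2_Pl[OF J]) blast+
 have G: "inJ J (wdg (?y 0) (PL [Suc (Suc n)..<Suc g]))" if "inJ J (wdg (W 0) Lam)"
 proof -
  have "?y 0 = Bl L l (wdg (psi l) (y 0))" by (simp add: Pl_def)
  thus ?thesis using inJ_Pl_Lam[OF J l, of "y 0" L] IH(7)[OF that] unfolding l_def by simp
 qed
 show ?case
  using A B C D E F G by (intro exI[of _ ?w] exI[of _ ?y]) blast
qed

text \<open>After g rounds the remainder lives at exponent 0 alone, so it vanishes unless j0 = 0. In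
  that case \<open>ex\<close> disposes of it: the strand ends with the product with
  \<open>Lam\<close>.\<close>

lemma eagon_northcott:
 assumes J: "is_idl J" and W: "supp (%i j. i = i0 & j = j0) W" and cyc: "inJ2 J (PsiH W)"
  and ex: "j0 = 0 ==> inJ J (wdg (W 0) Lam)"
 obtains w where "inJ2 J (scal2 (Lam L ^ g) W - PsiH w)" "supp (%i j. Suc i = i0 & j = Suc j0) w"
   "inJ2 J (tauH W) ==> inJ2 J (tauH w)"
proof -
 obtain w y where S: "inJ2 J (scal2 (Lam L ^ g) W - PsiH w - y)" "supp (%i j. Suc i = i0 & j = Suc j0) w"
   "supp (%i j. i = i0 & j = j0) y" "!!a K. y a K ~= 0 ==> (ALL l:{1..g}. a l = 0)"
   "inJ2 J (tauH W) ==> inJ2 J (tauH w)"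
   "inJ J (wdg (W 0) Lam) ==> inJ J (wdg (y 0) (PL [Suc g..<Suc g]))"
  using eagon_northcott_step[OF J W cyc order.refl, of L] by blast
 have "y a K : J" for a K
 proof (cases "y a K = 0")
  case False
  have s: "ok K a" "expdeg g a = j0" using suppD[OF S(3), OF False] by blast+
  have "a = 0" using S(4)[OF False] s(1) by (auto simp: fun_eq_iff ok_def)
  hence "j0 = 0" using s(2) by simp
  hence "inJ J (wdg (y 0) (PL []))" using S(6) ex by simp
  moreover have "wdg (y 0) (PL []) = y 0"
   unfolding PL_def by (simp add: wdg_one_right supp_finite[OF S(3)])
  ultimately show ?thesis using \<open>a = 0\<close> by (simp add: inJ_def)
 qed (simp add: is_idlD(1)[OF J])
 hence "inJ2 J y" by (rule inJ2I)
 hence "inJ2 J (scal2 (Lam L ^ g) W - PsiH w - y + y)" by (rule inJ2_add[OF J S(1)])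
 hence "inJ2 J (scal2 (Lam L ^ g) W - PsiH w)" by simp
 thus thesis using that S by blast
qed

end

section \<open>The homotopy given by a basis vector, and its defect\<close>

context koszul_data
begin

definition hh :: "nat => 'r dext => 'r dext" where
 "hh q W a = wdg (single q) (W a)"

lemma hh_add: "hh q (V + W) = hh q V + hh q W"
 by (rule ext) (simp only: hh_def plus_fun_apply wdg_add_right)

lemma hh_zero [simp]: "hh q 0 = 0"
 by (rule ext) (simp add: hh_def)

lemma hh_sum: "hh q (SUM i:A. W i) = (SUM i:A. hh q (W i))"
 by (rule additive_sum[where h = "hh q", OF hh_zero hh_add])

lemma inJ2_hh: "is_idl J ==> inJ2 J W ==> inJ2 J (hh q W)"
 by (auto simp: inJ2_def hh_def intro: inJ_wdg)

lemma tauH_hh: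
 assumes q: "q : {1..f}" and W: "!!a K. infinite K ==> W a K = 0"
 shows "tauH (hh q W) a K + hh q (tauH W) a K = t q * W a K"
proof -
 have v: "vec1 f (single q :: 'r ext)" by (rule single_vec1[OF q])
 have s: "(SUM p:{1..f}. t p * single q {p}) = t q"
  using q by (simp add: single_def sum.delta if_distrib cong: if_cong)
 have o: "wdg (scal (t q) wdg_one) (W a) = scal (t q) (W a)" by (rule wdg_scal_one_left) (rule W)
 have "tauH (hh q W) a = scal (t q) (W a) + wdg (- single q) (contr f t (W a))"
  unfolding tauH_def hh_def contr_wdg contr_vec1[OF v] s o alt_vec1[OF v] ..
 thus ?thesis by (simp add: wdg_uminus_left hh_def tauH_def)
qed

lemma PsiH_hh: assumes "q : {1..f}" shows "PsiH (hh q W) = - hh q (PsiH W)"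
proof
 fix a
 have "wdg (psi l) (wdg (single q) v) = - wdg (single q) (wdg (psi l) v)" for l v
  unfolding wdg_assoc[symmetric] wdg_vec1_anticommute[OF psi_vec1 single_vec1[OF assms]] wdg_uminus_left ..
 thus "PsiH (hh q W) a = (- hh q (PsiH W)) a"
  by (simp only: PsiH_def hh_def wdg_sum_right sum_negf uminus_apply)
qed

lemma muH_hh: "muH n (hh q W) = hh q (muH n W)"
 by (rule ext) (simp only: muH_def hh_def wdg_sum_right Dm_left_commute)

lemma hh_empty: "hh q W a {} = 0"
 by (simp add: hh_def wdg_def single_def)

end

context complex_data
begin

lemma eps_less: "eps <= de" "de >= 1" "de <= 2 * eps + 1" "2 * eps <= de + 1"
 using g_less eps_ge eps_le by auto

lemma hh_tr:
 assumes "ok K a" "q : {1..f}"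
 shows "hh q (tr c W) a K = c (card K - 1) (expdeg g a) * hh q W a K"
proof -
 have "wdg (single q) (tr c W a) K = wdg (single q) (%L. c (card L) (expdeg g a) * W a L) K"
  by (rule wdg_cong_subsets) (simp add: tr_def ok_subset[OF assms(1)])
 also have "... = c (card K - 1) (expdeg g a) * wdg (single q) (W a) K"
  by (rule wdg_weighted[OF vec1_homog[OF single_vec1[OF assms(2)]] ok_finite[OF assms(1)], where c = "%i. c i (expdeg g a)"])
 finally show ?thesis by (simp add: hh_def)
qed

lemma supp_hh:
 assumes q: "q : {1..f}" and W: "supp Q W"
 shows "supp (%i j. i >= 1 & Q (i - 1) j) (hh q W)"
 unfolding supp_def
proof (intro allI impI)
 fix a K assume nz: "hh q W a K ~= 0"
 then obtain L where L: "L <= K" "finite K" "single q L ~= (0::'r)" "W a (K - L) ~= 0"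
  unfolding hh_def by (elim wdg_nonzero)
 have Lq: "L = {q}" using L(3) by (auto simp: single_def split: if_splits)
 have s: "ok (K - L) a" using suppD[OF W, OF L(4)] by blast
 hence ok: "ok K a" using q Lq by (auto simp: ok_def)
 have "K ~= {}" using L(1) Lq by auto
 hence "card K >= 1" using L(2) by (simp add: Suc_leI card_gt_0_iff)
 moreover have "hh q W a K = of_bool (Q (card K - 1) (expdeg g a)) * hh q W a K"
  using hh_tr[OF ok q, of "%i j. of_bool (Q i j)" W] supp_tr_id[OF W, of "%i j. of_bool (Q i j)"] by simp
 ultimately show "ok K a & card K >= 1 & Q (card K - 1) (expdeg g a)"
  using ok of_boolD nz by blast
qed

definition hM :: "nat => (M_basis_elt => 'r) => M_basis_elt => 'r" where
 "hM q w = mk (tr iT (hh q (Tc w))) (tr iB (hh q (Bc w))) 0"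

lemma inM_hM:
 assumes q: "q : {1..f}" and w: "inM k w" shows "inM (Suc k) (hM q w)"
 unfolding hM_def
proof (rule inM_mkI)
 show "supp (%i j. chT i j & Suc k + de = i + 2 * j + 2) (tr iT (hh q (Tc w)))"
  by (rule supp_mono[OF supp_conj_tr(1)[OF supp_hh[OF q inM_suppT[OF w]]]]) auto
 show "supp (%i j. chB i j & Suc k + de = i + 2 * j + 1) (tr iB (hh q (Bc w)))"
  by (rule supp_mono[OF supp_conj_tr(1)[OF supp_hh[OF q inM_suppB[OF w]]]]) auto
qed simp

lemma inJ_hM: "is_idl J ==> inJ J w ==> inJ J (hM q w)"
 unfolding hM_def by (intro inJ_mk inJ2_tr inJ2_hh inJ_Tc inJ_Bc is_idlD(1))

lemma inM_add: "inM k v ==> inM k w ==> inM k (v + w)"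
 unfolding inM_def by (metis add_0 plus_fun_apply)

lemma inM_diff: "inM k v ==> inM k w ==> inM k (v - w)"
 unfolding inM_def by (metis diff_self minus_apply)

lemma inM_scal: "inM k v ==> inM k (scal c v)"
 unfolding inM_def by (metis mult_zero_right scal_apply)

lemma D_diff: "D k (v - w) = D k v - D k w"
proof -
 have "D k (v - w + w) = D k (v - w) + D k w" by (rule D_add)
 thus ?thesis by (simp add: algebra_simps)
qed

text \<open>The defect of the homotopy relation. \<open>dd\<close> is used in all positions,
  although in position 1 the differential is \<open>d1\<close>; \<open>dd_degree_0\<close>
  reconciles the two.\<close>

definition Vz :: "nat => (M_basis_elt => 'r) => M_basis_elt => 'r" where
 "Vz q z = scal (t q) z - dd (hM q z) - hM q (dd z)"

lemma inM_Vz: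
 assumes q: "q : {1..f}" and z: "inM (Suc k) z" shows "inM (Suc k) (Vz q z)"
 unfolding Vz_def
 by (intro inM_diff inM_scal z inM_dd inM_hM q)

text \<open>If the summand with one more exterior degree also belongs to V^T, all composites survive
  truncation and \<open>tauH_hh\<close> gives 0. So the defect sits on the edge I + J + 1 = f - g,
  and the position then determines J.\<close>

lemma Vz_T:
 assumes q: "q : {1..f}" and z: "inM (Suc k) z" and nz: "Tc (Vz q z) a K ~= 0"
 shows "ok K a & card K + expdeg g a + 1 = de & eps <= expdeg g a & expdeg g a = k"
proof -
 let ?T = "Tc z" and ?i = "card K" and ?j = "expdeg g a"
 have in_pos: "ok K a" "chT ?i ?j" "Suc k + de = ?i + 2 * ?j + 2"
  using inM_T[OF inM_Vz[OF q z] nz] by auto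
 note ok = in_pos(1)
 have fin: "infinite K ==> ?T a K = 0" for a K using supp_finite[OF inM_suppT[OF z]] .
 have "Tc (Vz q z) a K = 0" if c: "chT (Suc ?i) ?j"
 proof -
  have "Tc (Vz q z) a K = t q * ?T a K - ddT (hM q z) a K - tr iT (hh q (ddT z)) a K"
   by (simp add: Vz_def Tc_def dd_def hM_def mk_def)
  also have "ddT (hM q z) a K = iT (?i - 1) (Suc ?j) * PsiH (hh q ?T) a K + tauH (hh q ?T) a K"
   using ok in_pos(2) c by (simp add: ddT_def tr_def[of iT "_ + _"] hM_def PsiH_tr[OF ok] tauH_tr[OF ok])
  also have "tr iT (hh q (ddT z)) a K = iT (?i - 1) ?j * (hh q (PsiH ?T) a K + hh q (tauH ?T) a K)"
   using ok in_pos(2) by (simp add: ddT_def tr_def[of iT "hh _ _"] hh_tr[OF ok q] hh_add)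
  also have "PsiH (hh q ?T) a K = - hh q (PsiH ?T) a K" by (simp add: PsiH_hh[OF q])
  also have "t q * ?T a K = tauH (hh q ?T) a K + hh q (tauH ?T) a K" by (rule tauH_hh[OF q fin, symmetric])
  finally have e: "Tc (Vz q z) a K = (iT (?i - 1) (Suc ?j) - iT (?i - 1) ?j) * hh q (PsiH ?T) a K
    + (1 - iT (?i - 1) ?j) * hh q (tauH ?T) a K" by (simp add: algebra_simps)
  show ?thesis
  proof (cases "K = {}")
   case True
   thus ?thesis unfolding e by (simp add: hh_empty)
  next
   case False
   hence "?i >= 1" using ok_finite[OF ok] by (simp add: Suc_leI card_gt_0_iff)
   hence "chT (?i - 1) (Suc ?j)" "chT (?i - 1) ?j" using c by (auto simp: chT_def)
   thus ?thesis unfolding e by simp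
  qed
 qed
 hence "~ chT (Suc ?i) ?j" using nz by blast
 with in_pos(2) have "?i + ?j + 1 = de" "eps <= ?j" unfolding chT_def by linarith+
 moreover from this in_pos(3) have "?j = k" by linarith
 ultimately show ?thesis using ok by blast
qed

text \<open>\<open>noT\<close> ensures that \<open>hM\<close> cuts nothing off the V^T part;
  otherwise mu_n of the lost piece would show up in V^B. The defect then sits on the edge i + j = f
  - g.\<close>

lemma Vz_B:
 assumes q: "q : {1..f}" and z: "inM (Suc k) z" and nz: "Bc (Vz q z) a K ~= 0"
  and noT: "!!a K. Tc z a K ~= 0 ==> card K + expdeg g a + 1 < de"
 shows "ok K a & card K + expdeg g a = de & expdeg g a < eps & expdeg g a = k"
proof -
 let ?T = "Tc z" and ?B = "Bc z" and ?i = "card K" and ?j = "expdeg g a"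
 have in_pos: "ok K a" "chB ?i ?j" "Suc k + de = ?i + 2 * ?j + 1"
  using inM_B[OF inM_Vz[OF q z] nz] by auto
 note ok = in_pos(1)
 have fin: "infinite K ==> ?B a K = 0" for a K using supp_finite[OF inM_suppB[OF z]] .
 have "Bc (Vz q z) a K = 0" if c: "?i >= 1" "chB (?i - 1) ?j"
 proof -
  have sT: "supp (%i j. chT (Suc i) j) ?T"
   unfolding supp_def using inM_T[OF z] noT by (fastforce simp: chT_def)
  have trT: "tr iT (hh q ?T) = hh q ?T"
   by (rule supp_tr_id[OF supp_hh[OF q sT]]) auto
  \<comment> \<open>\<open>hh q\<close> commutes with mu_n, and the sign in \<open>cf\<close> flips
    with the exterior degree, so the mu terms of the two composites cancel.\<close>
  have cf: "cf n (?i - 1) ?j = - cf n ?i ?j" for n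
   using c(1) by (cases ?i) (auto simp: cf_def)
  have "Bc (Vz q z) a K = t q * ?B a K - ddB (hM q z) a K - tr iB (hh q (ddB z)) a K"
   by (simp add: Vz_def Bc_def dd_def hM_def mk_def)
  also have "ddB (hM q z) a K = iB (?i - 1) (Suc ?j) * PsiH (hh q ?B) a K + iB (Suc ?i) ?j * tauH (hh q ?B) a K +
    (SUM n:{1..f}. cf n ?i ?j * hh q (muH n ?T) a K)"
   using ok in_pos(2) by (simp add: ddB_def tr_def[of iB "_ + _"] tr_def[of "%i j. iB i j * _ i j"] hM_def PsiH_tr[OF ok] tauH_tr[OF ok] sum_apply2 trT muH_hh)
  also have "tr iB (hh q (ddB z)) a K = iB (?i - 1) ?j * (hh q (PsiH ?B) a K + hh q (tauH ?B) a K) +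
    (SUM n:{1..f}. iB (?i - 1) ?j * cf n (?i - 1) ?j * hh q (muH n ?T) a K)"
  proof -
   have "tr iB (hh q (ddB z)) a K = hh q (ddB z) a K" using ok in_pos(2) by (simp add: tr_def)
   thus ?thesis by (simp add: ddB_def hh_tr[OF ok q] hh_add hh_sum sum_apply2)
  qed
  also have "PsiH (hh q ?B) a K = - hh q (PsiH ?B) a K" by (simp add: PsiH_hh[OF q])
  also have "t q * ?B a K = tauH (hh q ?B) a K + hh q (tauH ?B) a K" by (rule tauH_hh[OF q fin, symmetric])
  also have "iB (?i - 1) ?j = 1" using c by simp
  also have "iB (Suc ?i) ?j = 1" using c by (auto simp: chB_def)
  finally have e: "Bc (Vz q z) a K = (iB (?i - 1) (Suc ?j) - 1) * hh q (PsiH ?B) a K"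
   by (cases "chB (?i - 1) (Suc ?j)") (simp_all add: cf[unfolded One_nat_def] algebra_simps sum_negf eq_neg_iff_add_eq_0)
  show ?thesis
  proof (cases "hh q (PsiH ?B) a K = 0")
   case False
   have "chB (?i - 1 - 1) (Suc ?j)" using suppD[OF supp_hh[OF q supp_PsiH[OF inM_suppB[OF z]]], OF False] by auto
   hence "chB (?i - 1) (Suc ?j)" using c by (auto simp: chB_def)
   thus ?thesis unfolding e by simp
  qed (simp add: e)
 qed
 moreover have i: "?i >= 1" using in_pos(2) eps_less by (auto simp: chB_def)
 ultimately have "~ chB (?i - 1) ?j" using nz by blast
 with in_pos(2) i have "?i + ?j = de" "?j < eps" unfolding chB_def by linarith+
 moreover from this in_pos(3) have "?j = k" by linarith
 ultimately show ?thesis using ok by blast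
qed

lemma Vz_Top: "k >= 1 ==> inM k z ==> Vz q z Top = 0"
proof -
 assume k: "k >= 1" and z: "inM k z"
 have "z Top = 0" using z[unfolded inM_def, rule_format, of Top] k by (auto simp: Mbasis_def)
 thus ?thesis by (simp add: Vz_def dd_def hM_def)
qed

definition bd :: "'r set => nat => (M_basis_elt => 'r) => bool" where
 "bd J k u <-> (EX v. inM (Suc k) v & inJ J (u - D (Suc k) v))"

lemma bdI: "inM (Suc k) v ==> inJ J (u - D (Suc k) v) ==> bd J k u"
 by (auto simp: bd_def)

lemma bd_add:
 assumes J: "is_idl J" and "bd J k u" "bd J k u'" shows "bd J k (u + u')"
proof -
 obtain v v' where v: "inM (Suc k) v" "inJ J (u - D (Suc k) v)" "inM (Suc k) v'" "inJ J (u' - D (Suc k) v')"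
  using assms by (auto simp: bd_def)
 have "u + u' - D (Suc k) (v + v') = (u - D (Suc k) v) + (u' - D (Suc k) v')"
  unfolding D_add by (simp add: algebra_simps)
 thus ?thesis using v inJ_add[OF J] inM_add by (intro bdI[of k "v + v'"]) (auto simp only:)
qed

lemma bd_scal:
 assumes J: "is_idl J" and "bd J k u" shows "bd J k (scal c u)"
proof -
 obtain v where v: "inM (Suc k) v" "inJ J (u - D (Suc k) v)" using assms by (auto simp: bd_def)
 have "scal c u - D (Suc k) (scal c v) = scal c (u - D (Suc k) v)"
  unfolding D_scal scal_diff ..
 thus ?thesis using v inJ_scal[OF J] inM_scal by (intro bdI[of k "scal c v"]) (auto simp only:)
qed

lemma bd_inJ: "is_idl J ==> inJ J u ==> bd J k u"
proof (rule bdI[of k 0])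
 assume "is_idl J" "inJ J u"
 moreover have "D (Suc k) 0 = 0"
  using D_scal[of "Suc k" 0 0] by (metis (no_types, lifting) ext mult_zero_left scal_apply zero_fun_apply)
 ultimately show "inJ J (u - D (Suc k) 0)" by (simp only: diff_zero)
qed (rule inM_zero)

lemma bd_D: "is_idl J ==> inM (Suc k) v ==> bd J k (D (Suc k) v)"
 by (rule bdI) (auto simp only: diff_self inJ_zero)

lemma bd_cong:
 assumes "is_idl J" "inJ J (u - u')" "bd J k u'" shows "bd J k u"
 using bd_add[OF assms(1) bd_inJ[OF assms(1,2)] assms(3)] by simp

text \<open>Position 0 consists of \<open>Top\<close> alone, and \<open>dd\<close> has no component
  there.\<close>

lemma dd_degree_0:
 assumes "inM 1 z" shows "hM q (dd z) = 0"
proof -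
 have w: "inM 0 (dd z)" using inM_dd assms by simp
 have "Tc (dd z) a K = 0" for a K
  using inM_T[OF w, of a K] eps_less by (cases "Tc (dd z) a K = 0") (auto simp: chT_def)
 hence 1: "Tc (dd z) = 0" by (auto simp: fun_eq_iff)
 have "Bc (dd z) a K = 0" for a K
  using inM_B[OF w, of a K] eps_less by (cases "Bc (dd z) a K = 0") (auto simp: chB_def)
 hence 2: "Bc (dd z) = 0" by (auto simp: fun_eq_iff)
 show ?thesis unfolding hM_def 1 2 by (simp only: hh_zero tr_zero mk_zero)
qed

lemma Vz_cycle:
 assumes J: "is_idl J" and q: "q : {1..f}" and z: "inM (Suc k) z" and cyc: "inJ J (D (Suc k) z)"
 shows "inJ J (D (Suc k) (Vz q z))" "inJ J (scal (t q) z - (Vz q z + D (Suc (Suc k)) (hM q z)))"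
proof -
 have h: "inJ J (hM q (dd z))"
 proof (cases k)
  case 0
  thus ?thesis using dd_degree_0[of z q] z by (simp only: inJ_zero[OF J] One_nat_def)
 next
  case (Suc k')
  hence "D (Suc k) z = dd z" by (simp add: D_def)
  thus ?thesis using inJ_hM[OF J cyc, of q] by (simp only:)
 qed
 have "D (Suc k) (D (Suc (Suc k)) (hM q z)) = 0" by (rule D_D[OF inM_hM[OF q z]])
 moreover have e: "D (Suc (Suc k)) (hM q z) = dd (hM q z)" by (simp add: D_def)
 ultimately have "D (Suc k) (Vz q z) = scal (t q) (D (Suc k) z) - D (Suc k) (hM q (dd z))"
  unfolding Vz_def D_diff D_scal by (simp only: diff_zero)
 thus "inJ J (D (Suc k) (Vz q z))"
  by (simp only:) (intro inJ_diff[OF J] inJ_scal[OF J] cyc inJ_D[OF J] h)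
 have "scal (t q) z - (Vz q z + D (Suc (Suc k)) (hM q z)) = hM q (dd z)"
  unfolding e Vz_def by (simp add: algebra_simps)
 thus "inJ J (scal (t q) z - (Vz q z + D (Suc (Suc k)) (hM q z)))" using h by (simp only:)
qed

text \<open>Modulo J, t q times a cycle differs from its defect by a boundary, so it is enough to
  kill the defect.\<close>

lemma bd_from_Vz:
 assumes J: "is_idl J" and q: "q : {1..f}" and z: "inM (Suc k) z" and cyc: "inJ J (D (Suc k) z)"
  and b: "bd J (Suc k) (scal c (Vz q z))"
 shows "bd J (Suc k) (scal (c * t q) z)"
proof (rule bd_cong[OF J])
 have sa: "scal c (u + v) = scal c u + scal c v" for u v :: "M_basis_elt => 'r"
  by (auto simp: fun_eq_iff algebra_simps)
 have "scal (c * t q) z = scal c (scal (t q) z)" by (auto simp: fun_eq_iff mult.assoc)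
 hence "scal (c * t q) z - (scal c (Vz q z) + scal c (D (Suc (Suc k)) (hM q z))) =
   scal c (scal (t q) z - (Vz q z + D (Suc (Suc k)) (hM q z)))"
  unfolding scal_diff sa by (simp only:)
 thus "inJ J (scal (c * t q) z - (scal c (Vz q z) + scal c (D (Suc (Suc k)) (hM q z))))"
  using inJ_scal[OF J Vz_cycle(2)[OF J q z cyc]] by (simp only:)
 show "bd J (Suc k) (scal c (Vz q z) + scal c (D (Suc (Suc k)) (hM q z)))"
  by (intro bd_add[OF J] b bd_scal[OF J] bd_D[OF J] inM_hM q z)
qed

text \<open>A defect in position k has J = k - 1 < f - g on the edge of V^T, or j = k - 1 < eps <= f
  - g on the edge of V^B. Beyond position f - g there is none.\<close>

lemma high_cycle:
 assumes J: "is_idl J" and q: "q : {1..f}" and z: "inM k z" and cyc: "inJ J (D k z)" and k: "de < k"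
 shows "bd J k (scal (t q) z)"
proof -
 obtain k' where k': "k = Suc k'" using k by (cases k) auto
 note z' = z[unfolded k'] and cyc' = cyc[unfolded k']
 have "Tc (Vz q z) a K = 0" for a K
  using Vz_T[OF q z', of a K] k k' by (cases "Tc (Vz q z) a K = 0") auto
 hence 1: "Tc (Vz q z) = Tc 0" by (auto simp: fun_eq_iff Tc_def)
 have noT: "Tc z a K ~= 0 ==> card K + expdeg g a + 1 < de" for a K
  using inM_T[OF z, of a K] k by (auto simp: chT_def)
 have "Bc (Vz q z) a K = 0" for a K
  using Vz_B[OF q z' _ noT, of a K] k k' eps_less by (cases "Bc (Vz q z) a K = 0") auto
 hence 2: "Bc (Vz q z) = Bc 0" by (auto simp: fun_eq_iff Bc_def)
 have "Vz q z = 0" by (rule M_eqI[OF 1 2]) (use Vz_Top[OF _ z] k' in simp)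
 hence "bd J (Suc k') (scal 1 (Vz q z))"
  by (simp only:) (intro bd_scal[OF J] bd_inJ[OF J] inJ_zero[OF J])
 from bd_from_Vz[OF J q z' cyc' this] show ?thesis by (simp add: k')
qed

end

section \<open>Killing the defect in positions up to eps\<close>

context complex_data
begin

lemma mk_diff: "mk T B c - mk T' B' c' = mk (T - T') (B - B') (c - c')"
 by (auto simp: mk_def fun_eq_iff split: M_basis_elt.splits)

lemma D_ge2: "k >= 2 ==> D k w = dd w" by (simp add: D_def)

lemma homog_full:
 assumes "homog f f u" "u {1..f} : J" "is_idl J" shows "inJ J u"
 unfolding inJ_def
proof
 fix K show "u K : J"
 proof (cases "u K = 0")
  case False
  hence "K <= {1..f}" "card K = f" using assms(1) by (auto simp: homog_def ext_basis_def)
  hence "K = {1..f}" by (intro card_subset_eq) auto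
  thus ?thesis using assms by simp
 qed (simp add: is_idlD(1)[OF assms(3)])
qed

lemma boundary_B:
 assumes w: "supp (%i j. Suc i = i0 & j = Suc j0) w" and i0: "i0 + j0 = de" and j0: "Suc j0 < eps"
 shows "inM (Suc (Suc j0)) (mk 0 w 0)" "dd (mk 0 w 0) = mk 0 (PsiH w) 0"
proof -
 show "inM (Suc (Suc j0)) (mk 0 w 0)"
 proof (rule inM_mkI)
  show "supp (%i j. chB i j & Suc (Suc j0) + de = i + 2 * j + 1) w"
   by (rule supp_mono[OF w]) (use i0 j0 in "auto simp: chB_def")
 qed (simp_all add: supp_zero)
 have 1: "tr iB (PsiH w) = PsiH w"
  by (rule supp_tr_id[OF supp_PsiH[OF w]]) (use i0 j0 in "auto simp: chB_def")
 have 2: "tr iB (tauH w) = 0"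
  by (rule supp_tr_zero[OF supp_tauH[OF w]]) (use i0 j0 in "auto simp: chB_def")
 show "dd (mk 0 w 0) = mk 0 (PsiH w) 0"
  unfolding dd_def ddT_def ddB_def Tc_mk Bc_mk PsiH_zero tauH_zero muH_zero tr_add tr_zero 1 2
  by simp
qed

lemma telescope:
 fixes h :: "nat => 'b::ab_group_add"
 shows "(SUM n:{1..m}. h n - h (n - 1)) = h m - h 0"
 by (induction m) auto

text \<open>The bidegree (i0 - 1, eps) of w belongs to neither family, so w itself cannot serve as a
  preimage of Psi w. It is replaced by tau w in V^T together with the alternating sum of the mu_n w
  in V^B, as if the differential were applied to w; the rest of its differential telescopes.\<close>

lemma boundary_mixed:
 assumes w: "supp (%i j. Suc i = i0 & j = Suc j0) w" and i0: "i0 + j0 = de" and j0: "Suc j0 = eps"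
 defines "u \<equiv> mk (tauH w) (SUM n:{1..eps}. scal2 ((-1) ^ (de + n)) (muH n w)) 0"
 shows "inM (Suc (Suc j0)) u" "dd u = mk 0 (scal2 ((-1) ^ Suc de) (PsiH w)) 0"
proof -
 have sm: "supp (%i j. i + j = de + n & j + n = eps) (muH n w)" for n
  by (rule supp_mono[OF supp_muH[OF w]]) (use i0 j0 in auto)
 have st: "supp (%i j. i + j + 1 = de & j = eps) (tauH w)"
  by (rule supp_mono[OF supp_tauH[OF w]]) (use i0 j0 in auto)
 show "inM (Suc (Suc j0)) u"
  unfolding u_def
 proof (rule inM_mkI)
  show "supp (%i j. chT i j & Suc (Suc j0) + de = i + 2 * j + 2) (tauH w)"
   by (rule supp_mono[OF st]) (use j0 in "auto simp: chT_def")
  show "supp (%i j. chB i j & Suc (Suc j0) + de = i + 2 * j + 1) (SUM n:{1..eps}. scal2 ((-1) ^ (de + n)) (muH n w))"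
   by (intro supp_sum supp_scal2 supp_mono[OF sm]) (use j0 in "auto simp: chB_def")
 qed simp
 have T0: "ddT u = 0"
 proof -
  have "tr iT (PsiH (tauH w)) = 0"
   by (rule supp_tr_zero[OF supp_PsiH[OF st]]) (auto simp: chT_def)
  thus ?thesis unfolding ddT_def u_def Tc_mk tauH_tauH add_0_right .
 qed
 let ?s = "%n. (-1) ^ (de + n) :: 'r"
 have t1: "tr iB (PsiH (muH n w)) = PsiH (muH n w)" for n
  by (rule supp_tr_id[OF supp_PsiH[OF sm]]) (auto simp: chB_def)
 have t2: "tr iB (tauH (muH n w)) = tauH (muH n w)" if "n >= 1" for n
  by (rule supp_tr_id[OF supp_tauH[OF sm]]) (use that in "auto simp: chB_def")
 have t3: "tr (%i j. iB i j * cf n i j) (muH n (tauH w)) = (if n <= eps then scal2 (- ?s n) (muH n (tauH w)) else 0)"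
  if n: "n >= 1" for n
 proof -
  have s: "supp (%i j. i >= 2 * n & i - 2 * n + (j + n) + 1 = de & j + n = eps) (muH n (tauH w))"
   by (rule supp_muH[OF st])
  show ?thesis
  proof (rule ext, rule ext)
   fix a K
   show "tr (%i j. iB i j * cf n i j) (muH n (tauH w)) a K = (if n <= eps then scal2 (- ?s n) (muH n (tauH w)) else 0) a K"
   proof (cases "muH n (tauH w) a K = 0")
    case False
    have p: "ok K a" "card K + expdeg g a + 1 = de + n" "expdeg g a + n = eps"
    using suppD[OF s, OF False] by auto
    hence "chB (card K) (expdeg g a)" using n by (auto simp: chB_def)
    moreover have "bn n (expdeg g a) = 1" using p by (simp add: bn_def)
    moreover have "(-1) ^ (card K + expdeg g a) = - ?s n"
    proof -
    have "(-1) ^ (card K + expdeg g a + 1) = ?s n" using p(2) by (simp only:)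
    hence "- ((-1) ^ (card K + expdeg g a)) = ?s n" by (simp add: power_add)
    thus ?thesis by (metis minus_minus)
    qed
    ultimately show ?thesis using p by (simp add: tr_def scal2_apply cf_def)
   next
    case True
    thus ?thesis by (simp add: tr_def scal2_apply)
   qed
  qed
 qed
 have "ddB u = (SUM n:{1..eps}. scal2 (?s n) (PsiH (muH n w)) + scal2 (?s n) (tauH (muH n w))) +
   (SUM n:{1..f}. if n <= eps then scal2 (- ?s n) (muH n (tauH w)) else 0)"
 proof -
  have "tr iB (PsiH (Bc u) + tauH (Bc u)) = (SUM n:{1..eps}. scal2 (?s n) (PsiH (muH n w)) + scal2 (?s n) (tauH (muH n w)))"
   unfolding u_def Bc_mk PsiH_sum tauH_sum tr_add tr_sum PsiH_scal tauH_scal tr_scal2 sum.distrib[symmetric]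
   by (intro sum.cong refl) (simp only: t1 t2 atLeastAtMost_iff)
  moreover have "(SUM n:{1..f}. tr (%i j. iB i j * cf n i j) (muH n (Tc u))) = (SUM n:{1..f}. if n <= eps then scal2 (- ?s n) (muH n (tauH w)) else 0)"
   unfolding u_def Tc_mk by (intro sum.cong refl t3) simp
  ultimately show ?thesis unfolding ddB_def by (simp only:)
 qed
 also have "(SUM n:{1..f}. if n <= eps then scal2 (- ?s n) (muH n (tauH w)) else 0) = (SUM n:{1..eps}. scal2 (- ?s n) (muH n (tauH w)))"
 proof -
  have "eps <= f" using eps_less g_less by linarith
  hence e: "{n : {1..f}. n <= eps} = {1..eps}" by auto
  show ?thesis unfolding sum.inter_filter[OF finite_atLeastAtMost, symmetric] e ..
 qed
 finally have B: "ddB u = (SUM n:{1..eps}. scal2 (?s n) (PsiH (muH n w)) + scal2 (?s n) (tauH (muH n w)) + scal2 (- ?s n) (muH n (tauH w)))"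
  unfolding sum.distrib by (simp only:)
 have B2: "ddB u a K = scal2 ((-1) ^ Suc de) (PsiH w) a K" for a K
 proof -
  define P where "P n = PsiH (muH n w) a K" for n
  \<comment> \<open>The terms mu_n tau w cancel those arriving from V^T, where \<open>bn\<close> is
    1 because J = eps; by \<open>tauH_muH_Suc\<close> only differences of neighbouring terms Psi
    mu_n w are left.\<close>
  have "ddB u a K = (SUM n:{1..eps}. ?s n * P n - ?s (n - 1) * P (n - 1))"
   unfolding B sum_apply
  proof (rule sum.cong)
   fix n assume n: "n : {1..eps}"
   then obtain n' where n': "n = Suc n'" by (cases n) auto
   have "tauH (muH n w) a K = muH n (tauH w) a K + P n'"
    unfolding n' tauH_muH_Suc P_def by simp
   thus "(scal2 (?s n) (PsiH (muH n w)) + scal2 (?s n) (tauH (muH n w)) + scal2 (- ?s n) (muH n (tauH w))) a K =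
    ?s n * P n - ?s (n - 1) * P (n - 1)"
    unfolding plus_fun_apply scal2_apply by (simp add: n' P_def algebra_simps)
  qed simp
  also have "... = ?s eps * P eps - ?s 0 * P 0" by (rule telescope)
  \<comment> \<open>mu_eps uses up the whole degree eps of w, and nothing is left for Psi to
    contract.\<close>
  also have "P eps = 0"
  proof (rule ccontr)
   assume "P eps ~= 0"
   thus False using suppD[OF supp_PsiH[OF sm[of eps]], of a K] by (auto simp: P_def)
  qed
  also have "muH 0 w = w" by (rule muH_0) (rule supp_finite[OF w])
  hence "P 0 = PsiH w a K" by (simp only: P_def)
  finally show ?thesis by (simp add: scal2_apply)
 qed
 hence "ddB u = scal2 ((-1) ^ Suc de) (PsiH w)" by (intro ext)
 thus "dd u = mk 0 (scal2 ((-1) ^ Suc de) (PsiH w)) 0" unfolding dd_def T0 by (simp only:)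
qed

text \<open>Psi W arrives at (i0 + 1, j0 - 1), where tau W does not, so the cycle condition isolates
  Psi. For j0 = 0 the cycle condition comes from \<open>d1\<close> and is the end condition of
  \<open>eagon_northcott\<close>.\<close>

lemma low_B_cycle:
 assumes J: "is_idl J" and W: "supp (%i j. i = i0 & j = j0) W" and i0: "i0 + j0 = de" and j0: "j0 < eps"
  and cyc: "inJ J (D (Suc j0) (mk 0 W 0))"
 shows "bd J (Suc j0) (scal (Lam L ^ g) (mk 0 W 0))"
proof -
 have Psi: "inJ2 J (PsiH W)"
 proof (rule inJ2I)
  fix a K show "PsiH W a K : J"
  proof (cases "PsiH W a K = 0")
   case False
   have p: "ok K a" "card K = Suc i0" "Suc (expdeg g a) = j0"
    using suppD[OF supp_PsiH[OF W], OF False] by auto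
   have "tauH W a K = 0"
    using suppD[OF supp_tauH[OF W], of a K] p by (cases "tauH W a K = 0") auto
   moreover note p(1)
   moreover have "chB (card K) (expdeg g a)" using p i0 j0 by (auto simp: chB_def)
   ultimately have "ddB (mk 0 W 0) a K = PsiH W a K"
    using p(1) by (simp add: ddB_def tr_def)
   moreover have "D (Suc j0) (mk 0 W 0) = dd (mk 0 W 0)" by (rule D_ge2) (use p in simp)
   hence "inJ J (dd (mk 0 W 0))" using cyc by (simp only:)
   hence "ddB (mk 0 W 0) a K : J" using inJ2D[OF inJ_Bc, of J "dd (mk 0 W 0)" a K] by (simp add: dd_def)
   ultimately show ?thesis by simp
  qed (simp add: is_idlD(1)[OF J])
 qed
 have W0: "inJ J (wdg (W 0) Lam)" if "j0 = 0"
 proof (rule homog_full[OF _ _ J])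
  have "homog f de (W 0)" unfolding homog_def ext_basis_def
  proof (intro allI impI)
   fix K assume "W 0 K ~= 0"
   thus "K : {K. K <= {1..f} & card K = de}" using suppD[OF W] i0 that by (auto simp: ok_def)
  qed
  moreover have "homog f g Lam" using homog_PL[of "[1..<Suc g]"] by (simp add: Lam_def del: upt_Suc)
  ultimately have "homog f (de + g) (wdg (W 0) Lam)" by (rule homog_wdg)
  thus "homog f f (wdg (W 0) Lam)" using g_less by simp
  have "D (Suc j0) (mk 0 W 0) = d1 (mk 0 W 0)" using that by (simp add: D_def)
  hence "inJ J (d1 (mk 0 W 0))" using cyc by (simp only:)
  hence "d1 (mk 0 W 0) Top : J" by (rule inJD)
  thus "wdg (W 0) Lam {1..f} : J" unfolding d1_def Tc_mk Bc_mk zero_fun_apply mult_zero_left sum.neutral_const by simp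
 qed
 obtain w where w: "inJ2 J (scal2 (Lam L ^ g) W - PsiH w)" "supp (%i j. Suc i = i0 & j = Suc j0) w"
  by (rule eagon_northcott[OF J W Psi, of L]) (use W0 in blast)+
 have base: "inJ J (scal (Lam L ^ g) (mk 0 W 0) - mk 0 (PsiH w) 0)"
  unfolding mk_scal mk_diff by (intro inJ_mk[OF J] w(1)) (simp_all only: scal2_zero diff_zero inJ2_zero[OF J] is_idlD(1)[OF J] mult_zero_right)
 have bdP: "bd J (Suc j0) (mk 0 (PsiH w) 0)"
 \<comment> \<open>w has bidegree (i0 - 1, j0 + 1), which still belongs to V^B exactly if j0 + 1 <
   eps.\<close>
 proof (cases "Suc j0 < eps")
  case True
  have "D (Suc (Suc j0)) (mk 0 w 0) = mk 0 (PsiH w) 0"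
   using boundary_B(2)[OF w(2) i0 True] by (simp add: D_ge2)
  thus ?thesis using bd_D[OF J boundary_B(1)[OF w(2) i0 True]] by (simp only:)
 next
  case False
  hence e: "Suc j0 = eps" using j0 by simp
  obtain u where u: "inM (Suc (Suc j0)) u" "dd u = mk 0 (scal2 ((-1) ^ Suc de) (PsiH w)) 0"
   using boundary_mixed[OF w(2) i0 e] by blast
  have "bd J (Suc j0) (dd u)" using bd_D[OF J u(1)] by (simp add: D_ge2)
  hence "bd J (Suc j0) (scal ((-1) ^ Suc de) (mk 0 (scal2 ((-1) ^ Suc de) (PsiH w)) 0))"
   unfolding u(2) by (rule bd_scal[OF J])
  moreover have "scal ((-1) ^ Suc de) (mk 0 (scal2 ((-1) ^ Suc de) (PsiH w)) 0) = mk 0 (PsiH w) 0"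
  proof -
   have "scal2 c (scal2 c V) = V" if "c * c = 1" for c :: 'r and V :: "'r dext"
    by (rule ext, rule ext) (simp add: scal2_apply that flip: mult.assoc)
   moreover have "(-1) ^ Suc de * (-1) ^ Suc de = (1::'r)" by (simp flip: power_mult_distrib)
   ultimately show ?thesis unfolding mk_scal by (simp only: scal2_zero mult_zero_right)
  qed
  ultimately show ?thesis by (simp only:)
 qed
 show ?thesis by (rule bd_cong[OF J base bdP])
qed

text \<open>A defect in V^T would have J = k, but V^T starts at eps > k. So the defect is a single
  strand of V^B.\<close>

lemma low_cycle:
 assumes J: "is_idl J" and q: "q : {1..f}" and z: "inM (Suc k) z" and cyc: "inJ J (D (Suc k) z)" and k: "Suc k <= eps"
 shows "bd J (Suc k) (scal (Lam L ^ g * t q) z)"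
proof (rule bd_from_Vz[OF J q z cyc])
 have "Tc (Vz q z) a K = 0" for a K
  using Vz_T[OF q z, of a K] k by (cases "Tc (Vz q z) a K = 0") auto
 hence 1: "Tc (Vz q z) = 0" by (auto simp: fun_eq_iff)
 have noT: "card K + expdeg g a + 1 < de" if "Tc z a K ~= 0" for a K
  using inM_T[OF z that] k by (auto simp: chT_def)
 let ?W = "Bc (Vz q z)"
 have s: "supp (%i j. i = de - k & j = k) ?W"
  unfolding supp_def
 proof (intro allI impI)
  fix a K assume "?W a K ~= 0"
  thus "ok K a & card K = de - k & expdeg g a = k" using Vz_B[OF q z _ noT, of a K] by auto
 qed
 have e: "Vz q z = mk 0 ?W 0"
  using mk_collapse[of "Vz q z"] Vz_Top[OF _ z] by (simp only: 1)
 have "bd J (Suc k) (scal (Lam L ^ g) (mk 0 ?W 0))"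
 proof (rule low_B_cycle[OF J s])
  show "inJ J (D (Suc k) (mk 0 ?W 0))"
   by (rule subst[OF e, of "%u. inJ J (D (Suc k) u)"]) (rule Vz_cycle(1)[OF J q z cyc])
 qed (use k eps_less in auto)
 thus "bd J (Suc k) (scal (Lam L ^ g) (Vz q z))"
  by (rule ssubst[OF e, of "%u. bd J (Suc k) (scal (Lam L ^ g) u)"])
qed

end

section \<open>Killing the defect in positions above eps\<close>

context complex_data
begin

lemma upper_tau_cycle:
 assumes J: "is_idl J" and V: "inM (Suc k) V" and k: "eps <= k" "1 <= k"
  and s: "supp (%i j. i + k + 1 = de & j = k) (Tc V)" and cyc: "inJ J (D (Suc k) V)"
 shows "inJ2 J (tauH (Tc V))"
proof (rule inJ2I)
 fix a K
 let ?T = "Tc V"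
 have "inJ J (dd V)" using cyc k(2) by (simp add: D_ge2)
 hence dT: "ddT V a K : J" using inJ2D[OF inJ_Tc, of J "dd V" a K] by (simp add: dd_def)
 show "tauH ?T a K : J"
 proof (cases "tauH ?T a K = 0")
  case False
  have p: "ok K a" "Suc (card K) + k + 1 = de" "expdeg g a = k"
   using suppD[OF supp_tauH[OF s], OF False] by auto
  have "PsiH ?T a K = 0"
   using suppD[OF supp_PsiH[OF s], of a K] p by (cases "PsiH ?T a K = 0") auto
  moreover have "chT (card K) (expdeg g a)" using p k by (auto simp: chT_def)
  ultimately have "ddT V a K = tauH ?T a K" using p(1) by (simp add: ddT_def tr_def)
  thus ?thesis using dT by simp
 qed (simp add: is_idlD(1)[OF J])
qed

text \<open>For k > eps, Psi of the V^T part lands in V^T and is visible in the cycle condition. For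
  k = eps it leaves V^T. Then the V^B component gives tau B +- mu_1 T = 0 modulo J, and applying tau
  once more produces Psi T, because tau T is already 0 modulo J.\<close>

lemma upper_Psi_cycle:
 assumes J: "is_idl J" and V: "inM (Suc k) V" and k: "eps <= k" "1 <= k"
  and s: "supp (%i j. i + k + 1 = de & j = k) (Tc V)" and cyc: "inJ J (D (Suc k) V)"
 shows "inJ2 J (PsiH (Tc V))"
proof -
 let ?T = "Tc V" and ?B = "Bc V"
 have cdd: "inJ J (dd V)" using cyc k(2) by (simp add: D_ge2)
 have dT: "ddT V a K : J" for a K using inJ2D[OF inJ_Tc[OF cdd], of a K] by (simp add: dd_def)
 have dB: "ddB V a K : J" for a K using inJ2D[OF inJ_Bc[OF cdd], of a K] by (simp add: dd_def)
 have tau: "inJ2 J (tauH ?T)" by (rule upper_tau_cycle[OF J V k s cyc])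
 show ?thesis
 proof (cases "eps = k")
  case False
  show ?thesis
  proof (rule inJ2I)
   fix a K show "PsiH ?T a K : J"
   proof (cases "PsiH ?T a K = 0")
    case nz: False
    have p: "ok K a" "1 <= card K" "card K - 1 + k + 1 = de" "Suc (expdeg g a) = k"
    using suppD[OF supp_PsiH[OF s], OF nz] by auto
    have "tauH ?T a K = 0"
    using suppD[OF supp_tauH[OF s], of a K] p by (cases "tauH ?T a K = 0") auto
    moreover have "chT (card K) (expdeg g a)" using p k False by (auto simp: chT_def)
    ultimately have "ddT V a K = PsiH ?T a K" using p(1) by (simp add: ddT_def tr_def)
    thus ?thesis using dT[of a K] by simp
   qed (simp add: is_idlD(1)[OF J])
  qed
 next
  case True
  \<comment> \<open>The part of V^B that tau carries to the edge i + j = f - g with j = eps - 1,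
    where mu_1 of the V^T part arrives as well.\<close>
  define B1 where "B1 = tr (%i j. of_bool (i + j = Suc de & Suc j = eps)) ?B"
  define Y where "Y = tauH B1 + scal2 ((-1) ^ de) (muH 1 ?T)"
  have sB1: "supp (%i j. i + j = Suc de & Suc j = eps) B1"
   unfolding B1_def by (rule supp_mono[OF supp_tr]) (metis (full_types) of_bool_eq(1))
  have sm: "supp (%i j. i + j = de & Suc j = eps) (muH 1 ?T)"
   by (rule supp_mono[OF supp_muH[OF s]]) (use True in auto)
  have st: "supp (%i j. i + j = de & Suc j = eps) (tauH B1)"
   by (rule supp_mono[OF supp_tauH[OF sB1]]) auto
  have Y: "inJ2 J Y"
  proof (rule inJ2I)
   fix a K
   have sY: "supp (%i j. i + j = de & Suc j = eps) Y"
    unfolding Y_def by (intro supp_add supp_scal2 st sm)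
   show "Y a K : J"
   proof (cases "Y a K = 0")
    case False
    have p: "ok K a" "card K + expdeg g a = de" "Suc (expdeg g a) = eps"
    using suppD[OF sY, OF False] by auto
    have ch: "chB (card K) (expdeg g a)" using p by (auto simp: chB_def)
    have "PsiH ?B a K = 0"
    using suppD[OF supp_PsiH[OF inM_suppB[OF V]], of a K] p by (cases "PsiH ?B a K = 0") (auto simp: chB_def)
    moreover have "tauH B1 a K = tauH ?B a K"
    unfolding B1_def tauH_tr[OF p(1)] using p by simp
    moreover have "(SUM n:{1..f}. cf n (card K) (expdeg g a) * muH n ?T a K) = (-1) ^ de * muH 1 ?T a K"
    proof -
    have "cf n (card K) (expdeg g a) * muH n ?T a K = (if n = 1 then (-1) ^ de * muH 1 ?T a K else 0)" if "n : {1..f}" for n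
    proof (cases "muH n ?T a K = 0")
    case nz: False
    have "expdeg g a + n = k" using suppD[OF supp_muH[OF s], OF nz] by auto
    hence n1: "n = 1" using p True by simp
    have "cf 1 (card K) (expdeg g a) = (-1) ^ de" using p by (simp add: cf_def bn_def)
    thus ?thesis using n1 by simp
    qed auto
    hence "(SUM n:{1..f}. cf n (card K) (expdeg g a) * muH n ?T a K) = (SUM n:{1..f}. if n = 1 then (-1) ^ de * muH 1 ?T a K else 0)"
    by (rule sum.cong[OF refl])
    also have "... = (-1) ^ de * muH 1 ?T a K" using g_less by (subst sum.delta) auto
    finally show ?thesis .
    qed
    ultimately have "ddB V a K = Y a K"
    using p(1) ch unfolding ddB_def Y_def plus_fun_apply by (simp add: tr_def sum_apply2 scal2_apply)
    thus ?thesis using dB[of a K] by simp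
   qed (simp add: is_idlD(1)[OF J])
  qed
  have fin: "infinite K ==> ?T a K = 0" for a K by (rule supp_finite[OF s])
  have "tauH Y = scal2 ((-1) ^ de) (muH 1 (tauH ?T) + PsiH ?T)"
  proof -
   have "tauH (muH 1 ?T) = muH 1 (tauH ?T) + PsiH ?T"
   proof -
    have "muH 0 ?T = ?T" by (rule muH_0) (rule fin)
    thus ?thesis using tauH_muH_Suc[of 0 ?T] by (simp only: One_nat_def)
   qed
   thus ?thesis unfolding Y_def tauH_add tauH_tauH tauH_scal add_0_left by (simp only:)
  qed
  hence e: "PsiH ?T a K = (-1) ^ de * tauH Y a K - muH 1 (tauH ?T) a K" for a K
   by (simp add: scal2_apply algebra_simps flip: power_add power_mult_distrib mult.assoc)
  show ?thesis
   by (rule inJ2I) (unfold e, intro is_idlD(6)[OF J] is_idlD(3)[OF J] inJ2D[OF inJ2_tauH[OF J Y]] inJ2D[OF inJ2_muH[OF J tau]])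
 qed
qed

text \<open>Here f - g = 1, so \<open>Wt 0\<close> is homogeneous of degree 2 + (g - 1) = f and has
  only a top coordinate. The cycle condition thus puts a multiple of the whole of
  \<open>Wt 0\<close> into J, and applying tau turns \<open>Wt 0\<close> into
  \<open>Lam\<close>.\<close>

lemma upper_cycle_0:
 assumes J: "is_idl J" and V: "inM 1 V" and e: "eps = 0" and cyc: "inJ J (D 1 V)"
  and s: "supp (%i j. i = 0 & j = 0) (Tc V)"
 shows "inJ2 J (scal2 (Lam L) (Tc V))"
proof -
 have de1: "de = 1" using e eps_less by simp
 have "Bc V a K = 0" for a K
  using inM_B[OF V, of a K] e unfolding chB_def by (cases "Bc V a K = 0") linarith+
 hence B0: "Bc V 0 = 0" by (auto simp: fun_eq_iff)
 have "d1 V Top : J" using inJD[OF cyc, of Top] by (simp add: D_def)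
 hence tc: "Tc V 0 {} * Wt 0 {1..f} : J"
  using e de1 unfolding d1_def by (simp add: B0 exponents_0)
 have hW: "homog f f (Wt 0)"
 proof -
  have "homog f (2 * expdeg g (0 + uexp 1)) (Dm (0 + uexp 1))" by (rule homog_Dm)
  moreover have "expdeg g (0 + uexp 1) = 1" using expdeg_uexp[of 1 g] g_pos by simp
  ultimately have "homog f 2 (Dm (0 + uexp 1))" by simp
  from homog_wdg[OF this homog_PL[of "[2..<Suc g]"]]
  have "homog f (2 + (Suc g - 2)) (Wt 0)" unfolding Wt_def length_upt .
  moreover have "2 + (Suc g - 2) = f" using de1 g_pos g_less by linarith
  ultimately show ?thesis by (simp only:)
 qed
 have TW: "Tc V 0 {} * Wt 0 K : J" for K
  using inJD[OF homog_full[of "scal (Tc V 0 {}) (Wt 0)" J]] hW tc J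
  by (auto simp: homog_def) (metis mult_zero_right)
 have "Lam = contr f t (Wt 0)"
  unfolding contr_Wt[OF g_pos] Dm_0 by (subst wdg_one_left) (auto simp: Lam_def intro: homog_infinite[OF homog_PL])
 hence "Tc V 0 {} * Lam L = contr f t (scal (Tc V 0 {}) (Wt 0)) L" by (simp add: contr_scal)
 moreover have "inJ J (contr f t (scal (Tc V 0 {}) (Wt 0)))"
  by (rule inJ_contr[OF J]) (simp add: inJ_def TW)
 ultimately have *: "Tc V 0 {} * Lam L : J" by (simp add: inJ_def)
 show ?thesis
 proof (rule inJ2I)
  fix a K show "scal2 (Lam L) (Tc V) a K : J"
  proof (cases "Tc V a K = 0")
   case False
   have p: "ok K a" "card K = 0" "expdeg g a = 0" using suppD[OF s, OF False] by auto
   have "K = {}" using p ok_finite by auto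
   moreover have "a : exponents g 0" using p by (auto simp: exponents_def ok_def)
   hence "a = 0" by (simp add: exponents_0)
   ultimately show ?thesis using * by (simp add: scal2_apply mult.commute)
  qed (simp add: is_idlD(1)[OF J] scal2_apply)
 qed
qed

lemma T_boundary:
 assumes w: "supp (%i j. Suc i + k + 1 = de & j = Suc k) w" and k: "eps <= k"
 shows "inM (Suc (Suc k)) (mk w 0 0)" "Tc (dd (mk w 0 0)) = PsiH w + tr iT (tauH w)"
proof -
 show "inM (Suc (Suc k)) (mk w 0 0)"
 proof (rule inM_mkI)
  show "supp (%i j. chT i j & Suc (Suc k) + de = i + 2 * j + 2) w"
   by (rule supp_mono[OF w]) (use k in "auto simp: chT_def")
 qed (simp_all add: supp_zero)
 have "tr iT (PsiH w) = PsiH w"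
  by (rule supp_tr_id[OF supp_PsiH[OF w]]) (use k in "auto simp: chT_def")
 thus "Tc (dd (mk w 0 0)) = PsiH w + tr iT (tauH w)"
  unfolding dd_def ddT_def Tc_mk tr_add by (simp only:)
qed

text \<open>Modulo J the cycle lies in V^B. Its defect would have j = k, while V^B needs j < eps <=
  k; so there is none and a factor t q is enough.\<close>

lemma upper_B_cycle:
 assumes J: "is_idl J" and q: "q : {1..f}" and X: "inM (Suc k) X" and k: "eps <= k" "1 <= k"
  and T: "inJ2 J (Tc X)" and cyc: "inJ J (D (Suc k) X)"
 shows "bd J (Suc k) (scal (t q) X)"
proof -
 define X3 where "X3 = mk 0 (Bc X) 0"
 have Top: "X Top = 0" using X[unfolded inM_def, rule_format, of Top] by (auto simp: Mbasis_def)
 have e: "X - X3 = mk (Tc X) 0 0"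
  unfolding X3_def by (subst mk_collapse[of X, symmetric]) (simp only: mk_diff Top diff_zero diff_self Bc_mk)
 have dX: "inJ J (X - X3)" unfolding e by (intro inJ_mk[OF J] T inJ2_zero[OF J] is_idlD(1)[OF J])
 have X3: "inM (Suc k) X3" unfolding X3_def
  by (rule inM_mkI) (simp_all only: supp_zero inM_suppB[OF X] simp_thms)
 have "D (Suc k) X3 = D (Suc k) X - D (Suc k) (X - X3)" unfolding D_diff by simp
 hence cyc3: "inJ J (D (Suc k) X3)" by (simp only:) (intro inJ_diff[OF J] cyc inJ_D[OF J dX])
 have T3: "Tc X3 = 0" by (simp add: X3_def)
 have "Tc (Vz q X3) = 0"
  unfolding Vz_def
 proof -
  have "Tc (u - v) = Tc u - Tc v" for u v :: "M_basis_elt => 'r" by (auto simp: Tc_def fun_eq_iff)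
  thus "Tc (scal (t q) X3 - dd (hM q X3) - hM q (dd X3)) = 0"
   by (simp only: Tc_scal T3 dd_def hM_def Tc_mk ddT_def hh_zero tr_zero PsiH_zero tauH_zero scal2_zero add_0_left diff_self)
 qed
 hence 1: "Tc (Vz q X3) = Tc 0" by (auto simp: Tc_def fun_eq_iff)
 have noT: "Tc X3 a K ~= 0 ==> card K + expdeg g a + 1 < de" for a K by (simp add: T3)
 have "Bc (Vz q X3) a K = 0" for a K
  using Vz_B[OF q X3 _ noT, of a K] k by (cases "Bc (Vz q X3) a K = 0") auto
 hence 2: "Bc (Vz q X3) = Bc 0" by (auto simp: fun_eq_iff Bc_def)
 have "Vz q X3 = 0" by (rule M_eqI[OF 1 2]) (use Vz_Top[OF _ X3] in simp)
 hence "bd J (Suc k) (scal 1 (Vz q X3))"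
  by (simp only:) (intro bd_scal[OF J] bd_inJ[OF J] inJ_zero[OF J])
 from bd_from_Vz[OF J q X3 cyc3 this] have "bd J (Suc k) (scal (t q) X3)" by simp
 moreover have "inJ J (scal (t q) X - scal (t q) X3)"
  unfolding scal_diff[symmetric] by (rule inJ_scal[OF J dX])
 ultimately show ?thesis by (rule bd_cong[OF J, rotated])
qed

text \<open>One t q leads to the defect, \<open>Lam L ^ g\<close> removes the V^T strand by a
  boundary, and the other t q removes the V^B part that this leaves behind.\<close>

lemma upper_cycle:
 assumes J: "is_idl J" and q: "q : {1..f}" and z: "inM (Suc k) z" and cyc: "inJ J (D (Suc k) z)" and k: "eps <= k"
 shows "bd J (Suc k) (scal (t q * (Lam L ^ g * t q)) z)"
proof -
 define V where "V = Vz q z"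
 have V: "inM (Suc k) V" unfolding V_def by (rule inM_Vz[OF q z])
 have cV: "inJ J (D (Suc k) V)" unfolding V_def by (rule Vz_cycle(1)[OF J q z cyc])
 have s: "supp (%i j. i + k + 1 = de & j = k) (Tc V)"
  unfolding supp_def V_def using Vz_T[OF q z] by auto
 have "bd J (Suc k) (scal (t q * Lam L ^ g) V)"
 proof (cases k)
  case 0
  hence e0: "eps = 0" using k by simp
  have "supp (%i j. i = 0 & j = 0) (Tc V)"
   by (rule supp_mono[OF s]) (use 0 e0 eps_less in auto)
  hence T: "inJ2 J (scal2 (Lam L) (Tc V))"
   using upper_cycle_0[OF J _ e0] V cV 0 by simp
  have B: "Bc V a K = 0" for a K
   using inM_B[OF V, of a K] e0 unfolding chB_def by (cases "Bc V a K = 0") linarith+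
  have Top: "V Top = 0" using V[unfolded inM_def, rule_format, of Top] by (auto simp: Mbasis_def)
  have "inJ J (scal (t q * Lam L ^ g) V)"
   unfolding inJ_def
  proof
   fix y
   obtain g' where g': "g = Suc g'" using g_pos by (cases g) auto
   have "Lam L * Tc V a K : J" for a K using inJ2D[OF T, of a K] by (simp add: scal2_apply)
   hence "(t q * Lam L ^ g') * (Lam L * Tc V a K) : J" for a K by (rule is_idlD(3)[OF J])
   hence "(t q * Lam L ^ g) * Tc V a K : J" for a K unfolding g' by (simp add: ac_simps)
   moreover have "V y = mk (Tc V) (Bc V) (V Top) y" by (simp add: mk_collapse)
   ultimately show "scal (t q * Lam L ^ g) V y : J"
    using B Top is_idlD(1)[OF J] by (cases y) (auto simp: mk_def)
  qed
  thus ?thesis by (rule bd_inJ[OF J])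
 next
  case (Suc k')
  hence k1: "1 <= k" by simp
  have s': "supp (%i j. i = de - (k + 1) & j = k) (Tc V)" by (rule supp_mono[OF s]) auto
  obtain w where w: "inJ2 J (scal2 (Lam L ^ g) (Tc V) - PsiH w)" "supp (%i j. Suc i = de - (k + 1) & j = Suc k) w"
    "inJ2 J (tauH (Tc V)) ==> inJ2 J (tauH w)"
   by (rule eagon_northcott[OF J s' upper_Psi_cycle[OF J V k k1 s cV], of L]) (use k1 in auto)
  have tw: "inJ2 J (tauH w)" by (rule w(3)[OF upper_tau_cycle[OF J V k k1 s cV]])
  have sw: "supp (%i j. Suc i + k + 1 = de & j = Suc k) w" by (rule supp_mono[OF w(2)]) auto
  note u = T_boundary[OF sw k]
  define u where "u = mk w 0 0"
  define X where "X = scal (Lam L ^ g) V - dd u"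
  have Du: "D (Suc (Suc k)) u = dd u" by (simp add: D_ge2)
  have uM: "inM (Suc (Suc k)) u" unfolding u_def by (rule u)
  have X: "inM (Suc k) X" unfolding X_def by (intro inM_diff inM_scal V inM_dd uM)
  have TX: "inJ2 J (Tc X)"
  proof (rule inJ2I)
   fix a K
   have "Tc X a K = (scal2 (Lam L ^ g) (Tc V) - PsiH w) a K - tr iT (tauH w) a K"
    using u(2) by (simp add: X_def Tc_def u_def[symmetric] scal2_apply fun_eq_iff algebra_simps)
   thus "Tc X a K : J"
    using is_idlD(6)[OF J inJ2D[OF w(1)] inJ2D[OF inJ2_tr[OF J tw]]] by simp
  qed
  have "D (Suc k) (dd u) = 0" using D_D[OF uM] Du by (simp only:)
  hence "D (Suc k) X = scal (Lam L ^ g) (D (Suc k) V)" unfolding X_def D_diff D_scal by (simp only: diff_zero)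
  hence cX: "inJ J (D (Suc k) X)" by (simp only:) (rule inJ_scal[OF J cV])
  have "bd J (Suc k) (scal (t q) X + scal (t q) (dd u))"
   using upper_B_cycle[OF J q X k k1 TX cX] bd_scal[OF J bd_D[OF J uM]] Du by (intro bd_add[OF J]) (auto simp only:)
  moreover have "scal (t q) X + scal (t q) (dd u) = scal (t q * Lam L ^ g) V"
   by (auto simp: X_def fun_eq_iff algebra_simps)
  ultimately show ?thesis by (simp only:)
 qed
 from bd_from_Vz[OF J q z cyc this[unfolded V_def]] show ?thesis by (simp add: mult.assoc)
qed

lemma cycle_torsion:
 assumes J: "is_idl J" and q: "q : {1..f}" and z: "inM (Suc k) z" and cyc: "inJ J (D (Suc k) z)"
 shows "bd J (Suc k) (scal (Lam L ^ g * t q ^ 2) z)"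
proof (cases "eps <= k")
 case True
 have "Lam L ^ g * t q ^ 2 = t q * (Lam L ^ g * t q)" by (simp add: power2_eq_square ac_simps)
 thus ?thesis using upper_cycle[OF J q z cyc True, of L] by (simp only:)
next
 case False
 have "bd J (Suc k) (scal (t q) (scal (Lam L ^ g * t q) z))"
  by (rule bd_scal[OF J low_cycle[OF J q z cyc]]) (use False in simp)
 moreover have "scal (t q) (scal (Lam L ^ g * t q) z) = scal (Lam L ^ g * t q ^ 2) z"
  by (auto simp: fun_eq_iff power2_eq_square ac_simps)
 ultimately show ?thesis by (simp only:)
qed

end

section \<open>Regular sequences and torsion\<close>

definition mult_set :: "'r::comm_ring_1 set => bool" where
 "mult_set S <-> 1 : S & (ALL a:S. ALL b:S. a * b : S)"

lemma mult_setD: "mult_set S ==> 1 : S" "mult_set S ==> a : S ==> b : S ==> a * b : S"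
 by (auto simp: mult_set_def)

definition adj :: "'r::comm_ring_1 set => 'r => 'r set" where
 "adj J a = {j + a * r | j r. j : J}"

lemma adjI: "j : J ==> x = j + a * r ==> x : adj J a"
 by (auto simp: adj_def)

declare scal_apply [simp del]

lemma adj_idl:
 assumes J: "is_idl J" shows "is_idl (adj J a)"
 unfolding is_idl_def
proof (intro conjI ballI allI)
 show "0 : adj J a" by (rule adjI[OF is_idlD(1)[OF J], where r = 0]) simp
 fix x assume "x : adj J a"
 then obtain j r where x: "x = j + a * r" "j : J" by (auto simp: adj_def)
 show "s * x : adj J a" for s
  by (rule adjI[OF is_idlD(3)[OF J x(2), of s], where r = "s * r"]) (simp add: x(1) algebra_simps)
 fix y assume "y : adj J a"
 then obtain j' r' where y: "y = j' + a * r'" "j' : J" by (auto simp: adj_def)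
 show "x + y : adj J a"
  by (rule adjI[OF is_idlD(2)[OF J x(2) y(2)], where r = "r + r'"]) (simp add: x(1) y(1) algebra_simps)
qed

lemma adj_sub: "J <= adj J a"
 by (auto intro!: adjI[where r = 0])

lemma adj_mem: "is_idl J ==> a * r : adj J a"
 by (rule adjI[OF is_idlD(1), where r = r]) auto

fun adjs :: "'r::comm_ring_1 set => 'r list => 'r set" where
 "adjs J [] = J"
| "adjs J (a # as) = adjs (adj J a) as"

text \<open>Regularity after inverting S, expressed without forming a localization; the multiplier s
  may depend on r.\<close>

definition reg :: "'r::comm_ring_1 set => 'r set => 'r => bool" where
 "reg S J a <-> (ALL r. a * r : J --> (EX s:S. s * r : J))"

lemma reg_mono: "reg S J a ==> S <= S' ==> reg S' J a"
 by (auto simp: reg_def)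

fun regseq :: "'r::comm_ring_1 set => 'r set => 'r list => bool" where
 "regseq S J [] = True"
| "regseq S J (a # as) = (reg S J a & regseq S (adj J a) as)"

lemma scal_scal: "scal a (scal b u) = scal (a * b) u"
 by (auto simp: fun_eq_iff scal_apply mult.assoc)

lemma scal_one: "scal 1 u = u"
 by (auto simp: fun_eq_iff scal_apply)

lemma scal_minus: "scal c (u - v) = scal c u - scal c v"
 by (auto simp: fun_eq_iff scal_apply algebra_simps)

lemma inJ_mono: "inJ J u ==> J <= J' ==> inJ J' u"
 by (auto simp: inJ_def)

lemma inJ_adj_scal: "is_idl J ==> inJ (adj J a) (scal a u)"
 by (auto simp: inJ_def adj_mem scal_apply)

context complex_data
begin

lemma finite_Mbasis: "finite {y. Mbasis k y}"
proof -
 let ?A = "Pow {1..f} \<times> (UN j:{0..k + de}. exponents g j)"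
 have "{y. Mbasis k y} <= insert Top (VT ` ?A Un VB ` ?A)"
 proof
  fix y assume y: "y : {y. Mbasis k y}"
  show "y : insert Top (VT ` ?A Un VB ` ?A)"
  proof (cases y)
   case (VT p)
   obtain K a where p: "p = (K, a)" by (cases p)
   have "ok K a" "expdeg g a <= k + de" using y by (auto simp: VT p Mbasis_def)
   hence "K : Pow {1..f}" "a : exponents g (expdeg g a)" "expdeg g a : {0..k + de}"
    by (auto simp: ok_def exponents_def)
   thus ?thesis unfolding VT p by blast
  next
   case (VB p)
   obtain K a where p: "p = (K, a)" by (cases p)
   have "ok K a" "expdeg g a <= k + de" using y by (auto simp: VB p Mbasis_def)
   hence "K : Pow {1..f}" "a : exponents g (expdeg g a)" "expdeg g a : {0..k + de}"
    by (auto simp: ok_def exponents_def)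
   thus ?thesis unfolding VB p by blast
  qed simp
 qed
 moreover have "finite (insert Top (VT ` ?A Un VB ` ?A))"
  by (intro finite.insertI finite_UnI finite_imageI finite_cartesian_product finite_UN_I finite_exponents) auto
 ultimately show ?thesis by (rule finite_subset)
qed

text \<open>Each position has finitely many basis elements, so the multipliers of the single
  coordinates can be multiplied together.\<close>

lemma common_multiplier:
 assumes S: "mult_set S" and J: "is_idl J" and u: "inM k u" and ex: "!!y. EX s:S. s * u y : J"
 shows "EX s:S. inJ J (scal s u)"
proof -
 have "EX s:S. ALL y:B. s * u y : J" if "finite B" for B
  using that
 proof (induction B rule: finite_induct)
  case empty
  thus ?case using mult_setD(1)[OF S] by blast
 next
  case (insert b B)
  then obtain s where s: "s : S" "ALL y:B. s * u y : J" by blast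
  obtain s' where s': "s' : S" "s' * u b : J" using ex by blast
  have "s' * s * u y : J" if "y : insert b B" for y
  proof (cases "y = b")
   case True
   thus ?thesis using is_idlD(3)[OF J s'(2), of s] by (simp add: ac_simps)
  next
   case False
   hence "s' * (s * u y) : J" using that s(2) is_idlD(3)[OF J, of "s * u y"] by blast
   thus ?thesis by (simp add: ac_simps)
  qed
  thus ?case using mult_setD(2)[OF S s'(1) s(1)] by blast
 qed
 from this[OF finite_Mbasis[of k]] obtain s where s: "s : S" "!!y. Mbasis k y ==> s * u y : J" by auto
 have "s * u y : J" for y
  using s(2)[of y] u is_idlD(1)[OF J] by (cases "u y = 0") (auto simp: inM_def)
 thus ?thesis using s(1) by (auto simp: inJ_def scal_apply)
qed

lemma split_adj:
 assumes e: "inM k e" and a: "inJ (adj J a) e" and J: "is_idl J"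
 shows "EX v. inM k v & inJ J (e - scal a v)"
proof -
 have "EX r. e y - a * r : J" for y
  using a by (auto simp: inJ_def adj_def) (metis add_diff_cancel_right')
 then obtain r where r: "!!y. e y - a * r y : J" by metis
 define v where "v y = (if e y = 0 then 0 else r y)" for y
 have "inM k v" using e by (auto simp: inM_def v_def)
 moreover have "inJ J (e - scal a v)"
  using r is_idlD(1)[OF J] by (auto simp: inJ_def v_def scal_apply)
 ultimately show ?thesis by blast
qed

text \<open>The homology in position k of the complex modulo J vanishes after inverting S. For S =
  {1} this is exactness.\<close>

definition tors :: "'r set => 'r set => nat => bool" where
 "tors S J k <-> (ALL z. inM k z --> inJ J (D k z) --> (EX s:S. bd J k (scal s z)))"

lemma torsD: "tors S J k ==> inM k z ==> inJ J (D k z) ==> EX s:S. bd J k (scal s z)"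
 by (auto simp: tors_def)

lemma bd_mono: "bd J k u ==> J <= J' ==> bd J' k u"
 unfolding bd_def using inJ_mono by blast

lemma D_D': "inM (Suc k) w ==> D k (D (Suc k) w) = 0"
proof (cases k)
 case 0
 thus ?thesis by (simp add: D_def)
next
 case (Suc k')
 assume "inM (Suc k) w"
 thus ?thesis unfolding Suc by (rule D_D)
qed

lemma inM_Dpred: "inM k z ==> inM (k - 1) (D k z)"
 using inM_D[of "k - 1" z] by (cases k) (auto simp: D_def inM_zero)

text \<open>Applying the differential to s w - d u - a v gives s d w = a d v modulo J. With a z = d
  w this becomes a (s z - d v) = 0 modulo J, and a can be cancelled up to S.\<close>

lemma lift_boundary:
 assumes S: "mult_set S" and J: "is_idl J" and r: "reg S J a" and z: "inM k z" and w: "inM (Suc k) w"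
  and zw: "inJ J (scal a z - D (Suc k) w)" and b: "bd (adj J a) (Suc k) (scal s w)"
 shows "EX s':S. bd J k (scal (s' * s) z)"
proof -
 obtain u where u: "inM (Suc (Suc k)) u" "inJ (adj J a) (scal s w - D (Suc (Suc k)) u)"
  using b by (auto simp: bd_def)
 obtain v where v: "inM (Suc k) v" "inJ J (scal s w - D (Suc (Suc k)) u - scal a v)"
  using split_adj[OF inM_diff[OF inM_scal[OF w] inM_D[OF u(1)]] u(2) J] by blast
 let ?y = "scal s z - D (Suc k) v"
 have "inJ J (D (Suc k) (scal s w - D (Suc (Suc k)) u - scal a v))" by (rule inJ_D[OF J v(2)])
 hence 1: "inJ J (scal s (D (Suc k) w) - scal a (D (Suc k) v))"
  unfolding D_diff D_scal D_D'[OF u(1)] by simp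
 have "inJ J (scal s (scal a z - D (Suc k) w) + (scal s (D (Suc k) w) - scal a (D (Suc k) v)))"
  by (rule inJ_add[OF J inJ_scal[OF J zw] 1])
 moreover have "scal s (scal a z - D (Suc k) w) + (scal s (D (Suc k) w) - scal a (D (Suc k) v)) = scal a ?y"
  by (auto simp: fun_eq_iff scal_apply algebra_simps)
 ultimately have "inJ J (scal a ?y)" by (simp only:)
 hence ex: "EX s':S. s' * ?y y : J" for y using r unfolding inJ_def reg_def scal_apply by blast
 have "inM k ?y" by (intro inM_diff inM_scal z inM_D v(1))
 from common_multiplier[OF S J this ex] obtain s' where s': "s' : S" "inJ J (scal s' ?y)" by blast
 have "scal s' ?y = scal (s' * s) z - D (Suc k) (scal s' v)"
  unfolding scal_minus scal_scal D_scal ..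
 hence "bd J k (scal (s' * s) z)" using s'(2) inM_scal[OF v(1)] by (intro bdI[of k "scal s' v"]) (auto simp only:)
 thus ?thesis using s'(1) by blast
qed

text \<open>The connecting map of the sequence given by multiplication by a. As a is regular only up
  to S, a factor s is needed to make z a cycle.\<close>

lemma connecting:
 assumes S: "mult_set S" and J: "is_idl J" and r: "reg S J a" and w: "inM (Suc k) w"
  and cyc: "inJ (adj J a) (D (Suc k) w)"
 obtains z s where "inM k z" "inJ J (D k z)" "s : S" "inJ J (scal s (D (Suc k) w) - scal a z)"
proof -
 obtain z0 where z0: "inM k z0" "inJ J (D (Suc k) w - scal a z0)"
  using split_adj[OF inM_D[OF w] cyc J] by blast
 have "inJ J (D k (D (Suc k) w - scal a z0))" by (rule inJ_D[OF J z0(2)])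
 hence "inJ J (0 - scal a (D k z0))" unfolding D_diff D_scal D_D'[OF w] .
 from inJ_uminus[OF J this] have "inJ J (scal a (D k z0))" by simp
 hence ex: "EX s:S. s * D k z0 y : J" for y using r unfolding inJ_def reg_def scal_apply by blast
 from common_multiplier[OF S J inM_Dpred[OF z0(1)] ex]
 obtain s where s: "s : S" "inJ J (scal s (D k z0))" by blast
 show thesis
 proof (rule that[of "scal s z0" s])
  show "inJ J (D k (scal s z0))" unfolding D_scal by (rule s)
  have "scal s (D (Suc k) w) - scal a (scal s z0) = scal s (D (Suc k) w - scal a z0)"
   by (auto simp: fun_eq_iff scal_apply algebra_simps)
  thus "inJ J (scal s (D (Suc k) w) - scal a (scal s z0))" using inJ_scal[OF J z0(2)] by (simp only:)
 qed (use s inM_scal[OF z0(1)] in auto)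
qed

text \<open>If the image z of w under the connecting map becomes a boundary, then a multiple of w
  can be changed by a multiple of a into a cycle modulo J.\<close>

lemma cycle_correction:
 assumes J: "is_idl J" and w: "inM (Suc k) w" and zw: "inJ J (scal s (D (Suc k) w) - scal a z)"
  and b: "inM (Suc k) u" "inJ J (scal c z - D (Suc k) u)"
 shows "inM (Suc k) (scal (c * s) w - scal a u)" "inJ J (D (Suc k) (scal (c * s) w - scal a u))"
proof -
 show "inM (Suc k) (scal (c * s) w - scal a u)" by (intro inM_diff inM_scal w b)
 have "D (Suc k) (scal (c * s) w - scal a u) = scal c (scal s (D (Suc k) w) - scal a z) + scal a (scal c z - D (Suc k) u)"
  unfolding D_diff D_scal by (auto simp: fun_eq_iff scal_apply algebra_simps)
 thus "inJ J (D (Suc k) (scal (c * s) w - scal a u))"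
  by (simp only:) (intro inJ_add[OF J] inJ_scal[OF J] zw b)
qed

lemma bd_drop_adj:
 assumes J: "is_idl J" and b: "bd J k (scal d (scal c w - scal a u))"
 shows "bd (adj J a) k (scal (d * c) w)"
proof -
 note J' = adj_idl[OF J, of a]
 have "bd (adj J a) k (scal d (scal c w - scal a u))" by (rule bd_mono[OF b adj_sub])
 moreover have "scal (d * c) w - scal d (scal c w - scal a u) = scal a (scal d u)"
  by (auto simp: fun_eq_iff scal_apply algebra_simps)
 hence "inJ (adj J a) (scal (d * c) w - scal d (scal c w - scal a u))"
  using inJ_adj_scal[OF J] by (simp only:)
 ultimately show ?thesis by (rule bd_cong[OF J', rotated])
qed

definition pw :: "'r set => 'r => 'r set" where
 "pw S a = {s * a ^ n | s n. s : S}"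

lemma pw_sub: "S <= pw S a"
 unfolding pw_def by auto (metis mult.right_neutral power_0)

lemma mult_pw: "mult_set S ==> mult_set (pw S a)"
 unfolding mult_set_def
proof (intro conjI ballI)
 assume S: "1 : S & (ALL b:S. ALL c:S. b * c : S)"
 thus "1 : pw S a" using pw_sub by blast
 fix b c assume "b : pw S a" "c : pw S a"
 then obtain s n s' n' where "b = s * a ^ n" "c = s' * a ^ n'" "s : S" "s' : S" by (auto simp: pw_def)
 hence "b * c = (s * s') * a ^ (n + n')" "s * s' : S" using S by (simp_all add: power_add ac_simps)
 thus "b * c : pw S a" unfolding pw_def by blast
qed

text \<open>The long homology sequence of multiplication by a: H_(k+1) modulo J and H_k modulo J
  enclose H_(k+1) modulo the larger ideal.\<close>

lemma tors_adj:
 assumes S: "mult_set S" and J: "is_idl J" and r: "reg S J a" and tor: "tors S J k" "tors S J (Suc k)"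
 shows "tors S (adj J a) (Suc k)"
 unfolding tors_def
proof (intro allI impI)
 fix w assume w: "inM (Suc k) w" and cyc: "inJ (adj J a) (D (Suc k) w)"
 obtain z s where z: "inM k z" "inJ J (D k z)" "s : S" "inJ J (scal s (D (Suc k) w) - scal a z)"
  using connecting[OF S J r w cyc] .
 obtain s1 where s1: "s1 : S" "bd J k (scal s1 z)" using torsD[OF tor(1) z(1,2)] by auto
 then obtain u where u: "inM (Suc k) u" "inJ J (scal s1 z - D (Suc k) u)" by (auto simp: bd_def)
 obtain s2 where s2: "s2 : S" "bd J (Suc k) (scal s2 (scal (s1 * s) w - scal a u))"
  using torsD[OF tor(2) cycle_correction[OF J w z(4) u]] by auto
 from bd_drop_adj[OF J s2(2)] show "EX s:S. bd (adj J a) (Suc k) (scal s w)"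
  using mult_setD(2)[OF S s2(1) mult_setD(2)[OF S s1(1) z(3)]] by blast
qed

lemma bd_scalE:
 assumes J: "is_idl J" and "bd J k (scal a z)"
 obtains w where "inM (Suc k) w" "inJ J (scal a z - D (Suc k) w)" "inJ (adj J a) (D (Suc k) w)"
proof -
 obtain w where w: "inM (Suc k) w" "inJ J (scal a z - D (Suc k) w)" using assms(2) by (auto simp: bd_def)
 have "inJ (adj J a) (scal a z - (scal a z - D (Suc k) w))"
  by (intro inJ_diff[OF adj_idl[OF J]] inJ_adj_scal[OF J] inJ_mono[OF w(2) adj_sub])
 thus thesis using that[OF w] by simp
qed

text \<open>If a^n z bounds, strip off one factor a: write a z1 = d w with z1 = a^(n-1) z up to S.
  Then w is a cycle modulo (J,a) one position higher, where the induction on the sequence applies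
  with m + 1, and \<open>lift_boundary\<close> cancels a. Position and number of elements used grow
  together, so after the whole sequence only positions above m + \<open>length as\<close> have to be
  known.\<close>

theorem acyclic_regseq:
 assumes S: "mult_set S"
 shows "is_idl J ==> regseq S J as ==> (!!a k. a : set as ==> k >= m + 1 ==> tors (pw S a) J k) ==>
  (!!k. k >= m + 1 + length as ==> tors S (adjs J as) k) ==> k >= m + 1 ==> tors S J k"
proof (induction as arbitrary: J m k)
 case Nil
 thus ?case by simp
next
 case (Cons a as)
 note J = Cons.prems(1) and T = Cons.prems(3)
 have r: "reg S J a" "regseq S (adj J a) as" using Cons.prems(2) by auto
 have T': "tors (pw S b) (adj J a) k" if "b : set as" "k >= m + 1 + 1" for b k
  using tors_adj[OF mult_pw[OF S] J reg_mono[OF r(1) pw_sub] T[of b "k - 1"] T[of b "Suc (k - 1)"]] that by simp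
 have IH: "tors S (adj J a) (Suc k)"
  by (rule Cons.IH[OF adj_idl[OF J] r(2) T', of "m + 1"]) (use Cons.prems(4,5) in simp_all)
 have peel: "EX s':S. bd J k (scal s' z)" if "inM k z" "inJ J (D k z)" "s : S" "bd J k (scal (s * a ^ n) z)" for n s z
  using that(3,4)
 proof (induction n arbitrary: s)
  case 0
  thus ?case by auto
 next
  case (Suc n)
  define z1 where "z1 = scal (s * a ^ n) z"
  have z1: "inM k z1" unfolding z1_def by (rule inM_scal[OF that(1)])
  have "scal a z1 = scal (s * a ^ Suc n) z" by (auto simp: z1_def fun_eq_iff scal_apply ac_simps)
  then obtain w where w: "inM (Suc k) w" "inJ J (scal a z1 - D (Suc k) w)" "inJ (adj J a) (D (Suc k) w)"
   using bd_scalE[OF J] Suc.prems(2) by metis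
  obtain s2 where s2: "s2 : S" "bd (adj J a) (Suc k) (scal s2 w)" using torsD[OF IH w(1,3)] by auto
  obtain s3 where s3: "s3 : S" "bd J k (scal (s3 * s2) z1)"
   using lift_boundary[OF S J r(1) z1 w(1,2) s2(2)] by blast
  have "scal (s3 * s2) z1 = scal ((s3 * s2 * s) * a ^ n) z" by (auto simp: z1_def fun_eq_iff scal_apply ac_simps)
  thus ?case using Suc.IH[of "s3 * s2 * s"] s3 mult_setD(2)[OF S] s2 Suc.prems by auto
 qed
 have "tors (pw S a) J k" using T[of a k] Cons.prems(5) by simp
 thus ?case unfolding tors_def pw_def using peel by blast
qed

text \<open>The relation a z = d w moves the class of z to the class of w modulo (J,a) one position
  higher, which the remaining elements still annihilate. At position m + \<open>length as\<close> it
  bounds by assumption, and \<open>lift_boundary\<close> carries this back down to z.\<close>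

theorem depth_chase:
 assumes S: "mult_set S"
 shows "is_idl J ==> regseq S J as ==> inM m z ==>
  (!!a. a : set as ==> EX s:S. bd J m (scal (s * a) z)) ==> inJ J (D m z) ==>
  (!!k. k >= m + 1 ==> tors S J k) ==> tors S (adjs J as) (m + length as) ==> EX s:S. bd J m (scal s z)"
proof (induction as arbitrary: J m z)
 case Nil
 thus ?case using torsD[of S J m z] by simp
next
 case (Cons a as)
 note J = Cons.prems(1) and z = Cons.prems(3) and ann = Cons.prems(4) and cyc = Cons.prems(5) and tor = Cons.prems(6)
 have r: "reg S J a" "regseq S (adj J a) as" using Cons.prems(2) by auto
 note J' = adj_idl[OF J, of a]
 obtain s0 where s0: "s0 : S" "bd J m (scal (s0 * a) z)" using ann[of a] by auto
 define z1 where "z1 = scal s0 z"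
 have z1: "inM m z1" unfolding z1_def by (rule inM_scal[OF z])
 have "scal a z1 = scal (s0 * a) z" by (auto simp: z1_def fun_eq_iff scal_apply ac_simps)
 then obtain w where w: "inM (Suc m) w" "inJ J (scal a z1 - D (Suc m) w)" and cw: "inJ (adj J a) (D (Suc m) w)"
  using bd_scalE[OF J] s0(2) by metis
 have zw: "inJ J (scal 1 (D (Suc m) w) - scal a z1)"
  using inJ_uminus[OF J w(2)] by (simp add: scal_one)
 have ann': "EX s:S. bd (adj J a) (m + 1) (scal (s * b) w)" if b: "b : set as" for b
 proof -
  obtain s1 where s1: "s1 : S" "bd J m (scal (s1 * b) z)" using ann[of b] b by auto
  have "scal s0 (scal (s1 * b) z) = scal (s1 * b) z1" by (auto simp: z1_def fun_eq_iff scal_apply ac_simps)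
  hence "bd J m (scal (s1 * b) z1)" using bd_scal[OF J s1(2), of s0] by (simp only:)
  then obtain u where u: "inM (Suc m) u" "inJ J (scal (s1 * b) z1 - D (Suc m) u)" by (auto simp: bd_def)
  note c = cycle_correction[OF J w(1) zw u]
  obtain s2 where s2: "s2 : S" "bd J (Suc m) (scal s2 (scal (s1 * b * 1) w - scal a u))"
   using torsD[OF tor[of "Suc m"] c] by auto
  from bd_drop_adj[OF J s2(2)] have "bd (adj J a) (m + 1) (scal ((s2 * s1) * b) w)" by (simp add: ac_simps)
  thus ?thesis using mult_setD(2)[OF S s2(1) s1(1)] by blast
 qed
 have tor': "tors S (adj J a) k" if "k >= m + 1 + 1" for k
  using tors_adj[OF S J r(1) tor[of "k - 1"] tor[of "Suc (k - 1)"]] that by simp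
 have "tors S (adjs (adj J a) as) (m + 1 + length as)" using Cons.prems(7) by simp
 moreover have "inM (m + 1) w" "inJ (adj J a) (D (m + 1) w)" using w(1) cw by simp_all
 ultimately obtain s where s: "s : S" "bd (adj J a) (Suc m) (scal s w)"
  using Cons.IH[OF J' r(2) _ ann' _ tor'] by auto
 obtain s' where s': "s' : S" "bd J m (scal (s' * s) z1)"
  using lift_boundary[OF S J r(1) z1 w s(2)] by blast
 have "scal (s' * s) z1 = scal (s' * s * s0) z" by (auto simp: z1_def fun_eq_iff scal_apply ac_simps)
 thus ?case using s' mult_setD(2)[OF S mult_setD(2)[OF S s'(1) s(1)] s0(1)] by auto
qed

end

section \<open>Covering rings\<close>

locale ring_cover = cring R for R :: "('a,'x) ring_scheme" (structure) +
 fixes ev :: "'r::comm_ring_1 => 'a"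
 assumes ev_closed [simp]: "ev u : carrier R"
  and ev_add: "ev (u + v) = ev u \<oplus> ev v"
  and ev_mult: "ev (u * v) = ev u \<otimes> ev v"
  and ev_one: "ev 1 = \<one>"
  and ev_surj: "a : carrier R ==> EX u. ev u = a"
begin

lemma ev_zero: "ev 0 = \<zero>"
proof -
 have "ev 0 \<oplus> ev 0 = ev 0" using ev_add[of 0 0] by simp
 thus ?thesis by (metis add.l_cancel_one ev_closed)
qed

lemma ev_uminus: "ev (- u) = \<ominus> ev u"
proof -
 have "ev (- u) \<oplus> ev u = \<zero>" using ev_add[of "- u" u] ev_zero by simp
 thus ?thesis by (simp add: minus_equality)
qed

lemma ev_minus: "ev (u - v) = ev u \<ominus> ev v"
 using ev_add[of u "- v"] by (simp add: ev_uminus minus_eq)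

lemma ev_sum: "ev (sum u A) = (\<Oplus>i\<in>A. ev (u i))"
proof (cases "finite A")
 case True
 thus ?thesis by (induction A rule: finite_induct) (simp_all add: ev_zero ev_add)
next
 case False
 thus ?thesis by (simp add: ev_zero finsum_infinite)
qed

lemma ev_prod: "ev (prod u A) = (\<Otimes>i\<in>A. ev (u i))"
proof (cases "finite A")
 case True
 thus ?thesis by (induction A rule: finite_induct) (simp_all add: ev_one ev_mult)
next
 case False
 thus ?thesis by (simp add: ev_one finprod_infinite)
qed

lemma ev_power: "ev (u ^ n) = ev u [^] n"
 by (induction n) (simp_all add: ev_one ev_mult m_comm)

lemma ev_sgn: "ev ((-1) ^ n) = sgn_pow R n"
 by (simp add: sgn_pow_def ev_power ev_uminus ev_one)

lemma ev_of_nat_mult: "ev (of_nat n * u) = [n] \<cdot> ev u"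
 by (induction n) (simp_all add: ev_zero ev_add algebra_simps add.m_comm)

lemma add_pow_int_nat: "add_pow R (int n) y = add_pow R n y"
 by (simp add: add_pow_def int_pow_int)

abbreviation E :: "('b => 'r) => 'b => 'a" where "E u \<equiv> (%k. ev (u k))"

lemma E_wdg: "E (wdg u v) = wedge R (E u) (E v)"
 by (rule ext) (simp add: wdg_def wedge_def isgn_def ev_sum ev_mult ev_sgn)

lemma E_one: "E wdg_one = ext_one R"
 by (rule ext) (simp add: wdg_one_def ext_one_def ev_one ev_zero)

lemma E_contr:
 assumes "!!p. p : {1..f} ==> ev (t p) = t' p"
 shows "E (contr f t v) = derivation R f t' (E v)"
proof
 fix L
 have t': "t' p : carrier R" if "p : {1..f}" for p using assms[OF that] ev_closed by metis
 have "ev (contr f t v L) = (\<Oplus>p\<in>{1..f}. if p : L then \<zero> else sgn_pow R (card {q : L. q < p}) \<otimes> (t' p \<otimes> ev (v (insert p L))))"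
  unfolding contr_def ev_sum
 proof (rule finsum_cong')
  fix p assume p: "p : {1..f}"
  show "ev (t p * ann1 p v L) = (if p : L then \<zero> else sgn_pow R (card {q : L. q < p}) \<otimes> (t' p \<otimes> ev (v (insert p L))))"
   using assms[OF p] t'[OF p] by (simp add: ann1_def isgn_single_card ev_mult ev_zero ev_sgn[symmetric] m_lcomm)
 qed (auto simp: ev_sgn[symmetric] t')
 also have "... = (\<Oplus>p\<in>{1..f} - L. sgn_pow R (card {q : L. q < p}) \<otimes> (t' p \<otimes> ev (v (insert p L))))"
 proof (rule add.finprod_mono_neutral_cong_right)
  fix p assume "p : {1..f} - L"
  thus "(if p : L then \<zero> else sgn_pow R (card {q : L. q < p}) \<otimes> (t' p \<otimes> ev (v (insert p L)))) =
    sgn_pow R (card {q : L. q < p}) \<otimes> (t' p \<otimes> ev (v (insert p L)))" by simp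
 qed (auto simp: ev_sgn[symmetric] t')
 finally show "ev (contr f t v L) = derivation R f t' (E v) L" by (simp add: derivation_def)
qed

lemma ev_pf: "ev (pf A K) = pfaffian R (%p q. ev (A p q)) K"
 by (simp add: pf_def pfaffian_def ev_sum ev_mult ev_sgn ev_prod)

lemma E_divpow: "E (divpow f v l) = ext_divpow R f (E v) l"
 by (rule ext) (simp add: divpow_def ext_divpow_def ev_pf ev_zero)

lemma E_foldr: "(!!l. l : set ls ==> E (u l) = u' l) ==> E (foldr wdg (map u ls) wdg_one) = wedge_list R (map u' ls)"
proof (induction ls)
 case Nil thus ?case by (simp add: wedge_list_def E_one)
next
 case (Cons l ls)
 thus ?case by (simp add: wedge_list_def E_wdg)
qed

end

text \<open>The integer division is exact because the falling factorial is k! times the binomial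
  coefficient; this is read off from the generalized binomial over the reals.\<close>

lemma zbinom_nat: "zbinom (int n) (int k) = int (n choose k)"
proof -
 have "real_of_int (fact k * int (n choose k)) = real_of_int (\<Prod>i=0..<k. int n - int i)"
  using gbinomial_mult_fact[of k "real n"] by (simp add: binomial_gbinomial)
 hence "fact k * int (n choose k) = (\<Prod>i=0..<k. int n - int i)" by (simp only: of_int_eq_iff)
 hence "int (n choose k) = (\<Prod>i=0..<k. int n - int i) div fact k" by (metis fact_nonzero nonzero_mult_div_cancel_left)
 also have "{0..<k} = {..<k}" by auto
 finally show ?thesis by (simp add: zbinom_def)
qed

lemma Mset_eq:
 "VT (K, a) : VT ` (UN (I,J):T_index f g \<epsilon> N. V_basis f g I J) <->
   K <= {1..f} & (ALL l. l ~: {1..g} --> a l = 0) & (card K, expdeg g a) : T_index f g \<epsilon> N"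
 "VB (K, a) : VB ` (UN (I,J):B_index f g \<epsilon> N. V_basis f g I J) <->
   K <= {1..f} & (ALL l. l ~: {1..g} --> a l = 0) & (card K, expdeg g a) : B_index f g \<epsilon> N"
 by (auto simp: V_basis_def ext_basis_def exponents_def image_iff)

locale complex_cover = ring_cover R ev + complex_data f g t x eps
 for R :: "('a,'x) ring_scheme" (structure) and ev :: "'r::comm_ring_1 => 'a"
  and f g :: nat and t :: "nat => 'r" and x :: "nat => 'r ext" and eps :: nat +
 fixes tR :: "nat => 'a" and xR :: "nat => nat set => 'a"
 assumes tR: "p : {1..f} ==> ev (t p) = tR p"
  and xR: "l : {1..g} ==> E (x l) = xR l"
begin

abbreviation MR :: "nat => ('a, M_basis_elt => 'a) module" where
 "MR \<equiv> M_module R f g (int eps)"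

abbreviation dR :: "nat => (M_basis_elt => 'a) => M_basis_elt => 'a" where
 "dR \<equiv> M_diff R f g tR xR (int eps)"

lemma E_psi: "l : {1..g} ==> E (psi l) = Psi R f tR xR l"
 unfolding psi_def Psi_def using E_contr[of f t tR] tR xR by simp

lemma E_PL: "set ls <= {1..g} ==> E (PL ls) = wedge_list R (map (Psi R f tR xR) ls)"
 unfolding PL_def by (rule E_foldr) (auto simp: E_psi)

lemma E_Lam: "E Lam = wedge_list R (map (Psi R f tR xR) [1..<Suc g])"
 unfolding Lam_def by (rule E_PL) auto

lemma E_Dm: "E (Dm m) = Dmu_mono R f g xR m"
 unfolding Dm_def DL_def Dmu_mono_def
proof (rule E_foldr)
 fix l assume "l : set [1..<Suc g]"
 hence "l : {1..g}" by auto
 thus "E (divpow f (x l) (m l)) = ext_divpow R f (xR l) (m l)" unfolding E_divpow by (simp only: xR)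
qed

text \<open>Besides evaluating, this passes from the order (exponent, exterior index) to the pairs
  (exterior index, exponent) of the given complex.\<close>

definition E2 :: "'r dext => nat set \<times> (nat => nat) => 'a" where
 "E2 W = (%(K,a). ev (W a K))"

lemma E2_PsiH: "Psi_term R f g tR xR (E2 W) = E2 (PsiH W)"
proof
 fix z :: "nat set \<times> (nat => nat)"
 obtain K a where z: "z = (K,a)" by (cases z)
 have e: "(%k. a k + unit_exponent l k) = a + uexp l" for l by (simp add: plus_fun_def)
 have 1: "on_ext (wedge R (Psi R f tR xR l)) (on_div (contract (unit_exponent l)) (E2 W)) (K,a) = ev (wdg (psi l) (W (a + uexp l)) K)"
  if "l : {1..g}" for l
  using fun_cong[OF E_wdg[of "psi l" "W (a + uexp l)"], of K]
  by (simp only: on_ext_def on_div_def contract_def E2_def case_prod_conv e E_psi[OF that])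
 have "Psi_term R f g tR xR (E2 W) (K,a) = (\<Oplus>l\<in>{1..g}. ev (wdg (psi l) (W (a + uexp l)) K))"
  unfolding Psi_term_def by (rule finsum_cong') (use 1 in auto)
 also have "... = E2 (PsiH W) (K,a)" by (simp add: E2_def PsiH_def sum_apply ev_sum)
 finally show "Psi_term R f g tR xR (E2 W) z = E2 (PsiH W) z" by (simp add: z)
qed

lemma E2_tauH: "on_ext (derivation R f tR) (E2 W) = E2 (tauH W)"
proof
 fix z :: "nat set \<times> (nat => nat)"
 obtain K a where z: "z = (K,a)" by (cases z)
 have "E (contr f t (W a)) = derivation R f tR (E (W a))" by (rule E_contr) (rule tR)
 thus "on_ext (derivation R f tR) (E2 W) z = E2 (tauH W) z"
  by (simp add: on_ext_def E2_def tauH_def z fun_eq_iff)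
qed

lemma E2_muH: "mu_term R f g xR (int n) (E2 W) = E2 (muH n W)"
proof
 fix z :: "nat set \<times> (nat => nat)"
 obtain K a where z: "z = (K,a)" by (cases z)
 have e: "(%k. a k + m k) = a + m" for m by (simp add: plus_fun_def)
 have 1: "on_ext (wedge R (Dmu_mono R f g xR m)) (on_div (contract m) (E2 W)) (K,a) = ev (wdg (Dm m) (W (a + m)) K)" for m
  using fun_cong[OF E_wdg[of "Dm m" "W (a + m)"], of K]
  by (simp only: on_ext_def on_div_def contract_def E2_def case_prod_conv e E_Dm)
 have "mu_term R f g xR (int n) (E2 W) (K,a) = (\<Oplus>m\<in>exponents g n. ev (wdg (Dm m) (W (a + m)) K))"
  unfolding mu_term_def Y_monomials_def by (rule finsum_cong') (use 1 in auto)
 also have "... = E2 (muH n W) (K,a)" by (simp add: E2_def muH_def sum_apply ev_sum)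
 finally show "mu_term R f g xR (int n) (E2 W) z = E2 (muH n W) z" by (simp add: z)
qed

lemma T_index_iff: "(i,j) : T_index f g (int eps) N <-> chT i j & N + de = i + 2 * j + 2"
 using g_less by (auto simp: T_index_def chT_def)

lemma B_index_iff: "(i,j) : B_index f g (int eps) N <-> chB i j & N + de = i + 2 * j + 1"
 using g_less by (auto simp: B_index_def chB_def)

lemma finite_T_index: "finite (T_index f g (int eps) N)"
 by (rule finite_subset[of _ "{0..N + de} \<times> {0..N + de}"]) (auto simp: T_index_iff)

lemma finite_B_index: "finite (B_index f g (int eps) N)"
 by (rule finite_subset[of _ "{0..N + de} \<times> {0..N + de}"]) (auto simp: B_index_iff)

definition Mset :: "nat => M_basis_elt set" where
 "Mset N = {y. Mbasis N y}"

lemma MR_eq: "MR N = free_module R (Mset N)"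
proof -
 have "VT ` (UN (I,J):T_index f g (int eps) N. V_basis f g I J) Un 
   VB ` (UN (i,j):B_index f g (int eps) N. V_basis f g i j) Un 
   (if N = 0 then {Top} else {}) = Mset N" (is "?L = _")
 proof (rule Set.set_eqI)
  fix y show "y : ?L <-> y : Mset N"
  proof (cases y)
   case (VT p)
   thus ?thesis using Mset_eq(1)[of "fst p" "snd p" f g "int eps" N]
    by (cases p) (auto simp: Mset_def Mbasis_def ok_def T_index_iff)
  next
   case (VB p)
   thus ?thesis using Mset_eq(2)[of "fst p" "snd p" f g "int eps" N]
    by (cases p) (auto simp: Mset_def Mbasis_def ok_def B_index_iff)
  next
   case Top
   thus ?thesis by (auto simp: Mset_def Mbasis_def)
  qed
 qed
 thus ?thesis by (simp add: M_module_def)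
qed

lemma finite_Mset: "finite (Mset N)"
 unfolding Mset_def by (rule finite_Mbasis)

lemma carrier_free: "finite B ==> v : carrier (free_module R B) <-> (ALL b. v b : carrier R) & (ALL b. b ~: B --> v b = \<zero>)"
 unfolding free_module_def by (auto intro: finite_subset[of _ B])

lemma E_in_MR: "inM N w ==> E w : carrier (MR N)"
 unfolding MR_eq carrier_free[OF finite_Mset] unfolding Mset_def inM_def
 by (metis ev_closed ev_zero mem_Collect_eq)

text \<open>The lift is chosen to be 0 outside the basis, so that it satisfies \<open>inM\<close>
  exactly and not just modulo the kernel of \<open>ev\<close>.\<close>

lemma MR_lift:
 assumes "v : carrier (MR N)" obtains w where "inM N w" "E w = v"
proof -
 have v: "v y : carrier R" "y ~: Mset N ==> v y = \<zero>" for y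
  using assms unfolding MR_eq carrier_free[OF finite_Mset] by auto
 define w where "w y = (if y : Mset N then SOME u. ev u = v y else 0)" for y
 have "ev (w y) = v y" for y
  using someI_ex[OF ev_surj[OF v(1)[of y]]] v(2)[of y] ev_zero by (auto simp: w_def)
 moreover have "inM N w" by (auto simp: inM_def w_def Mset_def)
 ultimately show thesis using that by blast
qed

lemma VT_part_E:
 assumes w: "inM N w" and IJ: "(I,J) : T_index f g (int eps) N"
 shows "VT_part R f g I J (E w) = E2 (tr (%i j. of_bool (i = I & j = J)) (Tc w))"
proof
 fix k :: "nat set \<times> (nat => nat)"
 obtain K a where k: "k = (K,a)" by (cases k)
 have "k : V_basis f g I J <-> ok K a & card K = I & expdeg g a = J"
  by (auto simp: k V_basis_def ext_basis_def exponents_def ok_def)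
 thus "VT_part R f g I J (E w) k = E2 (tr (%i j. of_bool (i = I & j = J)) (Tc w)) k"
  by (auto simp: VT_part_def E2_def k tr_def Tc_def ev_zero)
qed

lemma VB_part_E:
 shows "VB_part R f g I J (E w) = E2 (tr (%i j. of_bool (i = I & j = J)) (Bc w))"
proof
 fix k :: "nat set \<times> (nat => nat)"
 obtain K a where k: "k = (K,a)" by (cases k)
 have "k : V_basis f g I J <-> ok K a & card K = I & expdeg g a = J"
  by (auto simp: k V_basis_def ext_basis_def exponents_def ok_def)
 thus "VB_part R f g I J (E w) k = E2 (tr (%i j. of_bool (i = I & j = J)) (Bc w)) k"
  by (auto simp: VB_part_def E2_def k tr_def Bc_def ev_zero)
qed

end

section \<open>Splitting by bidegree, and agreement with the given differential\<close>

context complex_data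
begin

definition atd :: "nat => nat => 'r dext => 'r dext" where
 "atd I J = tr (%i j. of_bool (i = I & j = J))"

lemma supp_at: "supp (%i j. i = I & j = J) (atd I J W)"
 unfolding atd_def supp_def tr_def by (auto split: if_splits)

lemma sum_at:
 assumes W: "supp (%i j. (i,j) : A) W" and A: "finite A"
 shows "(SUM p:A. atd (fst p) (snd p) W) = W"
proof (rule ext, rule ext)
 fix a K
 show "(SUM p:A. atd (fst p) (snd p) W) a K = W a K"
 proof (cases "W a K = 0")
  case True
  hence "atd i j W a K = 0" for i j by (simp add: atd_def tr_def)
  thus ?thesis by (simp add: sum_apply2 True)
 next
  case False
  hence p: "ok K a" "(card K, expdeg g a) : A" using suppD[OF W, OF False] by auto
  have "(SUM p:A. atd (fst p) (snd p) W) a K = (SUM p:A. if p = (card K, expdeg g a) then W a K else 0)"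
   unfolding sum_apply2 by (rule sum.cong) (auto simp: atd_def tr_def p(1))
  also have "... = W a K" using p(2) A by (simp add: sum.delta)
  finally show ?thesis .
 qed
qed

lemma tr_PsiH_at:
 assumes "chT I J" and W: "supp (%i j. i = I & j = J) W"
 shows "tr iT (PsiH W) = (if eps + 1 <= J then PsiH W else 0)" "tr iT (tauH W) = tauH W"
proof -
 have "tr iT (PsiH W) = PsiH W" if "eps + 1 <= J"
  by (rule supp_tr_id[OF supp_PsiH[OF W]]) (use assms(1) that in "auto simp: chT_def")
 moreover have "tr iT (PsiH W) = 0" if "~ eps + 1 <= J"
  by (rule supp_tr_zero[OF supp_PsiH[OF W]]) (use assms(1) that in "auto simp: chT_def")
 ultimately show "tr iT (PsiH W) = (if eps + 1 <= J then PsiH W else 0)" by simp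
 show "tr iT (tauH W) = tauH W"
  by (rule supp_tr_id[OF supp_tauH[OF W]]) (use assms(1) in "auto simp: chT_def")
qed

lemma tr_PsiH_at_B:
 assumes "chB I J" and W: "supp (%i j. i = I & j = J) W"
 shows "tr iB (PsiH W) = PsiH W" "tr iB (tauH W) = (if de + 1 <= I + J then tauH W else 0)"
proof -
 show "tr iB (PsiH W) = PsiH W"
  by (rule supp_tr_id[OF supp_PsiH[OF W]]) (use assms(1) in "auto simp: chB_def")
 have "tr iB (tauH W) = tauH W" if "de + 1 <= I + J"
  by (rule supp_tr_id[OF supp_tauH[OF W]]) (use assms(1) that in "auto simp: chB_def")
 moreover have "tr iB (tauH W) = 0" if "~ de + 1 <= I + J"
  by (rule supp_tr_zero[OF supp_tauH[OF W]]) (use assms(1) that in "auto simp: chB_def")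
 ultimately show "tr iB (tauH W) = (if de + 1 <= I + J then tauH W else 0)" by simp
qed

text \<open>The targets (i,j) are indexed by n = J - j. The ranges {1..J} and {1..f} are compared
  inside {1..max f J}: for n > J no exponents are left, and for n > f no exterior index is large
  enough.\<close>

lemma mu_sum_at:
 assumes ch: "chT I J" and W: "supp (%i j. i = I & j = J) W"
 shows "(SUM n:{1..f}. tr (%i j. iB i j * cf n i j) (muH n W)) a K =
  (SUM (i,j):{(i,j). i + 2 * j = I + 2 * J & de <= i + j}.
    (-1) ^ (I + j) * (of_nat ((J - 1 - j) choose (J - eps)) * muH (J - j) W a K))" (is "?l = sum ?u ?S")
proof -
 have sm: "supp (%i j. i = I + 2 * n & j + n = J) (muH n W)" for n
  by (rule supp_mono[OF supp_muH[OF W]]) auto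
 let ?N = "{n : {1..J}. de <= I + J + n}"
 let ?v = "%n. (-1) ^ (I + J + n) * (of_nat ((n - 1) choose (J - eps)) * muH n W a K)"
 have "sum ?u ?S = sum ?v ?N"
 proof (rule sum.reindex_bij_witness[where i = "%n. (I + 2 * n, J - n)" and j = "%p. J - snd p"])
  fix p assume "p : ?S"
  then obtain i j where p: "p = (i,j)" "i + 2 * j = I + 2 * J" "de <= i + j" by auto
  have j: "j < J" using p ch by (auto simp: chT_def)
  show "(I + 2 * (J - snd p), J - (J - snd p)) = p" "J - snd p : ?N" using p j by auto
  have "(-1 :: 'r) ^ (I + J + (J - j)) = (-1) ^ (I + j)"
  proof -
   have "I + J + (J - j) = I + j + 2 * (J - j)" using j by simp
   thus ?thesis by (simp only: power_add power_mult) simp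
  qed
  moreover have "J - j - 1 = J - 1 - j" by simp
  ultimately show "?v (J - snd p) = ?u p" unfolding p(1) by (simp only: snd_conv case_prod_conv)
 qed auto
 also have "... = (SUM n:{1..J}. if de <= I + J + n then ?v n else 0)"
  by (rule sum.inter_filter) simp
 also have "... = (SUM n:{1..max f J}. if n <= J & de <= I + J + n then ?v n else 0)"
  by (rule sum.mono_neutral_cong_left) auto
 also have "... = (SUM n:{1..max f J}. tr (%i j. iB i j * cf n i j) (muH n W) a K)"
 proof (rule sum.cong)
  fix n assume n: "n : {1..max f J}"
  show "(if n <= J & de <= I + J + n then ?v n else 0) = tr (%i j. iB i j * cf n i j) (muH n W) a K"
  proof (cases "muH n W a K = 0")
   case False
   have p: "ok K a" "card K = I + 2 * n" "expdeg g a + n = J" using suppD[OF sm, OF False] by auto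
   have "(-1 :: 'r) ^ (card K + expdeg g a) = (-1) ^ (I + J + n)"
   proof -
    have "card K + expdeg g a = I + J + n" using p by simp
    thus ?thesis by (simp only:)
   qed
   moreover have "bn n (expdeg g a) = (n - 1) choose (J - eps)" using p ch by (auto simp: bn_def chT_def)
   \<comment> \<open>The given differential does not ask for j < eps; the binomial coefficient
     vanishes beyond that bound, so both truncations agree.\<close>
   moreover have "(n - 1) choose (J - eps) = 0" if "~ expdeg g a < eps"
    using that p n by (intro binomial_eq_0) auto
   ultimately show ?thesis using p by (cases "expdeg g a < eps") (auto simp: tr_def cf_def chB_def binomial_eq_0)
  qed (simp add: tr_def)
 qed simp
 also have "... = (SUM n:{1..f}. tr (%i j. iB i j * cf n i j) (muH n W) a K)"
 proof (rule sum.mono_neutral_right)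
  show "ALL n:{1..max f J} - {1..f}. tr (%i j. iB i j * cf n i j) (muH n W) a K = 0"
  proof
   fix n assume n: "n : {1..max f J} - {1..f}"
   have "ok K a ==> card K <= f" using card_mono[of "{1..f}" K] by (auto simp: ok_def)
   thus "tr (%i j. iB i j * cf n i j) (muH n W) a K = 0"
    using muH_small[of K n W a] ok_finite n by (fastforce simp: tr_def)
  qed
 qed auto
 finally show ?thesis by (simp add: sum_apply2)
qed

end

context complex_cover
begin

lemma E2_apply: "E2 W (K,a) = ev (W a K)" by (simp add: E2_def)

lemma dT_E:
 assumes ch: "chT I J" and W: "supp (%i j. i = I & j = J) W"
 shows "d_T R f g tR xR (int eps) I J (E2 W) = E (mk (tr iT (PsiH W + tauH W)) (SUM n:{1..f}. tr (%i j. iB i j * cf n i j) (muH n W)) 0)"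
proof
 fix z
 show "d_T R f g tR xR (int eps) I J (E2 W) z = E (mk (tr iT (PsiH W + tauH W)) (SUM n:{1..f}. tr (%i j. iB i j * cf n i j) (muH n W)) 0) z"
 proof (cases z)
  case (VT k)
  obtain K a where k: "k = (K,a)" by (cases k)
  have "int eps <= int J - 1 <-> eps + 1 <= J" by auto
  thus ?thesis
   unfolding VT k tr_add tr_PsiH_at[OF ch W]
   by (simp add: d_T_def mk_def E2_PsiH E2_tauH E2_apply ev_add ev_zero)
 next
  case (VB k)
  obtain K a where k: "k = (K,a)" by (cases k)
  let ?S = "{(i,j). i + 2 * j = I + 2 * J & delta f g <= int i + int j}"
  have S: "?S = {(i,j). i + 2 * j = I + 2 * J & de <= i + j}" using g_less by auto
  have "d_T R f g tR xR (int eps) I J (E2 W) z =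
    (\<Oplus>p\<in>?S. ev (case p of (i,j) => (-1) ^ (I + j) * (of_nat ((J - 1 - j) choose (J - eps)) * muH (J - j) W a K)))"
   unfolding d_T_def VB M_basis_elt.case Let_def
  proof (rule finsum_cong')
   fix p assume "p : ?S"
   then obtain i j where p: "p = (i,j)" "i + 2 * j = I + 2 * J" "de <= i + j" unfolding S by auto
   have j: "j < J" using p ch by (auto simp: chT_def)
   have "int J - 1 - int j = int (J - 1 - j)" "int J - int eps = int (J - eps)" "int J - int j = int (J - j)"
    using j ch by (auto simp: chT_def)
   hence "sgn_pow R (I + j) \<otimes> ([zbinom (int J - 1 - int j) (int J - int eps)] \<cdot> mu_term R f g xR (int J - int j) (E2 W) k) =
    ev ((-1) ^ (I + j)) \<otimes> add_pow R ((J - 1 - j) choose (J - eps)) (ev (muH (J - j) W a K))"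
    by (simp only: zbinom_nat add_pow_int_nat E2_muH E2_apply k ev_sgn)
   thus "sgn_pow R (I + snd p) \<otimes> ([zbinom (int J - 1 - int (snd p)) (int J - int eps)] \<cdot> mu_term R f g xR (int J - int (snd p)) (E2 W) k) =
    ev (case p of (i,j) => (-1) ^ (I + j) * (of_nat ((J - 1 - j) choose (J - eps)) * muH (J - j) W a K))"
    by (simp only: p(1) ev_mult[of "(-1) ^ (I + j)"] ev_of_nat_mult snd_conv case_prod_conv)
  qed auto
  also have "... = ev ((SUM n:{1..f}. tr (%i j. iB i j * cf n i j) (muH n W)) a K)"
   unfolding mu_sum_at[OF ch W] ev_sum S ..
  finally show ?thesis by (simp add: VB k mk_def)
 next
  case Top
  thus ?thesis by (simp add: d_T_def mk_def ev_zero)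
 qed
qed

lemma dB_E:
 assumes ch: "chB I J" and W: "supp (%i j. i = I & j = J) W"
 shows "d_B R f g tR xR I J (E2 W) = E (mk 0 (tr iB (PsiH W + tauH W)) 0)"
proof
 fix z
 show "d_B R f g tR xR I J (E2 W) z = E (mk 0 (tr iB (PsiH W + tauH W)) 0) z"
 proof (cases z)
  case (VB k)
  obtain K a where k: "k = (K,a)" by (cases k)
  have "delta f g <= int I + int J - 1 <-> de + 1 <= I + J" using g_less by auto
  thus ?thesis
   unfolding VB k tr_add tr_PsiH_at_B[OF ch W]
   by (simp add: d_B_def mk_def E2_PsiH E2_tauH E2_apply ev_add ev_zero)
 qed (simp_all add: d_B_def mk_def ev_zero)
qed

lemma VT_part_at: "(I,J) : T_index f g (int eps) N ==> inM N w ==> VT_part R f g I J (E w) = E2 (atd I J (Tc w))"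
 using VT_part_E by (simp add: atd_def)

lemma VB_part_at: "VB_part R f g I J (E w) = E2 (atd I J (Bc w))"
 using VB_part_E by (simp add: atd_def)

lemma sum_mk: "(SUM p:A. mk (T p) (B p) 0) = mk (SUM p:A. T p) (SUM p:A. B p) 0"
proof (induction A rule: infinite_finite_induct)
 case (insert p A)
 thus ?case by (simp only: sum.insert mk_add add_0_right simp_thms if_False)
qed (simp_all only: sum.infinite sum.empty mk_zero simp_thms)

lemma M_diff_dd:
 assumes w: "inM N w" and N: "N >= 2"
 shows "dR N (E w) = E (dd w)"
proof
 fix z
 let ?A = "T_index f g (int eps) N" and ?B = "B_index f g (int eps) N"
 have sT: "supp (%i j. (i,j) : ?A) (Tc w)" using inM_suppT[OF w] by (simp add: T_index_iff)
 have sB: "supp (%i j. (i,j) : ?B) (Bc w)" using inM_suppB[OF w] by (simp add: B_index_iff)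
 let ?wT = "%p. atd (fst p) (snd p) (Tc w)" and ?wB = "%p. atd (fst p) (snd p) (Bc w)"
 let ?mu = "%W. SUM n:{1..f}. tr (%i j. iB i j * cf n i j) (muH n W)"
 let ?dT = "%p. mk (tr iT (PsiH (?wT p) + tauH (?wT p))) (?mu (?wT p)) 0"
 let ?dB = "%p. mk 0 (tr iB (PsiH (?wB p) + tauH (?wB p))) 0"
 have "dR N (E w) z = (\<Oplus>p\<in>?A. ev (?dT p z)) \<oplus> (\<Oplus>p\<in>?B. ev (?dB p z))"
 proof -
  have "(\<Oplus>p\<in>?A. d_T R f g tR xR (int eps) (fst p) (snd p) (VT_part R f g (fst p) (snd p) (E w)) z) = (\<Oplus>p\<in>?A. ev (?dT p z))"
  proof (rule finsum_cong')
   fix p assume p: "p : ?A"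
   have "chT (fst p) (snd p)" using p T_index_iff[of "fst p" "snd p" N] by simp
   thus "d_T R f g tR xR (int eps) (fst p) (snd p) (VT_part R f g (fst p) (snd p) (E w)) z = ev (?dT p z)"
    using dT_E[OF _ supp_at] VT_part_at[of "fst p" "snd p" N w] p w by simp
  qed auto
  moreover have "(\<Oplus>p\<in>?B. d_B R f g tR xR (fst p) (snd p) (VB_part R f g (fst p) (snd p) (E w)) z) = (\<Oplus>p\<in>?B. ev (?dB p z))"
  proof (rule finsum_cong')
   fix p assume p: "p : ?B"
   have "chB (fst p) (snd p)" using p B_index_iff[of "fst p" "snd p" N] by simp
   thus "d_B R f g tR xR (fst p) (snd p) (VB_part R f g (fst p) (snd p) (E w)) z = ev (?dB p z)"
    using dB_E[OF _ supp_at] VB_part_at[of "fst p" "snd p" w] by simp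
  qed auto
  ultimately show ?thesis using N by (simp add: M_diff_def)
 qed
 also have "... = ev (((SUM p:?A. ?dT p) + (SUM p:?B. ?dB p)) z)"
  by (simp add: ev_add ev_sum sum_apply)
 also have "(SUM p:?A. ?dT p) + (SUM p:?B. ?dB p) = dd w"
 proof -
  have T: "(SUM p:?A. ?wT p) = Tc w" by (rule sum_at[OF sT finite_T_index])
  have B: "(SUM p:?B. ?wB p) = Bc w" by (rule sum_at[OF sB finite_B_index])
  have "(SUM p:?A. tr iT (PsiH (?wT p) + tauH (?wT p))) = ddT w"
   unfolding ddT_def tr_sum[symmetric] sum.distrib PsiH_sum[symmetric] tauH_sum[symmetric] T ..
  moreover have "(SUM p:?B. tr iB (PsiH (?wB p) + tauH (?wB p))) = tr iB (PsiH (Bc w) + tauH (Bc w))"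
   unfolding tr_sum[symmetric] sum.distrib PsiH_sum[symmetric] tauH_sum[symmetric] B ..
  moreover have "(SUM p:?A. ?mu (?wT p)) = ?mu (Tc w)"
  proof -
   have "(SUM p:?A. muH n (?wT p)) = muH n (Tc w)" for n
    using additive_sum[of "muH n" ?wT ?A] T by (simp only: muH_zero muH_add)
   thus ?thesis by (subst sum.swap) (simp only: tr_sum[symmetric])
  qed
  ultimately show ?thesis unfolding sum_mk mk_add dd_def ddB_def
   by (simp only: sum.neutral_const add_0_right add_0_left add.commute)
 qed
 finally show "dR N (E w) z = E (dd w) z" .
qed

text \<open>The integral shifts the support by \<open>uexp 1\<close>, and injectively, so the sum
  over exponents of degree n + 1 becomes one over degree n.\<close>

lemma c_map_E:
 assumes ga: "!!a. ga a ~= 0 ==> a : exponents g n"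
 shows "c_map R f g tR xR (E ga) = top_elt R (ev (SUM a:exponents g n. ga a * Wt a {1..f}))"
proof -
 let ?e = "%a. a + uexp 1"
 let ?I = "integral_X1 R (E ga)"
 have I_e: "?I (?e a) = ev (ga a)" for a
 proof -
  have "(?e a)(1 := ?e a 1 - 1) = a" by (auto simp: fun_eq_iff uexp_apply)
  thus ?thesis by (simp add: integral_X1_def uexp_apply)
 qed
 have I_nz: "b : ?e ` exponents g n" if "?I b ~= \<zero>" for b
 proof -
  have b: "b 1 ~= 0" "ev (ga (b(1 := b 1 - 1))) ~= \<zero>" using that by (auto simp: integral_X1_def split: if_splits)
  hence "b(1 := b 1 - 1) : exponents g n" using ga ev_zero by metis
  moreover have "b = ?e (b(1 := b 1 - 1))" using b(1) by (auto simp: fun_eq_iff uexp_apply)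
  ultimately show ?thesis by blast
 qed
 have inj: "inj_on ?e (exponents g n)" by (simp add: inj_on_def)
 have "Dmu R f g xR ?I K = ev ((SUM a:exponents g n. scal (ga a) (Dm (?e a))) K)" for K
 proof -
  have D: "Dmu_mono R f g xR b K = ev (Dm b K)" for b using E_Dm[of b] by (metis)
  have "Dmu R f g xR ?I K = (\<Oplus>b\<in>?e ` exponents g n. ?I b \<otimes> ev (Dm b K))"
   unfolding Dmu_def D
  proof (rule add.finprod_mono_neutral_cong_left)
   show "!!b. b : ?e ` exponents g n - {b. ?I b ~= \<zero>} ==> ?I b \<otimes> ev (Dm b K) = \<zero>" by auto
   show "(%b. ?I b \<otimes> ev (Dm b K)) : ?e ` exponents g n \<rightarrow> carrier R" using I_e by auto
  qed (use I_nz finite_exponents in auto)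
  also have "... = (\<Oplus>a\<in>exponents g n. ?I (?e a) \<otimes> ev (Dm (?e a) K))"
   by (rule add.finprod_reindex[OF _ inj]) (use I_e in auto)
  also have "... = (\<Oplus>a\<in>exponents g n. ev (ga a * Dm (?e a) K))"
   by (simp only: I_e ev_mult)
  also have "... = ev ((SUM a:exponents g n. scal (ga a) (Dm (?e a))) K)"
   by (simp only: sum_apply ev_sum scal_apply)
  finally show ?thesis .
 qed
 hence Dmu: "Dmu R f g xR ?I = E (SUM a:exponents g n. scal (ga a) (Dm (?e a)))" by blast
 have PL: "wedge_list R (map (Psi R f tR xR) [2..<Suc g]) = E (PL [2..<Suc g])"
  by (rule E_PL[symmetric]) auto
 have "wedge R (Dmu R f g xR ?I) (wedge_list R (map (Psi R f tR xR) [2..<Suc g])) {1..f} =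
   ev (wdg (SUM a:exponents g n. scal (ga a) (Dm (?e a))) (PL [2..<Suc g]) {1..f})"
  unfolding Dmu PL E_wdg[symmetric] ..
 also have "... = ev (SUM a:exponents g n. ga a * Wt a {1..f})"
  by (simp only: wdg_sum_left wdg_scal_left sum_apply scal_apply Wt_def)
 finally show ?thesis by (simp add: c_map_def)
qed

lemma M_diff_d1:
 assumes w: "inM 1 w"
 shows "dR 1 (E w) = E (d1 w)"
proof -
 have ok0: "K : ext_basis f de & 0 : exponents g 0" if "Bc w 0 K ~= 0" for K
  using inM_B[OF w that] by (auto simp: ok_def ext_basis_def exponents_def)
 have "VB_part R f g (f - g) 0 (E w) (K, %l. 0) = ev (Bc w 0 K)" for K
 proof (cases "Bc w 0 K = 0")
  case True
  thus ?thesis using ev_zero by (auto simp: VB_part_def Bc_def zero_fun_def)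
 next
  case False
  thus ?thesis using ok0[OF False] by (simp add: VB_part_def Bc_def V_basis_def zero_fun_def)
 qed
 hence VB: "(%K. VB_part R f g (f - g) 0 (E w) (K, %l. 0)) = E (Bc w 0)" by (rule ext)
 have 1: "wedge R (%K. VB_part R f g (f - g) 0 (E w) (K, %l. 0)) (wedge_list R (map (Psi R f tR xR) [1..<Suc g])) {1..f}
   = ev (wdg (Bc w 0) Lam {1..f})"
  unfolding VB E_Lam[symmetric] E_wdg[symmetric] ..
 have 2: "(2 * int eps = delta f g - 1) = (2 * eps + 1 = de)" using g_less by auto
 define ga where "ga a = (if a : exponents g eps then Tc w a {} else 0)" for a
 have "VT_part R f g 0 (nat (int eps)) (E w) ({}, a) = ev (ga a)" for a
  by (auto simp: VT_part_def V_basis_def ext_basis_def ga_def Tc_def ev_zero)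
 hence 3: "c_map R f g tR xR (%a. VT_part R f g 0 (nat (int eps)) (E w) ({}, a)) =
   top_elt R (ev (SUM a:exponents g eps. Tc w a {} * Wt a {1..f}))"
 proof -
  have nz: "ga a ~= 0 ==> a : exponents g eps" for a by (simp add: ga_def split: if_splits)
  have "(SUM a:exponents g eps. ga a * Wt a {1..f}) = (SUM a:exponents g eps. Tc w a {} * Wt a {1..f})"
   by (rule sum.cong) (simp_all add: ga_def)
  moreover have "c_map R f g tR xR (E ga) = top_elt R (ev (SUM a:exponents g eps. ga a * Wt a {1..f}))"
   by (rule c_map_E) (rule nz)
  ultimately show ?thesis by (simp only: \<open>!!a. VT_part R f g 0 (nat (int eps)) (E w) ({}, a) = ev (ga a)\<close>)
 qed
 show ?thesis
 proof
  fix z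
  have "dR 1 (E w) = d_1 R f g tR xR (int eps) (E w)" by (simp add: M_diff_def)
  thus "dR 1 (E w) z = E (d1 w) z"
   unfolding d_1_def 1 2 3 by (cases z) (auto simp: d1_def mk_def top_elt_def ev_add ev_zero)
 qed
qed

lemma M_diff_E: "inM N w ==> dR N (E w) = E (D N w)"
proof -
 assume w: "inM N w"
 consider "N >= 2" | "N = 1" | "N = 0" by linarith
 thus ?thesis
 proof cases
  case 1 thus ?thesis using M_diff_dd[OF w] by (simp add: D_def)
 next
  case 2 thus ?thesis using M_diff_d1 w by (simp add: D_def)
 next
  case 3 thus ?thesis by (simp add: D_def M_diff_def ev_zero)
 qed
qed

end

section \<open>Exactness, and the image in position 0\<close>

definition idl :: "'r::comm_ring_1 set => 'r set" where
 "idl A = \<Inter>{K. is_idl K & A <= K}"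

lemma idl_is_idl: "is_idl (idl A)"
 unfolding idl_def is_idl_def by auto

lemma idl_sub: "A <= idl A"
 by (auto simp: idl_def)

lemma idl_least: "is_idl K ==> A <= K ==> idl A <= K"
 by (auto simp: idl_def)

text \<open>In (c + d)^(n + m) every term contains c at least n times or d at least m times.\<close>

lemma is_idl_radical:
 assumes Q: "is_idl Q" shows "is_idl {c. EX n. c ^ n : Q}"
 unfolding is_idl_def
proof (intro conjI ballI allI)
 show "0 : {c. EX n. c ^ n : Q}" using is_idlD(1)[OF Q] by (auto intro!: exI[of _ 1])
 fix c assume "c : {c. EX n. c ^ n : Q}"
 then obtain n where n: "c ^ n : Q" by blast
 show "r * c : {c. EX n. c ^ n : Q}" for r
  using is_idlD(3)[OF Q n, of "r ^ n"] by (auto simp: power_mult_distrib[symmetric])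
 fix d assume "d : {c. EX n. c ^ n : Q}"
 then obtain m where m: "d ^ m : Q" by blast
 have "(c + d) ^ (n + m) = (SUM i<=n + m. of_nat (n + m choose i) * c ^ i * d ^ (n + m - i))"
  by (rule binomial_ring)
 also have "... : Q"
 proof (rule is_idl_sum[OF Q])
  fix i assume "i : {..n + m}"
  show "of_nat (n + m choose i) * c ^ i * d ^ (n + m - i) : Q"
  proof (cases "n <= i")
   case True
   hence "c ^ i = c ^ n * c ^ (i - n)" by (simp add: power_add[symmetric])
   hence "c ^ i : Q" using is_idlD(4)[OF Q n] by simp
   thus ?thesis by (intro is_idlD(4)[OF Q] is_idlD(3)[OF Q])
  next
   case False
   hence "n + m - i = m + (n - i)" by simp
   hence "d ^ (n + m - i) = d ^ m * d ^ (n - i)" by (simp only: power_add)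
   hence "d ^ (n + m - i) : Q" using is_idlD(4)[OF Q m] by simp
   thus ?thesis by (intro is_idlD(3)[OF Q])
  qed
 qed
 finally show "c + d : {c. EX n. c ^ n : Q}" by blast
qed

lemma adjs_idl: "is_idl J ==> is_idl (adjs J as)"
 by (induction as arbitrary: J) (simp_all add: adj_idl)

lemma adjs_sub: "is_idl J ==> J <= adjs J as"
proof (induction as arbitrary: J)
 case (Cons a as)
 thus ?case using adj_sub[of J a] adj_idl[of J a] by force
qed simp

lemma adjs_set: "is_idl J ==> set as <= adjs J as"
proof (induction as arbitrary: J)
 case (Cons a as)
 have "a : adj J a" using adj_mem[OF Cons.prems, of a 1] by simp
 thus ?case using Cons.IH[OF adj_idl[OF Cons.prems], of a] adjs_sub[OF adj_idl[OF Cons.prems], of a as] by auto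
qed simp

lemma adjs_least: "is_idl J ==> is_idl K ==> J <= K ==> set as <= K ==> adjs J as <= K"
proof (induction as arbitrary: J)
 case (Cons a as)
 have "adj J a <= K"
  using Cons.prems is_idlD(2,4)[OF Cons.prems(2)] by (auto simp: adj_def)
 thus ?case using Cons.IH[OF adj_idl[OF Cons.prems(1)] Cons.prems(2)] Cons.prems by simp
qed simp

lemma regseq_nth:
 "regseq S J as <-> (ALL i<length as. reg S (adjs J (take i as)) (as ! i))"
proof (induction as arbitrary: J)
 case (Cons a as)
 show ?case unfolding regseq.simps Cons.IH by (auto simp: All_less_Suc2)
qed simp

lemma regseq_mono: "regseq S J as ==> S <= S' ==> regseq S' J as"
 unfolding regseq_nth using reg_mono by blast

lemma mult_set_powers: "mult_set {c ^ n | n. True}"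
 unfolding mult_set_def
proof (intro conjI ballI)
 show "1 : {c ^ n | n. True}" by (auto intro!: exI[of _ 0])
 fix a b assume "a : {c ^ n | n. True}" "b : {c ^ n | n. True}"
 then obtain n m where "a = c ^ n" "b = c ^ m" by blast
 hence "a * b = c ^ (n + m)" by (simp add: power_add)
 thus "a * b : {c ^ n | n. True}" by blast
qed

lemma mult_set_1: "mult_set {1}"
 by (simp add: mult_set_def)

context complex_data
begin

lemma bd_multipliers_idl:
 assumes J: "is_idl J" shows "is_idl {c. bd J k (scal (s * c) z)}"
 unfolding is_idl_def
proof (intro conjI ballI allI)
 have "scal (s * 0) z = 0" by (auto simp: fun_eq_iff scal_apply)
 thus "0 : {c. bd J k (scal (s * c) z)}" using bd_inJ[OF J inJ_zero[OF J]] by simp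
 fix c assume c: "c : {c. bd J k (scal (s * c) z)}"
 have "scal (s * (r * c)) z = scal r (scal (s * c) z)" for r by (auto simp: scal_scal ac_simps)
 thus "r * c : {c. bd J k (scal (s * c) z)}" for r using bd_scal[OF J, of k "scal (s * c) z" r] c by simp
 fix d assume d: "d : {c. bd J k (scal (s * c) z)}"
 have "scal (s * (c + d)) z = scal (s * c) z + scal (s * d) z" by (auto simp: fun_eq_iff scal_apply algebra_simps)
 thus "c + d : {c. bd J k (scal (s * c) z)}" using bd_add[OF J] c d by simp
qed

lemma bd_J_multiple:
 assumes "is_idl J" "c : J" shows "bd J k (scal (s * c) z)"
 by (rule bd_inJ[OF assms(1)]) (use assms in "auto simp: inJ_def scal_apply intro: is_idlD")

text \<open>V^T ends at position f - g, reached at I = 0 and J = f - g - 1; V^B ends at position f +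
  2 eps - (f - g) - 1, reached at i = f and j = eps - 1.\<close>

lemma inM_high: "inM k z ==> de < k ==> f + 2 * eps < k + de + 1 ==> z = 0"
proof (rule ccontr)
 assume z: "inM k z" "z ~= 0" and k: "de < k" "f + 2 * eps < k + de + 1"
 then obtain y where "z y ~= 0" by (auto simp: fun_eq_iff)
 hence y: "Mbasis k y" using z by (auto simp: inM_def)
 have "card K <= f" if "ok K a" for K a using that card_mono[of "{1..f}" K] by (auto simp: ok_def)
 thus False using y k eps_less by (cases y) (fastforce simp: Mbasis_def chT_def chB_def)+
qed

lemma inM_0_iff: "inM 0 z <-> z = mk 0 0 (z Top)"
proof -
 have 0: "Mbasis 0 y <-> y = Top" for y
  using eps_less by (cases y) (auto simp: Mbasis_def chT_def chB_def)
 have m: "mk 0 0 c = (%y. if y = Top then c else 0)" for c :: 'r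
  by (auto simp: fun_eq_iff mk_def split: M_basis_elt.split)
 show ?thesis unfolding inM_def 0 by (subst m) (auto simp: fun_eq_iff)
qed

lemma tors_high:
 assumes "is_idl J" "q : {1..f}" "t q : S" "de < k" shows "tors S J k"
 unfolding tors_def using high_cycle[OF assms(1,2)] assms(3,4) by blast

lemma tors_zero:
 assumes "is_idl J" "mult_set S" "de < k" "f + 2 * eps < k + de + 1" shows "tors S J k"
 unfolding tors_def
proof (intro allI impI)
 fix z assume "inM k z" "inJ J (D k z)"
 hence "z = 0" using assms inM_high by blast
 hence "scal 1 z = 0" by (auto simp: fun_eq_iff scal_apply)
 hence "bd J k (scal 1 z)" using bd_inJ[OF assms(1) inJ_zero[OF assms(1)]] by simp
 thus "EX s:S. bd J k (scal s z)" using mult_setD(1)[OF assms(2)] by blast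
qed

text \<open>The multipliers that make z bound form an ideal, hence so do the elements with some
  power among them. Testing generators is therefore enough, which turns powers of minors or of the t
  q into powers of the elements of a regular sequence.\<close>

lemma bd_radical:
 assumes J: "is_idl J" and a: "a : idl (J Un A)" and A: "!!c. c : A ==> EX n. bd J k (scal (s * c ^ n) z)"
 shows "EX n. bd J k (scal (s * a ^ n) z)"
proof -
 let ?Q = "{c. bd J k (scal (s * c) z)}"
 have "c : {c. EX n. c ^ n : ?Q}" if "c : J" for c
  using bd_J_multiple[OF J that] by (auto intro!: exI[of _ 1])
 hence "idl (J Un A) <= {c. EX n. c ^ n : ?Q}"
  using A by (intro idl_least[OF is_idl_radical[OF bd_multipliers_idl[OF J]]]) blast
 thus ?thesis using a by blast
qed

text \<open>A sequence of f - g elements leads \<open>acyclic_regseq\<close> from position 1 to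
  position f - g + 1, just where \<open>tors_high\<close> takes over because t q has been
  inverted.\<close>

lemma top_torsion:
 assumes J: "is_idl J" and q: "q : {1..f}" and r: "regseq {1} J as" "length as = de"
  and as: "set as <= idl (J Un range Lam)" and k: "k >= 1"
 shows "tors {t q ^ n | n. True} J k"
proof (rule acyclic_regseq[OF mult_set_powers J regseq_mono[OF r(1)], where m = 0])
 show "{1} <= {t q ^ n | n. True}" by (auto intro!: exI[of _ 0])
 show "tors (pw {t q ^ n | n. True} a) J k" if a: "a : set as" and k: "0 + 1 <= k" for a k
  unfolding tors_def
 proof (intro allI impI)
  fix z assume z: "inM k z" "inJ J (D k z)"
  have "EX n. bd J k (scal (t q ^ 2 * a ^ n) z)"
  proof (rule bd_radical[OF J subsetD[OF as a]])
   fix c assume "c : range Lam"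
   then obtain L where "c = Lam L" by blast
   hence "bd J k (scal (t q ^ 2 * c ^ g) z)"
    using cycle_torsion[OF J q, of "k - 1" z L] z k by (simp add: mult.commute)
   thus "EX n. bd J k (scal (t q ^ 2 * c ^ n) z)" ..
  qed
  thus "EX s:pw {t q ^ n | n. True} a. bd J k (scal s z)" unfolding pw_def by blast
 qed
 have "t q : {t q ^ n | n. True}" by (auto intro!: exI[of _ 1])
 thus "tors {t q ^ n | n. True} (adjs J as) k" if "0 + 1 + length as <= k" for k
  using that r(2) by (intro tors_high[OF adjs_idl[OF J] q]) auto
qed (use k in simp)

text \<open>Length f leads to position f + 1, where the complex is zero even for the largest value 2
  eps = f - g + 1.\<close>

theorem exact:
 assumes J: "is_idl J" and r: "regseq {1} J as" "length as = de" "set as <= idl (J Un range Lam)"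
  and rb: "regseq {1} J bs" "length bs = f" "set bs <= idl (J Un t ` {1..f})" and k: "k >= 1"
 shows "tors {1} J k"
proof (rule acyclic_regseq[OF mult_set_1 J rb(1), where m = 0])
 show "tors (pw {1} a) J k" if a: "a : set bs" and k: "0 + 1 <= k" for a k
  unfolding tors_def
 proof (intro allI impI)
  fix z assume z: "inM k z" "inJ J (D k z)"
  have "EX n. bd J k (scal (1 * a ^ n) z)"
   by (rule bd_radical[OF J subsetD[OF rb(3) a]]) (use torsD[OF top_torsion[OF J _ r] z] k in fastforce)
  thus "EX s:pw {1} a. bd J k (scal s z)" unfolding pw_def by blast
 qed
 show "tors {1} (adjs J bs) k" if "0 + 1 + length bs <= k" for k
  by (rule tors_zero[OF adjs_idl[OF J] mult_set_1]) (use that rb(2) eps_le g_pos g_less in auto)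
qed (use k in simp)

text \<open>The preimage in the ring of the boundaries in position 0, that is, the image of
  \<open>d1\<close> enlarged by J.\<close>

definition im0 :: "'r set => 'r set" where
 "im0 J = {c. bd J 0 (mk 0 0 c)}"

lemma scal_mk_top: "scal s (mk 0 0 c) = mk 0 0 (s * c)"
 by (simp add: mk_scal scal2_zero del: zero_fun_apply)

lemma inM_mk_top: "inM 0 (mk 0 0 c)"
 by (simp add: inM_0_iff mk_def)

lemma im0_idl: assumes J: "is_idl J" shows "is_idl (im0 J)"
proof -
 have "im0 J = {c. bd J 0 (scal (1 * c) (mk 0 0 1))}"
  by (simp add: im0_def scal_mk_top)
 thus ?thesis using bd_multipliers_idl[OF J, of 0 1] by simp
qed

theorem im0_chase:
 assumes S: "mult_set S" and J: "is_idl J" and r: "regseq S J as"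
  and as: "!!a. a : set as ==> EX s:S. s * a * c : im0 J"
  and acyc: "!!k. k >= 1 ==> tors {1} J k" and top: "tors S (adjs J as) (length as)"
 shows "EX s:S. s * c : im0 J"
proof -
 have "EX s:S. bd J 0 (scal s (mk 0 0 c))"
 proof (rule depth_chase[OF S J r inM_mk_top])
  show "EX s:S. bd J 0 (scal (s * a) (mk 0 0 c))" if "a : set as" for a
   using as[OF that] by (simp add: im0_def scal_mk_top)
  show "inJ J (D 0 (mk 0 0 c))" by (simp add: D_def inJ_def is_idlD(1)[OF J])
  show "tors S J k" if "0 + 1 <= k" for k
   using acyc[of k] that mult_setD(1)[OF S] by (auto simp: tors_def)
  show "tors S (adjs J as) (0 + length as)" using top by simp
 qed
 thus ?thesis by (simp add: im0_def scal_mk_top)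
qed

text \<open>The values of c on the basis X^(a); the set is empty when c is not part of the
  differential.\<close>

definition cgens :: "'r set" where
 "cgens = (if 2 * eps + 1 = de then {Wt a {1..f} | a. a : exponents g eps} else {})"

lemma im0_iff:
 "c : im0 J <-> (EX w. inM 1 w &
   (ALL k. (mk 0 0 c - d1 w) k : J))"
 by (auto simp: im0_def bd_def inJ_def D_def)

lemma d1_Top: "d1 w Top = wdg (Bc w 0) Lam {1..f} +
   (if 2 * eps + 1 = de then SUM a:exponents g eps. Tc w a {} * Wt a {1..f} else 0)"
 by (simp add: d1_def mk_def)

lemma im0_iff2: "is_idl J ==> c : im0 J <-> (EX w. inM 1 w & c - d1 w Top : J)"
proof -
 assume J: "is_idl J"
 have "(ALL k. (mk 0 0 c - d1 w) k : J) <-> c - d1 w Top : J" for w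
 proof
  assume "ALL k. (mk 0 0 c - d1 w) k : J"
  from this[rule_format, of Top] show "c - d1 w Top : J" by (simp add: mk_def)
 next
  assume "c - d1 w Top : J"
  hence "(mk 0 0 c - d1 w) k : J" for k
   by (cases k) (simp_all add: mk_def d1_def is_idlD(1)[OF J])
  thus "ALL k. (mk 0 0 c - d1 w) k : J" by blast
 qed
 thus ?thesis by (simp add: im0_iff)
qed

lemma Lam_top_idl: "is_idl K ==> range Lam <= K ==> wdg u Lam M : K"
 unfolding wdg_def by (intro is_idl_sum is_idlD(3)) auto

lemma homog_Lam: "homog f g Lam"
 unfolding Lam_def using homog_PL[of "[1..<Suc g]"] by (simp del: upt_Suc)

lemma homog_infinite: "homog f n u ==> infinite K ==> u K = 0"
 using finite_subset[of K "{1..f}"] by (auto simp: homog_def ext_basis_def)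

definition evec :: "nat set => 'r ext" where
 "evec L K = of_bool (K = L)"

lemma wdg_evec_top: "L <= {1..f} ==> wdg (evec L) v {1..f} = isgn L ({1..f} - L) * v ({1..f} - L)"
proof -
 assume L: "L <= {1..f}"
 have "wdg (evec L) v {1..f} = (SUM K:Pow {1..f}. if K = L then isgn K ({1..f} - K) * v ({1..f} - K) else 0)"
  unfolding wdg_def evec_def by (rule sum.cong) auto
 also have "... = isgn L ({1..f} - L) * v ({1..f} - L)" using L by (simp add: sum.delta)
 finally show ?thesis .
qed

lemma t_Wt: "is_idl K ==> range Lam <= K ==> p : {1..f} ==> t p * Wt a {1..f} : K"
proof -
 assume K: "is_idl K" "range Lam <= K" and p: "p : {1..f}"
 have v: "vec1 f (evec {p})" using p by (auto simp: vec1_def evec_def)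
 have "(SUM q:{1..f}. t q * evec {p} {q}) = (SUM q:{1..f}. if q = p then t q else 0)"
  by (rule sum.cong) (auto simp: evec_def)
 also have "... = t p" using p by simp
 finally have "t p * Wt a {1..f} = wdg (evec {p}) (wdg (Dm a) Lam) {1..f}"
  using tau_Wt[OF g_pos v, of a] by simp
 also have "... = wdg (wdg (evec {p}) (Dm a)) Lam {1..f}" by (simp only: wdg_assoc)
 finally show "t p * Wt a {1..f} : K" using Lam_top_idl[OF K] by simp
qed

text \<open>For eps >= 1 the minors are values of \<open>d1\<close> on V^B. For eps = 0 there is no
  V^B, but then f = g + 1, \<open>Lam\<close> is tau of \<open>Wt 0\<close>, and \<open>Wt 0\<close>
  has only its top coordinate; so the minors are multiples of a value of c.\<close>

theorem im0_eq:
 assumes J: "is_idl J" shows "im0 J = idl (J Un range Lam Un cgens)"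
proof
 let ?K = "idl (J Un range Lam Un cgens)"
 have K: "is_idl ?K" "J <= ?K" "range Lam <= ?K" "cgens <= ?K"
  using idl_is_idl idl_sub[of "J Un range Lam Un cgens"] by auto
 show "im0 J <= ?K"
 proof
  fix c assume "c : im0 J"
  then obtain w where w: "inM 1 w" "c - d1 w Top : J" using im0_iff2[OF J] by blast
  have "d1 w Top : ?K" unfolding d1_Top
  proof (rule is_idlD(2)[OF K(1) Lam_top_idl[OF K(1,3)]])
   show "(if 2 * eps + 1 = de then SUM a:exponents g eps. Tc w a {} * Wt a {1..f} else 0) : ?K"
   proof (cases "2 * eps + 1 = de")
    case True
    hence "Wt a {1..f} : ?K" if "a : exponents g eps" for a using K(4) that by (auto simp: cgens_def)
    thus ?thesis using True by (auto intro!: is_idl_sum[OF K(1)] is_idlD(3)[OF K(1)])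
   qed (simp add: is_idlD(1)[OF K(1)])
  qed
  thus "c : ?K" using is_idlD(2)[OF K(1), of "c - d1 w Top" "d1 w Top"] w(2) K(2) by auto
 qed
 note N = im0_idl[OF J]
 have JN: "J <= im0 J"
 proof
  fix c assume "c : J"
  thus "c : im0 J" using im0_iff2[OF J] inM_zero D_scal[of 1 0 0]
   by (auto intro!: exI[of _ 0] simp: d1_Top Bc_def Tc_def wdg_def)
 qed
 have cN: "cgens <= im0 J"
 proof
  fix c assume "c : cgens"
  then obtain a where e: "2 * eps + 1 = de" and a: "a : exponents g eps" "c = Wt a {1..f}"
   by (auto simp: cgens_def split: if_splits)
  define w where "w = mk (%b K. of_bool (b = a & K = {})) 0 (0 :: 'r)"
  have Tw: "Tc w b K = of_bool (b = a & K = {})" and Bw: "Bc w = 0" for b K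
   by (auto simp: w_def mk_def Tc_def Bc_def fun_eq_iff)
  have "inM 1 w"
  proof (unfold inM_def, intro allI impI)
   fix z assume "w z ~= 0"
   hence "z = VT ({}, a)" by (cases z) (auto simp: w_def mk_def prod_eq_iff)
   thus "Mbasis 1 z" using a(1) e by (auto simp: Mbasis_def ok_def chT_def exponents_def)
  qed
  moreover have "d1 w Top = c"
  proof -
   have "(SUM b:exponents g eps. Tc w b {} * Wt b {1..f}) = (SUM b:exponents g eps. if b = a then Wt b {1..f} else 0)"
    by (rule sum.cong) (auto simp: Tw)
   also have "... = c" using a finite_exponents by (simp add: sum.delta)
   finally show ?thesis using e by (simp only: d1_Top Bw wdg_zero_left zero_fun_apply if_True add_0_left simp_thms)
  qed
  ultimately show "c : im0 J" using im0_iff2[OF J] is_idlD(1)[OF J] by fastforce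
 qed
 have LN: "Lam L : im0 J" for L
 proof (cases "Lam L = 0")
  case True
  thus ?thesis using is_idlD(1)[OF N] by simp
 next
  case False
  hence L: "L <= {1..f}" "card L = g" using homog_Lam by (auto simp: homog_def ext_basis_def)
  show ?thesis
  proof (cases "eps = 0")
   case False
   \<comment> \<open>Wedging \<open>Lam\<close> with the basis vector of the complement isolates the
     coordinate at L up to sign.\<close>
   let ?M = "{1..f} - L"
   have M: "{1..f} - ?M = L" "card ?M = de" using L by (auto simp: card_Diff_subset finite_subset[OF L(1)])
   define w where "w = mk 0 (%b K. of_bool (b = 0) * evec ?M K) 0"
   have "inM 1 w"
   proof (unfold inM_def, intro allI impI)
    fix z assume "w z ~= 0"
    hence "z = VB (?M, 0)" by (cases z) (auto simp: w_def mk_def evec_def prod_eq_iff of_bool_def split: if_splits)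
    thus "Mbasis 1 z" using False M by (auto simp: Mbasis_def ok_def chB_def)
   qed
   moreover have "Bc w 0 = evec ?M" "Tc w = 0" by (auto simp: w_def mk_def Bc_def Tc_def fun_eq_iff)
   hence "d1 w Top = isgn ?M L * Lam L" using wdg_evec_top[of ?M Lam] M(1) by (simp add: d1_Top)
   ultimately have "isgn ?M L * Lam L : im0 J" using im0_iff2[OF J] is_idlD(1)[OF J] by fastforce
   hence "isgn ?M L * (isgn ?M L * Lam L) : im0 J" by (rule is_idlD(3)[OF N])
   thus ?thesis by simp
  next
   case True
   hence e: "2 * eps + 1 = de" using eps_less by auto
   have 0: "(0 :: nat => nat) : exponents g eps" using True by (auto simp: exponents_def)
   have Wt0: "Wt 0 {1..f} : im0 J" using cN 0 e by (auto simp: cgens_def)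
   have "Lam = contr f t (Wt 0)" using contr_Wt[OF g_pos, of 0] by (simp add: Dm_0 wdg_one_left homog_infinite[OF homog_Lam])
   moreover have "contr f t (Wt 0) L : im0 J"
    unfolding contr_def
   proof (rule is_idl_sum[OF N], rule is_idlD(3)[OF N])
    fix p assume p: "p : {1..f}"
    show "ann1 p (Wt 0) L : im0 J"
    proof (cases "p : L")
    case False
    have "insert p L = {1..f}"
    by (rule card_subset_eq) (use p L False e True g_less finite_subset[OF L(1)] in auto)
    thus ?thesis using Wt0 False by (simp add: ann1_def is_idlD(3)[OF N])
    qed (simp add: ann1_def is_idlD(1)[OF N])
   qed
   ultimately show ?thesis by simp
  qed
 qed
 show "?K <= im0 J" by (rule idl_least[OF N]) (use JN LN cN in auto)
qed

end

section \<open>Maximal minors as coordinates of an exterior product\<close>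

fun inversions :: "nat list => nat" where
 "inversions [] = 0"
| "inversions (p # ps) = card {q : set ps. q < p} + inversions ps"

lemma inversions_map:
 "strict_mono_on (set ps) h ==> inversions (map h ps) = inversions ps"
proof (induction ps)
 case (Cons p ps)
 have m: "strict_mono_on (set ps) h" using Cons.prems by (auto simp: strict_mono_on_def)
 have lt: "h q < h p <-> q < p" if "q : set ps" for q
  using strict_mono_on_less[OF Cons.prems, of q p] that by simp
 have "{q : set (map h ps). q < h p} = h ` {q : set ps. q < p}" using lt by auto
 moreover have "inj_on h {q : set ps. q < p}"
  by (rule inj_on_subset[OF strict_mono_on_imp_inj_on[OF m]]) auto
 ultimately show ?case using Cons.IH[OF m] by (simp add: card_image)
qed simp

text \<open>The outer induction removes the first entry once it is the least; the inner one, on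
  \<open>sg m\<close> - m, brings the first entry down by adjacent transpositions of values, each
  changing both the sign and the inversion number by one step.\<close>

lemma sign_inversions:
 "m <= n ==> sg permutes {m..<n} ==> sign sg = (-1) ^ inversions (map sg [m..<n])"
proof (induction arbitrary: sg rule: inc_induct)
 case base
 thus ?case by simp
next
 case (step m)
 have "sign sg = (-1) ^ inversions (map sg [m..<n])" if "sg permutes {m..<n}" "sg m = m + d" for d sg
  using that
 proof (induction d arbitrary: sg)
  case 0
  have "sg permutes {Suc m..<n}"
   by (rule permutes_superset[OF 0(1)]) (use 0(2) in "auto simp: le_less_Suc_eq Suc_le_eq")
  hence s: "sign sg = (-1) ^ inversions (map sg [Suc m..<n])" by (rule step.IH)
  have "set (map sg [Suc m..<n]) = {Suc m..<n}" using permutes_image[OF \<open>sg permutes {Suc m..<n}\<close>] by simp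
  hence "{q : set (map sg [Suc m..<n]). q < sg m} = {}" using 0(2) by auto
  hence "card {q : set (map sg [Suc m..<n]). q < sg m} = 0" by (simp only: card.empty)
  thus ?case using s step.hyps by (simp only: upt_conv_Cons list.map inversions.simps add_0)
 next
  case (Suc d)
  \<comment> \<open>The values p and p + 1 are exchanged, p + 1 being the first entry. No later
    entry equals p + 1, so the relative order of the later entries stays and only the first entry
    loses an inversion.\<close>
  define p where "p = m + d"
  have mn: "m : {m..<n}" using step.hyps by simp
  have p: "Suc p = sg m" "p : {m..<n}" "Suc p : {m..<n}"
   using Suc.prems(2) permutes_in_image[OF Suc.prems(1), of m] mn by (auto simp: p_def)
  define sg' where "sg' = transpose p (Suc p) \<circ> sg"
  have sg': "sg' permutes {m..<n}" "sg' m = p"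
   using permutes_compose[OF Suc.prems(1) permutes_swap_id[OF p(2,3)]] by (auto simp: sg'_def p(1)[symmetric])
  have "sign sg' = - sign sg"
   unfolding sg'_def using sign_compose[of "transpose p (Suc p)" sg] permutes_imp_permutation[OF _ Suc.prems(1)]
   by (simp add: permutation_swap_id sign_swap_id)
  let ?t = "map sg [Suc m..<n]" and ?t' = "map sg' [Suc m..<n]"
  have nt: "Suc p ~: set ?t"
  proof
   assume "Suc p : set ?t"
   then obtain j where "j : {Suc m..<n}" "sg j = sg m" using p(1) by auto
   hence "j = m" using permutes_inj[OF Suc.prems(1)] by (simp add: inj_eq)
   thus False using \<open>j : {Suc m..<n}\<close> by simp
  qed
  have t': "?t' = map (transpose p (Suc p)) ?t" by (simp add: sg'_def)
  have "strict_mono_on (set ?t) (transpose p (Suc p))"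
   unfolding strict_mono_on_def
  proof (intro allI impI)
   fix r s assume "r : set ?t & s : set ?t & r < s"
   hence "r : set ?t" "s : set ?t" "r < s" by auto
   moreover have "r ~= Suc p" "s ~= Suc p" using nt calculation by blast+
   ultimately show "transpose p (Suc p) r < transpose p (Suc p) s" by (auto simp: transpose_def)
  qed
  hence inv: "inversions ?t' = inversions ?t" unfolding t' by (rule inversions_map)
  have im: "set ?t = {m..<n} - {Suc p}" "set ?t' = {m..<n} - {p}"
  proof -
   have e: "{Suc m..<n} = {m..<n} - {m}" by auto
   have "sg ` ({m..<n} - {m}) = {m..<n} - {sg m}"
    using permutes_image[OF Suc.prems(1)] permutes_inj[OF Suc.prems(1)] by (simp add: image_set_diff)
   thus "set ?t = {m..<n} - {Suc p}" using e p(1) by simp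
   have "sg' ` ({m..<n} - {m}) = {m..<n} - {sg' m}"
    using permutes_image[OF sg'(1)] permutes_inj[OF sg'(1)] by (simp add: image_set_diff)
   thus "set ?t' = {m..<n} - {p}" using e sg'(2) by simp
  qed
  have "{q : set ?t. q < sg m} = {m..<Suc p}" "{q : set ?t'. q < sg' m} = {m..<p}"
   unfolding im p(1)[symmetric] sg'(2) using p(2,3) by auto
  hence c: "card {q : set ?t. q < sg m} = Suc d" "card {q : set ?t'. q < sg' m} = d"
   by (simp_all add: p_def)
  have e: "[m..<n] = m # [Suc m..<n]" using step.hyps by (simp add: upt_conv_Cons)
  have "inversions (map sg [m..<n]) = Suc d + inversions ?t" "inversions (map sg' [m..<n]) = d + inversions ?t'"
   unfolding e list.map(2) inversions.simps c by simp_all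
  thus ?case using Suc.IH[OF sg'(1)] sg'(2) \<open>sign sg' = - sign sg\<close> inv p_def by simp
 qed
 moreover have "m <= sg m" using permutes_in_image[OF step.prems, of m] step.hyps by simp
 ultimately show ?case using step.prems by (metis le_add_diff_inverse)
qed

text \<open>Expanding one factor at a time lists the elements of L in some order; choosing p first
  costs the number of smaller elements still to come, and these numbers add up to the inversions of
  the list.\<close>

lemma foldr_wdg_leibniz:
 assumes "!!u K. u : set us ==> u K ~= 0 ==> EX p. K = {p}" and "finite L" and "card L = length us"
 shows "foldr wdg us wdg_one L =
  (SUM ps:permutations_of_set L. (-1) ^ inversions ps * prod_list (map2 (%u p. u {p}) us ps))"
 using assms
proof (induction us arbitrary: L)
 case Nil
 thus ?case by (simp add: wdg_one_def)
next
 case (Cons u us)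
 let ?v = "foldr wdg us wdg_one"
 let ?F = "%us ps. (-1) ^ inversions ps * prod_list (map2 (%u p. u {p}) us ps)"
 have L: "L ~= {}" using Cons.prems(3) by auto
 have "wdg u ?v L = (SUM K:(%p. {p}) ` L. isgn K (L - K) * (u K * ?v (L - K)))"
  unfolding wdg_def[of u ?v]
 proof (rule sum.mono_neutral_right)
  show "ALL K:Pow L - (%p. {p}) ` L. isgn K (L - K) * (u K * ?v (L - K)) = 0"
  proof
   fix K assume K: "K : Pow L - (%p. {p}) ` L"
   have "u K = 0" using Cons.prems(1)[of u K] K by auto
   thus "isgn K (L - K) * (u K * ?v (L - K)) = 0" by simp
  qed
 qed (use Cons.prems(2) in auto)
 also have "... = (SUM p:L. isgn {p} (L - {p}) * (u {p} * ?v (L - {p})))"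
  by (subst sum.reindex) auto
 also have "... = (SUM p:L. SUM ps:permutations_of_set (L - {p}). ?F (u # us) (p # ps))"
 proof (rule sum.cong)
  fix p assume p: "p : L"
  have "?v (L - {p}) = (SUM ps:permutations_of_set (L - {p}). ?F us ps)"
   using Cons.prems p by (intro Cons.IH) auto
  hence "isgn {p} (L - {p}) * (u {p} * ?v (L - {p})) =
    (SUM ps:permutations_of_set (L - {p}). isgn {p} (L - {p}) * (u {p} * ?F us ps))"
   by (simp only: sum_distrib_left)
  also have "... = (SUM ps:permutations_of_set (L - {p}). ?F (u # us) (p # ps))"
  proof (rule sum.cong[OF refl])
   fix ps assume "ps : permutations_of_set (L - {p})"
   hence "set ps = L - {p}" by (rule permutations_of_setD)
   thus "isgn {p} (L - {p}) * (u {p} * ?F us ps) = ?F (u # us) (p # ps)"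
    by (simp add: isgn_single_card power_add ac_simps)
  qed
  finally show "isgn {p} (L - {p}) * (u {p} * ?v (L - {p})) = (SUM ps:permutations_of_set (L - {p}). ?F (u # us) (p # ps))" .
 qed simp
 also have "... = (SUM p:L. SUM ps:(#) p ` permutations_of_set (L - {p}). ?F (u # us) ps)"
  by (rule sum.cong) (auto simp: sum.reindex)
 also have "... = (SUM ps:(UN p:L. (#) p ` permutations_of_set (L - {p})). ?F (u # us) ps)"
  by (rule sum.UNION_disjoint[symmetric]) (use Cons.prems(2) in auto)
 also have "(UN p:L. (#) p ` permutations_of_set (L - {p})) = permutations_of_set L"
  using permutations_of_set_nonempty[OF L] by simp
 finally show ?case by simp
qed

context complex_data
begin

text \<open>Orderings of the column set correspond to permutations through the increasing
  enumeration \<open>ka\<close>, which preserves inversions. This matches the Leibniz formula that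
  defines \<open>ring_det\<close>.\<close>

lemma Lam_det:
 assumes ka: "ka : {1..g} \<rightarrow> {1..f}" "strict_mono_on {1..g} ka"
 shows "Lam (ka ` {1..g}) = (SUM sg:{sg. sg permutes {1..g}}.
   (if evenperm sg then 1 else - 1) * (PROD i:{1..g}. psi i {ka (sg i)}))"
proof -
 let ?L = "ka ` {1..g}" and ?ls = "[1..<Suc g]"
 let ?F = "%ps. (-1) ^ inversions ps * prod_list (map2 (%u p. u {p}) (map psi ?ls) ps)"
 have ls: "{1..<Suc g} = {1..g}" "set ?ls = {1..g}" by auto
 have inj: "inj_on ka {1..g}" by (rule strict_mono_on_imp_inj_on[OF ka(2)])
 have cL: "card ?L = g" using card_image[OF inj] by simp
 have "Lam ?L = (SUM ps:permutations_of_set ?L. ?F ps)"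
  unfolding Lam_def PL_def
 proof (rule foldr_wdg_leibniz)
  show "EX p. K = {p}" if "u : set (map psi ?ls)" "u K ~= 0" for u K
   using that psi_vec1 unfolding vec1_def by fastforce
 qed (use cL in "simp_all del: upt_Suc")
 also have "... = (SUM sg:{sg. sg permutes {1..g}}. ?F (map (ka \<circ> sg) ?ls))"
 proof -
  let ?h = "%sg. map (ka \<circ> sg) ?ls" and ?P = "{sg. sg permutes {1..g}}"
  have injh: "inj_on ?h ?P"
  proof (rule inj_onI)
   fix sg sg' assume s: "sg : ?P" "sg' : ?P" "?h sg = ?h sg'"
   have "sg i = sg' i" if i: "i : {1..g}" for i
   proof -
    have "ka (sg i) = ka (sg' i)" using s(3) i ls(2) by (auto simp del: upt_Suc)
    thus ?thesis using inj s(1,2) permutes_in_image i by (metis inj_onD mem_Collect_eq)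
   qed
   moreover have "sg i = sg' i" if "i ~: {1..g}" for i
    using s(1,2) that by (metis mem_Collect_eq permutes_not_in)
   ultimately show "sg = sg'" by blast
  qed
  have sub: "?h ` ?P <= permutations_of_set ?L"
  proof
   fix ps assume "ps : ?h ` ?P"
   then obtain sg where s: "sg permutes {1..g}" "ps = ?h sg" by blast
   have "set ps = ?L" using s ls(2) permutes_image[OF s(1)] by (simp only: set_map image_comp[symmetric])
   moreover have "distinct ps"
    using s(2) ls(2) comp_inj_on[OF permutes_inj_on[OF s(1)], of ka] permutes_image[OF s(1)] inj
    by (simp add: distinct_map del: upt_Suc)
   ultimately show "ps : permutations_of_set ?L" by (rule permutations_of_setI)
  qed
  \<comment> \<open>An injection between finite sets of the same size g! is onto.\<close>
  have "card (?h ` ?P) = card (permutations_of_set ?L)"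
   using card_image[OF injh] card_permutations[of "{1..g}" g] cL by simp
  hence "?h ` ?P = permutations_of_set ?L" by (intro card_subset_eq sub) auto
  thus ?thesis using sum.reindex[OF injh, of ?F] by (simp only: o_def)
 qed
 also have "... = (SUM sg:{sg. sg permutes {1..g}}.
   (if evenperm sg then 1 else - 1) * (PROD i:{1..g}. psi i {ka (sg i)}))"
 proof (rule sum.cong[OF refl])
  fix sg assume "sg : {sg. sg permutes {1..g}}"
  hence s: "sg permutes {1..g}" by simp
  have "set (map sg ?ls) = {1..g}" using permutes_image[OF s] ls(2) by simp
  hence "inversions (map (ka \<circ> sg) ?ls) = inversions (map sg ?ls)"
   using inversions_map[of "map sg ?ls" ka] ka(2) by (simp del: upt_Suc)
  moreover have "sign sg = (-1) ^ inversions (map sg ?ls)"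
   using sign_inversions[of 1 "Suc g" sg] s ls(1) by simp
  hence "even (inversions (map sg ?ls)) <-> evenperm sg"
   by (cases "even (inversions (map sg ?ls))") (auto simp: sign_def split: if_splits)
  ultimately have 1: "(-1 :: 'r) ^ inversions (map (ka \<circ> sg) ?ls) = (if evenperm sg then 1 else - 1)"
   by (cases "even (inversions (map sg ?ls))") auto
  have "map2 (%u p. u {p}) (map psi ?ls) (map (ka \<circ> sg) ?ls) = map (%i. psi i {ka (sg i)}) ?ls"
   by (simp add: list_eq_iff_nth_eq del: upt_Suc)
  hence 2: "prod_list (map2 (%u p. u {p}) (map psi ?ls) (map (ka \<circ> sg) ?ls)) = (PROD i:{1..g}. psi i {ka (sg i)})"
   using prod.distinct_set_conv_list[OF distinct_upt, of "%i. psi i {ka (sg i)}" 1 "Suc g"] ls by (simp only:)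
  show "?F (map (ka \<circ> sg) ?ls) = (if evenperm sg then 1 else - 1) * (PROD i:{1..g}. psi i {ka (sg i)})"
   unfolding 1 2 ..
 qed
 finally show ?thesis .
qed

end

section \<open>Grade and regular sequences in the given ring\<close>

definition weak_regseq :: "('a,'x) ring_scheme => 'a list => bool" where
 "weak_regseq R xs <-> set xs <= carrier R &
   (ALL i<length xs. ALL r:carrier R.
    r \<otimes>\<^bsub>R\<^esub> (xs ! i) : Idl\<^bsub>R\<^esub> (set (take i xs)) --> r : Idl\<^bsub>R\<^esub> (set (take i xs)))"

context cring
begin

lemma idealI':
 assumes "J <= carrier R" "\<zero> : J" "!!a b. a : J ==> b : J ==> a \<oplus> b : J"
  and m: "!!r a. r : carrier R ==> a : J ==> r \<otimes> a : J"
 shows "ideal J R"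
proof (rule idealI[OF ring_axioms])
 show "subgroup J (add_monoid R)"
 proof
  show "inv\<^bsub>add_monoid R\<^esub> x : J" if "x : J" for x
   using m[of "\<ominus> \<one>" x] that assms(1) by (auto simp: l_minus a_inv_def[symmetric])
 qed (use assms in auto)
 fix a x assume "a : J" "x : carrier R"
 thus "x \<otimes> a : J" "a \<otimes> x : J" using m[of x a] assms(1) by (auto simp: m_comm[of a])
qed

lemma finsum_ideal:
 assumes "ideal J R" "finite A" "v : A \<rightarrow> J"
 shows "(\<Oplus>i\<in>A. v i) : J"
 using assms(2,3)
proof (induction A rule: finite_induct)
 interpret J: ideal J R by fact
 case (insert a A)
 hence "v : A \<rightarrow> carrier R" using J.a_subset by blast
 thus ?case using insert J.a_subset by (simp add: subset_eq)
qed (simp add: additive_subgroup.zero_closed[OF ideal.axioms(1)[OF assms(1)]])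

lemma weak_regseq_take: "weak_regseq R xs ==> weak_regseq R (take n xs)"
 unfolding weak_regseq_def by (auto simp: min_def dest: in_set_takeD)

text \<open>With properness dropped, units count as regular, so the unit ideal, of infinite grade,
  contains weak sequences of every length.\<close>

lemma weak_regseq_ones: "weak_regseq R (replicate n \<one>)"
 unfolding weak_regseq_def by auto

text \<open>For a proper ideal the supremum yields a regular sequence of length at least n, which is
  cut to length n; the unit ideal is served by a sequence of ones.\<close>

lemma grade_weak_regseq:
 assumes "ideal I R" "enat n <= grade R I"
 shows "EX xs. weak_regseq R xs & length xs = n & set xs <= I"
proof (cases "I = carrier R")
 case True
 thus ?thesis using weak_regseq_ones[of n] by (intro exI[of _ "replicate n \<one>"]) auto
next
 case False
 show ?thesis
 proof (cases n)
  case 0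
  thus ?thesis by (intro exI[of _ "[]"]) (auto simp: weak_regseq_def)
 next
  case (Suc m)
  let ?A = "{enat (length xs) | xs. regular_sequence R xs & set xs <= I}"
  have "EX xs. regular_sequence R xs & n <= length xs & set xs <= I"
  proof (rule ccontr)
   assume c: "~ ?thesis"
   have "x <= enat m" if "x : ?A" for x using that c Suc by fastforce
   hence "Sup ?A <= enat m" by (rule Sup_least)
   thus False using assms(2) False Suc by (auto simp: grade_def dest: order_trans)
  qed
  then obtain xs where xs: "regular_sequence R xs" "n <= length xs" "set xs <= I" by blast
  have "weak_regseq R xs" using xs(1) by (auto simp: regular_sequence_def weak_regseq_def)
  thus ?thesis using weak_regseq_take[of xs n] xs
   by (intro exI[of _ "take n xs"]) (auto dest: in_set_takeD)
 qed
qed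

lemma weak_regseq_grade:
 assumes "ideal I R" "weak_regseq R xs" "set xs <= I"
 shows "enat (length xs) <= grade R I"
proof (cases "I = carrier R")
 case False
 have "Idl (set xs) <= I" by (rule genideal_minimal[OF assms(1,3)])
 moreover have "I <= carrier R" using assms(1) by (simp add: additive_subgroup.a_subset ideal_def)
 ultimately have "regular_sequence R xs" using assms(2) False
  by (auto simp: regular_sequence_def weak_regseq_def)
 thus ?thesis using assms(3) False by (auto simp: grade_def intro!: Sup_upper)
qed (simp add: grade_def)

end

context ring_cover
begin

definition K0 :: "'r set" where "K0 = {u. ev u = \<zero>}"

lemma is_idl_vimage:
 assumes "ideal I R" shows "is_idl (ev -` I)" "K0 <= ev -` I"
proof -
 interpret ideal I R by (rule assms)
 show "is_idl (ev -` I)" unfolding is_idl_def by (auto simp: ev_zero ev_add ev_mult I_l_closed)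
 show "K0 <= ev -` I" by (auto simp: K0_def)
qed

lemma K0_idl: "is_idl K0"
 unfolding is_idl_def K0_def by (auto simp: ev_zero ev_add ev_mult)

lemma ideal_image:
 assumes K: "is_idl K" shows "ideal (ev ` K) R"
proof (rule idealI')
 show "\<zero> : ev ` K" using is_idlD(1)[OF K] ev_zero by (auto intro!: image_eqI[of _ _ 0])
 show "x \<oplus> y : ev ` K" if "x : ev ` K" "y : ev ` K" for x y
  using that is_idlD(2)[OF K] by (auto simp: ev_add[symmetric])
 show "x \<otimes> a : ev ` K" if x: "x : carrier R" and a: "a : ev ` K" for x a
  using ev_surj[OF x] a is_idlD(3)[OF K] by (auto simp: ev_mult[symmetric])
qed auto

lemma ev_image_carrier: "ev ` A <= carrier R"
 by auto

lemmas Idl_ev_ideal = genideal_ideal[OF ev_image_carrier]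
lemmas Idl_ev_self = genideal_self[OF ev_image_carrier]

lemma idl_ev: "u : idl (K0 Un A) <-> ev u : Idl (ev ` A)"
proof
 have I: "ideal (Idl (ev ` A)) R" by (rule genideal_ideal) auto
 have "idl (K0 Un A) <= ev -` (Idl (ev ` A))"
  using is_idl_vimage[OF I] Idl_ev_self[of A] by (intro idl_least) auto
 thus "u : idl (K0 Un A) ==> ev u : Idl (ev ` A)" by blast
 assume "ev u : Idl (ev ` A)"
 moreover have "Idl (ev ` A) <= ev ` idl (K0 Un A)"
  by (rule genideal_minimal[OF ideal_image[OF idl_is_idl]]) (use idl_sub[of "K0 Un A"] in auto)
 ultimately obtain v where v: "v : idl (K0 Un A)" "ev u = ev v" by blast
 have "u - v : K0" using v(2) by (simp add: K0_def ev_minus)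
 hence "u - v : idl (K0 Un A)" using idl_sub by blast
 thus "u : idl (K0 Un A)" using is_idlD(2)[OF idl_is_idl _ v(1)] by fastforce
qed

lemma adjs_eq_idl: "is_idl J ==> adjs J as = idl (J Un set as)"
 using adjs_least[OF _ idl_is_idl, of J "J Un set as" as] idl_sub[of "J Un set as"]
  idl_least[OF adjs_idl, of J "J Un set as" as] adjs_sub[of J as] adjs_set[of J as] by auto

lemma adjs_ev: "u : adjs K0 as <-> ev u : Idl (set (map ev as))"
 by (simp add: adjs_eq_idl[OF K0_idl] idl_ev)

lemma map_lift:
 assumes "set xs <= carrier R" obtains as where "map ev as = xs"
proof -
 have "EX as. map ev as = xs" using assms
 proof (induction xs)
  case (Cons x xs)
  then obtain as u where "map ev as = xs" "ev u = x" using ev_surj[of x] by auto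
  thus ?case by (intro exI[of _ "u # as"]) auto
 qed simp
 thus thesis using that by blast
qed

lemma regseq_lift:
 assumes "weak_regseq R (map ev as)" shows "regseq {1} K0 as"
 unfolding regseq_nth
proof (intro allI impI)
 fix i assume i: "i < length as"
 show "reg {1} (adjs K0 (take i as)) (as ! i)"
  unfolding reg_def adjs_ev using assms i
  by (auto simp: weak_regseq_def take_map ev_mult m_comm)
qed

end

context complex_cover
begin

lemma strict_mono_id:
 assumes "rho : {1..n} \<rightarrow> {1..n}" "strict_mono_on {1..n} rho" "i : {1..n}"
 shows "rho i = (i::nat)"
proof -
 have "j <= rho j" if "j : {1..n}" for j
  using that
 proof (induction j)
  case (Suc j)
  show ?case
  proof (cases "j = 0")
   case True
   thus ?thesis using assms(1) Suc.prems by auto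
  next
   case False
   hence "rho j < rho (Suc j)" using Suc.prems by (intro strict_mono_onD[OF assms(2)]) auto
   thus ?thesis using Suc False by auto
  qed
 qed simp
 moreover have "rho (n - j) <= n - j" if "j < n" for j
  using that
 proof (induction j)
  case 0
  thus ?case using assms(1) by auto
 next
  case (Suc j)
  have "rho (n - Suc j) < rho (n - j)" using Suc.prems by (intro strict_mono_onD[OF assms(2)]) auto
  thus ?case using Suc by auto
 qed
 from this[of "n - i"] have "rho i <= i" using assms(3) by auto
 ultimately show ?thesis using assms(3) by (simp add: le_antisym)
qed

text \<open>All g rows are used, so the increasing row selection \<open>rho\<close> is the identity,
  and only the choice of columns matters.\<close>

lemma ev_Lam:
 assumes "ka : {1..g} \<rightarrow> {1..f}" "strict_mono_on {1..g} ka" "rho : {1..g} \<rightarrow> {1..g}" "strict_mono_on {1..g} rho"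
 shows "ring_det R g (%i k. Psi R f tR xR (rho i) {ka k}) = ev (Lam (ka ` {1..g}))"
proof -
 have P: "Psi R f tR xR i K = ev (psi i K)" if "i : {1..g}" for i K
  using E_psi[OF that] by metis
 have s: "ev (if evenperm sg then 1 else - 1) = (if evenperm sg then \<one> else \<ominus> \<one>)" for sg :: "nat => nat"
  by (simp add: ev_one ev_uminus)
 have p: "(\<Otimes>i\<in>{1..g}. Psi R f tR xR (rho i) {ka (sg i)}) = (\<Otimes>i\<in>{1..g}. ev (psi i {ka (sg i)}))" for sg
  by (rule finprod_cong') (use P strict_mono_id[OF assms(3,4)] in auto)
 show ?thesis unfolding Lam_det[OF assms(1,2)] ev_sum ev_mult ev_prod s ring_det_def p ..
qed

lemma Ig_eq: "Psi_minors R f g tR xR = Idl (ev ` range Lam)"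
proof -
 let ?S = "{ring_det R g (%i k. Psi R f tR xR (rho i) {ka k}) | rho ka.
   rho : {1..g} \<rightarrow> {1..g} & strict_mono_on {1..g} rho &
   ka : {1..g} \<rightarrow> {1..f} & strict_mono_on {1..g} ka}"
 have 1: "?S <= ev ` range Lam"
 proof
  fix a assume "a : ?S"
  then obtain rho ka where "a = ring_det R g (%i k. Psi R f tR xR (rho i) {ka k})"
   "rho : {1..g} \<rightarrow> {1..g}" "strict_mono_on {1..g} rho" "ka : {1..g} \<rightarrow> {1..f}" "strict_mono_on {1..g} ka"
   by blast
  thus "a : ev ` range Lam" using ev_Lam[of ka rho] by simp
 qed
 have cS: "?S <= carrier R"
  by (rule order_trans[OF 1]) (rule image_subsetI, rule ev_closed)
 have 2: "ev ` range Lam <= Idl ?S"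
 proof (intro image_subsetI, elim rangeE)
  fix u L assume "u = Lam L"
  show "ev u : Idl ?S"
  proof (cases "Lam L = 0")
   case True
   thus ?thesis using \<open>u = Lam L\<close> ideal.axioms(1)[OF genideal_ideal[OF cS]]
    by (simp add: ev_zero additive_subgroup.zero_closed)
  next
   case False
   hence L: "L <= {1..f}" "card L = g" using homog_Lam by (auto simp: homog_def ext_basis_def)
   have fL: "finite L" using L(1) finite_subset by blast
   \<comment> \<open>The increasing enumeration of L; the shift by one is due to lists being indexed
     from 0.\<close>
   define ka where "ka i = sorted_list_of_set L ! (i - 1)" for i
   have len: "length (sorted_list_of_set L) = g" using L fL by simp
   have im: "ka ` {1..g} = L"
   proof -
    have "ka i : L" if "i : {1..g}" for i
    using nth_mem[of "i - 1" "sorted_list_of_set L"] that len fL by (auto simp: ka_def)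
    moreover have "p : ka ` {1..g}" if p: "p : L" for p
    proof -
    have "p : set (sorted_list_of_set L)" using p fL by simp
    then obtain i where "i < g" "sorted_list_of_set L ! i = p" unfolding in_set_conv_nth len by blast
    thus ?thesis by (intro image_eqI[of _ _ "Suc i"]) (auto simp: ka_def)
    qed
    ultimately show ?thesis by blast
   qed
   have mono: "strict_mono_on {1..g} ka"
    unfolding strict_mono_on_def ka_def
    using strict_sorted_list_of_set[of L] len by (auto simp: sorted_wrt_iff_nth_less)
   have k: "ka : {1..g} \<rightarrow> {1..f}" using im L(1) by blast
   have "ev (Lam L) = ring_det R g (%i k. Psi R f tR xR (id i) {ka k})"
    using ev_Lam[OF k mono, of id] im by (auto simp: strict_mono_on_def)
   moreover have "ring_det R g (%i k. Psi R f tR xR (id i) {ka k}) : ?S"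
    using k mono by (intro CollectI exI[of _ id] exI[of _ ka]) (auto simp: strict_mono_on_def)
   ultimately show ?thesis using genideal_self[OF cS] \<open>u = Lam L\<close> by auto
  qed
 qed
 have "Idl ?S = Idl (ev ` range Lam)"
 proof
  show "Idl ?S <= Idl (ev ` range Lam)"
   by (rule genideal_minimal[OF Idl_ev_ideal order_trans[OF 1 Idl_ev_self]])
  show "Idl (ev ` range Lam) <= Idl ?S" by (rule genideal_minimal[OF genideal_ideal[OF cS] 2])
 qed
 thus ?thesis by (simp add: Psi_minors_def minors_ideal_def)
qed

text \<open>The ideal whose quotient is resolved: generated by the minors and, when 2 eps + 1 = f -
  g, by the values of c.\<close>

definition NR :: "'a set" where "NR = ev ` im0 K0"

lemma im0_K0: "u : im0 K0 <-> ev u : Idl (ev ` (range Lam Un cgens))"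
 unfolding im0_eq[OF K0_idl] Un_assoc by (rule idl_ev)

lemma NR_eq: "NR = Idl (ev ` (range Lam Un cgens))"
proof -
 have c: "Idl (ev ` (range Lam Un cgens)) <= carrier R"
  by (rule additive_subgroup.a_subset[OF ideal.axioms(1)[OF Idl_ev_ideal]])
 show ?thesis
 proof (intro equalityI subsetI)
  fix a assume "a : NR"
  thus "a : Idl (ev ` (range Lam Un cgens))" using im0_K0 by (auto simp only: NR_def)
 next
  fix a assume a: "a : Idl (ev ` (range Lam Un cgens))"
  then obtain u where "ev u = a" using ev_surj c by blast
  thus "a : NR" using a im0_K0[of u] by (auto simp only: NR_def)
 qed
qed

lemma im0_ev: "u : im0 K0 <-> ev u : NR"
 by (simp add: im0_K0 NR_eq)

end

text \<open>The condition satisfied by the numerators of a regular sequence in the localization at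
  S, stated in the ring itself.\<close>

definition S_regseq :: "('a,'x) ring_scheme => 'a set => 'a list => bool" where
 "S_regseq R S xs <-> set xs <= carrier R &
   (ALL i<length xs. ALL r:carrier R.
    r \<otimes>\<^bsub>R\<^esub> (xs ! i) : Idl\<^bsub>R\<^esub> (set (take i xs)) --> (EX s:S. s \<otimes>\<^bsub>R\<^esub> r : Idl\<^bsub>R\<^esub> (set (take i xs))))"

lemma (in cring) weak_S_regseq: "weak_regseq R xs ==> \<one> : S ==> S_regseq R S xs"
 unfolding weak_regseq_def S_regseq_def by (auto intro!: bexI[of _ \<one>])

lemma (in cring) colon_elt_ideal:
 assumes I: "ideal I R" and c: "c : carrier R" shows "ideal {a : carrier R. a \<otimes> c : I} R"
proof -
 interpret N: ideal I R by (rule I)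
 show ?thesis by (rule idealI') (use c N.I_l_closed in "auto simp: l_distr m_assoc")
qed

section \<open>Membership in the resolved ideal\<close>

locale exact_cover = complex_cover +
 assumes grade_Ig: "EX xs. weak_regseq R xs & length xs = f - g & set xs <= Idl (ev ` range Lam)"
  and grade_I1: "EX ys. weak_regseq R ys & length ys = f & set ys <= Idl (tR ` {1..f})"
begin

abbreviation IgR :: "'a set" where "IgR \<equiv> Idl (ev ` range Lam)"
abbreviation I1R :: "'a set" where "I1R \<equiv> Idl (tR ` {1..f})"

lemma tR_image: "tR ` {1..f} = ev ` t ` {1..f}"
 using tR by (auto simp: image_image)

lemma tR_closed: "p : {1..f} ==> tR p : carrier R"
 using tR ev_closed by metis

lemma I1R_ideal: "ideal I1R R"
 unfolding tR_image by (rule Idl_ev_ideal)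

lemma acyclic: "k >= 1 ==> tors {1} K0 k"
proof -
 assume k: "k >= 1"
 obtain xs where xs: "weak_regseq R xs" "length xs = f - g" "set xs <= IgR" using grade_Ig by blast
 obtain ys where ys: "weak_regseq R ys" "length ys = f" "set ys <= I1R" using grade_I1 by blast
 have "set xs <= carrier R" "set ys <= carrier R" using xs ys by (auto simp: weak_regseq_def)
 then obtain as bs where l: "map ev as = xs" "map ev bs = ys" using map_lift by metis
 show ?thesis
 proof (rule exact[OF K0_idl regseq_lift _ _ regseq_lift _ _ k])
  show "weak_regseq R (map ev as)" "weak_regseq R (map ev bs)" using l xs ys by simp_all
  show "length as = f - g" "length bs = f" using l xs ys by auto
  show "set as <= idl (K0 Un range Lam)"
  proof
   fix a assume "a : set as"
   hence "ev a : set xs" using l by auto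
   thus "a : idl (K0 Un range Lam)" unfolding idl_ev using xs(3) by blast
  qed
  show "set bs <= idl (K0 Un t ` {1..f})"
  proof
   fix a assume "a : set bs"
   hence "ev a : set ys" using l by auto
   thus "a : idl (K0 Un t ` {1..f})" unfolding idl_ev using ys(3) tR_image by auto
  qed
 qed
qed

lemma NR_ideal: "ideal NR R"
 unfolding NR_eq by (rule Idl_ev_ideal)

lemma IgR_ideal: "ideal IgR R"
 by (rule Idl_ev_ideal)

lemma IgR_NR: "IgR <= NR"
 unfolding NR_eq by (rule genideal_minimal[OF Idl_ev_ideal]) (use Idl_ev_self[of "range Lam Un cgens"] in auto)

text \<open>For minors this is clear, and t p times a value of c is a combination of minors by
  \<open>t_Wt\<close>.\<close>

lemma t_NR:
 assumes p: "p : {1..f}" and c: "c : NR" shows "tR p \<otimes> c : IgR"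
proof -
 let ?I = "idl (K0 Un range Lam)"
 note I = idl_is_idl[of "K0 Un range Lam"] and s = idl_sub[of "K0 Un range Lam"]
 let ?K = "{u. t p * u : ?I}"
 have "is_idl ?K" unfolding is_idl_def
  using is_idlD[OF I] by (auto simp: distrib_left mult.left_commute)
 moreover have "K0 Un range Lam Un cgens <= ?K"
  using s is_idlD(3)[OF I] t_Wt[OF I _ p] by (auto simp: cgens_def split: if_splits)
 ultimately have "im0 K0 <= ?K" unfolding im0_eq[OF K0_idl] by (rule idl_least)
 moreover obtain u where u: "u : im0 K0" "c = ev u" using c by (auto simp: NR_def)
 ultimately have "t p * u : ?I" by blast
 thus ?thesis unfolding idl_ev by (simp add: u(2) tR[OF p, symmetric] ev_mult)
qed

text \<open>The chase starts in position 0 and ends in position \<open>length bs\<close>. There the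
  homology must vanish up to S: either a value of tau on the basis lies in S and the position
  exceeds f - g, or the position is past the end of the complex.\<close>

theorem NR_chase:
 assumes S: "S <= carrier R" "\<one> : S" "!!a b. a : S ==> b : S ==> a \<otimes> b : S"
  and bs: "S_regseq R S bs" and c: "c : carrier R" and ann: "!!b. b : set bs ==> b \<otimes> c : NR"
  and top: "(EX q:{1..f}. tR q : S) | f + 2 * eps < length bs + (f - g) + 1" "f - g < length bs"
 shows "EX s:S. s \<otimes> c : NR"
proof -
 let ?S = "ev -` S"
 have S': "mult_set ?S" using S by (auto simp: mult_set_def ev_one ev_mult)
 obtain as where as: "map ev as = bs" using bs map_lift by (auto simp: S_regseq_def)
 obtain u where u: "ev u = c" using c ev_surj by blast
 have "EX s:?S. s * u : im0 K0"
 proof (rule im0_chase[OF S' K0_idl])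
  show "regseq ?S K0 as" unfolding regseq_nth
  proof (intro allI impI)
   fix i assume i: "i < length as"
   show "reg ?S (adjs K0 (take i as)) (as ! i)"
    unfolding reg_def
   proof (intro allI impI)
    fix r assume "as ! i * r : adjs K0 (take i as)"
    hence "ev r \<otimes> bs ! i : Idl (set (take i bs))"
    using i as by (auto simp: adjs_ev ev_mult m_comm take_map)
    then obtain s where s: "s : S" "s \<otimes> ev r : Idl (set (take i bs))"
    using bs i as ev_closed unfolding S_regseq_def by (metis length_map)
    obtain s' where "ev s' = s" using s(1) S(1) ev_surj by blast
    thus "EX s:?S. s * r : adjs K0 (take i as)"
    using s as by (intro bexI[of _ s']) (auto simp: adjs_ev ev_mult take_map)
   qed
  qed
  show "EX s:?S. s * a * u : im0 K0" if "a : set as" for a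
   using ann[of "ev a"] that as S by (intro bexI[of _ 1]) (auto simp: im0_ev ev_mult ev_one u)
  show "tors {1} K0 k" if "k >= 1" for k by (rule acyclic[OF that])
  show "tors ?S (adjs K0 as) (length as)"
  proof (cases "EX q:{1..f}. tR q : S")
   case True
   then obtain q where q: "q : {1..f}" "t q : ?S" using tR by auto
   show ?thesis by (rule tors_high[OF adjs_idl[OF K0_idl] q]) (use top as in auto)
  next
   case False
   thus ?thesis using top as S' by (intro tors_zero adjs_idl K0_idl) auto
  qed
 qed
 thus ?thesis by (auto simp: im0_ev ev_mult u)
qed

text \<open>Because 2 eps <= f - g, the complex is zero in position f, so a chase along f elements
  of the ideal of tau ends in a zero module and needs no multiplier.\<close>

lemma NR_colon:
 assumes e: "2 * eps <= f - g" and c: "c : carrier R" and t: "!!q. q : {1..f} ==> tR q \<otimes> c : NR"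
 shows "c : NR"
proof -
 interpret N: ideal NR R by (rule NR_ideal)
 obtain ys where ys: "weak_regseq R ys" "length ys = f" "set ys <= I1R" using grade_I1 by blast
 have "ideal {a : carrier R. a \<otimes> c : NR} R" by (rule colon_elt_ideal[OF NR_ideal c])
 hence "I1R <= {a : carrier R. a \<otimes> c : NR}"
  by (rule genideal_minimal) (use t tR_closed in auto)
 hence "EX s:{\<one>}. s \<otimes> c : NR"
  using ys e c by (intro NR_chase[of _ ys] weak_S_regseq) (use g_less g_pos in auto)
 thus ?thesis using c by simp
qed

text \<open>Induction on the total exponent. Multiplying c by \<open>tR q\<close> lowers the
  exponent required at q by one, so every \<open>tR q \<otimes> c\<close> lies in the ideal, and
  \<open>NR_colon\<close> applies.\<close>

lemma NR_saturated:
 fixes n :: "nat => nat"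
 assumes e: "2 * eps <= f - g"
 shows "c : carrier R ==> (!!q. q : {1..f} ==> tR q [^] n q \<otimes> c : NR) ==> c : NR"
proof (induction "sum n {1..f}" arbitrary: n c rule: less_induct)
 case less
 show ?case
 proof (cases "EX q:{1..f}. n q = 0")
  case True
  thus ?thesis using less.prems by fastforce
 next
  case False
  show ?thesis
  proof (rule NR_colon[OF e less.prems(1)])
   fix q assume q: "q : {1..f}"
   let ?n = "n(q := n q - 1)"
   have lt: "sum ?n {1..f} < sum n {1..f}"
    by (rule sum_strict_mono_ex1) (use q False in "auto intro!: bexI[of _ q]")
   show "tR q \<otimes> c : NR"
   proof (rule less.hyps[OF lt])
    show "tR q \<otimes> c : carrier R" using tR_closed[OF q] less.prems(1) by simp
    fix p assume p: "p : {1..f}"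
    note m = less.prems(2)[OF p]
    have tp: "tR p : carrier R" "tR q : carrier R" using tR_closed p q by auto
    show "tR p [^] ?n p \<otimes> (tR q \<otimes> c) : NR"
    proof (cases "p = q")
    case True
    have "n q = Suc (n q - 1)" using False q by auto
    hence "tR q [^] n q = tR q [^] (n q - 1) \<otimes> tR q" by (metis nat_pow_Suc)
    thus ?thesis using True m less.prems(1) tp by (simp add: m_assoc)
    next
    case False
    have "tR p [^] n p \<otimes> (tR q \<otimes> c) = tR q \<otimes> (tR p [^] n p \<otimes> c)"
    using tp less.prems(1) by (simp add: m_lcomm)
    thus ?thesis using False ideal.I_l_closed[OF NR_ideal m tp(2)] by simp
    qed
   qed
  qed
 qed
qed

text \<open>f - g + 1 elements lead past position f - g, where each \<open>tR q\<close> kills the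
  homology. So the chase works after inverting any single \<open>tR q\<close>, and
  \<open>NR_saturated\<close> removes the resulting powers.\<close>

lemma NR_deep:
 assumes e: "2 * eps <= f - g" and c: "c : carrier R"
  and bs: "weak_regseq R bs" "length bs = f - g + 1" "!!b. b : set bs ==> b \<otimes> c : NR"
 shows "c : NR"
proof -
 have "EX n. tR q [^] (n::nat) \<otimes> c : NR" if q: "q : {1..f}" for q
 proof -
  let ?S = "{tR q [^] n | n::nat. True}"
  have "EX s:?S. s \<otimes> c : NR"
  proof (rule NR_chase[OF _ _ _ weak_S_regseq[OF bs(1)] c bs(3)])
   show "?S <= carrier R" using tR_closed[OF q] by auto
   show 1: "\<one> : ?S" by (auto intro!: exI[of _ "0::nat"])
   show "\<one> : ?S" by (rule 1)
   show "a \<otimes> b : ?S" if "a : ?S" "b : ?S" for a b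
    using that tR_closed[OF q] by (auto simp: nat_pow_mult)
   have "tR q [^] (1::nat) : ?S" by blast
   thus "(EX q:{1..f}. tR q : ?S) | f + 2 * eps < length bs + (f - g) + 1"
    using q tR_closed[OF q] by auto
  qed (use bs in auto)
  thus ?thesis by blast
 qed
 then obtain n where "!!q. q : {1..f} ==> tR q [^] (n q :: nat) \<otimes> c : NR" by metis
 thus ?thesis by (rule NR_saturated[OF e c])
qed

end

section \<open>Modules and resolutions\<close>

lemma mod_homI:
 assumes "!!x. x : carrier M ==> h x : carrier N"
  and "!!x y. x : carrier M ==> y : carrier M ==> h (x \<oplus>\<^bsub>M\<^esub> y) = h x \<oplus>\<^bsub>N\<^esub> h y"
  and "!!r x. r : carrier R ==> x : carrier M ==> h (r \<odot>\<^bsub>M\<^esub> x) = r \<odot>\<^bsub>N\<^esub> h x"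
 shows "h : mod_hom R M N"
 using assms by (auto simp: mod_hom_def)

lemma mod_homD:
 assumes "h : mod_hom R M N"
 shows "x : carrier M ==> h x : carrier N"
  and "x : carrier M ==> y : carrier M ==> h (x \<oplus>\<^bsub>M\<^esub> y) = h x \<oplus>\<^bsub>N\<^esub> h y"
  and "r : carrier R ==> x : carrier M ==> h (r \<odot>\<^bsub>M\<^esub> x) = r \<odot>\<^bsub>N\<^esub> h x"
 using assms by (auto simp: mod_hom_def)

lemma mod_hom_comp: "h : mod_hom R M N ==> k : mod_hom R N P ==> (%x. k (h x)) : mod_hom R M P"
 by (auto simp: mod_hom_def Pi_iff)

lemma mod_hom_zero:
 assumes "module R M" "module R N" "h : mod_hom R M N"
 shows "h \<zero>\<^bsub>M\<^esub> = \<zero>\<^bsub>N\<^esub>"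
proof -
 interpret M: module R M by fact
 interpret N: module R N by fact
 have "h (\<zero>\<^bsub>R\<^esub> \<odot>\<^bsub>M\<^esub> \<zero>\<^bsub>M\<^esub>) = \<zero>\<^bsub>R\<^esub> \<odot>\<^bsub>N\<^esub> h \<zero>\<^bsub>M\<^esub>"
  by (rule mod_homD(3)[OF assms(3)]) simp_all
 thus ?thesis using mod_homD(1)[OF assms(3), of "\<zero>\<^bsub>M\<^esub>"] by simp
qed

lemma mod_hom_finsum:
 assumes "module R M" "module R N" "h : mod_hom R M N" "finite A" "v : A \<rightarrow> carrier M"
 shows "h (\<Oplus>\<^bsub>M\<^esub>i\<in>A. v i) = (\<Oplus>\<^bsub>N\<^esub>i\<in>A. h (v i))"
proof -
 interpret M: module R M by fact
 interpret N: module R N by fact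
 show ?thesis using assms(4,5)
 proof (induction A rule: finite_induct)
  case empty
  thus ?case using mod_hom_zero[OF assms(1-3)] by simp
 next
  case (insert a A)
  have "(%i. h (v i)) : A \<rightarrow> carrier N" "h (v a) : carrier N"
   using insert.prems mod_homD(1)[OF assms(3)] by auto
  thus ?case using insert mod_homD(2)[OF assms(3)] by simp
 qed
qed

context module
begin

lemma mod_minus_eq: "x : carrier M ==> \<ominus>\<^bsub>M\<^esub> x = (\<ominus>\<^bsub>R\<^esub> \<one>\<^bsub>R\<^esub>) \<odot>\<^bsub>M\<^esub> x"
 using smult_l_minus[of "\<one>\<^bsub>R\<^esub>" x] by simp

lemma submodule_abelian_subgroup: "submodule H R M ==> abelian_subgroup H M"
 by (intro abelian_subgroupI3 additive_subgroup.intro submodule.axioms(1) M.abelian_group_axioms)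

lemma quot_module_simps:
 assumes H: "submodule H R M"
 shows "carrier (quot_module M H) = {H +>\<^bsub>M\<^esub> x | x. x : carrier M}"
  and "\<zero>\<^bsub>quot_module M H\<^esub> = H"
  and "x : carrier M ==> y : carrier M ==>
    (H +>\<^bsub>M\<^esub> x) \<oplus>\<^bsub>quot_module M H\<^esub> (H +>\<^bsub>M\<^esub> y) = H +>\<^bsub>M\<^esub> (x \<oplus>\<^bsub>M\<^esub> y)"
  and "r : carrier R ==> x : carrier M ==> r \<odot>\<^bsub>quot_module M H\<^esub> (H +>\<^bsub>M\<^esub> x) = H +>\<^bsub>M\<^esub> (r \<odot>\<^bsub>M\<^esub> x)"
  and "x : carrier M ==> H +>\<^bsub>M\<^esub> x = H <-> x : H"
proof -
 interpret H: abelian_subgroup H M by (rule submodule_abelian_subgroup[OF H])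
 interpret S: submodule H R M by (rule H)
 show "carrier (quot_module M H) = {H +>\<^bsub>M\<^esub> x | x. x : carrier M}"
  by (auto simp: quot_module_def A_RCOSETS_def')
 show "\<zero>\<^bsub>quot_module M H\<^esub> = H" by (simp add: quot_module_def)
 show "x : carrier M ==> y : carrier M ==>
    (H +>\<^bsub>M\<^esub> x) \<oplus>\<^bsub>quot_module M H\<^esub> (H +>\<^bsub>M\<^esub> y) = H +>\<^bsub>M\<^esub> (x \<oplus>\<^bsub>M\<^esub> y)"
  by (simp add: quot_module_def H.a_rcos_sum)
 show "r \<odot>\<^bsub>quot_module M H\<^esub> (H +>\<^bsub>M\<^esub> x) = H +>\<^bsub>M\<^esub> (r \<odot>\<^bsub>M\<^esub> x)" if r: "r : carrier R" and x: "x : carrier M"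
 proof -
  have "H +>\<^bsub>M\<^esub> (r \<odot>\<^bsub>M\<^esub> y) = H +>\<^bsub>M\<^esub> (r \<odot>\<^bsub>M\<^esub> x)" if y: "y : H +>\<^bsub>M\<^esub> x" for y
  proof -
   obtain h where h: "h : H" "y = h \<oplus>\<^bsub>M\<^esub> x" using y by (auto simp: a_r_coset_def')
   have hM: "h : carrier M" using h(1) H.a_subset by blast
   have "r \<odot>\<^bsub>M\<^esub> y = r \<odot>\<^bsub>M\<^esub> h \<oplus>\<^bsub>M\<^esub> r \<odot>\<^bsub>M\<^esub> x" using h hM r x by (simp add: smult_r_distr)
   hence "r \<odot>\<^bsub>M\<^esub> y : H +>\<^bsub>M\<^esub> (r \<odot>\<^bsub>M\<^esub> x)" using S.smult_closed[OF r h(1)] by (auto simp: a_r_coset_def')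
   thus ?thesis using a_repr_independence[of _ H "r \<odot>\<^bsub>M\<^esub> x"] r x H.a_subgroup by simp
  qed
  moreover have "x : H +>\<^bsub>M\<^esub> x" using H.a_rcos_self x by simp
  ultimately have "(UN y:H +>\<^bsub>M\<^esub> x. H +>\<^bsub>M\<^esub> (r \<odot>\<^bsub>M\<^esub> y)) = H +>\<^bsub>M\<^esub> (r \<odot>\<^bsub>M\<^esub> x)" by blast
  thus ?thesis by (simp add: quot_module_def)
 qed
 show "x : carrier M ==> H +>\<^bsub>M\<^esub> x = H <-> x : H"
  using a_coset_join1[of H x] a_coset_join2[of x H] H.a_subgroup by blast
qed

end

context cring
begin

lemma free_module_simps [simp]:
 "\<zero>\<^bsub>free_module R B\<^esub> = (%b. \<zero>)"
 "v \<oplus>\<^bsub>free_module R B\<^esub> w = (%b. v b \<oplus> w b)"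
 "r \<odot>\<^bsub>free_module R B\<^esub> v = (%b. r \<otimes> v b)"
 by (simp_all add: free_module_def)

lemma fm_carrier:
 "v : carrier (free_module R B) <-> (ALL b. v b : carrier R) & (ALL b. b ~: B --> v b = \<zero>) & finite {b. v b ~= \<zero>}"
 by (simp add: free_module_def)

lemma free_module_module: "module R (free_module R B)"
proof (rule moduleI)
 show "abelian_group (free_module R B)"
 proof (rule abelian_groupI)
  fix x y assume x: "x : carrier (free_module R B)" and y: "y : carrier (free_module R B)"
  have "finite {b. x b \<oplus> y b ~= \<zero>}"
   by (rule finite_subset[of _ "{b. x b ~= \<zero>} Un {b. y b ~= \<zero>}"]) (use x y in "auto simp: fm_carrier")
  thus "x \<oplus>\<^bsub>free_module R B\<^esub> y : carrier (free_module R B)"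
   using x y by (auto simp: fm_carrier)
 next
  fix x assume x: "x : carrier (free_module R B)"
  have "finite {b. \<ominus> x b ~= \<zero>}"
   by (rule finite_subset[of _ "{b. x b ~= \<zero>}"]) (use x in "auto simp: fm_carrier")
  thus "EX y:carrier (free_module R B). y \<oplus>\<^bsub>free_module R B\<^esub> x = \<zero>\<^bsub>free_module R B\<^esub>"
   using x by (intro bexI[of _ "%b. \<ominus> x b"]) (auto simp: fm_carrier l_neg)
 qed (auto simp: fm_carrier a_ac)
 fix a x assume a: "a : carrier R" and x: "x : carrier (free_module R B)"
 have "finite {b. a \<otimes> x b ~= \<zero>}"
  by (rule finite_subset[of _ "{b. x b ~= \<zero>}"]) (use a x in "auto simp: fm_carrier")
 thus "a \<odot>\<^bsub>free_module R B\<^esub> x : carrier (free_module R B)"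
  using a x by (auto simp: fm_carrier)
qed (auto simp: fm_carrier l_distr r_distr m_assoc is_cring)

definition unitv :: "'i => 'i => 'a" where
 "unitv b = (%c. if c = b then \<one> else \<zero>)"

lemma unitv_carrier: "b : B ==> unitv b : carrier (free_module R B)"
 by (auto simp: fm_carrier unitv_def intro: finite_subset[of _ "{b}"])

lemma free_finsum_apply:
 assumes "finite A" "v : A \<rightarrow> carrier (free_module R B)"
 shows "(\<Oplus>\<^bsub>free_module R B\<^esub>i\<in>A. v i) b = (\<Oplus>i\<in>A. v i b)"
proof -
 interpret M: module R "free_module R B" by (rule free_module_module)
 show ?thesis using assms
 proof (induction A rule: finite_induct)
  case (insert a A)
  have "(%i. v i b) : A \<rightarrow> carrier R" using insert.prems by (auto simp: fm_carrier Pi_iff)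
  thus ?case using insert by (simp add: fm_carrier)
 qed simp
qed

lemma free_module_expand:
 assumes v: "v : carrier (free_module R B)" and A: "finite A" "{b. v b ~= \<zero>} <= A" "A <= B"
 shows "v = (\<Oplus>\<^bsub>free_module R B\<^esub>b\<in>A. v b \<odot>\<^bsub>free_module R B\<^esub> unitv b)"
proof
 fix c
 interpret M: module R "free_module R B" by (rule free_module_module)
 have vc: "v b : carrier R" for b using v by (simp add: fm_carrier)
 have "(%b. v b \<odot>\<^bsub>free_module R B\<^esub> unitv b) : A \<rightarrow> carrier (free_module R B)"
  using A(3) vc by (intro Pi_I M.smult_closed unitv_carrier) auto
 hence "(\<Oplus>\<^bsub>free_module R B\<^esub>b\<in>A. v b \<odot>\<^bsub>free_module R B\<^esub> unitv b) c = (\<Oplus>b\<in>A. v b \<otimes> unitv b c)"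
  by (simp add: free_finsum_apply[OF A(1)])
 also have "... = (\<Oplus>b\<in>A. if c = b then v b else \<zero>)"
  by (rule finsum_cong') (auto simp: unitv_def vc)
 also have "... = v c"
 proof (cases "c : A")
  case True
  thus ?thesis using add.finprod_singleton[of c A v] A(1) vc by simp
 next
  case False
  hence "(\<Oplus>b\<in>A. if c = b then v b else \<zero>) = (\<Oplus>b\<in>A. \<zero>)"
   by (intro finsum_cong') auto
  moreover have "v c = \<zero>" using A(2) False by auto
  ultimately show ?thesis by simp
 qed
 finally show "v c = (\<Oplus>\<^bsub>free_module R B\<^esub>b\<in>A. v b \<odot>\<^bsub>free_module R B\<^esub> unitv b) c" by simp
qed

lemma free_module_finite_free:
 assumes B: "finite B" shows "finite_free R (free_module R B)"
proof -
 let ?F = "free_module R B" and ?K = "{1..card B}"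
 interpret M: module R ?F by (rule free_module_module)
 obtain h where h: "bij_betw h ?K B" using ex_bij_betw_nat_finite_1[OF B] by blast
 have inj: "inj_on h ?K" and im: "h ` ?K = B" using h by (auto simp: bij_betw_def)
 have u: "unitv (h k) : carrier ?F" if "k : ?K" for k using im that by (blast intro: unitv_carrier)
 have coord: "(\<Oplus>\<^bsub>?F\<^esub>k\<in>?K. c k \<odot>\<^bsub>?F\<^esub> unitv (h k)) (h j) = c j" if c: "c : ?K \<rightarrow> carrier R" and j: "j : ?K" for c j
 proof -
  have "(%k. c k \<odot>\<^bsub>?F\<^esub> unitv (h k)) : ?K \<rightarrow> carrier ?F" using c u by (intro Pi_I M.smult_closed) auto
  hence "(\<Oplus>\<^bsub>?F\<^esub>k\<in>?K. c k \<odot>\<^bsub>?F\<^esub> unitv (h k)) (h j) = (\<Oplus>k\<in>?K. c k \<otimes> unitv (h k) (h j))"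
   by (simp add: free_finsum_apply)
  also have "... = (\<Oplus>k\<in>?K. if j = k then c k else \<zero>)"
   by (rule finsum_cong') (use c inj j in "auto simp: unitv_def inj_on_eq_iff Pi_iff")
  also have "... = c j" using add.finprod_singleton[OF j _ c] by simp
  finally show ?thesis .
 qed
 have "EX! c. c : ?K \<rightarrow>\<^sub>E carrier R & v = (\<Oplus>\<^bsub>?F\<^esub>k\<in>?K. c k \<odot>\<^bsub>?F\<^esub> unitv (h k))" if v: "v : carrier ?F" for v
 proof (rule ex1I[of _ "\<lambda>k\<in>?K. v (h k)"])
  have vc: "v b : carrier R" for b using v by (simp add: fm_carrier)
  have "v = (\<Oplus>\<^bsub>?F\<^esub>b\<in>h ` ?K. v b \<odot>\<^bsub>?F\<^esub> unitv b)"
   unfolding im by (rule free_module_expand[OF v B]) (use v in "auto simp: fm_carrier")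
  also have "... = (\<Oplus>\<^bsub>?F\<^esub>k\<in>?K. v (h k) \<odot>\<^bsub>?F\<^esub> unitv (h k))"
   by (rule M.add.finprod_reindex[OF _ inj]) (use vc u in "blast intro: M.smult_closed")
  also have "... = (\<Oplus>\<^bsub>?F\<^esub>k\<in>?K. (\<lambda>k\<in>?K. v (h k)) k \<odot>\<^bsub>?F\<^esub> unitv (h k))"
   by (rule M.finsum_cong') (use M.smult_closed[OF vc u] in auto)
  finally show "(\<lambda>k\<in>?K. v (h k)) : ?K \<rightarrow>\<^sub>E carrier R & v = (\<Oplus>\<^bsub>?F\<^esub>k\<in>?K. (\<lambda>k\<in>?K. v (h k)) k \<odot>\<^bsub>?F\<^esub> unitv (h k))"
   using vc by auto
  fix c assume "c : ?K \<rightarrow>\<^sub>E carrier R & v = (\<Oplus>\<^bsub>?F\<^esub>k\<in>?K. c k \<odot>\<^bsub>?F\<^esub> unitv (h k))"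
  thus "c = (\<lambda>k\<in>?K. v (h k))" using coord[of c] by (auto simp: PiE_def extensional_def fun_eq_iff)
 qed
 thus ?thesis using u unfolding finite_free_def is_basis_def by (intro exI[of _ "card B"] exI[of _ "%k. unitv (h k)"]) auto
qed

lemma ring_module_simps [simp]:
 "carrier (ring_module R) = carrier R" "\<zero>\<^bsub>ring_module R\<^esub> = \<zero>" "x \<oplus>\<^bsub>ring_module R\<^esub> y = x \<oplus> y"
 "r \<odot>\<^bsub>ring_module R\<^esub> x = r \<otimes> x"
 by (simp_all add: ring_module_def)

lemma ring_module_module: "module R (ring_module R)"
proof (rule moduleI)
 show "abelian_group (ring_module R)"
 proof (rule abelian_groupI)
  fix x assume "x : carrier (ring_module R)"
  thus "EX y:carrier (ring_module R). y \<oplus>\<^bsub>ring_module R\<^esub> x = \<zero>\<^bsub>ring_module R\<^esub>"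
   by (intro bexI[of _ "\<ominus> x"]) (auto simp: l_neg)
 qed (auto simp: a_ac)
qed (auto simp: l_distr r_distr m_assoc is_cring)

lemma ideal_submodule: "ideal I R ==> submodule I R (ring_module R)"
proof -
 assume "ideal I R"
 then interpret I: ideal I R .
 interpret M: module R "ring_module R" by (rule ring_module_module)
 have n: "\<ominus>\<^bsub>ring_module R\<^esub> a = \<ominus> a" if "a : carrier R" for a
  using M.mod_minus_eq[of a] that by (simp add: l_minus)
 show ?thesis
  by (rule M.submoduleI) (use I.a_subset n I.I_l_closed in auto)
qed

abbreviation rquot :: "'a set => ('a, 'a set) module" where
 "rquot I \<equiv> quot_module (ring_module R) I"

lemma quot_ring_simps:
 assumes I: "ideal I R"
 shows "carrier (rquot I) = {I +> x | x. x : carrier R}"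
  and "\<zero>\<^bsub>rquot I\<^esub> = I"
  and "x : carrier R ==> y : carrier R ==>
    (I +> x) \<oplus>\<^bsub>rquot I\<^esub> (I +> y) = I +> (x \<oplus> y)"
  and "r : carrier R ==> x : carrier R ==> r \<odot>\<^bsub>rquot I\<^esub> (I +> x) = I +> (r \<otimes> x)"
  and "x : carrier R ==> I +> x = I <-> x : I"
proof -
 interpret M: module R "ring_module R" by (rule ring_module_module)
 have "I +>\<^bsub>ring_module R\<^esub> x = I +> x" for x by (simp add: a_r_coset_def')
 thus "carrier (rquot I) = {I +> x | x. x : carrier R}"
  and "\<zero>\<^bsub>rquot I\<^esub> = I"
  and "x : carrier R ==> y : carrier R ==>
    (I +> x) \<oplus>\<^bsub>rquot I\<^esub> (I +> y) = I +> (x \<oplus> y)"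
  and "r : carrier R ==> x : carrier R ==> r \<odot>\<^bsub>rquot I\<^esub> (I +> x) = I +> (r \<otimes> x)"
  and "x : carrier R ==> I +> x = I <-> x : I"
  using M.quot_module_simps[OF ideal_submodule[OF I]] by auto
qed

lemma Ass_quot:
 assumes I: "ideal I R"
 shows "p : Ass R (rquot I) <->
  primeideal p R & (EX c:carrier R. p = {r : carrier R. r \<otimes> c : I})"
proof -
 have "{r : carrier R. r \<odot>\<^bsub>rquot I\<^esub> (I +> c) = \<zero>\<^bsub>rquot I\<^esub>} = {r : carrier R. r \<otimes> c : I}"
  if "c : carrier R" for c
  using quot_ring_simps(4)[OF I _ that] quot_ring_simps(5)[OF I] quot_ring_simps(2)[OF I] that by (intro Collect_cong conj_cong refl) simp
 thus ?thesis unfolding Ass_def quot_ring_simps(1)[OF I] by blast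
qed

end

context complex_cover
begin

lemma MR_module: "module R (MR N)"
 unfolding MR_eq by (rule free_module_module)

lemma dR_hom: "dR (Suc k) : mod_hom R (MR (Suc k)) (MR k)"
proof (rule mod_homI)
 fix v assume v: "v : carrier (MR (Suc k))"
 obtain w where w: "inM (Suc k) w" "E w = v" using MR_lift[OF v] .
 show "dR (Suc k) v : carrier (MR k)" using M_diff_E[OF w(1)] E_in_MR[OF inM_D[OF w(1)]] w(2) by simp
 fix v' assume v': "v' : carrier (MR (Suc k))"
 obtain w' where w': "inM (Suc k) w'" "E w' = v'" using MR_lift[OF v'] .
 have "E (w + w') = (%b. v b \<oplus> v' b)" unfolding w(2)[symmetric] w'(2)[symmetric] by (simp add: ev_add)
 hence "dR (Suc k) (%b. v b \<oplus> v' b) = E (D (Suc k) (w + w'))" using M_diff_E[OF inM_add[OF w(1) w'(1)]] by simp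
 thus "dR (Suc k) (v \<oplus>\<^bsub>MR (Suc k)\<^esub> v') = dR (Suc k) v \<oplus>\<^bsub>MR k\<^esub> dR (Suc k) v'"
  unfolding MR_eq free_module_simps D_add w(2)[symmetric] w'(2)[symmetric] M_diff_E[OF w(1)] M_diff_E[OF w'(1)]
  by (simp add: ev_add)
next
 fix r v assume r: "r : carrier R" and v: "v : carrier (MR (Suc k))"
 obtain w where w: "inM (Suc k) w" "E w = v" using MR_lift[OF v] .
 obtain c where c: "ev c = r" using ev_surj[OF r] by blast
 have "E (scal c w) = (%b. r \<otimes> v b)" unfolding w(2)[symmetric] by (simp add: ev_mult c scal_apply)
 hence "dR (Suc k) (%b. r \<otimes> v b) = E (D (Suc k) (scal c w))" using M_diff_E[OF inM_scal[OF w(1)], of c] by simp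
 thus "dR (Suc k) (r \<odot>\<^bsub>MR (Suc k)\<^esub> v) = r \<odot>\<^bsub>MR k\<^esub> dR (Suc k) v"
  unfolding MR_eq free_module_simps D_scal w(2)[symmetric] M_diff_E[OF w(1)]
  by (simp add: ev_mult c scal_apply)
qed

theorem MR_chain_complex: "chain_complex R MR dR"
 unfolding chain_complex_def
proof (intro conjI allI ballI)
 fix k x assume x: "x : carrier (MR (Suc (Suc k)))"
 obtain w where w: "inM (Suc (Suc k)) w" "E w = x" using MR_lift[OF x] .
 have "dR (Suc k) (dR (Suc (Suc k)) x) = E (D (Suc k) (D (Suc (Suc k)) w))"
  unfolding w(2)[symmetric] M_diff_E[OF w(1)] by (rule M_diff_E[OF inM_D[OF w(1)]])
 thus "dR (Suc k) (dR (Suc (Suc k)) x) = \<zero>\<^bsub>MR k\<^esub>"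
  unfolding D_D'[OF w(1)] MR_eq by (simp add: ev_zero)
qed (rule MR_module dR_hom)+

end

context exact_cover
begin

lemma inM_0_zero: "inM 0 w ==> y ~= Top ==> w y = 0"
 by (cases y; subst (asm) inM_0_iff; erule ssubst) (simp_all add: mk_def)

lemma MR_0: "v : carrier (MR 0) <-> (EX c:carrier R. v = top_elt R c)"
proof
 assume "v : carrier (MR 0)"
 then obtain w where w: "inM 0 w" "E w = v" using MR_lift by blast
 hence "v y = top_elt R (ev (w Top)) y" for y
  using inM_0_zero[OF w(1), of y] by (auto simp: top_elt_def ev_zero)
 thus "EX c:carrier R. v = top_elt R c" by (intro bexI[of _ "ev (w Top)"]) auto
next
 assume "EX c:carrier R. v = top_elt R c"
 then obtain c u where c: "v = top_elt R c" "ev u = c" using ev_surj by blast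
 have "E (mk 0 0 u) y = v y" for y by (cases y) (auto simp: c mk_def top_elt_def ev_zero)
 hence "E (mk 0 0 u) = v" by blast
 thus "v : carrier (MR 0)" using E_in_MR[OF inM_mk_top[of u]] by simp
qed

text \<open>A cycle over R lifts to an element whose differential has coordinates in the kernel of
  \<open>ev\<close>. Exactness modulo that kernel gives a boundary modulo the kernel, which
  \<open>ev\<close> turns into an honest boundary.\<close>

theorem MR_resolution: "free_resolution R MR dR (rquot NR)"
 unfolding free_resolution_def resolution_def
proof (intro conjI allI)
 show "chain_complex R MR dR" by (rule MR_chain_complex)
 show "finite_free R (MR k)" for k unfolding MR_eq by (rule free_module_finite_free[OF finite_Mset])
 show "a_kernel (MR (Suc k)) (MR k) (dR (Suc k)) = dR (Suc (Suc k)) ` carrier (MR (Suc (Suc k)))" for k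
 proof
  show "dR (Suc (Suc k)) ` carrier (MR (Suc (Suc k))) <= a_kernel (MR (Suc k)) (MR k) (dR (Suc k))"
   using MR_chain_complex mod_homD(1)[OF dR_hom, of _ "Suc k"]
   by (auto simp: a_kernel_def' chain_complex_def)
  show "a_kernel (MR (Suc k)) (MR k) (dR (Suc k)) <= dR (Suc (Suc k)) ` carrier (MR (Suc (Suc k)))"
  proof
   fix v assume "v : a_kernel (MR (Suc k)) (MR k) (dR (Suc k))"
   hence v: "v : carrier (MR (Suc k))" "dR (Suc k) v = (%b. \<zero>)"
    by (auto simp: a_kernel_def' MR_eq)
   obtain w where w: "inM (Suc k) w" "E w = v" using MR_lift[OF v(1)] .
   have "inJ K0 (D (Suc k) w)" using v(2) M_diff_E[OF w(1)] w(2) by (auto simp: inJ_def K0_def fun_eq_iff)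
   hence "bd K0 (Suc k) w" using torsD[OF acyclic w(1)] by (auto simp: scal_one)
   then obtain u where u: "inM (Suc (Suc k)) u" "inJ K0 (w - D (Suc (Suc k)) u)" by (auto simp: bd_def)
   have "v b = dR (Suc (Suc k)) (E u) b" for b
    unfolding M_diff_E[OF u(1)] w(2)[symmetric] using u(2) by (auto simp: inJ_def K0_def ev_minus minus_eq)
    (metis ev_closed r_right_minus_eq minus_eq)
   hence "v = dR (Suc (Suc k)) (E u)" by blast
   thus "v : dR (Suc (Suc k)) ` carrier (MR (Suc (Suc k)))" using E_in_MR[OF u(1)] by blast
  qed
 qed
 let ?h = "%v. NR +> v Top"
 have s: "!!x y. x \<oplus>\<^bsub>MR 0\<^esub> y = (%b. x b \<oplus> y b)" "!!r x. r \<odot>\<^bsub>MR 0\<^esub> x = (%b. r \<otimes> x b)"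
  by (simp_all add: MR_eq)
 have tc: "v Top : carrier R" if "v : carrier (MR 0)" for v
  using that by (auto simp: MR_eq fm_carrier)
 note q = quot_ring_simps[OF NR_ideal]
 show "EX h : mod_hom R (MR 0) (rquot NR). h ` carrier (MR 0) = carrier (rquot NR) &
    a_kernel (MR 0) (rquot NR) h = dR 1 ` carrier (MR 1)"
 proof (rule bexI[of _ ?h], intro conjI)
  show "?h : mod_hom R (MR 0) (rquot NR)"
   by (rule mod_homI) (use q tc in "auto simp: s")
  show "?h ` carrier (MR 0) = carrier (rquot NR)"
  proof
   show "?h ` carrier (MR 0) <= carrier (rquot NR)" using tc q(1) by auto
   show "carrier (rquot NR) <= ?h ` carrier (MR 0)"
   proof
    fix X assume "X : carrier (rquot NR)"
    then obtain x where x: "x : carrier R" "X = NR +> x" using q(1) by auto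
    thus "X : ?h ` carrier (MR 0)"
    by (intro image_eqI[of _ _ "top_elt R x"]) (auto simp: MR_0 top_elt_def)
   qed
  qed
  show "a_kernel (MR 0) (rquot NR) ?h = dR 1 ` carrier (MR 1)"
  proof (intro equalityI subsetI)
   fix v assume "v : a_kernel (MR 0) (rquot NR) ?h"
   hence v: "v : carrier (MR 0)" "v Top : NR" using q(2,5) tc by (auto simp: a_kernel_def')
   obtain w where w: "inM 0 w" "E w = v" using MR_lift[OF v(1)] .
   have "w Top : im0 K0" using v(2) w(2) by (auto simp: im0_ev)
   hence "bd K0 0 w" using w(1) by (simp add: im0_def inM_0_iff[of w, symmetric]) (metis inM_0_iff)
   then obtain u where u: "inM 1 u" "inJ K0 (w - D 1 u)" by (auto simp: bd_def)
   have "v b = dR 1 (E u) b" for b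
    unfolding M_diff_E[OF u(1)] w(2)[symmetric] using u(2) by (auto simp: inJ_def K0_def ev_minus minus_eq)
    (metis ev_closed r_right_minus_eq minus_eq)
   hence "v = dR 1 (E u)" by blast
   thus "v : dR 1 ` carrier (MR 1)" using E_in_MR[OF u(1)] by blast
  next
   fix v assume "v : dR 1 ` carrier (MR 1)"
   then obtain v' where v': "v' : carrier (MR 1)" "v = dR 1 v'" by blast
   obtain u where u: "inM 1 u" "E u = v'" using MR_lift[OF v'(1)] .
   have v: "v = E (D 1 u)" using M_diff_E[OF u(1)] u(2) v'(2) by simp
   have m: "inM 0 (D 1 u)" using inM_D[of 0 u] u(1) by simp
   have "bd K0 0 (D 1 u)" using bd_D[OF K0_idl, of 0 u] u(1) by simp
   hence "D 1 u Top : im0 K0" using inM_0_iff[of "D 1 u"] m by (simp add: im0_def)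
   thus "v : a_kernel (MR 0) (rquot NR) ?h"
    using E_in_MR[OF m] q(2,5) by (auto simp: a_kernel_def' v im0_ev)
  qed
 qed
qed

end

section \<open>Comparison of resolutions, and projective dimension\<close>

lemma mod_hom_diff:
 assumes M: "module R M" and N: "module R N" and h: "h : mod_hom R M N" and k: "k : mod_hom R M N"
 shows "(%x. h x \<ominus>\<^bsub>N\<^esub> k x) : mod_hom R M N"
proof -
 interpret M: module R M by (rule M)
 interpret N: module R N by (rule N)
 note hc = mod_homD(1)[OF h] mod_homD(1)[OF k]
 show ?thesis
 proof (rule mod_homI)
  fix x y assume x: "x : carrier M" and y: "y : carrier M"
  show "h (x \<oplus>\<^bsub>M\<^esub> y) \<ominus>\<^bsub>N\<^esub> k (x \<oplus>\<^bsub>M\<^esub> y) = (h x \<ominus>\<^bsub>N\<^esub> k x) \<oplus>\<^bsub>N\<^esub> (h y \<ominus>\<^bsub>N\<^esub> k y)"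
   using hc x y mod_homD(2)[OF h x y] mod_homD(2)[OF k x y]
   by (simp add: N.M.minus_eq N.M.minus_add N.M.a_ac)
 next
  fix r x assume r: "r : carrier R" and x: "x : carrier M"
  show "h (r \<odot>\<^bsub>M\<^esub> x) \<ominus>\<^bsub>N\<^esub> k (r \<odot>\<^bsub>M\<^esub> x) = r \<odot>\<^bsub>N\<^esub> (h x \<ominus>\<^bsub>N\<^esub> k x)"
   using hc r x mod_homD(3)[OF h r x] mod_homD(3)[OF k r x]
   by (simp add: N.M.minus_eq N.smult_r_distr N.smult_r_minus)
 qed (use hc in auto)
qed

lemma mod_hom_id: "(%x. x) : mod_hom R M M"
 by (simp add: mod_hom_def)

context cring
begin

lemma free_lift:
 assumes N: "module R N" and N': "module R N'" and d: "d : mod_hom R N N'"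
  and h: "h : mod_hom R (free_module R B) N'" and sub: "h ` carrier (free_module R B) <= d ` carrier N"
 shows "EX h':mod_hom R (free_module R B) N. ALL x:carrier (free_module R B). d (h' x) = h x"
proof -
 let ?F = "free_module R B"
 interpret F: module R ?F by (rule free_module_module)
 interpret N: module R N by (rule N)
 interpret N': module R N' by (rule N')
 have "EX y:carrier N. d y = h (unitv b)" if "b : B" for b
 proof -
  have "h (unitv b) : d ` carrier N" by (rule subsetD[OF sub imageI[OF unitv_carrier[OF that]]])
  thus ?thesis by (rule imageE) auto
 qed
 hence "ALL b:B. EX y:carrier N. d y = h (unitv b)" by blast
 then obtain l where l: "!!b. b : B ==> l b : carrier N" "!!b. b : B ==> d (l b) = h (unitv b)" by metis
 define lin where "lin v = (\<Oplus>\<^bsub>N\<^esub>b\<in>{b. v b ~= \<zero>}. v b \<odot>\<^bsub>N\<^esub> l b)" for v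
 have supp: "finite {b. v b ~= \<zero>}" "{b. v b ~= \<zero>} <= B" "v b : carrier R" if "v : carrier ?F" for v b
  using that by (auto simp: fm_carrier)
 have lin: "lin v = (\<Oplus>\<^bsub>N\<^esub>b\<in>A. v b \<odot>\<^bsub>N\<^esub> l b)"
  if v: "v : carrier ?F" and A: "finite A" "{b. v b ~= \<zero>} <= A" "A <= B" for v A
  unfolding lin_def
 proof (rule N.M.add.finprod_mono_neutral_cong_left[OF A(1,2)])
  show "v b \<odot>\<^bsub>N\<^esub> l b = \<zero>\<^bsub>N\<^esub>" if "b : A - {b. v b ~= \<zero>}" for b using that l(1) A(3) by auto
  show "(%b. v b \<odot>\<^bsub>N\<^esub> l b) : A \<rightarrow> carrier N" using l(1) A(3) supp(3)[OF v] by auto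
 qed simp
 have closed: "(%b. v b \<odot>\<^bsub>N\<^esub> l b) : A \<rightarrow> carrier N" if "v : carrier ?F" "A <= B" for v A
  using that supp(3) l(1) by auto
 have hom: "lin : mod_hom R ?F N"
 proof (rule mod_homI)
  show "lin v : carrier N" if v: "v : carrier ?F" for v
   unfolding lin_def by (rule N.M.finsum_closed[OF closed[OF v supp(2)[OF v]]])
  show "lin (v \<oplus>\<^bsub>?F\<^esub> w) = lin v \<oplus>\<^bsub>N\<^esub> lin w" if v: "v : carrier ?F" and w: "w : carrier ?F" for v w
  proof -
   let ?A = "{b. v b ~= \<zero>} Un {b. w b ~= \<zero>}"
   have A: "finite ?A" "?A <= B" using supp[OF v] supp[OF w] by auto
   have vw: "v \<oplus>\<^bsub>?F\<^esub> w : carrier ?F" by (rule F.M.a_closed[OF v w])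
   have sA: "{b. (v \<oplus>\<^bsub>?F\<^esub> w) b ~= \<zero>} <= ?A" by auto
   have "lin (v \<oplus>\<^bsub>?F\<^esub> w) = (\<Oplus>\<^bsub>N\<^esub>b\<in>?A. (v b \<odot>\<^bsub>N\<^esub> l b) \<oplus>\<^bsub>N\<^esub> (w b \<odot>\<^bsub>N\<^esub> l b))"
    unfolding lin[OF vw A(1) sA A(2)]
    by (rule N.M.finsum_cong') (use A(2) supp(3)[OF v] supp(3)[OF w] l(1) N.smult_l_distr in auto)
   also have "... = lin v \<oplus>\<^bsub>N\<^esub> lin w"
    unfolding lin[OF v A(1) Un_upper1 A(2)] lin[OF w A(1) Un_upper2 A(2)]
    by (rule N.M.finsum_addf[OF closed[OF v A(2)] closed[OF w A(2)]])
   finally show ?thesis .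
  qed
  show "lin (r \<odot>\<^bsub>?F\<^esub> v) = r \<odot>\<^bsub>N\<^esub> lin v" if r: "r : carrier R" and v: "v : carrier ?F" for r v
  proof -
   let ?A = "{b. v b ~= \<zero>}"
   have rv: "r \<odot>\<^bsub>?F\<^esub> v : carrier ?F" by (rule F.smult_closed[OF r v])
   have sA: "{b. (r \<odot>\<^bsub>?F\<^esub> v) b ~= \<zero>} <= ?A" using r by auto
   have "lin (r \<odot>\<^bsub>?F\<^esub> v) = (\<Oplus>\<^bsub>N\<^esub>b\<in>?A. r \<odot>\<^bsub>N\<^esub> (v b \<odot>\<^bsub>N\<^esub> l b))"
    unfolding lin[OF rv supp(1)[OF v] sA supp(2)[OF v]]
    by (rule N.M.finsum_cong') (use supp[OF v] l(1) r N.smult_assoc1 in auto)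
   also have "... = r \<odot>\<^bsub>N\<^esub> lin v"
    unfolding lin_def by (rule N.finsum_smult_ldistr[OF supp(1)[OF v] r closed[OF v supp(2)[OF v]], symmetric])
   finally show ?thesis .
  qed
 qed
 have "d (lin v) = h v" if v: "v : carrier ?F" for v
 proof -
  let ?A = "{b. v b ~= \<zero>}"
  note s = supp[OF v]
  have "d (lin v) = (\<Oplus>\<^bsub>N'\<^esub>b\<in>?A. d (v b \<odot>\<^bsub>N\<^esub> l b))"
   unfolding lin_def by (rule mod_hom_finsum[OF N N' d s(1) closed[OF v s(2)]])
  also have "... = (\<Oplus>\<^bsub>N'\<^esub>b\<in>?A. h (v b \<odot>\<^bsub>?F\<^esub> unitv b))"
  proof (rule N'.M.finsum_cong')
   fix b assume b: "b : ?A"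
   hence bB: "b : B" using s(2) by blast
   show "d (v b \<odot>\<^bsub>N\<^esub> l b) = h (v b \<odot>\<^bsub>?F\<^esub> unitv b)"
    using mod_homD(3)[OF d s(3)] mod_homD(3)[OF h s(3) unitv_carrier[OF bB]] l[OF bB] by simp
  next
   show "(%b. h (v b \<odot>\<^bsub>?F\<^esub> unitv b)) : ?A \<rightarrow> carrier N'"
    using s(2,3) by (intro Pi_I mod_homD(1)[OF h] F.smult_closed unitv_carrier) auto
  qed simp
  also have "... = h (\<Oplus>\<^bsub>?F\<^esub>b\<in>?A. v b \<odot>\<^bsub>?F\<^esub> unitv b)"
   by (rule mod_hom_finsum[OF F.module_axioms N' h s(1), symmetric])
    (use s(2,3) in "intro Pi_I F.smult_closed unitv_carrier; auto")
  also have "... = h v" using free_module_expand[OF v s(1) _ s(2)] by simp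
  finally show ?thesis .
 qed
 thus ?thesis using hom by blast
qed

lemma projective_lift:
 fixes P :: "('a,'p,'y) module_scheme"
 assumes P: "projective R P" and N: "module R N" and N': "module R N'" and d: "d : mod_hom R N N'"
  and h: "h : mod_hom R P N'" and sub: "h ` carrier P <= d ` carrier N"
 shows "EX h':mod_hom R P N. ALL x:carrier P. d (h' x) = h x"
proof -
 obtain B :: "'p set" and i q where B: "i : mod_hom R P (free_module R B)" "q : mod_hom R (free_module R B) P"
  "!!x. x : carrier P ==> q (i x) = x"
  using P unfolding projective_def by blast
 have "EX h':mod_hom R (free_module R B) N. ALL x:carrier (free_module R B). d (h' x) = h (q x)"
  by (rule free_lift[OF N N' d mod_hom_comp[OF B(2) h]]) (use sub mod_homD(1)[OF B(2)] in auto)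
 then obtain h' where h': "h' : mod_hom R (free_module R B) N" "!!x. x : carrier (free_module R B) ==> d (h' x) = h (q x)"
  by blast
 show ?thesis
  by (rule bexI[OF _ mod_hom_comp[OF B(1) h'(1)]]) (use h'(2) B mod_homD(1)[OF B(1)] in auto)
qed

text \<open>\<open>projective\<close> wants an index set consisting of elements of the type of the
  module, so B is replaced by its unit vectors; these are distinct because 1 ~= 0.\<close>

lemma free_module_projective:
 fixes B :: "'i set"
 assumes ne: "\<one> ~= \<zero>" shows "projective R (free_module R B)"
proof -
 let ?B = "unitv ` B :: ('i => 'a) set"
 have inj: "inj_on (unitv :: 'i => 'i => 'a) B"
  using ne by (auto simp: inj_on_def unitv_def fun_eq_iff split: if_splits)
 define i where "i v w = (if w : ?B then v (inv_into B unitv w) else \<zero>)" for v :: "'i => 'a" and w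
 define q where "q v b = (if b : B then v (unitv b) else \<zero>)" for v :: "('i => 'a) => 'a" and b
 have ic: "i v : carrier (free_module R ?B)" if v: "v : carrier (free_module R B)" for v
 proof -
  have "{w. i v w ~= \<zero>} <= unitv ` {b. v b ~= \<zero>}"
   using inj by (auto simp: i_def split: if_splits)
  hence "finite {w. i v w ~= \<zero>}" by (rule finite_subset) (use v in "simp add: fm_carrier")
  thus ?thesis using v by (auto simp: fm_carrier i_def)
 qed
 have qc: "q v : carrier (free_module R B)" if v: "v : carrier (free_module R ?B)" for v
 proof -
  have "finite (unitv -` {w. v w ~= \<zero>} Int B)"
   by (rule finite_vimage_IntI[OF _ inj]) (use v in "simp add: fm_carrier")
  hence "finite {b. q v b ~= \<zero>}" by (rule rev_finite_subset) (auto simp: q_def split: if_splits)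
  thus ?thesis using v by (auto simp: fm_carrier q_def)
 qed
 have ih: "i : mod_hom R (free_module R B) (free_module R ?B)"
  by (rule mod_homI) (use ic in "auto simp: i_def fun_eq_iff")
 have qh: "q : mod_hom R (free_module R ?B) (free_module R B)"
  by (rule mod_homI) (use qc in "auto simp: q_def fun_eq_iff")
 have "q (i v) = v" if "v : carrier (free_module R B)" for v
 proof
  fix b show "q (i v) b = v b"
  proof (cases "b : B")
   case True
   thus ?thesis by (simp add: q_def i_def inv_into_f_f[OF inj])
  next
   case False
   thus ?thesis using that by (simp add: q_def fm_carrier)
  qed
 qed
 thus ?thesis unfolding projective_def
  by (intro conjI free_module_module exI[of _ ?B] bexI[OF _ ih] bexI[OF _ qh] ballI)
qed

lemma comparison:
 assumes P: "chain_complex R P dP" and proj: "!!k. projective R (P k)"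
  and hP: "hP : mod_hom R (P 0) Q" and hP0: "!!x. x : carrier (P 1) ==> hP (dP 1 x) = \<zero>\<^bsub>Q\<^esub>"
  and N: "chain_complex R N dN"
  and exN: "!!k. a_kernel (N (Suc k)) (N k) (dN (Suc k)) = dN (Suc (Suc k)) ` carrier (N (Suc (Suc k)))"
  and hN: "hN : mod_hom R (N 0) Q" "hN ` carrier (N 0) = carrier Q" "a_kernel (N 0) Q hN = dN 1 ` carrier (N 1)"
  and Q: "module R Q"
 shows "EX ph. (ALL k. ph k : mod_hom R (P k) (N k)) & (ALL x:carrier (P 0). hN (ph 0 x) = hP x) &
  (ALL k. ALL x:carrier (P (Suc k)). dN (Suc k) (ph (Suc k) x) = ph k (dP (Suc k) x))"
proof -
 have Pm: "module R (P k)" and dPh: "dP (Suc k) : mod_hom R (P (Suc k)) (P k)" for k using P by (auto simp: chain_complex_def)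
 have Nm: "module R (N k)" and dNh: "dN (Suc k) : mod_hom R (N (Suc k)) (N k)" for k using N by (auto simp: chain_complex_def)
 have dPd: "dP (Suc k) (dP (Suc (Suc k)) x) = \<zero>\<^bsub>P k\<^esub>" if "x : carrier (P (Suc (Suc k)))" for k x using P that by (auto simp: chain_complex_def)
 let ?G = "%k ph. ph : mod_hom R (P k) (N k) & (ALL x:carrier (P (Suc k)). ph (dP (Suc k) x) : dN (Suc k) ` carrier (N (Suc k))) &
   (k = 0 --> (ALL x:carrier (P 0). hN (ph x) = hP x))"
 let ?H = "%k ph ph'. ALL x:carrier (P (Suc k)). dN (Suc k) (ph' x) = ph (dP (Suc k) x)"
 have "EX ph. ALL k. ?G k (ph k) & ?H k (ph k) (ph (Suc k))"
 \<comment> \<open>The invariant says that the map already built carries boundaries to boundaries,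
   which is what lifting the next one through the differential requires.\<close>
 proof (rule dependent_nat_choice)
  have "EX ph:mod_hom R (P 0) (N 0). ALL x:carrier (P 0). hN (ph x) = hP x"
   by (rule projective_lift[OF proj Nm Q hN(1) hP]) (use hN(2) mod_homD(1)[OF hP] in auto)
  then obtain ph where f: "ph : mod_hom R (P 0) (N 0)" "!!x. x : carrier (P 0) ==> hN (ph x) = hP x" by blast
  have "ph (dP (Suc 0) x) : dN (Suc 0) ` carrier (N (Suc 0))" if x: "x : carrier (P (Suc 0))" for x
  proof -
   have y: "dP (Suc 0) x : carrier (P 0)" by (rule mod_homD(1)[OF dPh x])
   have "hN (ph (dP (Suc 0) x)) = \<zero>\<^bsub>Q\<^esub>" using f(2)[OF y] hP0 x by simp
   hence "ph (dP (Suc 0) x) : a_kernel (N 0) Q hN" using mod_homD(1)[OF f(1) y] by (simp add: a_kernel_def')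
   thus ?thesis using hN(3) by simp
  qed
  thus "EX ph. ?G 0 ph" using f by (intro exI[of _ ph]) simp
 next
  fix ph k assume G: "?G k ph"
  have hom: "(%x. ph (dP (Suc k) x)) : mod_hom R (P (Suc k)) (N k)" by (rule mod_hom_comp[OF dPh]) (use G in blast)
  have "EX ph':mod_hom R (P (Suc k)) (N (Suc k)). ALL x:carrier (P (Suc k)). dN (Suc k) (ph' x) = ph (dP (Suc k) x)"
   by (rule projective_lift[OF proj Nm Nm dNh hom]) (use G in auto)
  then obtain ph' where f: "ph' : mod_hom R (P (Suc k)) (N (Suc k))"
   "!!x. x : carrier (P (Suc k)) ==> dN (Suc k) (ph' x) = ph (dP (Suc k) x)" by blast
  have "ph' (dP (Suc (Suc k)) x) : dN (Suc (Suc k)) ` carrier (N (Suc (Suc k)))" if x: "x : carrier (P (Suc (Suc k)))" for x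
  proof -
   have y: "dP (Suc (Suc k)) x : carrier (P (Suc k))" by (rule mod_homD(1)[OF dPh x])
   have "dN (Suc k) (ph' (dP (Suc (Suc k)) x)) = ph \<zero>\<^bsub>P k\<^esub>" using f(2)[OF y] dPd[OF x] by simp
   also have "... = \<zero>\<^bsub>N k\<^esub>" by (rule mod_hom_zero[OF Pm Nm]) (use G in blast)
   finally have "ph' (dP (Suc (Suc k)) x) : a_kernel (N (Suc k)) (N k) (dN (Suc k))"
    using mod_homD(1)[OF f(1) y] by (simp add: a_kernel_def')
   thus ?thesis using exN by simp
  qed
  thus "EX ph'. ?G (Suc k) ph' & ?H k ph ph'" using f by (intro exI[of _ ph']) simp
 qed
 then obtain ph where ph: "!!k. ?G k (ph k)" "!!k. ?H k (ph k) (ph (Suc k))" by metis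
 show ?thesis by (intro exI[of _ ph] conjI allI) (use ph in simp_all)
qed

lemma homotopy_id:
 assumes N: "chain_complex R N d" and proj: "!!k. projective R (N k)"
  and exN: "!!k. a_kernel (N (Suc k)) (N k) (d (Suc k)) = d (Suc (Suc k)) ` carrier (N (Suc (Suc k)))"
  and h: "h : mod_hom R (N 0) Q" "a_kernel (N 0) Q h = d 1 ` carrier (N 1)" and Q: "module R Q"
  and th: "!!k. th k : mod_hom R (N k) (N k)" and th0: "!!x. x : carrier (N 0) ==> h (th 0 x) = h x"
  and thd: "!!k x. x : carrier (N (Suc k)) ==> d (Suc k) (th (Suc k) x) = th k (d (Suc k) x)"
 shows "EX s. (ALL k. s k : mod_hom R (N k) (N (Suc k))) &
  (ALL k. ALL x:carrier (N (Suc k)). x \<ominus>\<^bsub>N (Suc k)\<^esub> th (Suc k) x \<ominus>\<^bsub>N (Suc k)\<^esub> s k (d (Suc k) x) = d (Suc (Suc k)) (s (Suc k) x))"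
proof -
 have Nm: "module R (N k)" and dh: "d (Suc k) : mod_hom R (N (Suc k)) (N k)" for k using N by (auto simp: chain_complex_def)
 have dd: "d (Suc k) (d (Suc (Suc k)) x) = \<zero>\<^bsub>N k\<^esub>" if "x : carrier (N (Suc (Suc k)))" for k x using N that by (auto simp: chain_complex_def)
 have sub: "u (x \<ominus>\<^bsub>A\<^esub> y) = u x \<ominus>\<^bsub>B\<^esub> u y"
  if "module R A" "module R B" "u : mod_hom R A B" "x : carrier A" "y : carrier A" for u x y and A :: "('a,'m,'y) module_scheme" and B :: "('a,'n,'z) module_scheme"
 proof -
  interpret A: module R A by fact
  interpret B: module R B by fact
  have "u (\<ominus>\<^bsub>A\<^esub> y) = \<ominus>\<^bsub>B\<^esub> u y"
   using that mod_homD(3)[OF that(3), of "\<ominus> \<one>" y] mod_homD(1)[OF that(3), of y]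
   by (simp add: A.mod_minus_eq B.mod_minus_eq)
  thus ?thesis using that mod_homD(2)[OF that(3), of x "\<ominus>\<^bsub>A\<^esub> y"] by (simp add: A.M.minus_eq B.M.minus_eq)
 qed
 \<comment> \<open>On a boundary y the term s (d y) vanishes, and the homotopy relation reduces to y
   - th y = d (s y). This makes the next difference a cycle, hence liftable.\<close>
 let ?G = "%k s. s : mod_hom R (N k) (N (Suc k)) &
   (ALL x:carrier (N (Suc k)). d (Suc k) x \<ominus>\<^bsub>N k\<^esub> th k (d (Suc k) x) = d (Suc k) (s (d (Suc k) x)))"
 let ?H = "%k s s'. ALL x:carrier (N (Suc k)). x \<ominus>\<^bsub>N (Suc k)\<^esub> th (Suc k) x \<ominus>\<^bsub>N (Suc k)\<^esub> s (d (Suc k) x) = d (Suc (Suc k)) (s' x)"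
 have "EX s. ALL k. ?G k (s k) & ?H k (s k) (s (Suc k))"
 proof (rule dependent_nat_choice)
  interpret N0: module R "N 0" by (rule Nm)
  interpret Q: module R Q by (rule Q)
  have "EX s:mod_hom R (N 0) (N (Suc 0)). ALL x:carrier (N 0). d (Suc 0) (s x) = x \<ominus>\<^bsub>N 0\<^esub> th 0 x"
  proof (rule projective_lift[OF proj Nm Nm dh mod_hom_diff[OF Nm Nm mod_hom_id th]], rule image_subsetI)
   fix x assume x: "x : carrier (N 0)"
   have t: "th 0 x : carrier (N 0)" by (rule mod_homD(1)[OF th x])
   have "h (x \<ominus>\<^bsub>N 0\<^esub> th 0 x) = h x \<ominus>\<^bsub>Q\<^esub> h x" using sub[OF Nm Q h(1) x t] th0[OF x] by simp
   also have "... = \<zero>\<^bsub>Q\<^esub>" using mod_homD(1)[OF h(1) x] by (simp add: Q.M.minus_eq Q.M.r_neg)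
   finally have "x \<ominus>\<^bsub>N 0\<^esub> th 0 x : a_kernel (N 0) Q h" using x t by (simp add: a_kernel_def')
   thus "x \<ominus>\<^bsub>N 0\<^esub> th 0 x : d (Suc 0) ` carrier (N (Suc 0))" using h(2) by simp
  qed
  thus "EX s. ?G 0 s" using mod_homD(1)[OF dh, of _ 0] by fastforce
 next
  fix s k assume G: "?G k s"
  interpret Nk: module R "N k" by (rule Nm)
  interpret Nk1: module R "N (Suc k)" by (rule Nm)
  have sh: "s : mod_hom R (N k) (N (Suc k))" using G by blast
  let ?r = "%x. x \<ominus>\<^bsub>N (Suc k)\<^esub> th (Suc k) x \<ominus>\<^bsub>N (Suc k)\<^esub> s (d (Suc k) x)"
  have rh: "?r : mod_hom R (N (Suc k)) (N (Suc k))"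
   by (rule mod_hom_diff[OF Nm Nm mod_hom_diff[OF Nm Nm mod_hom_id th] mod_hom_comp[OF dh sh]])
  have "EX s':mod_hom R (N (Suc k)) (N (Suc (Suc k))). ALL x:carrier (N (Suc k)). d (Suc (Suc k)) (s' x) = ?r x"
  proof (rule projective_lift[OF proj Nm Nm dh rh], rule image_subsetI)
   fix x assume x: "x : carrier (N (Suc k))"
   have t: "th (Suc k) x : carrier (N (Suc k))" by (rule mod_homD(1)[OF th x])
   have dx: "d (Suc k) x : carrier (N k)" by (rule mod_homD(1)[OF dh x])
   have sdx: "s (d (Suc k) x) : carrier (N (Suc k))" by (rule mod_homD(1)[OF sh dx])
   have xt: "x \<ominus>\<^bsub>N (Suc k)\<^esub> th (Suc k) x : carrier (N (Suc k))" using x t by simp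
   have "d (Suc k) (?r x) = (d (Suc k) x \<ominus>\<^bsub>N k\<^esub> th k (d (Suc k) x)) \<ominus>\<^bsub>N k\<^esub> d (Suc k) (s (d (Suc k) x))"
    unfolding sub[OF Nm Nm dh xt sdx] sub[OF Nm Nm dh x t] thd[OF x] ..
   also have "... = \<zero>\<^bsub>N k\<^esub>" using G x mod_homD(1)[OF dh sdx] by (simp add: Nk.M.minus_eq Nk.M.r_neg)
   finally have "?r x : a_kernel (N (Suc k)) (N k) (d (Suc k))" using mod_homD(1)[OF rh x] by (simp add: a_kernel_def')
   thus "?r x : d (Suc (Suc k)) ` carrier (N (Suc (Suc k)))" using exN by simp
  qed
  then obtain s' where s': "s' : mod_hom R (N (Suc k)) (N (Suc (Suc k)))"
   "!!x. x : carrier (N (Suc k)) ==> d (Suc (Suc k)) (s' x) = ?r x" by blast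
  have "d (Suc (Suc k)) x \<ominus>\<^bsub>N (Suc k)\<^esub> th (Suc k) (d (Suc (Suc k)) x) = d (Suc (Suc k)) (s' (d (Suc (Suc k)) x))"
   if x: "x : carrier (N (Suc (Suc k)))" for x
  proof -
   let ?y = "d (Suc (Suc k)) x"
   have y: "?y : carrier (N (Suc k))" by (rule mod_homD(1)[OF dh x])
   have "s (d (Suc k) ?y) = \<zero>\<^bsub>N (Suc k)\<^esub>" unfolding dd[OF x] by (rule mod_hom_zero[OF Nm Nm sh])
   thus ?thesis using s'(2)[OF y] y mod_homD(1)[OF th y] by (simp add: Nk1.M.minus_eq)
  qed
  thus "EX s'. ?G (Suc k) s' & ?H k s s'" using s' by (intro exI[of _ s']) simp
 qed
 then obtain s where s: "!!k. ?G k (s k)" "!!k. ?H k (s k) (s (Suc k))" by metis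
 show ?thesis by (intro exI[of _ s] conjI allI) (use s in simp_all)
qed

text \<open>A shorter projective resolution P would make the identity of M homotopic to a map
  through P. In position m + 1 that map is 0 because P vanishes there, and M vanishes in position m
  + 2; so the homotopy would give s (d v) = v for all v, which \<open>ns\<close> excludes.\<close>

theorem proj_dim_ge:
 fixes M :: "nat => ('a,'i,'y) module_scheme"
 assumes res: "resolution R M d Q" and proj: "!!k. projective R (M k)" and Q: "module R Q"
  and top: "carrier (M (Suc (Suc m))) = {\<zero>\<^bsub>M (Suc (Suc m))\<^esub>}"
  and ns: "!!s. s : mod_hom R (M m) (M (Suc m)) ==> EX v:carrier (M (Suc m)). s (d (Suc m) v) ~= v"
 shows "enat (Suc m) <= proj_dim R Q"
 unfolding proj_dim_def
proof (rule Inf_greatest, safe)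
 fix n and P :: "nat => ('a, ('m + 'a + nat) => 'a) module" and \<delta>
 assume P: "resolution R P \<delta> Q" "ALL k. projective R (P k)" "ALL k>n. carrier (P k) = {\<zero>\<^bsub>P k\<^esub>}"
 show "enat (Suc m) <= enat n"
 proof (rule ccontr)
  assume "~ enat (Suc m) <= enat n"
  hence P0: "carrier (P (Suc m)) = {\<zero>\<^bsub>P (Suc m)\<^esub>}" using P(3) by simp
  obtain h where h: "h : mod_hom R (M 0) Q" "h ` carrier (M 0) = carrier Q" "a_kernel (M 0) Q h = d 1 ` carrier (M 1)"
   using res unfolding resolution_def by blast
  obtain hP where hP: "hP : mod_hom R (P 0) Q" "hP ` carrier (P 0) = carrier Q" "a_kernel (P 0) Q hP = \<delta> 1 ` carrier (P 1)"
   using P(1) unfolding resolution_def by blast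
  have M: "chain_complex R M d" "!!k. a_kernel (M (Suc k)) (M k) (d (Suc k)) = d (Suc (Suc k)) ` carrier (M (Suc (Suc k)))"
   using res by (auto simp: resolution_def)
  have Pc: "chain_complex R P \<delta>" "!!k. a_kernel (P (Suc k)) (P k) (\<delta> (Suc k)) = \<delta> (Suc (Suc k)) ` carrier (P (Suc (Suc k)))"
   using P(1) by (auto simp: resolution_def)
  have k0: "h (d 1 x) = \<zero>\<^bsub>Q\<^esub>" if "x : carrier (M 1)" for x using h(3) that by (auto simp: a_kernel_def')
  have kP: "hP (\<delta> 1 x) = \<zero>\<^bsub>Q\<^esub>" if "x : carrier (P 1)" for x using hP(3) that by (auto simp: a_kernel_def')
  obtain ph where ph: "!!k. ph k : mod_hom R (M k) (P k)" "!!x. x : carrier (M 0) ==> hP (ph 0 x) = h x"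
   "!!k x. x : carrier (M (Suc k)) ==> \<delta> (Suc k) (ph (Suc k) x) = ph k (d (Suc k) x)"
   using comparison[where P = M and dP = d and N = P and dN = \<delta>, OF M(1) proj h(1) k0 Pc hP Q] by blast
  obtain \<psi> where \<psi>: "!!k. \<psi> k : mod_hom R (P k) (M k)" "!!x. x : carrier (P 0) ==> h (\<psi> 0 x) = hP x"
   "!!k x. x : carrier (P (Suc k)) ==> d (Suc k) (\<psi> (Suc k) x) = \<psi> k (\<delta> (Suc k) x)"
   using comparison[where P = P and dP = \<delta> and N = M and dN = d, OF Pc(1) P(2)[rule_format] hP(1) kP M h Q] by blast
  have th: "(%x. \<psi> k (ph k x)) : mod_hom R (M k) (M k)" for k by (rule mod_hom_comp[OF ph(1) \<psi>(1)])
  have "EX s. (ALL k. s k : mod_hom R (M k) (M (Suc k))) &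
   (ALL k. ALL x:carrier (M (Suc k)). x \<ominus>\<^bsub>M (Suc k)\<^esub> \<psi> (Suc k) (ph (Suc k) x) \<ominus>\<^bsub>M (Suc k)\<^esub> s k (d (Suc k) x) = d (Suc (Suc k)) (s (Suc k) x))"
   by (rule homotopy_id[OF M(1) proj M(2) h(1,3) Q th])
    (use ph \<psi> mod_homD(1)[OF ph(1)] in auto)
  then obtain s where s: "!!k. s k : mod_hom R (M k) (M (Suc k))"
   "!!k x. x : carrier (M (Suc k)) ==> x \<ominus>\<^bsub>M (Suc k)\<^esub> \<psi> (Suc k) (ph (Suc k) x) \<ominus>\<^bsub>M (Suc k)\<^esub> s k (d (Suc k) x) = d (Suc (Suc k)) (s (Suc k) x)"
   by blast
  have Mm: "module R (M k)" and Pm: "module R (P k)" for k using M(1) Pc(1) by (auto simp: chain_complex_def)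
  have dh: "d (Suc k) : mod_hom R (M (Suc k)) (M k)" for k using M(1) by (auto simp: chain_complex_def)
  interpret Mm: module R "M (Suc m)" by (rule Mm)
  obtain v where v: "v : carrier (M (Suc m))" "s m (d (Suc m) v) ~= v" using ns[OF s(1)] by blast
  have "ph (Suc m) v = \<zero>\<^bsub>P (Suc m)\<^esub>" using mod_homD(1)[OF ph(1) v(1)] P0 by simp
  hence 1: "\<psi> (Suc m) (ph (Suc m) v) = \<zero>\<^bsub>M (Suc m)\<^esub>" using mod_hom_zero[OF Pm Mm \<psi>(1)] by simp
  have "s (Suc m) v = \<zero>\<^bsub>M (Suc (Suc m))\<^esub>" using mod_homD(1)[OF s(1) v(1)] top by simp
  hence 2: "d (Suc (Suc m)) (s (Suc m) v) = \<zero>\<^bsub>M (Suc m)\<^esub>" using mod_hom_zero[OF Mm Mm dh] by simp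
  have 3: "s m (d (Suc m) v) : carrier (M (Suc m))" by (rule mod_homD(1)[OF s(1) mod_homD(1)[OF dh v(1)]])
  have "\<ominus>\<^bsub>M (Suc m)\<^esub> \<zero>\<^bsub>M (Suc m)\<^esub> = \<zero>\<^bsub>M (Suc m)\<^esub>"
   using Mm.mod_minus_eq[of "\<zero>\<^bsub>M (Suc m)\<^esub>"] by simp
  hence "v \<ominus>\<^bsub>M (Suc m)\<^esub> \<zero>\<^bsub>M (Suc m)\<^esub> = v"
   using v(1) by (simp only: Mm.M.minus_eq Mm.M.r_zero)
  hence "v \<ominus>\<^bsub>M (Suc m)\<^esub> s m (d (Suc m) v) = \<zero>\<^bsub>M (Suc m)\<^esub>"
   using s(2)[OF v(1)] unfolding 1 2 by (simp only:)
  moreover have "v = (v \<ominus>\<^bsub>M (Suc m)\<^esub> s m (d (Suc m) v)) \<oplus>\<^bsub>M (Suc m)\<^esub> s m (d (Suc m) v)"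
   using v(1) 3 by (simp add: Mm.M.minus_eq Mm.M.a_assoc Mm.M.l_neg)
  ultimately have "v = s m (d (Suc m) v)" using 3 Mm.M.l_zero by metis
  thus False using v(2) by simp
 qed
qed

end

context cring
begin

lemma quot_ring_module:
 assumes I: "ideal I R" shows "module R (rquot I)"
proof -
 let ?Q = "rquot I"
 note q = quot_ring_simps[OF I]
 interpret I: ideal I R by (rule I)
 interpret Q: ring "R Quot I" by (rule I.quotient_is_ring)
 have ex: "EX x:carrier R. X = I +> x" if "X : carrier ?Q" for X using that q(1) by auto
 have e: "carrier ?Q = carrier (R Quot I)" "X \<oplus>\<^bsub>?Q\<^esub> Y = X \<oplus>\<^bsub>R Quot I\<^esub> Y" "\<zero>\<^bsub>?Q\<^esub> = \<zero>\<^bsub>R Quot I\<^esub>" for X Y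
  by (auto simp: quot_module_def FactRing_def A_RCOSETS_def' a_r_coset_def' set_add_def')
 have "abelian_group ?Q" by (rule abelian_groupI; unfold e) (auto simp: Q.a_ac intro: Q.l_neg)
 thus ?thesis
 proof (rule moduleI[OF is_cring])
  fix a X assume a: "a : carrier R" and "X : carrier ?Q"
  then obtain x where x: "x : carrier R" "X = I +> x" using ex by blast
  show "a \<odot>\<^bsub>?Q\<^esub> X : carrier ?Q" using a x q(1,4) by auto
  show "a \<odot>\<^bsub>?Q\<^esub> (X \<oplus>\<^bsub>?Q\<^esub> Y) = a \<odot>\<^bsub>?Q\<^esub> X \<oplus>\<^bsub>?Q\<^esub> a \<odot>\<^bsub>?Q\<^esub> Y" if "Y : carrier ?Q" for Y
   using ex[OF that] a x q(3,4) by (auto simp: r_distr)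
  show "(a \<oplus> b) \<odot>\<^bsub>?Q\<^esub> X = a \<odot>\<^bsub>?Q\<^esub> X \<oplus>\<^bsub>?Q\<^esub> b \<odot>\<^bsub>?Q\<^esub> X" "a \<otimes> b \<odot>\<^bsub>?Q\<^esub> X = a \<odot>\<^bsub>?Q\<^esub> (b \<odot>\<^bsub>?Q\<^esub> X)" if "b : carrier R" for b
   using a that x q(3,4) by (simp_all add: l_distr m_assoc)
 next
  show "\<one> \<odot>\<^bsub>?Q\<^esub> X = X" if "X : carrier ?Q" for X using ex[OF that] q(4) by auto
 qed
qed

text \<open>The work is a change of type: \<open>proj_dim\<close> ranges over modules of functions
  on \<open>'m + 'a + nat\<close>. The finitely many basis elements are numbered and placed in the
  third summand, and the resolution is transported along \<open>push\<close> and
  \<open>pull\<close>.\<close>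

theorem proj_dim_le:
 fixes B :: "nat => 'i set" and Q :: "('a,'m,'y) module_scheme"
 assumes ne: "\<one> ~= \<zero>" and res: "resolution R (%k. free_module R (B k)) d Q"
  and fin: "finite (\<Union>k. B k)" and van: "!!k. k > n ==> B k = {}"
 shows "proj_dim R Q <= enat n"
proof -
 let ?A = "\<Union>k. B k" and ?F = "%k. free_module R (B k)"
 obtain j :: "'i => nat" where j: "inj_on j ?A" using fin finite_imp_inj_to_nat_seg by metis
 define J :: "'i => 'm + 'a + nat" where "J b = Inr (Inr (j b))" for b
 have J: "inj_on J ?A" using j by (auto simp: inj_on_def J_def)
 define pull where "pull u b = (if b : ?A then u (J b) else \<zero>)" for u :: "'m + 'a + nat => 'a" and b
 define push where "push v c = (if c : J ` ?A then v (inv_into ?A J c) else \<zero>)" for v :: "'i => 'a" and c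
 let ?P = "%k. free_module R (J ` B k)"
 define \<delta> where "\<delta> k y = push (d k (pull y))" for k y
 have finB: "finite (B k)" "B k <= ?A" for k using fin finite_subset[of "B k" ?A] by auto
 have inv: "inv_into ?A J (J b) = b" if "b : ?A" for b by (rule inv_into_f_f[OF J that])
 have fc: "v : carrier (free_module R C) <-> (ALL b. v b : carrier R) & (ALL b. b ~: C --> v b = \<zero>)" if "finite C" for v C
  using that by (auto simp: fm_carrier intro: finite_subset[of _ C])
 have pullc: "pull : mod_hom R (?P k) (?F k)" for k
 proof (rule mod_homI)
  fix u assume u: "u : carrier (?P k)"
  have "pull u b = \<zero>" if "b ~: B k" for b
  proof (cases "b : ?A")
   case True
   hence "J b ~: J ` B k" using J that finB(2)[of k] by (auto simp: inj_on_def)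
   thus ?thesis using u finB by (simp add: pull_def fc)
  qed (simp add: pull_def)
  thus "pull u : carrier (?F k)" using u finB by (auto simp: fc pull_def)
 qed (auto simp: pull_def fun_eq_iff)
 have pushc: "push : mod_hom R (?F k) (?P k)" for k
 proof (rule mod_homI)
  fix v assume v: "v : carrier (?F k)"
  have "push v c = \<zero>" if "c ~: J ` B k" for c
  proof (cases "c : J ` ?A")
   case True
   then obtain b where b: "b : ?A" "c = J b" by blast
   hence "b ~: B k" using that by blast
   thus ?thesis using v finB b inv by (simp add: push_def fc)
  qed (simp add: push_def)
  thus "push v : carrier (?P k)" using v finB by (auto simp: fc push_def)
 qed (auto simp: push_def fun_eq_iff)
 have pp: "pull (push v) = v" if "v : carrier (?F k)" for v k
  using that finB by (auto simp: pull_def push_def fun_eq_iff inv fc simp del: UN_iff)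
 have pp': "push (pull u) = u" if u: "u : carrier (?P k)" for u k
 proof
  fix c show "push (pull u) c = u c"
  proof (cases "c : J ` ?A")
   case True
   then obtain b where b: "b : ?A" "c = J b" by blast
   thus ?thesis by (simp add: push_def pull_def inv del: UN_iff)
  next
   case False
   hence "c ~: J ` B k" using finB(2)[of k] by blast
   thus ?thesis using u finB(1) False by (auto simp: push_def fc)
  qed
 qed
 have M: "chain_complex R ?F d" "!!k. a_kernel (?F (Suc k)) (?F k) (d (Suc k)) = d (Suc (Suc k)) ` carrier (?F (Suc (Suc k)))"
  using res by (auto simp: resolution_def)
 have dh: "d (Suc k) : mod_hom R (?F (Suc k)) (?F k)" for k using M(1) by (auto simp: chain_complex_def)
 have dd: "d (Suc k) (d (Suc (Suc k)) x) = (%b. \<zero>)" if "x : carrier (?F (Suc (Suc k)))" for k x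
  using M(1) that by (auto simp: chain_complex_def)
 obtain h where h: "h : mod_hom R (?F 0) Q" "h ` carrier (?F 0) = carrier Q" "a_kernel (?F 0) Q h = d 1 ` carrier (?F 1)"
  using res unfolding resolution_def by blast
 have push0: "push (%b. \<zero>) = (%b. \<zero>)" by (auto simp: push_def)
 have pull0: "pull (%b. \<zero>) = (%b. \<zero>)" by (auto simp: pull_def)
 have \<delta>h: "\<delta> (Suc k) : mod_hom R (?P (Suc k)) (?P k)" for k
 proof -
  have "\<delta> (Suc k) = (%y. push (d (Suc k) (pull y)))" by (rule ext) (simp only: \<delta>_def)
  thus ?thesis using mod_hom_comp[OF mod_hom_comp[OF pullc dh] pushc] by (simp only:)
 qed
 have im: "\<delta> (Suc k) ` carrier (?P (Suc k)) = push ` (d (Suc k) ` carrier (?F (Suc k)))" for k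
 proof -
  have "pull ` carrier (?P k) = carrier (?F k)" for k
   using mod_homD(1)[OF pullc] mod_homD(1)[OF pushc] pp by (auto intro!: rev_image_eqI)
  hence "push ` (d (Suc k) ` carrier (?F (Suc k))) = push ` (d (Suc k) ` (pull ` carrier (?P (Suc k))))" by (simp only:)
  moreover have "\<delta> (Suc k) = (%y. push (d (Suc k) (pull y)))" by (rule ext) (simp only: \<delta>_def)
  ultimately show ?thesis by (simp only: image_image)
 qed
 have kp: "{x : carrier (?P k). pull x : K} = push ` K" if "K <= carrier (?F k)" for k K
 proof (intro equalityI subsetI)
  show "x : push ` K" if "x : {x : carrier (?P k). pull x : K}" for x using that pp'[of x k] by (auto intro: rev_image_eqI)
 qed (use that pp mod_homD(1)[OF pushc] in auto)
 have p0: "push y = (%b. \<zero>) <-> y = (%b. \<zero>)" if "y : carrier (?F k)" for y k using pp[OF that] push0 pull0 by metis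
 have "resolution R ?P \<delta> Q"
  unfolding resolution_def chain_complex_def
 proof (intro conjI allI ballI)
  show "module R (?P k)" for k by (rule free_module_module)
  show "\<delta> (Suc k) : mod_hom R (?P (Suc k)) (?P k)" for k by (rule \<delta>h)
  show "\<delta> (Suc k) (\<delta> (Suc (Suc k)) x) = \<zero>\<^bsub>?P k\<^esub>" if x: "x : carrier (?P (Suc (Suc k)))" for x k
   using dd[OF mod_homD(1)[OF pullc x]] pp[OF mod_homD(1)[OF dh mod_homD(1)[OF pullc x]]] push0
   by (simp add: \<delta>_def)
  show "a_kernel (?P (Suc k)) (?P k) (\<delta> (Suc k)) = \<delta> (Suc (Suc k)) ` carrier (?P (Suc (Suc k)))" for k
  proof -
   have "a_kernel (?P (Suc k)) (?P k) (\<delta> (Suc k)) = {x : carrier (?P (Suc k)). pull x : a_kernel (?F (Suc k)) (?F k) (d (Suc k))}"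
    using p0[OF mod_homD(1)[OF dh mod_homD(1)[OF pullc]]] mod_homD(1)[OF pullc] by (auto simp: a_kernel_def' \<delta>_def)
   also have "... = push ` a_kernel (?F (Suc k)) (?F k) (d (Suc k))" by (rule kp) (auto simp: a_kernel_def')
   finally show ?thesis unfolding im M(2) .
  qed
  show "EX h:mod_hom R (?P 0) Q. h ` carrier (?P 0) = carrier Q & a_kernel (?P 0) Q h = \<delta> 1 ` carrier (?P 1)"
  proof (rule bexI[OF _ mod_hom_comp[OF pullc h(1)]], intro conjI)
   have s: "pull ` carrier (?P 0) = carrier (?F 0)"
    using mod_homD(1)[OF pullc] mod_homD(1)[OF pushc] pp by (auto intro!: rev_image_eqI)
   show "(%x. h (pull x)) ` carrier (?P 0) = carrier Q" using h(2) s by (simp add: image_image[symmetric])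
   have "a_kernel (?P 0) Q (%x. h (pull x)) = {x : carrier (?P 0). pull x : a_kernel (?F 0) Q h}"
    using mod_homD(1)[OF pullc] by (auto simp: a_kernel_def')
   also have "... = push ` a_kernel (?F 0) Q h" by (rule kp) (auto simp: a_kernel_def')
   finally show "a_kernel (?P 0) Q (%x. h (pull x)) = \<delta> 1 ` carrier (?P 1)" using im[of 0] h(3) by simp
  qed
 qed
 moreover have "projective R (?P k)" for k by (rule free_module_projective[OF ne])
 moreover have "carrier (?P k) = {\<zero>\<^bsub>?P k\<^esub>}" if "k > n" for k
  using van[OF that] by (auto simp: fc)
 ultimately show ?thesis unfolding proj_dim_def by (intro Inf_lower) blast
qed

text \<open>All coordinates of s u lie in I, whereas a unit vector has a coordinate 1.\<close>

lemma no_section: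
 assumes I: "ideal I R" "I ~= carrier R" and b: "b : B" and B: "finite B'"
  and s: "s : mod_hom R (free_module R B') (free_module R B)"
  and u: "u : carrier (free_module R B')" "!!c. u c : I"
 shows "s u ~= unitv b"
proof
 assume e: "s u = unitv b"
 let ?F = "free_module R B'"
 interpret I: ideal I R by (rule I)
 interpret F: module R ?F by (rule free_module_module)
 have uc: "u c : carrier R" for c using u(1) by (simp add: fm_carrier)
 have cl: "(%c. u c \<odot>\<^bsub>?F\<^esub> unitv c) : B' \<rightarrow> carrier ?F"
  using uc by (intro Pi_I F.smult_closed unitv_carrier)
 have ue: "u = (\<Oplus>\<^bsub>?F\<^esub>c\<in>B'. u c \<odot>\<^bsub>?F\<^esub> unitv c)"
  by (rule free_module_expand[OF u(1) B]) (use u(1) in "auto simp: fm_carrier")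
 have sc: "s (unitv c) : carrier (free_module R B)" if "c : B'" for c
  by (rule mod_homD(1)[OF s unitv_carrier[OF that]])
 have "s u = (\<Oplus>\<^bsub>free_module R B\<^esub>c\<in>B'. s (u c \<odot>\<^bsub>?F\<^esub> unitv c))"
  by (subst ue) (rule mod_hom_finsum[OF free_module_module free_module_module s B cl])
 hence "s u b = (\<Oplus>c\<in>B'. s (u c \<odot>\<^bsub>?F\<^esub> unitv c) b)"
  using free_finsum_apply[OF B, of "%c. s (u c \<odot>\<^bsub>?F\<^esub> unitv c)" B b] mod_homD(1)[OF s] cl by (auto simp: Pi_iff)
 also have "... : I"
 proof (intro finsum_ideal[OF I(1) B] Pi_I)
  show "s (u c \<odot>\<^bsub>?F\<^esub> unitv c) b : I" if c: "c : B'" for c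
   using mod_homD(3)[OF s uc unitv_carrier[OF c]] sc[OF c] I.I_r_closed[OF u(2)] by (simp add: fm_carrier)
 qed
 finally have "\<one> : I" using e by (simp add: unitv_def)
 thus False using I.one_imp_carrier I(2) by blast
qed

end

section \<open>Entries of the last differential\<close>

context complex_data
begin

lemma Mbasis_le: "Mbasis k y ==> k <= de | (1 <= eps & k + de + 1 <= f + 2 * eps)"
proof -
 assume y: "Mbasis k y"
 have c: "card K <= f" if "ok K a" for K a using that card_mono[of "{1..f}" K] by (auto simp: ok_def)
 show ?thesis
 proof (cases y)
  case (VT p)
  obtain K a where "p = (K, a)" by (cases p)
  thus ?thesis using y VT eps_less by (auto simp: Mbasis_def chT_def)
 next
  case (VB p)
  obtain K a where "p = (K, a)" by (cases p)
  thus ?thesis using y VB c[of K a] by (auto simp: Mbasis_def chB_def)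
 next
  case Top
  thus ?thesis using y by (simp add: Mbasis_def)
 qed
qed

definition bvec :: "M_basis_elt => M_basis_elt => 'r" where
 "bvec y = (%z. of_bool (z = y))"

lemma inM_bvec: "Mbasis k y ==> inM k (bvec y)"
 by (auto simp: inM_def bvec_def)

lemma vec1_infinite: "vec1 f u ==> infinite K ==> u K = 0"
 by (auto simp: vec1_def)

lemma Dm_wdg_one: "wdg (Dm m) wdg_one = Dm m"
 by (rule wdg_one_right) (rule homog_infinite[OF homog_Dm])

lemma psi_in_idl: "is_idl I ==> t ` {1..f} <= I ==> contr f t v K : I"
 unfolding contr_def by (intro is_idl_sum is_idlD(4)) auto

lemma wdg_psi_in_idl: "is_idl I ==> t ` {1..f} <= I ==> wdg (psi l) v K : I"
 using inJD[OF inJ_wdg_left[of I "psi l"]] psi_in_idl[of I "x l"] by (simp add: inJ_def psi_def)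

text \<open>From position 2 on, only Psi and tau act on V^B, and their entries are combinations of
  the t p.\<close>

lemma bottom_entries:
 assumes I: "is_idl I" "t ` {1..f} <= I" and y: "y = VB p" and k: "2 <= k"
 shows "D k (bvec y) z : I"
proof -
 have T: "Tc (bvec y) = 0" by (auto simp: Tc_def bvec_def y fun_eq_iff)
 have "inJ2 I (PsiH W)" for W
  by (rule inJ2I) (simp only: PsiH_def sum_apply, intro is_idl_sum[OF I(1)] wdg_psi_in_idl[OF I])
 moreover have "inJ2 I (tauH W)" for W
  by (rule inJ2I) (simp only: tauH_def, rule psi_in_idl[OF I])
 ultimately have P: "inJ2 I (PsiH W + tauH W)" for W by (intro inJ2_add I)
 have "inJ I (dd (bvec y))"
  unfolding dd_def ddT_def ddB_def T muH_zero
  by (intro inJ_mk inJ2_add inJ2_tr inJ2_sum I P is_idlD(1) inJ2_zero)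
 thus ?thesis using k by (simp add: D_def inJ_def)
qed

text \<open>For f - g = 1 the differential is c itself. For g = 1 the entries of Psi are the minors,
  tau kills exterior degree 0, and the only mu terms that survive are values of c.\<close>

lemma top_entries:
 assumes I: "is_idl I" "range Lam <= I" "cgens <= I" and e: "2 * eps + 1 = de" and g1: "g = 1 | de = 1"
  and y: "y = VT ({}, a)" and a: "a : exponents g (de - 1)"
 shows "D de (bvec y) z : I"
proof -
 let ?w = "bvec y"
 have T: "Tc ?w b K = of_bool (b = a & K = {})" for b K by (auto simp: Tc_def bvec_def y)
 have B: "Bc ?w = 0" by (auto simp: Bc_def bvec_def y fun_eq_iff)
 show ?thesis
 proof (cases "de = 1")
  case True
  hence 0: "eps = 0" using e by simp
  have "(SUM b:exponents g eps. Tc ?w b {} * Wt b {1..f}) = (SUM b:exponents g eps. if b = a then Wt b {1..f} else 0)"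
   by (rule sum.cong) (auto simp: T)
  also have "... = Wt a {1..f}" using a finite_exponents True 0 by (simp add: sum.delta)
  finally have s: "(SUM b:exponents g eps. Tc ?w b {} * Wt b {1..f}) = Wt a {1..f}" .
  have "Wt a {1..f} : cgens" unfolding cgens_def using e a True 0 by (auto intro!: exI[of _ a])
  hence "Wt a {1..f} : I" using I(3) by blast
  hence "d1 ?w z : I"
   using is_idlD(1)[OF I(1)] s e by (cases z) (simp_all add: d1_def mk_def B)
  thus ?thesis using True by (simp add: D_def)
 next
  case False
  hence g: "g = 1" and de: "2 <= de" using g1 eps_less by auto
  have "[2..<Suc g] = []" using g by simp
  have "[1..<Suc g] = [1]" using g by simp
  hence Lam: "Lam = psi 1"
   using vec1_infinite[OF psi_vec1] by (simp add: Lam_def PL_def wdg_one_right del: upt_Suc)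
  have "inJ2 I (PsiH W)" for W
  proof (rule inJ2I)
   fix b K
   have "psi 1 L : I" for L using I(2) Lam by auto
   hence "inJ I (psi 1)" by (simp add: inJ_def)
   hence "inJ I (psi l)" if "l : {1..g}" for l using that g by simp
   thus "PsiH W b K : I" unfolding PsiH_def sum_apply
    by (intro is_idl_sum[OF I(1)] inJD[OF inJ_wdg_left[OF I(1)]])
  qed
  moreover have "tauH (Tc ?w) = 0"
   by (auto simp: tauH_def contr_def ann1_def fun_eq_iff T intro!: sum.neutral)
  ultimately have "inJ2 I (ddT ?w)" unfolding ddT_def using inJ2_tr[OF I(1)] by simp
  moreover have "inJ2 I (ddB ?w)"
   unfolding ddB_def B
  proof (intro inJ2_add[OF I(1)] inJ2_sum[OF I(1)])
   show "inJ2 I (tr iB (PsiH 0 + tauH 0))" by (intro inJ2_tr I(1)) (simp add: inJ2_zero I(1))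
   fix n assume n: "n : {1..f}"
   show "inJ2 I (tr (%i j. iB i j * cf n i j) (muH n (Tc ?w)))"
   proof (rule inJ2I)
    fix b K
    have W: "Tc ?w c = (if c = a then wdg_one else 0)" for c
    by (auto simp: fun_eq_iff T wdg_one_def)
    have m: "wdg (Dm m) (Tc ?w (b + m)) K : I" if m: "m : exponents g n" and ok: "ok K b" and ch: "chB (card K) (expdeg g b)" for m
    proof (cases "b + m = a")
    case True
    \<comment> \<open>The total degree f - g - 1 equals 2 eps, and V^B has j < eps, so n > eps; on
      the other hand 2n <= f = 2 eps + 2. Hence n = eps + 1 and K is everything.\<close>
    have "expdeg g b + n = 2 * eps"
    using True a e m by (auto simp: exponents_def sum.distrib[symmetric])
    hence n1: "eps + 1 <= n" using ch by (auto simp: chB_def)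
    show ?thesis
    proof (cases "Dm m K = 0")
    case False
    hence K: "card K = 2 * n" using homog_Dm[of m] m by (auto simp: homog_def ext_basis_def exponents_def)
    moreover have "card K <= f" using ok card_mono[of "{1..f}" K] by (auto simp: ok_def)
    ultimately have n2: "n = eps + 1" "card K = f" using n1 e g g_less by auto
    hence Kf: "K = {1..f}" using ok card_subset_eq[of "{1..f}" K] by (auto simp: ok_def)
    \<comment> \<open>Taking one X_1 out of m exhibits the coefficient as c(X_1^(eps)).\<close>
    define a' where "a' = (%l::nat. if l = 1 then eps else 0 :: nat)"
    have "m = a' + uexp 1" using m n2 g by (auto simp: exponents_def a'_def uexp_apply fun_eq_iff)
    hence "Dm m = Wt a'" using \<open>[2..<Suc g] = []\<close> by (simp add: Wt_def PL_def Dm_wdg_one del: upt_Suc)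
    moreover have "a' : exponents g eps" by (auto simp: exponents_def a'_def g)
    ultimately have "Dm m K : cgens" using e by (auto simp: cgens_def Kf)
    thus ?thesis using I(3) True by (auto simp: W Dm_wdg_one)
    qed (use True is_idlD(1)[OF I(1)] in "auto simp: W Dm_wdg_one")
    qed (use is_idlD(1)[OF I(1)] in "simp add: W")
    show "tr (%i j. iB i j * cf n i j) (muH n (Tc ?w)) b K : I"
    proof (cases "ok K b & chB (card K) (expdeg g b)")
    case True
    hence "muH n (Tc ?w) b K : I" unfolding muH_def sum_apply
    by (intro is_idl_sum[OF I(1)] m) auto
    thus ?thesis using is_idlD[OF I(1)] by (auto simp: tr_def)
    qed (use is_idlD(1)[OF I(1)] in "auto simp: tr_def")
   qed
  qed
  ultimately have "inJ I (dd ?w)" unfolding dd_def by (intro inJ_mk I(1) is_idlD(1))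
  thus ?thesis using de by (simp add: D_def inJ_def)
 qed
qed

end

section \<open>Localization\<close>

locale mult_closed = cring R for R :: "('a,'x) ring_scheme" (structure) +
 fixes S :: "'a set"
 assumes S_carrier: "S <= carrier R" and S_one [simp]: "\<one> : S" and S_mult [simp]: "!!s t. s : S ==> t : S ==> s \<otimes> t : S"
begin

abbreviation fr :: "'a => 'a => ('a \<times> 'a) set" where "fr \<equiv> fraction R S"
abbreviation L :: "('a \<times> 'a) set ring" where "L \<equiv> fraction_ring R S"

lemma S_closed [simp]: "s : S ==> s : carrier R"
 using S_carrier by blast

lemma fr_sub:
 assumes c: "a : carrier R" "b : carrier R" "s : S" "t : S" "u : S" and e: "u \<otimes> (t \<otimes> a) = u \<otimes> (s \<otimes> b)"
 shows "fr a s <= fr b t"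
proof (rule subrelI)
 fix d w assume "(d,w) : fr a s"
 then obtain v where d: "d : carrier R" "w : S" "v : S" "v \<otimes> (w \<otimes> a) = v \<otimes> (s \<otimes> d)" by (auto simp: fraction_def)
 have "(u \<otimes> (v \<otimes> s)) \<otimes> (w \<otimes> b) = (v \<otimes> w) \<otimes> (u \<otimes> (s \<otimes> b))" using c d(1-3) by (simp add: m_ac)
 also have "... = (u \<otimes> t) \<otimes> (v \<otimes> (w \<otimes> a))" unfolding e[symmetric] using c d(1-3) by (simp add: m_ac)
 also have "... = (u \<otimes> (v \<otimes> s)) \<otimes> (t \<otimes> d)" unfolding d(4) using c d(1-3) by (simp add: m_ac)
 finally show "(d,w) : fr b t"
  using d c by (auto simp: fraction_def intro!: bexI[of _ "u \<otimes> (v \<otimes> s)"])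
qed

lemma fr_self: "a : carrier R ==> s : S ==> (a,s) : fr a s"
 using S_one by (auto simp: fraction_def intro!: bexI[of _ \<one>])

lemma fr_eq:
 assumes c: "a : carrier R" "b : carrier R" "s : S" "t : S"
 shows "fr a s = fr b t <-> (EX u:S. u \<otimes> (t \<otimes> a) = u \<otimes> (s \<otimes> b))"
proof
 assume "fr a s = fr b t"
 hence "(b,t) : fr a s" using fr_self c by simp
 thus "EX u:S. u \<otimes> (t \<otimes> a) = u \<otimes> (s \<otimes> b)" by (auto simp: fraction_def)
next
 assume "EX u:S. u \<otimes> (t \<otimes> a) = u \<otimes> (s \<otimes> b)"
 then obtain u where u: "u : S" "u \<otimes> (t \<otimes> a) = u \<otimes> (s \<otimes> b)" by blast
 show "fr a s = fr b t"
  using fr_sub[OF c u] fr_sub[OF c(2,1,4,3) u(1) u(2)[symmetric]] by blast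
qed

lemma fr_memD: "(b,t) : fr a s ==> EX u. b : carrier R & t : S & u : S & u \<otimes> (t \<otimes> a) = u \<otimes> (s \<otimes> b)"
 unfolding fraction_def by blast

lemma fr_cancel:
 assumes "a : carrier R" "s : S" "u : S" shows "fr (u \<otimes> a) (u \<otimes> s) = fr a s"
 using assms by (subst fr_eq) (auto simp: m_ac intro!: bexI[of _ \<one>])

text \<open>Operations on fractions are unions over all pairs of representatives; if every pair
  yields the same class, the union is that class.\<close>

lemma fr_UN:
 assumes c: "a : carrier R" "b : carrier R" "s : S" "t : S"
  and H: "!!a' s' u b' t' v. a' : carrier R ==> s' : S ==> u : S ==> u \<otimes> (s' \<otimes> a) = u \<otimes> (s \<otimes> a') ==>
   b' : carrier R ==> t' : S ==> v : S ==> v \<otimes> (t' \<otimes> b) = v \<otimes> (t \<otimes> b') ==> H (a',s') (b',t') = H (a,s) (b,t)"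
 shows "(UN p:fr a s. UN q:fr b t. H p q) = H (a,s) (b,t)"
proof -
 have "H p q = H (a,s) (b,t)" if "p : fr a s" "q : fr b t" for p q
  using fr_memD[of "fst p" "snd p" a s] fr_memD[of "fst q" "snd q" b t] that H[of "fst p" "snd p" _ "fst q" "snd q"]
  by (simp only: prod.collapse) blast
 hence "(UN p:fr a s. UN q:fr b t. H p q) = (UN p:fr a s. UN q:fr b t. H (a,s) (b,t))"
  by (intro SUP_cong refl)
 thus ?thesis using fr_self[OF c(1,3)] fr_self[OF c(2,4)] by auto
qed

lemma fr_mult:
 assumes c: "a : carrier R" "b : carrier R" "s : S" "t : S"
 shows "fr a s \<otimes>\<^bsub>L\<^esub> fr b t = fr (a \<otimes> b) (s \<otimes> t)"
proof -
 have "(UN p:fr a s. UN q:fr b t. fr (fst p \<otimes> fst q) (snd p \<otimes> snd q)) = fr (fst (a,s) \<otimes> fst (b,t)) (snd (a,s) \<otimes> snd (b,t))"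
 proof (rule fr_UN[OF c], goal_cases)
  case (1 a' s' u b' t' v)
  have "(u \<otimes> v) \<otimes> ((s \<otimes> t) \<otimes> (a' \<otimes> b')) = (u \<otimes> (s \<otimes> a')) \<otimes> (v \<otimes> (t \<otimes> b'))" using c 1(1-3,5-7) by (simp add: m_ac)
  also have "... = (u \<otimes> v) \<otimes> ((s' \<otimes> t') \<otimes> (a \<otimes> b))" unfolding 1(4,8)[symmetric] using c 1(1-3,5-7) by (simp add: m_ac)
  finally show ?case unfolding fst_conv snd_conv using c 1(1-3,5-7) by (subst fr_eq) (auto intro!: bexI[of _ "u \<otimes> v"])
 qed
 thus ?thesis by (simp add: fraction_ring_def case_prod_unfold)
qed

lemma fr_add:
 assumes c: "a : carrier R" "b : carrier R" "s : S" "t : S"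
 shows "fr a s \<oplus>\<^bsub>L\<^esub> fr b t = fr (t \<otimes> a \<oplus> s \<otimes> b) (s \<otimes> t)"
proof -
 have "(UN p:fr a s. UN q:fr b t. fr (snd q \<otimes> fst p \<oplus> snd p \<otimes> fst q) (snd p \<otimes> snd q)) =
  fr (snd (b,t) \<otimes> fst (a,s) \<oplus> snd (a,s) \<otimes> fst (b,t)) (snd (a,s) \<otimes> snd (b,t))"
 proof (rule fr_UN[OF c], goal_cases)
  case (1 a' s' u b' t' v)
  have "(u \<otimes> v) \<otimes> ((s \<otimes> t) \<otimes> (t' \<otimes> a' \<oplus> s' \<otimes> b')) = (v \<otimes> t \<otimes> t') \<otimes> (u \<otimes> (s \<otimes> a')) \<oplus> (u \<otimes> s \<otimes> s') \<otimes> (v \<otimes> (t \<otimes> b'))"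
   using c 1(1-3,5-7) by (simp add: m_ac r_distr)
  also have "... = (u \<otimes> v) \<otimes> ((s' \<otimes> t') \<otimes> (t \<otimes> a \<oplus> s \<otimes> b))" unfolding 1(4,8)[symmetric] using c 1(1-3,5-7) by (simp add: m_ac r_distr)
  finally show ?case unfolding fst_conv snd_conv using c 1(1-3,5-7) by (subst fr_eq) (auto intro!: bexI[of _ "u \<otimes> v"])
 qed
 thus ?thesis by (simp add: fraction_ring_def case_prod_unfold)
qed

lemma L_carrier: "X : carrier L <-> (EX a:carrier R. EX s:S. X = fr a s)"
 by (auto simp: fraction_ring_def)

lemma L_carrierI: "a : carrier R ==> s : S ==> fr a s : carrier L"
 using L_carrier by blast

lemma L_carrierE: "X : carrier L ==> (!!a s. a : carrier R ==> s : S ==> X = fr a s ==> P) ==> P"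
 using L_carrier by blast

lemma L_one: "\<one>\<^bsub>L\<^esub> = fr \<one> \<one>" and L_zero: "\<zero>\<^bsub>L\<^esub> = fr \<zero> \<one>"
 by (simp_all add: fraction_ring_def)

lemma L_cring: "cring L"
proof (rule cringI)
 show "abelian_group L"
 proof (rule abelian_groupI)
  fix X assume "X : carrier L"
  then obtain a s where X: "a : carrier R" "s : S" "X = fr a s" by (rule L_carrierE)
  have "fr (\<ominus> a) s \<oplus>\<^bsub>L\<^esub> X = fr \<zero> (s \<otimes> s)" using X by (simp add: fr_add r_distr[symmetric] l_neg)
  also have "... = \<zero>\<^bsub>L\<^esub>" using X by (auto simp: L_zero fr_eq intro!: bexI[of _ \<one>])
  finally show "EX Y:carrier L. Y \<oplus>\<^bsub>L\<^esub> X = \<zero>\<^bsub>L\<^esub>" using X by (intro bexI[of _ "fr (\<ominus> a) s"]) (auto simp: L_carrier)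
 qed (auto elim!: L_carrierE intro!: L_carrierI simp: fr_add L_zero r_distr m_ac a_ac)
 show "comm_monoid L"
  by (rule comm_monoidI) (auto elim!: L_carrierE intro!: L_carrierI simp: fr_mult L_one m_ac)
 fix X Y Z assume "X : carrier L" "Y : carrier L" "Z : carrier L"
 then obtain a s b t d u where X: "a : carrier R" "s : S" "X = fr a s"
  and Y: "b : carrier R" "t : S" "Y = fr b t" and Z: "d : carrier R" "u : S" "Z = fr d u"
  by (metis L_carrier)
 have "X \<otimes>\<^bsub>L\<^esub> Z \<oplus>\<^bsub>L\<^esub> Y \<otimes>\<^bsub>L\<^esub> Z = fr (u \<otimes> ((t \<otimes> a \<oplus> s \<otimes> b) \<otimes> d)) (u \<otimes> ((s \<otimes> t) \<otimes> u))"
  using X Y Z by (simp add: fr_mult fr_add r_distr l_distr m_ac)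
 also have "... = (X \<oplus>\<^bsub>L\<^esub> Y) \<otimes>\<^bsub>L\<^esub> Z"
  using X Y Z by (simp add: fr_cancel fr_mult fr_add)
 finally show "(X \<oplus>\<^bsub>L\<^esub> Y) \<otimes>\<^bsub>L\<^esub> Z = X \<otimes>\<^bsub>L\<^esub> Z \<oplus>\<^bsub>L\<^esub> Y \<otimes>\<^bsub>L\<^esub> Z" ..
qed

definition ext_ideal :: "'a set => ('a \<times> 'a) set set" where
 "ext_ideal I = {fr r s | r s. r : I & s : S}"

lemma ext_idealI: "r : I ==> s : S ==> fr r s : ext_ideal I"
 unfolding ext_ideal_def by blast

lemma ext_ideal_mem:
 assumes I: "ideal I R" and r: "r : carrier R" "s : S"
 shows "fr r s : ext_ideal I <-> (EX u:S. u \<otimes> r : I)"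
proof
 interpret I: ideal I R by (rule I)
 assume "fr r s : ext_ideal I"
 then obtain r' s' where r': "fr r s = fr r' s'" "r' : I" "s' : S" by (auto simp: ext_ideal_def)
 then obtain u where u: "u : S" "u \<otimes> (s' \<otimes> r) = u \<otimes> (s \<otimes> r')" using fr_eq[of r r' s s'] r I.a_subset by auto
 have "u \<otimes> (s \<otimes> r') : I" using u(1) r r'(2) S_closed by (intro I.I_l_closed)
 hence "(u \<otimes> s') \<otimes> r : I" using u r r' S_closed by (simp add: m_assoc)
 thus "EX u:S. u \<otimes> r : I" using S_mult u(1) r'(3) by blast
next
 assume "EX u:S. u \<otimes> r : I"
 then obtain u where "u : S" "u \<otimes> r : I" by blast
 thus "fr r s : ext_ideal I"
  using fr_cancel[of r s u] r S_mult ext_idealI[of "u \<otimes> r" I "u \<otimes> s"] by simp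
qed

lemma ext_ideal_ideal:
 assumes I: "ideal I R" shows "ideal (ext_ideal I) L"
proof -
 interpret I: ideal I R by (rule I)
 interpret L: cring L by (rule L_cring)
 have Ic [simp]: "r : I ==> r : carrier R" for r using I.a_subset by blast
 show ?thesis
 proof (rule L.idealI')
  show "ext_ideal I <= carrier L" by (auto simp: ext_ideal_def intro: L_carrierI)
  show "\<zero>\<^bsub>L\<^esub> : ext_ideal I" using ext_idealI[OF I.zero_closed S_one] by (simp add: L_zero)
  fix X assume "X : ext_ideal I"
  then obtain r s where r: "X = fr r s" "r : I" "s : S" by (auto simp: ext_ideal_def)
  show "X \<oplus>\<^bsub>L\<^esub> Y : ext_ideal I" if "Y : ext_ideal I" for Y
   using that r I.I_l_closed by (auto simp: ext_ideal_def[of I] fr_add) (metis I.a_closed S_closed S_mult I.I_l_closed)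
  show "Y \<otimes>\<^bsub>L\<^esub> X : ext_ideal I" if "Y : carrier L" for Y
   using that r I.I_l_closed ext_idealI by (auto simp: fr_mult elim!: L_carrierE)
 qed
qed

text \<open>Denominators are units of the fraction ring, so each generator may carry its own without
  changing the ideal.\<close>

lemma Idl_fr:
 assumes bs: "!!i. i < length bs ==> bs ! i : carrier R & ss ! i : S" and len: "length ss = length bs"
 shows "Idl\<^bsub>L\<^esub> (set (map2 fr bs ss)) = ext_ideal (Idl (set bs))"
proof -
 interpret L: cring L by (rule L_cring)
 have bc: "set bs <= carrier R" using bs by (auto simp: in_set_conv_nth)
 have m: "X : set (map2 fr bs ss) <-> (EX i<length bs. X = fr (bs ! i) (ss ! i))" for X
  unfolding in_set_conv_nth using len by (simp add: eq_commute cong: conj_cong)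
 note I = genideal_ideal[OF bc]
 have mc: "set (map2 fr bs ss) <= carrier L"
 proof
  fix X assume "X : set (map2 fr bs ss)"
  thus "X : carrier L" unfolding m using bs L_carrierI by blast
 qed
 show ?thesis
 proof
  show "Idl\<^bsub>L\<^esub> (set (map2 fr bs ss)) <= ext_ideal (Idl (set bs))"
  proof (rule L.genideal_minimal[OF ext_ideal_ideal[OF I]], rule subsetI)
   fix X assume "X : set (map2 fr bs ss)"
   then obtain i where i: "i < length bs" "X = fr (bs ! i) (ss ! i)" using m by blast
   thus "X : ext_ideal (Idl (set bs))" using genideal_self[OF bc] bs[OF i(1)] nth_mem[OF i(1)] ext_idealI by blast
  qed
  let ?J = "Idl\<^bsub>L\<^esub> (set (map2 fr bs ss))"
  interpret J: ideal ?J L by (rule L.genideal_ideal[OF mc])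
  let ?K = "{r : carrier R. fr r \<one> : ?J}"
  have c1: "fr x \<one> : carrier L" if "x : carrier R" for x by (rule L_carrierI[OF that S_one])
  have "ideal ?K R"
  proof (rule idealI')
   show "\<zero> : ?K" using J.zero_closed by (simp add: L_zero)
   show "x \<oplus> y : ?K" if "x : ?K" "y : ?K" for x y
    using that J.a_closed[of "fr x \<one>" "fr y \<one>"] fr_add[of x y \<one> \<one>] by simp
   show "x \<otimes> a : ?K" if "x : carrier R" "a : ?K" for x a
    using that J.I_l_closed[OF _ c1] fr_mult[of x a \<one> \<one>] by force
  qed auto
  moreover have "set bs <= ?K"
  proof
   fix b assume "b : set bs"
   then obtain i where i: "i < length bs" "b = bs ! i" by (auto simp: in_set_conv_nth)
   have b: "b : carrier R" "ss ! i : S" using bs[OF i(1)] i(2) by auto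
   have "fr b (ss ! i) : ?J" using L.genideal_self[OF mc] m i by blast
   moreover have "fr (ss ! i) \<one> \<otimes>\<^bsub>L\<^esub> fr b (ss ! i) = fr b \<one>"
    using b S_one S_closed[OF b(2)] fr_cancel[OF b(1) S_one b(2)] by (simp add: fr_mult)
   moreover have "fr (ss ! i) \<one> : carrier L" using S_one S_closed[OF b(2)] by (auto intro!: L_carrierI)
   ultimately show "b : ?K" using J.I_l_closed[of "fr b (ss ! i)" "fr (ss ! i) \<one>"] b by simp
  qed
  ultimately have K: "Idl (set bs) <= ?K" by (rule genideal_minimal)
  show "ext_ideal (Idl (set bs)) <= ?J"
  proof
   fix X assume "X : ext_ideal (Idl (set bs))"
   then obtain r s where r: "X = fr r s" "r : Idl (set bs)" "s : S" by (auto simp: ext_ideal_def)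
   have rK: "r : carrier R" "fr r \<one> : ?J" using r(2) K by auto
   have "fr \<one> s \<otimes>\<^bsub>L\<^esub> fr r \<one> = X" using r rK S_one S_closed by (simp add: fr_mult)
   moreover have "fr \<one> s : carrier L" using r by (auto intro!: L_carrierI)
   ultimately show "X : ?J" using J.I_l_closed[OF rK(2)] by blast
  qed
 qed
qed

end

context cring
begin

text \<open>A multiplier outside p can be absorbed into r, so weak regularity passes to fractions;
  properness, which it lacks, comes from the inclusion in p.\<close>

theorem localization_depth_ge:
 assumes p: "primeideal p R" and xs: "weak_regseq R xs" "set xs <= p"
 shows "enat (length xs) <= local_depth (localization R p)"
proof -
 interpret p: primeideal p R by (rule p)
 interpret mult_closed R "carrier R - p"
  by unfold_locales (use p.I_notcarr p.one_imp_carrier p.I_prime in auto)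
 note S_closed [simp del] S_mult [simp del] S_one [simp del]
 interpret L: cring L by (rule L_cring)
 have loc: "localization R p = L" by (simp add: localization_def)
 let ?ys = "map (%x. fr x \<one>) xs"
 let ?m = "carrier L - Units L"
 have xc: "set xs <= carrier R" using xs(1) by (simp add: weak_regseq_def)
 have Idl: "Idl\<^bsub>L\<^esub> (set (take i ?ys)) = ext_ideal (Idl (set (take i xs)))" for i
 proof -
  have "take i ?ys = map2 fr (take i xs) (map (%x. \<one>) (take i xs))"
   by (rule nth_equalityI) auto
  moreover have "take i xs ! j : carrier R" if "j < length (take i xs)" for j
   using nth_mem[of j xs] xc that by auto
  ultimately show ?thesis
   using Idl_fr[of "take i xs" "map (%x. \<one>) (take i xs)"] S_one by simp
 qed
 have nu: "fr a s : ?m" if a: "a : p" "s : carrier R - p" for a s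
 proof -
  have ac: "a : carrier R" using a p.a_subset by blast
  have "fr a s ~: Units L"
  proof
   assume "fr a s : Units L"
   then obtain Y where Y: "Y : carrier L" "Y \<otimes>\<^bsub>L\<^esub> fr a s = \<one>\<^bsub>L\<^esub>" by (auto simp: Units_def)
   obtain b t where b: "Y = fr b t" "b : carrier R" "t : carrier R - p" using Y(1) L_carrier by auto
   have "fr (b \<otimes> a) (t \<otimes> s) = fr \<one> \<one>" using Y(2) b a ac by (simp add: fr_mult L_one)
   then obtain u where u: "u : carrier R - p" "u \<otimes> (\<one> \<otimes> (b \<otimes> a)) = u \<otimes> (t \<otimes> s \<otimes> \<one>)"
    using fr_eq[of "b \<otimes> a" \<one> "t \<otimes> s" \<one>] b a ac S_mult S_one by auto
   have "u \<otimes> (b \<otimes> a) : p" using u(1) b(2) a(1) by (intro p.I_l_closed) auto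
   hence "u \<otimes> (t \<otimes> s) : p" using u b a ac by simp
   moreover have "u \<otimes> (t \<otimes> s) : carrier R - p" using u(1) b(3) a(2) S_mult by blast
   ultimately show False by blast
  qed
  thus ?thesis using ac a by (auto intro!: L_carrierI)
 qed
 have "regular_sequence L ?ys"
  unfolding regular_sequence_def
 proof (intro conjI allI impI ballI)
  show "set ?ys <= carrier L" using xc S_one by (auto intro!: L_carrierI)
  have i: "ideal (Idl (set xs)) R" by (rule genideal_ideal[OF xc])
  show "Idl\<^bsub>L\<^esub> (set ?ys) ~= carrier L"
  proof
   assume "Idl\<^bsub>L\<^esub> (set ?ys) = carrier L"
   hence "fr \<one> \<one> : ext_ideal (Idl (set xs))" using Idl[of "length xs"] L.one_closed by (simp add: L_one)
   then obtain u where "u : carrier R - p" "u \<otimes> \<one> : Idl (set xs)" using ext_ideal_mem[OF i, of \<one> \<one>] S_one by auto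
   thus False using genideal_minimal[OF p.is_ideal xs(2)] by auto
  qed
  fix i X assume i: "i < length ?ys" and X: "X : carrier L" and m: "X \<otimes>\<^bsub>L\<^esub> ?ys ! i : Idl\<^bsub>L\<^esub> (set (take i ?ys))"
  have ti: "ideal (Idl (set (take i xs))) R" by (rule genideal_ideal) (use xc in "auto dest: in_set_takeD")
  obtain r s where r: "X = fr r s" "r : carrier R" "s : carrier R - p" using X L_carrier by auto
  have il: "i < length xs" using i by simp
  have xi: "xs ! i : carrier R" using xc nth_mem[OF il] by blast
  have "X \<otimes>\<^bsub>L\<^esub> ?ys ! i = fr (r \<otimes> xs ! i) s" using r xi il S_one by (simp add: fr_mult)
  then obtain u where u: "u : carrier R - p" "u \<otimes> (r \<otimes> xs ! i) : Idl (set (take i xs))"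
   using m r xi ext_ideal_mem[OF ti, of "r \<otimes> xs ! i" s] unfolding Idl by auto
  have "(u \<otimes> r) \<otimes> xs ! i : Idl (set (take i xs))" using u r xi by (simp add: m_assoc)
  hence "u \<otimes> r : Idl (set (take i xs))" using xs(1) il u(1) r(2) unfolding weak_regseq_def by blast
  thus "X : Idl\<^bsub>L\<^esub> (set (take i ?ys))" using ext_ideal_mem[OF ti r(2,3)] u(1) r(1) unfolding Idl by blast
 qed
 moreover have "set ?ys <= ?m"
  using nu[OF _ S_one] xs(2) by auto
 moreover have "?m ~= carrier L" using L.one_closed L.Units_one_closed by blast
 hence "grade L ?m = Sup {enat (length xs) | xs. regular_sequence L xs & set xs <= ?m}"
  unfolding grade_def by (rule if_not_P)
 ultimately have "enat (length ?ys) <= grade L ?m" by (simp only:) (rule Sup_upper, blast)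
 thus ?thesis by (simp add: local_depth_def loc)
qed

text \<open>Nonunits of the localization have numerators in p. A regular sequence longer than n, cut
  after n + 1 terms, would thus give a sequence of numerators excluded by \<open>no\<close>.\<close>

theorem localization_depth_le:
 assumes p: "primeideal p R"
  and no: "!!bs. S_regseq R (carrier R - p) bs ==> set bs <= p ==> length bs ~= Suc n"
 shows "local_depth (localization R p) <= enat n"
proof -
 interpret p: primeideal p R by (rule p)
 interpret mult_closed R "carrier R - p"
  by unfold_locales (use p.I_notcarr p.one_imp_carrier p.I_prime in auto)
 note S_closed [simp del] S_mult [simp del] S_one [simp del]
 interpret L: cring L by (rule L_cring)
 have loc: "localization R p = L" by (simp add: localization_def)
 let ?m = "carrier L - Units L"
 have nu: "EX b s. X = fr b s & b : p & s : carrier R - p" if X: "X : ?m" for X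
 proof -
  obtain b s where b: "X = fr b s" "b : carrier R" "s : carrier R - p" using X L_carrier by auto
  have "b : p"
  proof (rule ccontr)
   assume nb: "b ~: p"
   have "fr s b \<otimes>\<^bsub>L\<^esub> X = fr (s \<otimes> b) (b \<otimes> s)" using b nb by (simp add: fr_mult)
   also have "... = fr \<one> \<one>" using fr_cancel[of \<one> \<one> "s \<otimes> b"] b nb S_one S_mult by (simp add: m_comm)
   finally have 1: "fr s b \<otimes>\<^bsub>L\<^esub> X = \<one>\<^bsub>L\<^esub>" by (simp add: L_one)
   moreover have c: "fr s b : carrier L" using b nb by (auto intro!: L_carrierI)
   ultimately have "X \<otimes>\<^bsub>L\<^esub> fr s b = \<one>\<^bsub>L\<^esub>" using X L.m_comm by auto
   thus False using X 1 c by (auto simp: Units_def)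
  qed
  thus ?thesis using b by blast
 qed
 have len: "length ys <= n" if ys: "regular_sequence L ys" "set ys <= ?m" for ys
 proof (rule ccontr)
  assume "~ length ys <= n"
  hence n: "n < length ys" by simp
  have "EX b s. ys ! i = fr b s & b : p & s : carrier R - p" if "i < length ys" for i
   using nu ys(2) nth_mem[OF that] by blast
  then obtain b s where bs: "!!i. i < length ys ==> ys ! i = fr (b i) (s i) & b i : p & s i : carrier R - p" by metis
  let ?bs = "map b [0..<Suc n]" and ?ss = "map s [0..<Suc n]"
  have bp: "b i : p" "b i : carrier R" "s i : carrier R - p" if "i < Suc n" for i
   using bs[of i] that n p.a_subset by auto
  have Idl: "Idl\<^bsub>L\<^esub> (set (take i ys)) = ext_ideal (Idl (set (take i ?bs)))" if i: "i < Suc n" for i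
  proof -
   have "take i ys = map2 fr (take i ?bs) (take i ?ss)"
    by (rule nth_equalityI) (use i n bs in auto)
   thus ?thesis using Idl_fr[of "take i ?bs" "take i ?ss"] bp i by auto
  qed
  have "S_regseq R (carrier R - p) ?bs"
   unfolding S_regseq_def
  proof (intro conjI allI impI ballI)
   show bc: "set ?bs <= carrier R" using bp by auto
   fix i r assume i: "i < length ?bs" and r: "r : carrier R" and m: "r \<otimes> ?bs ! i : Idl (set (take i ?bs))"
   have i': "i < Suc n" "i < length ys" using i n by auto
   have ti: "ideal (Idl (set (take i ?bs))) R" by (rule genideal_ideal[OF order_trans[OF set_take_subset bc]])
   have bi: "?bs ! i = b i" using i' by (simp del: upt_Suc)
   have "fr r \<one> \<otimes>\<^bsub>L\<^esub> ys ! i = fr (r \<otimes> b i) (s i)" using bs[OF i'(2)] bp[OF i'(1)] r S_one by (simp add: fr_mult)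
   also have "... : ext_ideal (Idl (set (take i ?bs)))"
    using m bp[OF i'(1)] unfolding bi ext_ideal_def by blast
   finally have "fr r \<one> \<otimes>\<^bsub>L\<^esub> ys ! i : Idl\<^bsub>L\<^esub> (set (take i ys))" unfolding Idl[OF i'(1)] .
   moreover have "fr r \<one> : carrier L" using r S_one by (auto intro!: L_carrierI)
   ultimately have "fr r \<one> : Idl\<^bsub>L\<^esub> (set (take i ys))" using ys(1) i'(2) unfolding regular_sequence_def by blast
   thus "EX s:carrier R - p. s \<otimes> r : Idl (set (take i ?bs))"
    using ext_ideal_mem[OF ti r S_one] unfolding Idl[OF i'(1)] by blast
  qed
  moreover have "set ?bs <= p" using bp by auto
  ultimately have "length ?bs ~= Suc n" by (rule no)
  thus False by simp
 qed
 have "?m ~= carrier L" using L.one_closed L.Units_one_closed by blast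
 hence "grade L ?m = Sup {enat (length xs) | xs. regular_sequence L xs & set xs <= ?m}"
  unfolding grade_def by (rule if_not_P)
 hence "grade L ?m <= enat n" using len by (simp only:) (rule Sup_least, auto)
 thus ?thesis by (simp add: local_depth_def loc)
qed

end

section \<open>Projective dimension, colon ideals and associated primes\<close>

context complex_data
begin

lemma Lam_in_idl: "is_idl I ==> t ` {1..f} <= I ==> Lam L : I"
proof -
 assume I: "is_idl I" "t ` {1..f} <= I"
 have e: "[1..<Suc g] = 1 # [2..<Suc g]" using g_pos by (simp add: upt_conv_Cons numeral_2_eq_2 del: upt_Suc)
 show ?thesis unfolding Lam_def e PL_Cons by (rule wdg_psi_in_idl[OF I])
qed

text \<open>For g >= 2 the product still contains Psi(X_2), whose coordinates are combinations of
  the t p; for g = 1 no such factor is left. This is the origin of the distinction between g = 1 and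
  g >= 2.\<close>

lemma Wt_in_idl:
 assumes I: "is_idl I" "t ` {1..f} <= I" and g: "2 <= g" shows "Wt a L : I"
proof -
 have e: "[2..<Suc g] = 2 # [3..<Suc g]" using g by (simp add: upt_conv_Cons numeral_eq_Suc del: upt_Suc)
 have "inJ I (PL [2..<Suc g])" unfolding inJ_def e PL_Cons using wdg_psi_in_idl[OF I] by blast
 thus ?thesis unfolding Wt_def using inJD[OF inJ_wdg[OF I(1)]] by blast
qed

end

context exact_cover
begin

lemma ev_I1R: "u : idl (K0 Un t ` {1..f}) <-> ev u : I1R"
 unfolding tR_image by (rule idl_ev)

lemma IgR_I1R: "IgR <= I1R"
proof (rule genideal_minimal[OF I1R_ideal], rule subsetI)
 fix a assume "a : ev ` range Lam"
 then obtain L where "a = ev (Lam L)" by blast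
 moreover have "Lam L : idl (K0 Un t ` {1..f})"
  by (rule Lam_in_idl[OF idl_is_idl]) (use idl_sub[of "K0 Un t ` {1..f}"] in blast)
 ultimately show "a : I1R" by (simp only: ev_I1R)
qed

lemma NR_I1R:
 assumes "2 <= g | 2 * eps + 1 ~= f - g" shows "NR <= I1R"
proof -
 note I = idl_is_idl[of "K0 Un t ` {1..f}"] and s = idl_sub[of "K0 Un t ` {1..f}"]
 have "im0 K0 <= idl (K0 Un t ` {1..f})"
  unfolding im0_eq[OF K0_idl]
 proof (rule idl_least[OF I])
  have "cgens <= idl (K0 Un t ` {1..f})"
   using assms Wt_in_idl[OF I] s by (auto simp: cgens_def split: if_splits)
  thus "K0 Un range Lam Un cgens <= idl (K0 Un t ` {1..f})"
   using Lam_in_idl[OF I] s by blast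
 qed
 thus ?thesis unfolding NR_def using ev_I1R by blast
qed

lemma NR_carrier: "a : NR ==> a : carrier R"
 using ideal.Icarr[OF NR_ideal] by blast

text \<open>If 1 lies in the resolved ideal, \<open>t_NR\<close> puts every \<open>tR p\<close> into
  the ideal of minors.\<close>

lemma NR_full: "NR = carrier R ==> I1R <= IgR"
 using t_NR[of _ \<one>] tR_closed by (intro genideal_minimal[OF IgR_ideal]) auto

lemma NR_I1R_IgR:
 assumes r: "r : NR" and b: "b : I1R" shows "r \<otimes> b : IgR"
proof -
 have rc: "r : carrier R" by (rule NR_carrier[OF r])
 have "I1R <= {a : carrier R. a \<otimes> r : IgR}"
  by (rule genideal_minimal[OF colon_elt_ideal[OF IgR_ideal rc]]) (use t_NR[OF _ r] tR_closed in auto)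
 thus ?thesis using b rc m_comm[of r b] by auto
qed

lemma Mset_empty:
 assumes "f - g < k" "f + 2 * eps < k + (f - g) + 1 | eps = 0" shows "Mset k = {}"
proof -
 have "~ Mbasis k y" for y using Mbasis_le[of k y] assms by linarith
 thus ?thesis by (simp add: Mset_def)
qed

text \<open>The length of the resolution bounds from above. From below, a single basis element y of
  the last module is enough: a section would take its differential, with entries in the proper ideal
  J, to a unit vector.\<close>

lemma proj_dim_NR:
 assumes J: "ideal J R" "J ~= carrier R" and y: "Mbasis (Suc m) y" and D: "!!z. ev (D (Suc m) (bvec y) z) : J"
  and van: "!!k. k > Suc m ==> Mset k = {}"
 shows "proj_dim R (rquot NR) = enat (Suc m)"
proof (rule antisym)
 have ne: "\<one> ~= \<zero>"
 proof
  assume "\<one> = \<zero>"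
  hence "\<one> : J" using additive_subgroup.zero_closed[OF ideal.axioms(1)[OF J(1)]] by simp
  thus False using ideal.one_imp_carrier[OF J(1)] J(2) by blast
 qed
 have M: "MR = (%k. free_module R (Mset k))" by (rule ext) (rule MR_eq)
 have res: "resolution R MR dR (rquot NR)"
  using MR_resolution by (simp add: free_resolution_def)
 have "finite (\<Union>k. Mset k)"
 proof (rule finite_subset)
  show "(\<Union>k. Mset k) <= (UN k:{..Suc m}. Mset k)" using van by (auto simp: not_less[symmetric]) (metis atMost_iff empty_iff not_less)
  show "finite (UN k:{..Suc m}. Mset k)" using finite_Mset by blast
 qed
 thus "proj_dim R (rquot NR) <= enat (Suc m)"
  by (rule proj_dim_le[OF ne res[unfolded M]]) (rule van)
 show "enat (Suc m) <= proj_dim R (rquot NR)"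
 proof (rule proj_dim_ge[OF res])
  show "projective R (MR k)" for k unfolding MR_eq by (rule free_module_projective[OF ne])
  show "module R (rquot NR)" by (rule quot_ring_module[OF NR_ideal])
  show "carrier (MR (Suc (Suc m))) = {\<zero>\<^bsub>MR (Suc (Suc m))\<^esub>}"
   using van[of "Suc (Suc m)"] unfolding MR_eq by (auto simp: fm_carrier)
  fix s assume s: "s : mod_hom R (MR m) (MR (Suc m))"
  have b: "inM (Suc m) (bvec y)" by (rule inM_bvec[OF y])
  have E: "E (bvec y) = unitv y" by (auto simp: bvec_def unitv_def ev_one ev_zero)
  have yM: "y : Mset (Suc m)" using y by (simp add: Mset_def)
  have d: "dR (Suc m) (unitv y) = E (D (Suc m) (bvec y))" using M_diff_E[OF b] unfolding E .
  have "s (dR (Suc m) (unitv y)) ~= unitv y"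
   unfolding d by (rule no_section[OF J yM finite_Mset s[unfolded MR_eq] E_in_MR[OF inM_D[OF b], unfolded MR_eq] D])
  moreover have "unitv y : carrier (MR (Suc m))" unfolding MR_eq by (rule unitv_carrier[OF yM])
  ultimately show "EX v:carrier (MR (Suc m)). s (dR (Suc m) v) ~= v" by blast
 qed
qed

text \<open>The witness is e_1 ... e_f with X_1^(eps - 1), the last basis element of V^B; its
  position is f + 2 eps - (f - g) - 1.\<close>

lemma proj_dim_bottom:
 assumes I1: "I1R ~= carrier R" and e: "1 <= eps" "f + 2 * eps = k + (f - g) + 1" "f - g <= k" "2 <= k"
 shows "proj_dim R (rquot NR) = enat k"
proof -
 define a where "a = (%l::nat. if l = 1 then eps - 1 else 0)"
 have "sum a {1..g} = eps - 1" using g_pos by (simp add: a_def)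
 hence y: "Mbasis k (VB ({1..f}, a))"
  using e g_pos by (auto simp: Mbasis_def ok_def chB_def a_def)
 obtain m where m: "k = Suc m" using e(4) by (cases k) auto
 note I = idl_is_idl[of "K0 Un t ` {1..f}"]
 have "t ` {1..f} <= idl (K0 Un t ` {1..f})" using idl_sub[of "K0 Un t ` {1..f}"] by blast
 hence "D k (bvec (VB ({1..f}, a))) z : idl (K0 Un t ` {1..f})" for z
  by (rule bottom_entries[OF I _ refl e(4)])
 hence "ev (D (Suc m) (bvec (VB ({1..f}, a))) z) : I1R" for z unfolding ev_I1R[symmetric] m .
 thus ?thesis unfolding m
  by (rule proj_dim_NR[OF I1R_ideal I1 y[unfolded m]]) (use e m in "auto intro!: Mset_empty")
qed

text \<open>Here V^T outlasts V^B. Its last summand has I = 0, J = f - g - 1 and position f - g, and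
  the proper ideal containing the entries is the resolved ideal itself.\<close>

lemma proj_dim_top:
 assumes N: "NR ~= carrier R" and e: "2 * eps + 1 = f - g" and g1: "g = 1 | f - g = 1"
 shows "proj_dim R (rquot NR) = enat (f - g)"
proof -
 define a where "a = (%l::nat. if l = 1 then f - g - 1 else 0)"
 have s: "sum a {1..g} = f - g - 1" using g_pos by (simp add: a_def)
 have y: "Mbasis (f - g) (VT ({}, a))"
  unfolding Mbasis_def using e s g_pos by (auto simp: ok_def chT_def a_def)
 have ae: "a : exponents g (f - g - 1)" using s g_pos by (auto simp: exponents_def a_def)
 obtain m where m: "f - g = Suc m" using g_less by (cases "f - g") auto
 have "D (f - g) (bvec (VT ({}, a))) z : im0 K0" for z
 proof (rule top_entries[OF im0_idl[OF K0_idl] _ _ e g1 refl ae])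
  show "range Lam <= im0 K0" "cgens <= im0 K0"
   unfolding im0_eq[OF K0_idl] using idl_sub[of "K0 Un range Lam Un cgens"] by auto
 qed
 hence "ev (D (Suc m) (bvec (VT ({}, a))) z) : NR" for z unfolding im0_ev[symmetric] m .
 thus ?thesis unfolding m
  by (rule proj_dim_NR[OF NR_ideal N y[unfolded m]]) (use e m g1 in "auto intro!: Mset_empty")
qed

text \<open>A regular sequence of f - g + 1 elements among the minors would annihilate 1 modulo the
  resolved ideal, and \<open>NR_deep\<close> would make that ideal improper.\<close>

lemma grade_IgR_le:
 assumes N: "NR ~= carrier R" and e: "2 * eps <= f - g" shows "grade R IgR <= enat (f - g)"
proof (rule ccontr)
 assume "~ grade R IgR <= enat (f - g)"
 hence "enat (f - g + 1) <= grade R IgR" by (cases "grade R IgR") auto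
 then obtain bs where bs: "weak_regseq R bs" "length bs = f - g + 1" "set bs <= IgR"
  using grade_weak_regseq[OF IgR_ideal] by blast
 have "b \<otimes> \<one> : NR" if "b : set bs" for b
  using that bs(3) IgR_NR NR_carrier[of b] by auto
 hence "\<one> : NR" by (rule NR_deep[OF e one_closed bs(1,2)])
 thus False using N ideal.one_imp_carrier[OF NR_ideal] by blast
qed

lemma NR_colon_ideal:
 assumes e: "2 * eps <= f - g" and c: "c : carrier R" and x: "!!x. x : I1R ==> c \<otimes> x : NR"
 shows "c : NR"
proof (rule NR_colon[OF e c])
 fix q assume q: "q : {1..f}"
 have tc: "tR ` {1..f} <= carrier R" using tR_closed by blast
 have "tR q : I1R" using genideal_self[OF tc] q by blast
 thus "tR q \<otimes> c : NR" using x[of "tR q"] c tR_closed[OF q] by (simp add: m_comm)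
qed

theorem colon_eq:
 assumes e: "2 * eps <= f - g" shows "colon R IgR I1R = NR"
proof
 show "colon R IgR I1R <= NR"
  using NR_colon_ideal[OF e] IgR_NR by (auto simp: colon_def)
 show "NR <= colon R IgR I1R"
  using NR_I1R_IgR NR_carrier by (auto simp: colon_def)
qed

theorem saturation_eq:
 assumes e: "2 * eps <= f - g" shows "saturation R IgR I1R = NR"
proof -
 interpret IM: comm_monoid "ideals_set R" by (rule ideals_set_is_comm_monoid)
 have I1: "I1R : carrier (ideals_set R)" using I1R_ideal by (simp add: ideals_set_def)
 have pI: "ideal (I1R [^]\<^bsub>ideals_set R\<^esub> n) R" for n :: nat
  using IM.nat_pow_closed[OF I1, of n] by (simp add: ideals_set_def)
 have "c : carrier R ==> (!!x. x : I1R [^]\<^bsub>ideals_set R\<^esub> n ==> c \<otimes> x : NR) ==> c : NR" for n :: nat and c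
 proof (induction n)
  case 0
  from 0(2)[of \<one>] show ?case using 0(1) by (simp add: ideals_set_def)
 next
  case (Suc n)
  show ?case
  proof (rule Suc.IH[OF Suc.prems(1)])
   fix x assume x: "x : I1R [^]\<^bsub>ideals_set R\<^esub> n"
   have xc: "x : carrier R" using ideal.Icarr[OF pI x] .
   show "c \<otimes> x : NR"
   proof (rule NR_colon_ideal[OF e])
    show "c \<otimes> x : carrier R" using xc Suc.prems(1) by simp
    fix y assume y: "y : I1R"
    have "x \<otimes> y : I1R [^]\<^bsub>ideals_set R\<^esub> Suc n"
    using x y by (auto simp: ideals_set_def intro: ideal_prod.intros)
    hence "c \<otimes> (x \<otimes> y) : NR" by (rule Suc.prems(2))
    thus "c \<otimes> x \<otimes> y : NR" using Suc.prems(1) xc ideal.Icarr[OF I1R_ideal y] by (simp add: m_assoc)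
   qed
  qed
 qed
 hence "saturation R IgR I1R <= NR"
  using IgR_NR by (auto simp: saturation_def colon_def)
 moreover have "I1R [^]\<^bsub>ideals_set R\<^esub> (1::nat) = I1R" using I1 by simp
 hence "colon R IgR I1R <= saturation R IgR I1R" unfolding saturation_def by (metis UN_upper UNIV_I)
 ultimately show ?thesis using colon_eq[OF e] by blast
qed

text \<open>The resolved ideal is a candidate since the ideal of tau, of grade at least f > f - g,
  multiplies it into the minors. For any other candidate K a regular sequence of length f - g + 1
  does so, and \<open>NR_deep\<close> puts K inside.\<close>

theorem gunm_eq:
 assumes e: "2 * eps <= f - g" and gl: "grade R IgR <= enat (f - g)" and gI1: "enat f <= grade R I1R"
 shows "gunm R IgR = NR"
 unfolding gunm_def
proof (rule Greatest_equality)
 have "enat (f - g) <= grade R IgR" using grade_Ig weak_regseq_grade[OF IgR_ideal] by metis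
 hence gr: "grade R IgR = enat (f - g)" using gl by simp
 have cI: "ideal (colon R IgR K) R" if K: "K <= carrier R" for K
 proof -
  \<comment> \<open>The whole ring is inserted to keep the family nonempty when K is empty.\<close>
  have e: "colon R IgR K = \<Inter> (insert (carrier R) ((%x. {a : carrier R. a \<otimes> x : IgR}) ` K))"
   by (auto simp: colon_def)
  show ?thesis unfolding e
  proof (rule i_Intersect)
   fix I assume "I : insert (carrier R) ((%x. {a : carrier R. a \<otimes> x : IgR}) ` K)"
   thus "ideal I R" using K colon_elt_ideal[OF IgR_ideal] oneideal by blast
  qed blast
 qed
 obtain ys where ys: "weak_regseq R ys" "length ys = f" "set ys <= I1R" using grade_I1 by blast
 have "a \<otimes> r : IgR" if "a : I1R" "r : NR" for a r
  using NR_I1R_IgR[OF that(2,1)] NR_carrier[OF that(2)] ideal.Icarr[OF I1R_ideal that(1)] by (simp add: m_comm)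
 hence "I1R <= colon R IgR NR"
  using ideal.Icarr[OF I1R_ideal] by (auto simp: colon_def)
 hence "set ys <= colon R IgR NR" using ys(3) by blast
 moreover have "NR <= carrier R" using NR_carrier by blast
 ultimately have "enat f <= grade R (colon R IgR NR)"
  using weak_regseq_grade[OF cI ys(1)] ys(2) by blast
 moreover have "enat (f - g) < enat f" using g_pos g_less by simp
 ultimately have "grade R IgR < grade R (colon R IgR NR)" unfolding gr by (rule less_le_trans[rotated])
 thus "ideal NR R & IgR <= NR & grade R IgR < grade R (colon R IgR NR)"
  using NR_ideal IgR_NR by blast
 fix K assume K: "ideal K R & IgR <= K & grade R IgR < grade R (colon R IgR K)"
 have Kc: "K <= carrier R" using ideal.Icarr[OF conjunct1[OF K]] by blast
 have "enat (f - g + 1) <= grade R (colon R IgR K)"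
  using K Suc_ile_eq[of "f - g" "grade R (colon R IgR K)"] unfolding gr by simp
 then obtain bs where bs: "weak_regseq R bs" "length bs = f - g + 1" "set bs <= colon R IgR K"
  using grade_weak_regseq[OF cI[OF Kc]] by blast
 show "K <= NR"
 proof
  fix c assume c: "c : K"
  show "c : NR"
   by (rule NR_deep[OF e _ bs(1,2)]) (use c Kc bs(3) IgR_NR in "auto simp: colon_def")
 qed
qed

text \<open>p consists of the multipliers of some c into the resolved ideal. By
  \<open>NR_colon\<close> some \<open>tR q\<close> lies outside p; then f - g + 1 locally regular
  elements of p would drive c into the ideal by a multiplier outside p, a contradiction. The lower
  bound comes from the minors, which lie in p.\<close>

theorem Ass_depth:
 assumes e: "2 * eps <= f - g" and p: "p : Ass R (rquot NR)"
 shows "local_depth (localization R p) = enat (f - g)"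
proof -
 obtain c where pp: "primeideal p R" and c: "c : carrier R" and pe: "p = {r : carrier R. r \<otimes> c : NR}"
  using p unfolding Ass_quot[OF NR_ideal] by blast
 have pm: "r : p <-> r : carrier R & r \<otimes> c : NR" for r unfolding pe by simp
 interpret p: primeideal p R by (rule pp)
 have cN: "c ~: NR"
 proof
  assume "c : NR"
  hence "\<one> : p" using c by (simp add: pm)
  thus False using p.one_imp_carrier p.I_notcarr by simp
 qed
 have "EX q:{1..f}. tR q \<otimes> c ~: NR" using NR_colon[OF e c] cN by blast
 hence "EX q:{1..f}. tR q ~: p" by (auto simp: pm)
 then obtain q where q: "q : {1..f}" "tR q : carrier R - p" using tR_closed by blast
 obtain xs where xs: "weak_regseq R xs" "length xs = f - g" "set xs <= IgR" using grade_Ig by blast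
 have "NR <= p" using c NR_carrier ideal.I_r_closed[OF NR_ideal] by (auto simp: pm)
 hence "set xs <= p" using xs(3) IgR_NR by blast
 from localization_depth_ge[OF pp xs(1) this] have "enat (f - g) <= local_depth (localization R p)" using xs(2) by simp
 moreover have "local_depth (localization R p) <= enat (f - g)"
 proof (rule localization_depth_le[OF pp], rule notI)
  fix bs assume bs: "S_regseq R (carrier R - p) bs" "set bs <= p" "length bs = Suc (f - g)"
  have "EX s:carrier R - p. s \<otimes> c : NR"
  proof (rule NR_chase[OF _ _ _ bs(1) c])
   show "\<one> : carrier R - p" using p.one_imp_carrier p.I_notcarr by auto
   show "a \<otimes> b : carrier R - p" if "a : carrier R - p" "b : carrier R - p" for a b
    using that p.I_prime by auto
   show "b \<otimes> c : NR" if "b : set bs" for b using that bs(2) by (auto simp: pm)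
  qed (use q bs in auto)
  thus False by (auto simp: pm)
 qed
 ultimately show ?thesis by simp
qed

end

section \<open>Formal sums and ideals\<close>

context cring
begin

text \<open>Elements outside the carrier are read as 1, so that every multiset over the type has a
  product in R.\<close>

definition mprod :: "'a multiset => 'a" where
 "mprod m = (\<Otimes>a\<in>set_mset m. (if a : carrier R then a else \<one>) [^] count m a)"

text \<open>Finitely supported integer functions on multisets form the polynomial ring over the
  integers with one variable for each element of the type; this is evaluation of
  polynomials.\<close>

definition formal_eval :: "('a multiset \<Rightarrow>\<^sub>0 int) => 'a" where
 "formal_eval p = (\<Oplus>m\<in>Poly_Mapping.keys p. add_pow R (Poly_Mapping.lookup p m) (mprod m))"

lemma mprod_closed: "mprod m : carrier R"
 unfolding mprod_def by (intro finprod_closed) auto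

lemma mprod_superset:
 assumes "finite A" "set_mset m <= A"
 shows "mprod m = (\<Otimes>a\<in>A. (if a : carrier R then a else \<one>) [^] count m a)"
 unfolding mprod_def
 by (rule finprod_mono_neutral_cong_left[OF assms]) (auto simp: not_in_iff)

lemma mprod_add: "mprod (m + n) = mprod m \<otimes> mprod n"
proof -
 let ?A = "set_mset m Un set_mset n"
 have "mprod (m + n) = (\<Otimes>a\<in>?A. (if a : carrier R then a else \<one>) [^] count m a \<otimes> (if a : carrier R then a else \<one>) [^] count n a)"
  unfolding mprod_superset[of ?A "m + n", OF finite_UnI[OF finite_set_mset finite_set_mset], simplified]
  by (rule finprod_cong') (auto simp: nat_pow_mult)
 also have "... = mprod m \<otimes> mprod n"
  unfolding mprod_superset[of ?A m, OF finite_UnI[OF finite_set_mset finite_set_mset] Un_upper1]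
   mprod_superset[of ?A n, OF finite_UnI[OF finite_set_mset finite_set_mset] Un_upper2]
  by (rule finprod_multf) auto
 finally show ?thesis .
qed

lemma formal_eval_closed: "formal_eval p : carrier R"
 unfolding formal_eval_def by (intro finsum_closed) (auto simp: mprod_closed)

lemma formal_eval_superset:
 assumes "finite A" "Poly_Mapping.keys p <= A"
 shows "formal_eval p = (\<Oplus>m\<in>A. add_pow R (Poly_Mapping.lookup p m) (mprod m))"
proof -
 have "add_pow R (0::int) a = \<zero>" for a by (simp add: add_pow_def)
 thus ?thesis unfolding formal_eval_def
  by (intro add.finprod_mono_neutral_cong_left[OF assms]) (auto simp: mprod_closed in_keys_iff)
qed

lemma formal_eval_add: "formal_eval (p + q) = formal_eval p \<oplus> formal_eval q"
proof -
 let ?A = "Poly_Mapping.keys p Un Poly_Mapping.keys q"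
 have A: "finite ?A" by simp
 have "formal_eval (p + q) = (\<Oplus>m\<in>?A. add_pow R (Poly_Mapping.lookup p m) (mprod m) \<oplus> add_pow R (Poly_Mapping.lookup q m) (mprod m))"
  unfolding formal_eval_superset[OF A keys_add]
  by (rule finsum_cong') (auto simp: lookup_add add.int_pow_mult mprod_closed)
 also have "... = formal_eval p \<oplus> formal_eval q"
  unfolding formal_eval_superset[OF A Un_upper1] formal_eval_superset[OF A Un_upper2]
  by (rule finsum_addf) (auto simp: mprod_closed)
 finally show ?thesis .
qed

lemma formal_eval_diff: "formal_eval (p - q) = formal_eval p \<ominus> formal_eval q"
proof -
 have "formal_eval p = formal_eval (p - q) \<oplus> formal_eval q" using formal_eval_add[of "p - q" q] by simp
 thus ?thesis by (simp add: formal_eval_closed minus_eq a_assoc r_neg)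
qed

lemma formal_eval_zero: "formal_eval 0 = \<zero>"
 by (simp add: formal_eval_def)

lemma formal_eval_frag: "formal_eval (frag_of m) = mprod m"
 by (simp add: formal_eval_def mprod_closed)

text \<open>Both arguments are built from single multisets by differences, and for two multisets the
  claim is \<open>mprod_add\<close>.\<close>

lemma formal_eval_mult: "formal_eval (p * q) = formal_eval p \<otimes> formal_eval q"
proof -
 have UNIV: "Poly_Mapping.keys r <= UNIV" for r :: "'a multiset \<Rightarrow>\<^sub>0 int" by simp
 note cl = formal_eval_closed
 have 1: "formal_eval (frag_of m * q) = mprod m \<otimes> formal_eval q" for m q
  using UNIV[of q]
 proof (induction q rule: frag_induction)
  case (one n)
  have "frag_of m * frag_of n = frag_of (m + n)" by (simp add: mult_single)
  thus ?case by (simp only: formal_eval_frag mprod_add)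
 next
  case (diff a b)
  thus ?case by (simp add: right_diff_distrib formal_eval_diff cl mprod_closed r_distr minus_eq r_minus)
 qed (simp add: formal_eval_zero mprod_closed)
 show ?thesis
  using UNIV[of p]
 proof (induction p rule: frag_induction)
  case (one m)
  thus ?case by (simp add: 1 formal_eval_frag)
 next
  case (diff a b)
  thus ?case by (simp add: left_diff_distrib formal_eval_diff cl l_distr minus_eq l_minus)
 qed (simp add: formal_eval_zero cl)
qed

lemma formal_eval_cover: "ring_cover R formal_eval"
proof (unfold_locales)
 show "formal_eval u : carrier R" for u by (rule formal_eval_closed)
 show "formal_eval (u + v) = formal_eval u \<oplus> formal_eval v" for u v by (rule formal_eval_add)
 show "formal_eval (u * v) = formal_eval u \<otimes> formal_eval v" for u v by (rule formal_eval_mult)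
 have "formal_eval 1 = mprod {#}" using formal_eval_frag[of "{#}"] by (simp only: single_one)
 thus "formal_eval 1 = \<one>" by (simp add: mprod_def)
 show "EX u. formal_eval u = a" if "a : carrier R" for a
  using that formal_eval_frag[of "{#a#}"] by (intro exI[of _ "frag_of {#a#}"]) (simp add: mprod_def)
qed

lemma image_ideal_basis:
 assumes F: "module R F" and e: "is_basis R F I e" and \<tau>: "\<tau> : mod_hom R F (ring_module R)"
 shows "\<tau> ` carrier F = Idl ((%i. \<tau> (e i)) ` I)"
proof -
 interpret F: module R F by (rule F)
 have I: "finite I" "e : I \<rightarrow> carrier F" using e by (auto simp: is_basis_def)
 let ?J = "Idl ((%i. \<tau> (e i)) ` I)"
 note h = mod_homD[OF \<tau>, simplified]
 have tc: "(%i. \<tau> (e i)) ` I <= carrier R" using h(1) I(2) by auto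
 interpret J: ideal ?J R by (rule genideal_ideal[OF tc])
 show ?thesis
 proof
  show "\<tau> ` carrier F <= ?J"
  proof (rule image_subsetI)
   fix v assume "v : carrier F"
   then obtain c where c: "c : I \<rightarrow>\<^sub>E carrier R" "v = (\<Oplus>\<^bsub>F\<^esub>i\<in>I. c i \<odot>\<^bsub>F\<^esub> e i)"
    using e unfolding is_basis_def by blast
   have "\<tau> v = (\<Oplus>\<^bsub>ring_module R\<^esub>i\<in>I. \<tau> (c i \<odot>\<^bsub>F\<^esub> e i))"
    unfolding c(2) by (rule mod_hom_finsum[OF F ring_module_module \<tau> I(1)]) (use c(1) I(2) in "auto intro!: F.smult_closed")
   also have "... = (\<Oplus>i\<in>I. \<tau> (c i \<odot>\<^bsub>F\<^esub> e i))" by (simp add: finsum_def finprod_def ring_module_def)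
   also have "... : ?J"
   proof (rule finsum_ideal[OF J.is_ideal I(1)], rule Pi_I)
    fix i assume "i : I"
    thus "\<tau> (c i \<odot>\<^bsub>F\<^esub> e i) : ?J"
    using h(3)[of "c i" "e i"] c(1) I(2) J.I_l_closed[of "\<tau> (e i)" "c i"] genideal_self[OF tc] by (auto simp: PiE_def Pi_iff)
   qed
   finally show "\<tau> v : ?J" .
  qed
  have "ideal (\<tau> ` carrier F) R"
  proof (rule idealI')
   show "\<tau> ` carrier F <= carrier R" using h(1) by auto
   show "\<zero> : \<tau> ` carrier F" using mod_hom_zero[OF F ring_module_module \<tau>] by (auto intro!: image_eqI[of _ _ "\<zero>\<^bsub>F\<^esub>"])
   show "x \<oplus> y : \<tau> ` carrier F" if "x : \<tau> ` carrier F" "y : \<tau> ` carrier F" for x y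
    using that h(2) by (auto simp flip: h(2))
   show "r \<otimes> x : \<tau> ` carrier F" if "r : carrier R" "x : \<tau> ` carrier F" for r x
    using that by (auto simp flip: h(3))
  qed
  thus "?J <= \<tau> ` carrier F" by (rule genideal_minimal) (use I(2) in auto)
 qed
qed

lemma Idl_Un:
 assumes A: "A <= carrier R" and B: "B <= carrier R"
 shows "Idl (A Un B) = Idl A <+> Idl B"
proof -
 note I = genideal_ideal[OF A] genideal_ideal[OF B]
 have AB: "A Un B <= carrier R" using A B by blast
 have c: "Idl A Un Idl B <= carrier R" using ideal.Icarr[OF I(1)] ideal.Icarr[OF I(2)] by blast
 have "Idl (A Un B) = Idl (Idl A Un Idl B)"
 proof
  show "Idl (A Un B) <= Idl (Idl A Un Idl B)"
   using genideal_self[OF A] genideal_self[OF B] genideal_self[OF c] by (intro genideal_minimal[OF genideal_ideal[OF c]]) blast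
  have "Idl A <= Idl (A Un B)" "Idl B <= Idl (A Un B)"
   using genideal_self[OF AB] by (auto intro!: genideal_minimal[OF genideal_ideal[OF AB]])
  thus "Idl (Idl A Un Idl B) <= Idl (A Un B)" by (intro genideal_minimal[OF genideal_ideal[OF AB]]) blast
 qed
 thus ?thesis using union_genideal[OF I] by simp
qed

text \<open>The quotient is a copy of R/J, whose annihilator is tested on the class of 1.\<close>

lemma annihilator_top:
 assumes J: "ideal J R" shows "annihilator R (quot_module (top_module R) (top_elt R ` J)) = J"
proof -
 interpret J: ideal J R by (rule J)
 have M: "module R (top_module R)" unfolding top_module_def by (rule free_module_module)
 interpret M: module R "top_module R" by (rule M)
 have s: "\<zero>\<^bsub>top_module R\<^esub> = top_elt R \<zero>"
  "top_elt R a \<oplus>\<^bsub>top_module R\<^esub> top_elt R b = top_elt R (a \<oplus> b)"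
  "c : carrier R ==> c \<odot>\<^bsub>top_module R\<^esub> top_elt R a = top_elt R (c \<otimes> a)" for a b c
  by (auto simp: top_module_def top_elt_def fun_eq_iff)
 have tc: "v : carrier (top_module R) <-> (EX a:carrier R. v = top_elt R a)" for v
 proof
  assume v: "v : carrier (top_module R)"
  hence "v = top_elt R (v Top)" by (auto simp: top_module_def fm_carrier top_elt_def fun_eq_iff)
  thus "EX a:carrier R. v = top_elt R a" using v by (auto simp: top_module_def fm_carrier)
 next
  assume "EX a:carrier R. v = top_elt R a"
  thus "v : carrier (top_module R)"
   by (auto simp: top_module_def fm_carrier top_elt_def intro: finite_subset[of _ "{Top}"])
 qed
 have inj: "top_elt R a = top_elt R b <-> a = b" for a b by (auto simp: top_elt_def fun_eq_iff)
 have mem: "top_elt R a : top_elt R ` J <-> a : J" for a using inj by auto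
 have H: "submodule (top_elt R ` J) R (top_module R)"
 proof (rule M.submoduleI)
  show "top_elt R ` J <= carrier (top_module R)" using tc J.a_subset by auto
  show "\<zero>\<^bsub>top_module R\<^esub> : top_elt R ` J" using J.zero_closed by (simp add: s mem)
  show "\<ominus>\<^bsub>top_module R\<^esub> a : top_elt R ` J" if aJ: "a : top_elt R ` J" for a
  proof -
   obtain b where b: "b : J" "a = top_elt R b" using aJ by blast
   have "a : carrier (top_module R)" using b tc J.a_subset by blast
   hence "\<ominus>\<^bsub>top_module R\<^esub> a = top_elt R (\<ominus> b)" using M.mod_minus_eq[of a] b J.a_subset by (auto simp: s l_minus)
   thus ?thesis using b by (simp add: mem)
  qed
  show "a \<oplus>\<^bsub>top_module R\<^esub> b : top_elt R ` J" if "a : top_elt R ` J" "b : top_elt R ` J" for a b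
   using that by (auto simp: s mem)
  show "a \<odot>\<^bsub>top_module R\<^esub> b : top_elt R ` J" if "a : carrier R" "b : top_elt R ` J" for a b
   using that J.I_l_closed by (auto simp: s mem)
 qed
 note q = M.quot_module_simps[OF H]
 have "r : annihilator R (quot_module (top_module R) (top_elt R ` J)) <->
  r : carrier R & (ALL v:carrier (top_module R). r \<odot>\<^bsub>top_module R\<^esub> v : top_elt R ` J)" for r
 proof (cases "r : carrier R")
  case True
  have "r \<odot>\<^bsub>quot_module (top_module R) (top_elt R ` J)\<^esub> (top_elt R ` J +>\<^bsub>top_module R\<^esub> v) = top_elt R ` J <->
    r \<odot>\<^bsub>top_module R\<^esub> v : top_elt R ` J" if "v : carrier (top_module R)" for v
   unfolding q(4)[OF True that] by (rule q(5)) (rule M.smult_closed[OF True that])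
  thus ?thesis unfolding annihilator_def q(1,2) using True by blast
 qed (simp add: annihilator_def)
 also have "... r <-> r : carrier R & (ALL a:carrier R. r \<otimes> a : J)" for r
 proof (cases "r : carrier R")
  case True
  have "r \<odot>\<^bsub>top_module R\<^esub> top_elt R a : top_elt R ` J <-> r \<otimes> a : J" for a unfolding s(3)[OF True] by (rule mem)
  thus ?thesis using tc by (metis (full_types))
 qed simp
 also have "... r <-> r : J" for r
  using J.I_r_closed J.a_subset by (auto dest: bspec[of _ _ \<one>])
 finally show ?thesis by blast
qed

end

context complex_cover
begin

text \<open>The image of c is a copy of the ideal generated by its values on the basis, since c is
  linear and its target has rank one; \<open>annihilator_top\<close> identifies the annihilator of
  the cokernel with it.\<close>

lemma C_ideal_eq:
 assumes e: "2 * eps + 1 = f - g" shows "C_ideal R f g tR xR = Idl (ev ` cgens)"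
proof -
 define Z where "Z = {SUM a:exponents g eps. ga a * Wt a {1..f} | ga. ALL a. ga a ~= 0 --> a : exponents g eps}"
 have n: "(f - g - 1) div 2 = eps" using e by simp
 have Z: "is_idl Z" unfolding is_idl_def
 proof (intro conjI ballI allI)
  show "0 : Z" unfolding Z_def by (intro CollectI exI[of _ "%a. 0"]) simp
  fix u assume "u : Z"
  then obtain ga where u: "u = (SUM a:exponents g eps. ga a * Wt a {1..f})" "ALL a. ga a ~= 0 --> a : exponents g eps"
   by (auto simp: Z_def)
  have "r * ga a ~= 0 ==> a : exponents g eps" for a r using u(2) by (metis mult_zero_right)
  thus "r * u : Z" for r
   unfolding Z_def by (intro CollectI exI[of _ "%a. r * ga a"]) (use u in "auto simp: sum_distrib_left mult.assoc")
  fix v assume "v : Z"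
  then obtain ga' where v: "v = (SUM a:exponents g eps. ga' a * Wt a {1..f})" "ALL a. ga' a ~= 0 --> a : exponents g eps"
   by (auto simp: Z_def)
  have "ga a + ga' a ~= 0 ==> a : exponents g eps" for a using u(2) v(2) by (metis add_0)
  thus "u + v : Z"
   unfolding Z_def by (intro CollectI exI[of _ "%a. ga a + ga' a"]) (auto simp: u v sum.distrib distrib_right)
 qed
 have cZ: "cgens <= Z"
 proof
  fix c assume "c : cgens"
  then obtain a where a: "a : exponents g eps" "c = Wt a {1..f}" using e by (auto simp: cgens_def)
  have "(SUM b:exponents g eps. of_bool (b = a) * Wt b {1..f}) = (SUM b:exponents g eps. if b = a then Wt b {1..f} else 0)"
   by (rule sum.cong) auto
  also have "... = c" using a finite_exponents by (simp add: sum.delta)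
  finally show "c : Z" unfolding Z_def using a(1) by (intro CollectI exI[of _ "%b. of_bool (b = a)"]) auto
 qed
 have im: "c_map R f g tR xR ` carrier (div_power R g eps) = top_elt R ` (ev ` Z)"
 proof (intro equalityI subsetI)
  fix v assume "v : c_map R f g tR xR ` carrier (div_power R g eps)"
  then obtain ga where g: "ga : carrier (div_power R g eps)" "v = c_map R f g tR xR ga" by blast
  hence gc: "ga a : carrier R" "a ~: exponents g eps ==> ga a = \<zero>" for a
   by (auto simp: div_power_def fm_carrier)
  define ga' where "ga' a = (if a : exponents g eps then SOME u. ev u = ga a else 0)" for a
  have E: "E ga' = ga"
  proof
   fix a show "ev (ga' a) = ga a"
    using someI_ex[OF ev_surj[OF gc(1)[of a]]] gc(2)[of a] ev_zero by (auto simp: ga'_def)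
  qed
  have s: "ga' a ~= 0 ==> a : exponents g eps" for a by (auto simp: ga'_def split: if_splits)
  have "v = top_elt R (ev (SUM a:exponents g eps. ga' a * Wt a {1..f}))"
   unfolding g(2) E[symmetric] by (rule c_map_E[OF s])
  thus "v : top_elt R ` (ev ` Z)" using s by (auto simp: Z_def)
 next
  fix v assume "v : top_elt R ` (ev ` Z)"
  then obtain ga where v: "v = top_elt R (ev (SUM a:exponents g eps. ga a * Wt a {1..f}))" "ALL a. ga a ~= 0 --> a : exponents g eps"
   by (auto simp: Z_def)
  have "v = c_map R f g tR xR (E ga)" unfolding v(1) by (rule c_map_E[symmetric]) (use v(2) in blast)
  moreover have "E ga : carrier (div_power R g eps)"
   unfolding div_power_def carrier_free[OF finite_exponents] using v(2) ev_zero by (metis ev_closed)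
  ultimately show "v : c_map R f g tR xR ` carrier (div_power R g eps)" by blast
 qed
 have eZ: "ev ` Z = Idl (ev ` cgens)"
 proof
  interpret I: ideal "Idl (ev ` cgens)" R by (rule Idl_ev_ideal)
  show "Idl (ev ` cgens) <= ev ` Z" by (rule genideal_minimal[OF ideal_image[OF Z]]) (use cZ in blast)
  note V = is_idl_vimage(1)[OF I.is_ideal]
  have "Wt a {1..f} : ev -` (Idl (ev ` cgens))" if "a : exponents g eps" for a
  proof -
   have "Wt a {1..f} : cgens" using that e by (auto simp: cgens_def)
   thus ?thesis using Idl_ev_self[of cgens] by blast
  qed
  hence "Z <= ev -` (Idl (ev ` cgens))"
   unfolding Z_def using V by (auto intro!: is_idl_sum[OF V] is_idlD(3)[OF V] simp del: vimage_eq)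
  thus "ev ` Z <= Idl (ev ` cgens)" by blast
 qed
 have "odd (f - g)" unfolding e[symmetric] by simp
 thus ?thesis
  using annihilator_top[OF ideal_image[OF Z]] unfolding C_ideal_def n im eZ by simp
qed

lemma NR_sum:
 assumes e: "2 * eps + 1 = f - g"
 shows "NR = Psi_minors R f g tR xR <+> C_ideal R f g tR xR"
 unfolding NR_eq Ig_eq C_ideal_eq[OF e] image_Un by (rule Idl_Un[OF ev_image_carrier ev_image_carrier])

lemma NR_minors:
 assumes e: "2 * eps + 1 ~= f - g" shows "NR = Psi_minors R f g tR xR"
 using e by (simp add: NR_eq Ig_eq cgens_def)

end

text \<open>The lifts are chosen before e, so the covers for different e share the same
  \<open>Lam\<close>; the ideal of minors is then literally the same for both resolutions.\<close>

lemma cover_exists: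
 fixes R :: "('a,'x) ring_scheme" (structure)
 assumes R: "cring R" and g: "1 <= g" "g < f"
  and tR: "!!p. p : {1..f} ==> tR p : carrier R"
  and xR: "!!l. l : {1..g} ==> xR l : carrier (ext_power R f 2)"
 obtains tU :: "nat => ('a multiset \<Rightarrow>\<^sub>0 int)" and xU where
  "!!e. f <= g + 2 * e + 1 ==> g + 2 * e <= f + 1 ==> complex_cover R (cring.formal_eval R) f g tU xU e tR xR"
proof -
 interpret cring R by (rule R)
 interpret ring_cover R formal_eval by (rule formal_eval_cover)
 define lift where "lift a = (SOME u. formal_eval u = a)" for a
 have lift: "formal_eval (lift a) = a" if "a : carrier R" for a
  unfolding lift_def by (rule someI_ex[OF ev_surj[OF that]])
 define tU where "tU p = lift (tR p)" for p
 define xU where "xU l K = (if l : {1..g} & K : ext_basis f 2 then lift (xR l K) else 0)" for l K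
 have xc: "xR l K : carrier R" "K ~: ext_basis f 2 ==> xR l K = \<zero>" if "l : {1..g}" for l K
  using xR[OF that] by (auto simp: ext_power_def fm_carrier)
 show thesis
 proof (rule that[of tU xU])
  fix e assume e: "f <= g + 2 * e + 1" "g + 2 * e <= f + 1"
  show "complex_cover R formal_eval f g tU xU e tR xR"
  proof unfold_locales
   show "twoform f (xU l)" for l by (auto simp: twoform_def xU_def)
   show "formal_eval (tU p) = tR p" if "p : {1..f}" for p
    using lift[OF tR[OF that]] by (simp add: tU_def)
   show "(%K. formal_eval (xU l K)) = xR l" if "l : {1..g}" for l
    using that xc[OF that] lift ev_zero by (auto simp: xU_def fun_eq_iff)
  qed (use g e in auto)
 qed
qed

theorem theorem2p5:
  fixes R :: "('a,'x) ring_scheme"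
    and F :: "('a,'u,'y) module_scheme"
    and G :: "('a,'v,'z) module_scheme"
    and f g :: nat
    and e :: "nat \<Rightarrow> 'u"
    and Y :: "nat \<Rightarrow> 'v"
    and X :: "nat \<Rightarrow> 'v \<Rightarrow> 'a"
    and \<tau> :: "'u \<Rightarrow> 'a"
    and \<mu> :: "('v \<Rightarrow> 'a) \<Rightarrow> nat set \<Rightarrow> 'a"
    and \<delta> :: nat
    and \<epsilon> :: int
  assumes "cring R" and "noetherian_ring R"
    and "module R F" and "is_basis R F {1..f} e"
    and "module R G" and "is_basis R G {1..g} Y"
    and "1 \<le> g" and "g < f"
    and "\<And>l. l \<in> {1..g} \<Longrightarrow> X l \<in> carrier (dual_module R G)"
    and "\<And>l k. l \<in> {1..g} \<Longrightarrow> k \<in> {1..g} \<Longrightarrow> X l (Y k) = (if l = k then \<one>\<^bsub>R\<^esub> else \<zero>\<^bsub>R\<^esub>)"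
    and "\<tau> \<in> mod_hom R F (ring_module R)"
    and "\<mu> \<in> mod_hom R (dual_module R G) (ext_power R f 2)"
    and "\<delta> = f - g"
    and "\<lceil>(real \<delta> - 1) / 2\<rceil> \<le> \<epsilon>" and "\<epsilon> \<le> \<lceil>real \<delta> / 2\<rceil>"
    and t: "t = (\<lambda>p. \<tau> (e p))"
    and x: "x = (\<lambda>l. \<mu> (X l))"
    and I1: "I1 = \<tau> ` carrier F"
    and Ig: "Ig = Psi_minors R f g t x"
    and C: "C = C_ideal R f g t x"
    and M: "M = M_module R f g \<epsilon>"
    and d: "d = M_diff R f g t x \<epsilon>"
    and Rbar: "Rbar = quot_module (ring_module R) Ig"
    and Rtilde: "Rtilde = quot_module (ring_module R) (Ig <+>\<^bsub>R\<^esub> C)"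
    and hyp: "hyp \<longleftrightarrow> even \<delta> \<or> (odd \<delta> \<and> 2 \<le> g) \<or> (odd \<delta> \<and> g = 1 \<and> grade R Ig \<le> enat \<delta>)"
  shows
    \<comment> \<open>(a)\<close>
    "chain_complex R M d \<and>
     (enat \<delta> \<le> grade R Ig \<and> enat f \<le> grade R I1 \<longrightarrow>
        \<comment> \<open>(b)\<close>
        (\<epsilon> = \<lceil>real \<delta> / 2\<rceil> \<longrightarrow> free_resolution R M d Rbar) \<and>
        \<comment> \<open>(c)\<close>
        (\<epsilon> = \<lceil>(real \<delta> - 1) / 2\<rceil> \<longrightarrow> free_resolution R M d Rtilde) \<and>
        (I1 \<noteq> carrier R \<longrightarrow>
           \<comment> \<open>(d)\<close>
           (even \<delta> \<longrightarrow> proj_dim R Rbar = enat (f - 1)) \<and>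
           (odd \<delta> \<longrightarrow> proj_dim R Rbar = enat f) \<and>
           (even \<delta> \<longrightarrow> proj_dim R Rtilde = enat (f - 1)) \<and>
           (odd \<delta> \<and> 3 \<le> \<delta> \<and> 2 \<le> g \<longrightarrow> proj_dim R Rtilde = enat (f - 2)) \<and>
           (odd \<delta> \<and> g = 1 \<and> grade R Ig \<le> enat \<delta> \<longrightarrow> proj_dim R Rtilde = enat (f - 1)) \<and>
           (\<delta> = 1 \<and> 2 \<le> g \<longrightarrow> proj_dim R Rtilde = 1) \<and>
           \<comment> \<open>(e)\<close>
           (even \<delta> \<longrightarrow> (\<forall>p \<in> Ass R Rbar. local_depth (localization R p) = enat \<delta>)) \<and>
           \<comment> \<open>(f)\<close>
           (hyp \<longrightarrow> (\<forall>p \<in> Ass R Rtilde. local_depth (localization R p) = enat \<delta>)) \<and>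
           \<comment> \<open>(g)\<close>
           (hyp \<longrightarrow>
              C <+>\<^bsub>R\<^esub> Ig = colon R Ig I1 \<and>
              colon R Ig I1 = saturation R Ig I1 \<and>
              saturation R Ig I1 = gunm R Ig \<and>
              Rtilde = quot_module (ring_module R) (gunm R Ig)) \<and>
           \<comment> \<open>(h)\<close>
           (hyp \<and> \<epsilon> = \<lceil>(real \<delta> - 1) / 2\<rceil> \<longrightarrow>
              free_resolution R M d (quot_module (ring_module R) (gunm R Ig)))))"
proof -
 interpret cring R by fact
 note g = \<open>1 <= g\<close> \<open>g < f\<close>
 have eF: "e : {1..f} \<rightarrow> carrier F" using \<open>is_basis R F {1..f} e\<close> by (simp add: is_basis_def)
 have tc: "t p : carrier R" if "p : {1..f}" for p
  using mod_homD(1)[OF \<open>\<tau> : mod_hom R F (ring_module R)\<close> funcset_mem[OF eF that]] by (simp add: t)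
 have xc: "x l : carrier (ext_power R f 2)" if "l : {1..g}" for l
  unfolding x by (rule mod_homD(1)[OF \<open>\<mu> : mod_hom R (dual_module R G) (ext_power R f 2)\<close>]) (rule assms(9)[OF that])
 obtain tU :: "nat => ('a multiset \<Rightarrow>\<^sub>0 int)" and xU where cover:
  "!!e. f <= g + 2 * e + 1 ==> g + 2 * e <= f + 1 ==> complex_cover R formal_eval f g tU xU e t x"
  using cover_exists[of R g f t x, OF \<open>cring R\<close> g tc xc] by blast
 have \<delta>: "\<delta> = f - g" "1 <= \<delta>" using \<open>\<delta> = f - g\<close> g by auto
 \<comment> \<open>The two extreme values of \<epsilon>, the ceilings of \<delta>/2 and (\<delta> -
   1)/2; they agree exactly for even \<delta>.\<close>
 define e0 where "e0 = (\<delta> + 1) div 2"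
 define e1 where "e1 = \<delta> div 2"
 have c0: "\<lceil>real \<delta> / 2\<rceil> = int e0"
  by (rule ceiling_unique; cases "even \<delta>") (auto simp: e0_def elim!: evenE oddE)
 have c1: "\<lceil>(real \<delta> - 1) / 2\<rceil> = int e1"
  by (rule ceiling_unique; cases "even \<delta>") (auto simp: e1_def elim!: evenE oddE)
 have "int e1 <= \<epsilon>" "\<epsilon> <= int e0" using assms(14,15) by (simp_all only: c0 c1)
 then obtain n where n: "\<epsilon> = int n" "e1 <= n" "n <= e0"
  by (metis int_nat_eq nat_int nat_mono of_nat_0_le_iff order_trans)
 have bnd: "f <= g + 2 * k + 1 & g + 2 * k <= f + 1" if "e1 <= k" "k <= e0" for k
  using that \<delta> g by (auto simp: e0_def e1_def)
 have e01: "e1 <= e0" by (simp add: e0_def e1_def)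
 have a: "chain_complex R M d"
 proof -
  interpret complex_cover R formal_eval f g tU xU n t x using cover bnd[OF n(2,3)] by blast
  show ?thesis unfolding M d n(1) by (rule MR_chain_complex)
 qed
 interpret C0: complex_cover R formal_eval f g tU xU e0 t x using cover bnd[OF e01] by blast
 have I1i: "I1 = Idl\<^bsub>R\<^esub> (t ` {1..f})"
  unfolding I1 t by (rule image_ideal_basis) fact+
 have Igi: "Ig = Idl\<^bsub>R\<^esub> (formal_eval ` range C0.Lam)" unfolding Ig by (rule C0.Ig_eq)
 have idI1: "ideal I1 R" unfolding I1i by (rule genideal_ideal) (use tc in auto)
 have idIg: "ideal Ig R" unfolding Igi by (rule C0.Idl_ev_ideal)
 have C_even: "Ig <+>\<^bsub>R\<^esub> C = Ig" if "even \<delta>"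
 proof -
  have "C = {\<zero>\<^bsub>R\<^esub>}" using that \<delta> by (simp add: C C_ideal_def)
  moreover have "Ig <+>\<^bsub>R\<^esub> {\<zero>\<^bsub>R\<^esub>} = Ig" using ideal.Icarr[OF idIg] by (force simp: set_add_def')
  ultimately show ?thesis by simp
 qed
 have CIg: "C <+>\<^bsub>R\<^esub> Ig = Ig <+>\<^bsub>R\<^esub> C"
 proof -
  have "C <= carrier R" by (auto simp: C C_ideal_def annihilator_def)
  thus ?thesis using set_add_comm ideal.Icarr[OF idIg] by blast
 qed
 show ?thesis (is "_ & (_ --> _ & _ & (_ --> ?deep))")
 proof (rule conjI[OF a], rule impI, intro conjI)
  assume "enat \<delta> <= grade R Ig & enat f <= grade R I1"
  hence grIg: "enat \<delta> <= grade R Ig" and grI1: "enat f <= grade R I1" by auto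
  have exact: "exact_cover R formal_eval f g tU xU k t x" if "e1 <= k" "k <= e0" for k
  proof -
   interpret complex_cover R formal_eval f g tU xU k t x using cover bnd[OF that] by blast
   show ?thesis
    by unfold_locales
    (use grade_weak_regseq[OF idIg grIg] grade_weak_regseq[OF idI1 grI1] in "simp_all only: Igi I1i \<delta>(1)")
  qed
  interpret E0: exact_cover R formal_eval f g tU xU e0 t x by (rule exact[OF e01 order_refl])
  interpret E1: exact_cover R formal_eval f g tU xU e1 t x by (rule exact[OF order_refl e01])
  \<comment> \<open>2 e0 is \<delta> or \<delta> + 1, never \<delta> - 1, so c does not
    enter.\<close>
  have N0: "C0.NR = Ig"
   unfolding Ig by (rule C0.NR_minors) (use \<delta> in "auto simp: e0_def")
  have N1: "E1.NR = Ig <+>\<^bsub>R\<^esub> C"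
  proof (cases "even \<delta>")
   case True
   have "E1.NR = Ig" unfolding Ig by (rule E1.NR_minors) (use \<delta> True in "auto simp: e1_def")
   thus ?thesis using C_even[OF True] by simp
  next
   case False
   hence "2 * e1 + 1 = f - g" using \<delta> by (auto simp: e1_def elim!: oddE)
   thus ?thesis unfolding Ig C by (rule E1.NR_sum)
  qed
  have e1le: "2 * e1 <= f - g" using \<delta> by (simp add: e1_def)
  have b: "free_resolution R M d Rbar" if "\<epsilon> = \<lceil>real \<delta> / 2\<rceil>"
  proof -
   have "\<epsilon> = int e0" using that c0 by simp
   thus ?thesis using E0.MR_resolution unfolding M d Rbar N0 by simp
  qed
  have c: "free_resolution R M d Rtilde" if "\<epsilon> = \<lceil>(real \<delta> - 1) / 2\<rceil>"
  proof -
   have "\<epsilon> = int e1" using that c1 by simp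
   thus ?thesis using E1.MR_resolution unfolding M d Rtilde N1 by simp
  qed
  have rest: ?deep if I1: "I1 ~= carrier R"
  proof -
   have I1c: "I1 <= carrier R" using ideal.Icarr[OF idI1] by blast
   have N1I1: "E1.NR ~= carrier R" if "even \<delta> | 2 <= g"
   proof -
    have "2 <= g | 2 * e1 + 1 ~= f - g" using that \<delta> by (auto simp: e1_def elim!: evenE)
    hence "E1.NR <= I1" unfolding I1i by (rule E1.NR_I1R)
    thus ?thesis using I1 I1c by blast
   qed
   \<comment> \<open>If the resolved ideal were the unit ideal, \<open>I1\<close> and
     \<open>Ig\<close> would coincide, and the grade of \<open>Ig\<close> would be at least f =
     \<delta> + 1.\<close>
   have N1g: "E1.NR ~= carrier R" if "odd \<delta>" "g = 1" "grade R Ig <= enat \<delta>"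
   proof
    assume "E1.NR = carrier R"
    hence "I1 <= Ig" unfolding I1i Igi by (rule E1.NR_full)
    moreover have "Ig <= I1" using E1.IgR_I1R unfolding I1i Igi .
    ultimately have "Ig = I1" by blast
    hence "enat f <= enat \<delta>" using order_trans[OF grI1, of "enat \<delta>"] that(3) by blast
    thus False using \<delta> that(2) g by simp
   qed
   \<comment> \<open>Under the first two hypotheses the resolved ideal lies in the proper ideal
     \<open>I1\<close>, so \<open>grade_IgR_le\<close> supplies the bound that the third one
     assumes.\<close>
   have hN: "grade R Ig <= enat \<delta>" if hyp
   proof (cases "even \<delta> | 2 <= g")
    case True
    show ?thesis using E1.grade_IgR_le[OF N1I1[OF True] e1le] unfolding Igi \<delta>(1) .
   next
    case False
    thus ?thesis using that unfolding hyp by auto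
   qed
   have nI1: "Idl\<^bsub>R\<^esub> (t ` {1..f}) ~= carrier R" using I1 unfolding I1i .
   have ev: "f = g + 2 * e1" "1 <= e1" "e0 = e1" if "even \<delta>"
   proof -
    obtain m where "\<delta> = 2 * m" using \<open>even \<delta>\<close> by (elim evenE)
    thus "f = g + 2 * e1" "1 <= e1" "e0 = e1" using \<delta> g by (simp_all add: e0_def e1_def)
   qed
   have od: "f = g + 2 * e1 + 1" "e0 = e1 + 1" if "odd \<delta>"
   proof -
    obtain m where "\<delta> = 2 * m + 1" using \<open>odd \<delta>\<close> by (elim oddE)
    thus "f = g + 2 * e1 + 1" "e0 = e1 + 1" using \<delta> g by (simp_all add: e0_def e1_def)
   qed
   \<comment> \<open>\<open>proj_dim_bottom\<close> gives f + 2 eps - \<delta> - 1, that is f - 1, f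
     or f - 2 according to whether 2 eps is \<delta>, \<delta> + 1 or \<delta> - 1.\<close>
   have pd_bar0: "proj_dim R Rbar = enat (f - 1)" if "even \<delta>"
    unfolding Rbar N0[symmetric]
    by (rule E0.proj_dim_bottom[OF nI1]) (use ev[OF that] g in arith)+
   have pd_bar1: "proj_dim R Rbar = enat f" if "odd \<delta>"
    unfolding Rbar N0[symmetric]
    by (rule E0.proj_dim_bottom[OF nI1]) (use od[OF that] g in arith)+
   have pd1: "proj_dim R Rtilde = enat (f - 1)" if "even \<delta>"
    unfolding Rtilde N1[symmetric]
    by (rule E1.proj_dim_bottom[OF nI1]) (use ev[OF that] g in arith)+
   have pd2: "proj_dim R Rtilde = enat (f - 2)" if "odd \<delta>" "3 <= \<delta>" "2 <= g"
    unfolding Rtilde N1[symmetric]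
    by (rule E1.proj_dim_bottom[OF nI1]) (use od[OF that(1)] that(2,3) \<delta>(1) g in arith)+
   have odd_e1: "2 * e1 + 1 = f - g" if "odd \<delta>" using that \<delta> by (auto simp: e1_def elim!: oddE)
   have pd3: "proj_dim R Rtilde = enat (f - 1)" if "odd \<delta>" "g = 1" "grade R Ig <= enat \<delta>"
    using E1.proj_dim_top[OF N1g[OF that] odd_e1[OF that(1)]] that(2) unfolding Rtilde N1 by simp
   have pd4: "proj_dim R Rtilde = 1" if "\<delta> = 1" "2 <= g"
    using E1.proj_dim_top[OF N1I1 odd_e1] that \<delta>(1) unfolding Rtilde N1 by (simp add: one_enat_def)
   have depth: "local_depth (localization R p) = enat \<delta>" if "p : Ass R Rtilde" for p
    using E1.Ass_depth[OF e1le] that unfolding Rtilde N1 \<delta>(1) by blast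
   have RR: "Rbar = Rtilde" if "even \<delta>" unfolding Rbar Rtilde C_even[OF that] ..
   have col: "colon R Ig I1 = Ig <+>\<^bsub>R\<^esub> C" using E1.colon_eq[OF e1le] unfolding Igi[symmetric] I1i[symmetric] N1 .
   have sat: "saturation R Ig I1 = Ig <+>\<^bsub>R\<^esub> C" using E1.saturation_eq[OF e1le] unfolding Igi[symmetric] I1i[symmetric] N1 .
   have gun: "gunm R Ig = Ig <+>\<^bsub>R\<^esub> C" if hyp
    using E1.gunm_eq[OF e1le] hN[OF that] grI1 unfolding Igi[symmetric] I1i[symmetric] N1 \<delta>(1) by blast
   show ?thesis
    using pd_bar0 pd_bar1 pd1 pd2 pd3 pd4 depth RR col sat gun c CIg unfolding Rtilde by auto
  qed
  show "\<epsilon> = \<lceil>real \<delta> / 2\<rceil> --> free_resolution R M d Rbar" using b by blast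
  show "\<epsilon> = \<lceil>(real \<delta> - 1) / 2\<rceil> --> free_resolution R M d Rtilde" using c by blast
  show "I1 ~= carrier R --> ?deep" by (rule impI) (rule rest)
 qed
qed

end
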